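(* Fix a categorical $\mathcal{S}\ell\lambda$-model (as in the context), with interpretation $[\![-]\!]$. Then: (1) If $\Gamma, x^\iota, \Delta \vdash M : \sigma$ and $n$ is a numeral, then $[\![\Gamma,\Delta \vdash M[\underline{n}/x] : \sigma]\!] = [\![\Gamma, x^\iota, \Delta \vdash M : \sigma]\!] \circ (\mathrm{id}_{[\![\Gamma]\!]} \otimes n \otimes \mathrm{id}_{[\![\Delta]\!]})$, where $n : {\mathbf 1} \to N$ is the corresponding categorical numeral. (2) If $f$ is a higher-order variable of (arrow) type $\sigma$, $\Gamma, f^\sigma \vdash M : \tau$ and $\Delta \vdash N' : \sigma$ with $\Gamma \cap \Delta = \emptyset$, then $[\![\Gamma,\Delta \vdash M[N'/f] : \tau]\!] = [\![\Gamma, f^\sigma \vdash M : \tau]\!] \circ (\mathrm{id}_{[\![\Gamma]\!]} \otimes [\![\Delta \vdash N' : \sigma]\!])$. (3) If $\digamma$ is a stable variable, $\Gamma, \digamma^\sigma \vdash M : \tau$ and $\Delta_1^\iota, \Delta_2^* \vdash N' : \sigma$, where $\Delta_1^\iota$ consists only of ground variables, $\Delta_2^*$ only of stable variables, and $\Gamma, \Delta_1, \Delta_2$ are pairwise disjoint, then $[\![\Gamma,\Delta_1^\iota,\Delta_2^* \vdash M[N'/\digamma] : \tau]\!] = [\![\Gamma, \digamma^\sigma \vdash M : \tau]\!] \circ \big(\mathrm{id}_{[\![\Gamma]\!]} \otimes (!\,[\![\Delta_1^\iota,\Delta_2^* \vdash N' : \sigma]\!] \circ q \circ (p_{\Delta_1}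 \otimes \delta_{\Delta_2}))\big)$.
   Context: $\mathcal{S}\ell\lambda$-calculus. Types: $\sigma,\tau ::= \iota \mid \sigma \multimap \tau$. There are three disjoint kinds of typed variables: ground variables $x^\iota, y^\iota,\dots$ (type $\iota$), higher-order variables $f^{\sigma\multimap\tau}, g,\dots$ (arrow types), and stable variables $\digamma^\sigma$ (any type). A basis is a finite list of variables; $\Gamma^\iota$ denotes a basis of ground variables only, $\Gamma^*$ a basis of stable variables only; $\Gamma,\Delta$ is concatenation. Typing rules: $\vdash \underline{0}:\iota$; $\vdash \mathtt{succ}:\iota\multimap\iota$; $\vdash \mathtt{pred}:\iota\multimap\iota$; from $\Gamma \vdash M:\iota$, $\Delta\vdash L:\iota$, $\Delta \vdash R:\iota$ with $\Gamma\cap\Delta=\emptyset$ derive $\Gamma,\Delta \vdash \ell\mathtt{if}\,M\,L\,R : \iota$; exchange of adjacent variables; $x^\iota \vdash x:\iota$; ground weakening ($\Gamma\vdash M:\tau$ gives $\Gamma,x^\iota\vdash M:\tau$); ground contraction ($\Gamma,x_1^\iota,x_2^\iota \vdash M:\tau$ gives $\Gamma,x^\iota\vdash M[x/x_1,x/x_2]:\tau$); $f^{\sigma\multimap\tau}\vdash f:\sigma\multimap\tau$; application: from $\Gamma\vdash M:\sigma\multimap\tau$, $\Delta\vdash N:\sigma$, $\Gamma\cap\Delta=\emptyset$ derive $\Gamma,\Delta\vdash MN:\tau$; abstraction: from $\Gamma, x^\sigma\vdash M:\tau$ (x a ground or higher-order variable) derive $\Gamma\vdash\lambda x^\sigma.M:\sigma\multimap\tau$;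 $\digamma^\sigma\vdash\digamma:\sigma$; stable contraction and stable weakening analogous to the ground ones; fixpoint: from $\Gamma^\iota,\Delta^*,\digamma^\sigma\vdash M:\sigma$ derive $\Gamma^\iota,\Delta^*\vdash \mu\digamma.M:\sigma$. Numerals $\underline{n}$ are $\mathtt{succ}(\cdots(\mathtt{succ}\,\underline{0}))$; substitutions are capture-free. Linear category: a symmetric monoidal closed category $(\mathcal{L},\otimes,\multimap,{\mathbf 1})$ with a symmetric monoidal comonad $(!,\delta,\varepsilon,q)$ (with $q_{A,B}: !A\otimes !B\to !(A\otimes B)$, $q_{\mathbf 1}:{\mathbf 1}\to !{\mathbf 1}$; $q$ also denotes the iterated map $!A_1\otimes\cdots\otimes !A_k \to !(A_1\otimes\cdots\otimes A_k)$) such that every free coalgebra $(!A,\delta_A)$ carries monoidal natural transformations $d_A : !A\to !A\otimes !A$, $e_A: !A\to{\mathbf 1}$ forming a commutative comonoid and being coalgebra morphisms, and every coalgebra morphism between free coalgebras is a comonoid morphism. $\mathrm{cur}(-)$ denotes currying $\mathrm{Hom}(C\otimes A,B)\cong\mathrm{Hom}(C,A\multimap B)$, $\mathrm{eval}:(A\multimap B)\otimes A\to B$ the evaluation, $\gamma$ the symmetry; coherence isomorphisms such as ${\mathbf 1}\otimes A\cong A$ are left implicit. $\mathcal{S}\ell\lambda$-category: a linear category with (i) an object $N$ and morphisms $0:{\mathbf 1}\to N$, $succ, pred : N\to N$ with $pred\circ(n+1)=n$ for all numerals (numeral $0$ is $0$, numeral $n+1$ is $succ\circ n$); a morphism $p:N\to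 !N$ making $(N,p)$ a $!$-coalgebra; morphisms $w_N:N\to{\mathbf 1}$, $c_N:N\to N\otimes N$ forming a commutative comonoid such that $0$ and $succ$ are coalgebra morphisms and comonoid morphisms and $p$ is a comonoid morphism (w.r.t. $(d_N,e_N)$ on $!N$); (ii) $\mathcal{L}$ is cartesian (product $\times$, pairing $\langle-,-\rangle$) and there is $\ell if: N\otimes(N\times N)\to N$ with $\ell if\circ(0\otimes\langle f,g\rangle)=f$ and $\ell if\circ((n+1)\otimes\langle f,g\rangle)=g$ for all $f,g:{\mathbf 1}\to N$ and numerals $n$; (iii) for each object $B$ a morphism $fix_B: !(!B\multimap B)\to B$ with $fix_B = \mathrm{eval}\circ(\varepsilon_{!B\multimap B}\otimes(!fix_B\circ\delta_{!B\multimap B}))\circ d_{!B\multimap B}$. Categorical $\mathcal{S}\ell\lambda$-model: an $\mathcal{S}\ell\lambda$-category with $[\![\iota]\!]=N$, $[\![\sigma\multimap\tau]\!]=[\![\sigma]\!]\multimap[\![\tau]\!]$; $[\![\emptyset]\!]={\mathbf 1}$, $[\![x^\sigma,\Delta]\!]=[\![\sigma]\!]\otimes[\![\Delta]\!]$ for ground/higher-order $x$, $[\![\digamma^\sigma,\Delta]\!]=![\![\sigma]\!]\otimes[\![\Delta]\!]$. For ground $\Gamma^\iota$ of length $k$, $p_\Gamma=p\otimes\cdots\otimes p$ ($k$ times); for $\Delta^*=\digamma_1^{\sigma_1},\dots,\digamma_m^{\sigma_m}$, $\delta_\Delta=\delta_{[\![\sigma_1]\!]}\otimes\cdots\otimes\delta_{[\![\sigma_m]\!]}$.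 The interpretation of a judgment $\Gamma\vdash M:\sigma$ is a morphism $[\![\Gamma]\!]\to[\![\sigma]\!]$ defined by: $[\![\underline 0]\!]=0$, $[\![\mathtt{succ}]\!]=\mathrm{cur}(succ)$, $[\![\mathtt{pred}]\!]=\mathrm{cur}(pred)$, $[\![x^\iota\vdash x]\!]=\mathrm{id}_N$, $[\![f\vdash f]\!]=\mathrm{id}$, $[\![\digamma^\sigma\vdash\digamma]\!]=\varepsilon_{[\![\sigma]\!]}$; $[\![\Gamma^\iota,\Delta^*\vdash\mu\digamma.M]\!]=fix_{[\![\sigma]\!]}\circ !\mathrm{cur}([\![\Gamma^\iota,\Delta^*,\digamma^\sigma\vdash M]\!])\circ q\circ(p_\Gamma\otimes\delta_\Delta)$; $[\![\lambda x.M]\!]=\mathrm{cur}([\![\Gamma,x^\sigma\vdash M]\!])$; exchange is precomposition with $\mathrm{id}\otimes\gamma\otimes\mathrm{id}$; $[\![\Gamma,\Delta\vdash MN]\!]=\mathrm{eval}\circ([\![\Gamma\vdash M]\!]\otimes[\![\Delta\vdash N]\!])$; $[\![\Gamma,\Delta\vdash\ell\mathtt{if}\,M\,L\,R]\!]=\ell if\circ([\![\Gamma\vdash M]\!]\otimes\langle[\![\Delta\vdash L]\!],[\![\Delta\vdash R]\!]\rangle)$; ground contraction/weakening are precomposition with $\mathrm{id}\otimes c_N$ / $\mathrm{id}\otimes w_N$; stable contraction/weakening are precomposition with $\mathrm{id}\otimes d_{[\![\sigma]\!]}$ / $\mathrm{id}\otimes e_{[\![\sigma]\!]}$. *)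

theory Defs
  imports Main
begin

section \<open>Syntax\<close>

datatype ty = Iota | Lolli ty ty

text \<open>Variables carry their kind and type: ground variables have type \<^const>\<open>Iota\<close>, higher-order
  variables an arrow type, stable variables an arbitrary type.\<close>

datatype var = Gnd nat | Hov nat ty ty | Stb nat ty

fun var_ty :: "var \<Rightarrow> ty" where
  "var_ty (Gnd k) = Iota"
| "var_ty (Hov k \<sigma> \<tau>) = Lolli \<sigma> \<tau>"
| "var_ty (Stb k \<sigma>) = \<sigma>"

definition ground :: "var list \<Rightarrow> bool" where
  "ground \<Gamma> \<longleftrightarrow> (\<forall>v\<in>set \<Gamma>. \<exists>k. v = Gnd k)"

definition stable :: "var list \<Rightarrow> bool" where
  "stable \<Gamma> \<longleftrightarrow> (\<forall>v\<in>set \<Gamma>. \<exists>k \<sigma>. v = Stb k \<sigma>)"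

text \<open>Terms modulo \<open>\<alpha>\<close>-equivalence, in locally nameless form: free variables are named, bound
  variables are de Bruijn indices (one index space for both binders). The named binders
  \<open>\<lambda>x. M\<close> and \<open>\<mu>F. M\<close> are \<open>LAM x M\<close> and \<open>MU F M\<close> below. Typable terms have no dangling
  indices, so \<open>subst\<close> is capture-free on them.\<close>

datatype trm =
    Zero | Succ | Pred
  | Lif trm trm trm
  | Fv var
  | Bv nat
  | App trm trm
  | Lam ty trm
  | Mu ty trm

primrec close :: "nat \<Rightarrow> var \<Rightarrow> trm \<Rightarrow> trm" where
  "close i x Zero = Zero"
| "close i x Succ = Succ"
| "close i x Pred = Pred"
| "close i x (Lif M L R) = Lif (close i x M) (close i x L) (close i x R)"
| "close i x (Fv y) = (if y = x then Bv i else Fv y)"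
| "close i x (Bv j) = Bv j"
| "close i x (App M N) = App (close i x M) (close i x N)"
| "close i x (Lam \<sigma> M) = Lam \<sigma> (close (Suc i) x M)"
| "close i x (Mu \<sigma> M) = Mu \<sigma> (close (Suc i) x M)"

definition LAM :: "var \<Rightarrow> trm \<Rightarrow> trm" where
  "LAM x M = Lam (var_ty x) (close 0 x M)"

definition MU :: "var \<Rightarrow> trm \<Rightarrow> trm" where
  "MU F M = Mu (var_ty F) (close 0 F M)"

primrec subst :: "trm \<Rightarrow> var \<Rightarrow> trm \<Rightarrow> trm"  ("_[_::=_]" [1000, 0, 0] 1000) where
  "Zero[x::=N] = Zero"
| "Succ[x::=N] = Succ"
| "Pred[x::=N] = Pred"
| "(Lif M L R)[x::=N] = Lif (M[x::=N]) (L[x::=N]) (R[x::=N])"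
| "(Fv y)[x::=N] = (if y = x then N else Fv y)"
| "(Bv j)[x::=N] = Bv j"
| "(App M P)[x::=N] = App (M[x::=N]) (P[x::=N])"
| "(Lam \<sigma> M)[x::=N] = Lam \<sigma> (M[x::=N])"
| "(Mu \<sigma> M)[x::=N] = Mu \<sigma> (M[x::=N])"

primrec numeral_trm :: "nat \<Rightarrow> trm" where
  "numeral_trm 0 = Zero"
| "numeral_trm (Suc n) = App Succ (numeral_trm n)"


section \<open>Typing\<close>

text \<open>The freshness conditions on weakening and contraction keep every derivable basis free of
  repetitions. In a contraction, renaming \<open>x1\<close> and then \<open>x2\<close> to \<open>x\<close> agrees with the simultaneous
  renaming, also when \<open>x\<close> is one of them.\<close>

inductive typing :: "var list \<Rightarrow> trm \<Rightarrow> ty \<Rightarrow> bool"  ("_ \<turnstile> _ \<Colon> _" [51, 51, 51] 50) where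
  T_zero: "[] \<turnstile> Zero \<Colon> Iota"
| T_succ: "[] \<turnstile> Succ \<Colon> Lolli Iota Iota"
| T_pred: "[] \<turnstile> Pred \<Colon> Lolli Iota Iota"
| T_lif: "\<lbrakk>\<Gamma> \<turnstile> M \<Colon> Iota; \<Delta> \<turnstile> L \<Colon> Iota; \<Delta> \<turnstile> R \<Colon> Iota; set \<Gamma> \<inter> set \<Delta> = {}\<rbrakk>
    \<Longrightarrow> \<Gamma> @ \<Delta> \<turnstile> Lif M L R \<Colon> Iota"
| T_exchange: "\<Gamma> @ [v, u] @ \<Delta> \<turnstile> M \<Colon> \<tau> \<Longrightarrow> \<Gamma> @ [u, v] @ \<Delta> \<turnstile> M \<Colon> \<tau>"
| T_ground: "[Gnd k] \<turnstile> Fv (Gnd k) \<Colon> Iota"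
| T_ground_weak: "\<lbrakk>\<Gamma> \<turnstile> M \<Colon> \<tau>; Gnd k \<notin> set \<Gamma>\<rbrakk> \<Longrightarrow> \<Gamma> @ [Gnd k] \<turnstile> M \<Colon> \<tau>"
| T_ground_contr: "\<lbrakk>\<Gamma> @ [Gnd k1, Gnd k2] \<turnstile> M \<Colon> \<tau>; Gnd k \<notin> set \<Gamma>\<rbrakk>
    \<Longrightarrow> \<Gamma> @ [Gnd k] \<turnstile> M[Gnd k1 ::= Fv (Gnd k)][Gnd k2 ::= Fv (Gnd k)] \<Colon> \<tau>"
| T_higher: "[Hov k \<sigma> \<tau>] \<turnstile> Fv (Hov k \<sigma> \<tau>) \<Colon> Lolli \<sigma> \<tau>"
| T_app: "\<lbrakk>\<Gamma> \<turnstile> M \<Colon> Lolli \<sigma> \<tau>; \<Delta> \<turnstile> N \<Colon> \<sigma>; set \<Gamma> \<inter> set \<Delta> = {}\<rbrakk> \<Longrightarrow> \<Gamma> @ \<Delta> \<turnstile> App M N \<Colon> \<tau>"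
| T_lam: "\<lbrakk>\<Gamma> @ [x] \<turnstile> M \<Colon> \<tau>; \<not> stable [x]\<rbrakk> \<Longrightarrow> \<Gamma> \<turnstile> LAM x M \<Colon> Lolli (var_ty x) \<tau>"
| T_stable: "[Stb k \<sigma>] \<turnstile> Fv (Stb k \<sigma>) \<Colon> \<sigma>"
| T_stable_weak: "\<lbrakk>\<Gamma> \<turnstile> M \<Colon> \<tau>; Stb k \<sigma> \<notin> set \<Gamma>\<rbrakk> \<Longrightarrow> \<Gamma> @ [Stb k \<sigma>] \<turnstile> M \<Colon> \<tau>"
| T_stable_contr: "\<lbrakk>\<Gamma> @ [Stb k1 \<sigma>, Stb k2 \<sigma>] \<turnstile> M \<Colon> \<tau>; Stb k \<sigma> \<notin> set \<Gamma>\<rbrakk>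
    \<Longrightarrow> \<Gamma> @ [Stb k \<sigma>] \<turnstile> M[Stb k1 \<sigma> ::= Fv (Stb k \<sigma>)][Stb k2 \<sigma> ::= Fv (Stb k \<sigma>)] \<Colon> \<tau>"
| T_mu: "\<lbrakk>\<Gamma> @ \<Delta> @ [Stb k \<sigma>] \<turnstile> M \<Colon> \<sigma>; ground \<Gamma>; stable \<Delta>\<rbrakk> \<Longrightarrow> \<Gamma> @ \<Delta> \<turnstile> MU (Stb k \<sigma>) M \<Colon> \<sigma>"

lemma typing_distinct: "\<Gamma> \<turnstile> M \<Colon> \<sigma> \<Longrightarrow> distinct \<Gamma>"
  by (induction rule: typing.induct) auto


section \<open>Symmetric monoidal closed categories\<close>

text \<open>All elements of the type \<open>'o\<close> are objects. Operations on arrows are total functions that are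
  meaningful only on (composable) members of the hom-sets. The operation \<open>cur\<close> takes its objects
  explicitly, since \<open>X \<otimes> A\<close> does not determine \<open>X\<close> and \<open>A\<close>.\<close>

record ('o, 'm) cat =
  Hom :: "'o \<Rightarrow> 'o \<Rightarrow> 'm set"
  Id :: "'o \<Rightarrow> 'm"
  Comp :: "'m \<Rightarrow> 'm \<Rightarrow> 'm"  (infixr "\<cdot>\<index>" 55)

record ('o, 'm) smcc = "('o, 'm) cat" +
  tensor :: "'o \<Rightarrow> 'o \<Rightarrow> 'o"  (infixr "\<otimes>\<index>" 70)
  tensor_arr :: "'m \<Rightarrow> 'm \<Rightarrow> 'm"  (infixr "\<boxtimes>\<index>" 70)
  tunit :: "'o"  ("\<one>\<index>")
  assoc :: "'o \<Rightarrow> 'o \<Rightarrow> 'o \<Rightarrow> 'm"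
  assoc' :: "'o \<Rightarrow> 'o \<Rightarrow> 'o \<Rightarrow> 'm"
  lunit :: "'o \<Rightarrow> 'm"
  lunit' :: "'o \<Rightarrow> 'm"
  runit :: "'o \<Rightarrow> 'm"
  runit' :: "'o \<Rightarrow> 'm"
  braid :: "'o \<Rightarrow> 'o \<Rightarrow> 'm"
  ihom :: "'o \<Rightarrow> 'o \<Rightarrow> 'o"  (infixr "\<leadsto>\<index>" 65)
  ev :: "'o \<Rightarrow> 'o \<Rightarrow> 'm"
  cur :: "'o \<Rightarrow> 'o \<Rightarrow> 'o \<Rightarrow> 'm \<Rightarrow> 'm"

locale category =
  fixes C :: "('o, 'm, 'r) cat_scheme" (structure)
  assumes Id_hom: "Id C A \<in> Hom C A A"
    and Comp_hom: "\<lbrakk>f \<in> Hom C A B; g \<in> Hom C B D\<rbrakk> \<Longrightarrow> g \<cdot> f \<in> Hom C A D"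
    and Comp_Id_left: "f \<in> Hom C A B \<Longrightarrow> Id C B \<cdot> f = f"
    and Comp_Id_right: "f \<in> Hom C A B \<Longrightarrow> f \<cdot> Id C A = f"
    and Comp_assoc: "\<lbrakk>f \<in> Hom C A B; g \<in> Hom C B D; h \<in> Hom C D E\<rbrakk>
      \<Longrightarrow> (h \<cdot> g) \<cdot> f = h \<cdot> (g \<cdot> f)"

locale sym_monoidal_closed_category = category C
  for C :: "('o, 'm, 'r) smcc_scheme" (structure) +
  assumes tensor_hom: "\<lbrakk>f \<in> Hom C A B; g \<in> Hom C A' B'\<rbrakk> \<Longrightarrow> f \<boxtimes> g \<in> Hom C (A \<otimes> A') (B \<otimes> B')"
    and tensor_Id: "Id C A \<boxtimes> Id C B = Id C (A \<otimes> B)"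
    and tensor_Comp: "\<lbrakk>f \<in> Hom C A B; g \<in> Hom C B D; f' \<in> Hom C A' B'; g' \<in> Hom C B' D'\<rbrakk>
      \<Longrightarrow> (g \<cdot> f) \<boxtimes> (g' \<cdot> f') = (g \<boxtimes> g') \<cdot> (f \<boxtimes> f')"
    and assoc_hom: "assoc C A B D \<in> Hom C ((A \<otimes> B) \<otimes> D) (A \<otimes> (B \<otimes> D))"
    and assoc'_hom: "assoc' C A B D \<in> Hom C (A \<otimes> (B \<otimes> D)) ((A \<otimes> B) \<otimes> D)"
    and assoc_iso: "assoc' C A B D \<cdot> assoc C A B D = Id C ((A \<otimes> B) \<otimes> D)"
      "assoc C A B D \<cdot> assoc' C A B D = Id C (A \<otimes> (B \<otimes> D))"
    and assoc_nat: "\<lbrakk>f \<in> Hom C A A'; g \<in> Hom C B B'; h \<in> Hom C D D'\<rbrakk>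
      \<Longrightarrow> assoc C A' B' D' \<cdot> ((f \<boxtimes> g) \<boxtimes> h) = (f \<boxtimes> (g \<boxtimes> h)) \<cdot> assoc C A B D"
    and lunit_hom: "lunit C A \<in> Hom C (\<one> \<otimes> A) A"
    and lunit'_hom: "lunit' C A \<in> Hom C A (\<one> \<otimes> A)"
    and lunit_iso: "lunit' C A \<cdot> lunit C A = Id C (\<one> \<otimes> A)" "lunit C A \<cdot> lunit' C A = Id C A"
    and lunit_nat: "f \<in> Hom C A B \<Longrightarrow> lunit C B \<cdot> (Id C \<one> \<boxtimes> f) = f \<cdot> lunit C A"
    and runit_hom: "runit C A \<in> Hom C (A \<otimes> \<one>) A"
    and runit'_hom: "runit' C A \<in> Hom C A (A \<otimes> \<one>)"
    and runit_iso: "runit' C A \<cdot> runit C A = Id C (A \<otimes> \<one>)" "runit C A \<cdot> runit' C A = Id C A"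
    and runit_nat: "f \<in> Hom C A B \<Longrightarrow> runit C B \<cdot> (f \<boxtimes> Id C \<one>) = f \<cdot> runit C A"
    and braid_hom: "braid C A B \<in> Hom C (A \<otimes> B) (B \<otimes> A)"
    and braid_inv: "braid C B A \<cdot> braid C A B = Id C (A \<otimes> B)"
    and braid_nat: "\<lbrakk>f \<in> Hom C A A'; g \<in> Hom C B B'\<rbrakk>
      \<Longrightarrow> braid C A' B' \<cdot> (f \<boxtimes> g) = (g \<boxtimes> f) \<cdot> braid C A B"
    and pentagon: "assoc C A B (D \<otimes> E) \<cdot> assoc C (A \<otimes> B) D E
      = (Id C A \<boxtimes> assoc C B D E) \<cdot> assoc C A (B \<otimes> D) E \<cdot> (assoc C A B D \<boxtimes> Id C E)"
    and triangle: "(Id C A \<boxtimes> lunit C B) \<cdot> assoc C A \<one> B = runit C A \<boxtimes> Id C B"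
    and hexagon: "assoc C B D A \<cdot> braid C A (B \<otimes> D) \<cdot> assoc C A B D
      = (Id C B \<boxtimes> braid C A D) \<cdot> assoc C B A D \<cdot> (braid C A B \<boxtimes> Id C D)"
    and ev_hom: "ev C A B \<in> Hom C ((A \<leadsto> B) \<otimes> A) B"
    and cur_hom: "f \<in> Hom C (X \<otimes> A) B \<Longrightarrow> cur C X A B f \<in> Hom C X (A \<leadsto> B)"
    and ev_cur: "f \<in> Hom C (X \<otimes> A) B \<Longrightarrow> ev C A B \<cdot> (cur C X A B f \<boxtimes> Id C A) = f"
    and cur_ev: "g \<in> Hom C X (A \<leadsto> B) \<Longrightarrow> cur C X A B (ev C A B \<cdot> (g \<boxtimes> Id C A)) = g"


section \<open>Linear categories\<close>

text \<open>\<open>dig\<close> and \<open>der\<close> are the comultiplication \<open>\<delta>\<close> and counit \<open>\<epsilon>\<close> of the comonad \<open>!\<close>, \<open>qmon\<close> and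
  \<open>qmon_unit\<close> its monoidal structure \<open>q\<close>, and \<open>dupl\<close> and \<open>erase\<close> the comonoid structure \<open>d\<close>, \<open>e\<close> of
  the free coalgebras.\<close>

record ('o, 'm) lincat = "('o, 'm) smcc" +
  bang :: "'o \<Rightarrow> 'o"
  bang_arr :: "'m \<Rightarrow> 'm"
  dig :: "'o \<Rightarrow> 'm"
  der :: "'o \<Rightarrow> 'm"
  qmon :: "'o \<Rightarrow> 'o \<Rightarrow> 'm"
  qmon_unit :: "'m"
  dupl :: "'o \<Rightarrow> 'm"
  erase :: "'o \<Rightarrow> 'm"

context
  fixes C :: "('o, 'm, 'r) smcc_scheme" (structure)
begin

definition mid :: "'o \<Rightarrow> 'o \<Rightarrow> 'o \<Rightarrow> 'o \<Rightarrow> 'm" where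
  \<comment> \<open>\<open>id \<otimes> \<gamma> \<otimes> id : (A \<otimes> B) \<otimes> (D \<otimes> E) \<rightarrow> (A \<otimes> D) \<otimes> (B \<otimes> E)\<close>\<close>
  "mid A B D E = assoc' C A D (B \<otimes> E)
     \<cdot> (Id C A \<boxtimes> (assoc C D B E \<cdot> (braid C B D \<boxtimes> Id C E) \<cdot> assoc' C B D E))
     \<cdot> assoc C A B (D \<otimes> E)"

definition comm_comonoid :: "'o \<Rightarrow> 'm \<Rightarrow> 'm \<Rightarrow> bool" where
  "comm_comonoid A c w \<longleftrightarrow>
     c \<in> Hom C A (A \<otimes> A) \<and> w \<in> Hom C A \<one> \<and>
     assoc C A A A \<cdot> (c \<boxtimes> Id C A) \<cdot> c = (Id C A \<boxtimes> c) \<cdot> c \<and>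
     lunit C A \<cdot> (w \<boxtimes> Id C A) \<cdot> c = Id C A \<and>
     runit C A \<cdot> (Id C A \<boxtimes> w) \<cdot> c = Id C A \<and>
     braid C A A \<cdot> c = c"

definition comonoid_mor :: "'o \<Rightarrow> 'm \<Rightarrow> 'm \<Rightarrow> 'o \<Rightarrow> 'm \<Rightarrow> 'm \<Rightarrow> 'm \<Rightarrow> bool" where
  "comonoid_mor A c w A' c' w' f \<longleftrightarrow>
     f \<in> Hom C A A' \<and> c' \<cdot> f = (f \<boxtimes> f) \<cdot> c \<and> w' \<cdot> f = w"

end

context
  fixes C :: "('o, 'm, 'r) lincat_scheme" (structure)
begin

definition coalgebra :: "'o \<Rightarrow> 'm \<Rightarrow> bool" where
  "coalgebra A a \<longleftrightarrow>
     a \<in> Hom C A (bang C A) \<and> der C A \<cdot> a = Id C A \<and> dig C A \<cdot> a = bang_arr C a \<cdot> a"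

definition coalgebra_mor :: "'o \<Rightarrow> 'm \<Rightarrow> 'o \<Rightarrow> 'm \<Rightarrow> 'm \<Rightarrow> bool" where
  "coalgebra_mor A a B b f \<longleftrightarrow> f \<in> Hom C A B \<and> b \<cdot> f = bang_arr C f \<cdot> a"

end

locale linear_category = sym_monoidal_closed_category C
  for C :: "('o, 'm, 'r) lincat_scheme" (structure) +
  assumes bang_hom: "f \<in> Hom C A B \<Longrightarrow> bang_arr C f \<in> Hom C (bang C A) (bang C B)"
    and bang_Id: "bang_arr C (Id C A) = Id C (bang C A)"
    and bang_Comp: "\<lbrakk>f \<in> Hom C A B; g \<in> Hom C B D\<rbrakk>
      \<Longrightarrow> bang_arr C (g \<cdot> f) = bang_arr C g \<cdot> bang_arr C f"
    and dig_hom: "dig C A \<in> Hom C (bang C A) (bang C (bang C A))"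
    and dig_nat: "f \<in> Hom C A B \<Longrightarrow> dig C B \<cdot> bang_arr C f = bang_arr C (bang_arr C f) \<cdot> dig C A"
    and der_hom: "der C A \<in> Hom C (bang C A) A"
    and der_nat: "f \<in> Hom C A B \<Longrightarrow> der C B \<cdot> bang_arr C f = f \<cdot> der C A"
    and dig_coassoc: "dig C (bang C A) \<cdot> dig C A = bang_arr C (dig C A) \<cdot> dig C A"
    and der_dig: "der C (bang C A) \<cdot> dig C A = Id C (bang C A)"
      "bang_arr C (der C A) \<cdot> dig C A = Id C (bang C A)"
    and q_hom: "qmon C A B \<in> Hom C (bang C A \<otimes> bang C B) (bang C (A \<otimes> B))"
    and q_unit_hom: "qmon_unit C \<in> Hom C \<one> (bang C \<one>)"
    and q_nat: "\<lbrakk>f \<in> Hom C A A'; g \<in> Hom C B B'\<rbrakk>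
      \<Longrightarrow> qmon C A' B' \<cdot> (bang_arr C f \<boxtimes> bang_arr C g) = bang_arr C (f \<boxtimes> g) \<cdot> qmon C A B"
    and q_assoc: "bang_arr C (assoc C A B D) \<cdot> qmon C (A \<otimes> B) D \<cdot> (qmon C A B \<boxtimes> Id C (bang C D))
      = qmon C A (B \<otimes> D) \<cdot> (Id C (bang C A) \<boxtimes> qmon C B D) \<cdot> assoc C (bang C A) (bang C B) (bang C D)"
    and q_lunit: "bang_arr C (lunit C A) \<cdot> qmon C \<one> A \<cdot> (qmon_unit C \<boxtimes> Id C (bang C A))
      = lunit C (bang C A)"
    and q_runit: "bang_arr C (runit C A) \<cdot> qmon C A \<one> \<cdot> (Id C (bang C A) \<boxtimes> qmon_unit C)
      = runit C (bang C A)"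
    and q_braid: "bang_arr C (braid C A B) \<cdot> qmon C A B = qmon C B A \<cdot> braid C (bang C A) (bang C B)"
    and dig_q: "dig C (A \<otimes> B) \<cdot> qmon C A B
      = bang_arr C (qmon C A B) \<cdot> qmon C (bang C A) (bang C B) \<cdot> (dig C A \<boxtimes> dig C B)"
    and dig_q_unit: "dig C \<one> \<cdot> qmon_unit C = bang_arr C (qmon_unit C) \<cdot> qmon_unit C"
    and der_q: "der C (A \<otimes> B) \<cdot> qmon C A B = der C A \<boxtimes> der C B"
    and der_q_unit: "der C \<one> \<cdot> qmon_unit C = Id C \<one>"
    and bang_comonoid: "comm_comonoid C (bang C A) (dupl C A) (erase C A)"
    and dupl_nat: "f \<in> Hom C A B \<Longrightarrow> dupl C B \<cdot> bang_arr C f = (bang_arr C f \<boxtimes> bang_arr C f) \<cdot> dupl C A"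
    and erase_nat: "f \<in> Hom C A B \<Longrightarrow> erase C B \<cdot> bang_arr C f = erase C A"
    and dupl_q: "dupl C (A \<otimes> B) \<cdot> qmon C A B
      = (qmon C A B \<boxtimes> qmon C A B) \<cdot> mid C (bang C A) (bang C A) (bang C B) (bang C B) \<cdot> (dupl C A \<boxtimes> dupl C B)"
    and dupl_q_unit: "dupl C \<one> \<cdot> qmon_unit C = (qmon_unit C \<boxtimes> qmon_unit C) \<cdot> lunit' C \<one>"
    and erase_q: "erase C (A \<otimes> B) \<cdot> qmon C A B = lunit C \<one> \<cdot> (erase C A \<boxtimes> erase C B)"
    and erase_q_unit: "erase C \<one> \<cdot> qmon_unit C = Id C \<one>"
    and dupl_coalgebra_mor: "coalgebra_mor C (bang C A) (dig C A)
      (bang C A \<otimes> bang C A) (qmon C (bang C A) (bang C A) \<cdot> (dig C A \<boxtimes> dig C A)) (dupl C A)"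
    and erase_coalgebra_mor: "coalgebra_mor C (bang C A) (dig C A) \<one> (qmon_unit C) (erase C A)"
    and free_coalgebra_mor: "coalgebra_mor C (bang C A) (dig C A) (bang C B) (dig C B) f
      \<Longrightarrow> comonoid_mor C (bang C A) (dupl C A) (erase C A) (bang C B) (dupl C B) (erase C B) f"


section \<open>\<open>S\<ell>\<lambda>\<close>-categories\<close>

record ('o, 'm) sllcat = "('o, 'm) lincat" +
  nat_obj :: "'o"
  zero_arr :: "'m"
  succ_arr :: "'m"
  pred_arr :: "'m"
  p_N :: "'m"
  w_N :: "'m"
  c_N :: "'m"
  cprod :: "'o \<Rightarrow> 'o \<Rightarrow> 'o"
  proj1 :: "'o \<Rightarrow> 'o \<Rightarrow> 'm"
  proj2 :: "'o \<Rightarrow> 'o \<Rightarrow> 'm"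
  pair :: "'m \<Rightarrow> 'm \<Rightarrow> 'm"
  lif_arr :: "'m"
  fix_arr :: "'o \<Rightarrow> 'm"

primrec numeral_arr :: "('o, 'm, 'r) sllcat_scheme \<Rightarrow> nat \<Rightarrow> 'm" where
  "numeral_arr C 0 = zero_arr C"
| "numeral_arr C (Suc n) = succ_arr C \<cdot>\<^bsub>C\<^esub> numeral_arr C n"

locale sll_category = linear_category C
  for C :: "('o, 'm, 'r) sllcat_scheme" (structure) +
  assumes zero_hom: "zero_arr C \<in> Hom C \<one> (nat_obj C)"
    and succ_hom: "succ_arr C \<in> Hom C (nat_obj C) (nat_obj C)"
    and pred_hom: "pred_arr C \<in> Hom C (nat_obj C) (nat_obj C)"
    and pred_numeral: "pred_arr C \<cdot> numeral_arr C (Suc n) = numeral_arr C n"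
    and p_coalgebra: "coalgebra C (nat_obj C) (p_N C)"
    and N_comonoid: "comm_comonoid C (nat_obj C) (c_N C) (w_N C)"
    and zero_coalgebra_mor: "coalgebra_mor C \<one> (qmon_unit C) (nat_obj C) (p_N C) (zero_arr C)"
    and succ_coalgebra_mor: "coalgebra_mor C (nat_obj C) (p_N C) (nat_obj C) (p_N C) (succ_arr C)"
    and zero_comonoid_mor:
      "comonoid_mor C \<one> (lunit' C \<one>) (Id C \<one>) (nat_obj C) (c_N C) (w_N C) (zero_arr C)"
    and succ_comonoid_mor:
      "comonoid_mor C (nat_obj C) (c_N C) (w_N C) (nat_obj C) (c_N C) (w_N C) (succ_arr C)"
    and p_comonoid_mor:
      "comonoid_mor C (nat_obj C) (c_N C) (w_N C) (bang C (nat_obj C)) (dupl C (nat_obj C)) (erase C (nat_obj C)) (p_N C)"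
    and terminal: "\<exists>T. \<forall>A. \<exists>!t. t \<in> Hom C A T"
    and proj1_hom: "proj1 C A B \<in> Hom C (cprod C A B) A"
    and proj2_hom: "proj2 C A B \<in> Hom C (cprod C A B) B"
    and pair_hom: "\<lbrakk>f \<in> Hom C X A; g \<in> Hom C X B\<rbrakk> \<Longrightarrow> pair C f g \<in> Hom C X (cprod C A B)"
    and proj1_pair: "\<lbrakk>f \<in> Hom C X A; g \<in> Hom C X B\<rbrakk> \<Longrightarrow> proj1 C A B \<cdot> pair C f g = f"
    and proj2_pair: "\<lbrakk>f \<in> Hom C X A; g \<in> Hom C X B\<rbrakk> \<Longrightarrow> proj2 C A B \<cdot> pair C f g = g"
    and pair_proj: "h \<in> Hom C X (cprod C A B) \<Longrightarrow> pair C (proj1 C A B \<cdot> h) (proj2 C A B \<cdot> h) = h"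
    \<comment> \<open>\<open>lunit'\<close> is the implicit isomorphism \<open>1 \<cong> 1 \<otimes> 1\<close>\<close>
    and lif_hom: "lif_arr C \<in> Hom C (nat_obj C \<otimes> cprod C (nat_obj C) (nat_obj C)) (nat_obj C)"
    and lif_zero: "\<lbrakk>f \<in> Hom C \<one> (nat_obj C); g \<in> Hom C \<one> (nat_obj C)\<rbrakk>
      \<Longrightarrow> lif_arr C \<cdot> (numeral_arr C 0 \<boxtimes> pair C f g) \<cdot> lunit' C \<one> = f"
    and lif_Suc: "\<lbrakk>f \<in> Hom C \<one> (nat_obj C); g \<in> Hom C \<one> (nat_obj C)\<rbrakk>
      \<Longrightarrow> lif_arr C \<cdot> (numeral_arr C (Suc n) \<boxtimes> pair C f g) \<cdot> lunit' C \<one> = g"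
    and fix_hom: "fix_arr C B \<in> Hom C (bang C (bang C B \<leadsto> B)) B"
    and fix_eq: "fix_arr C B = ev C (bang C B) B
      \<cdot> (der C (bang C B \<leadsto> B) \<boxtimes> (bang_arr C (fix_arr C B) \<cdot> dig C (bang C B \<leadsto> B)))
      \<cdot> dupl C (bang C B \<leadsto> B)"


section \<open>Interpretation\<close>

text \<open>A basis is interpreted as the right-nested tensor of its variables, ending in \<open>\<one>\<close>. The
  arrows \<open>tsplit\<close>, \<open>tjoin\<close>, \<open>tunsnoc\<close> and \<open>tsnoc\<close> are the coherence isomorphisms that regroup such
  tensors; \<open>tensors_arr\<close> is the \<open>n\<close>-fold tensor of arrows and \<open>qs\<close> the iterated \<open>q\<close>.\<close>

context
  fixes C :: "('o, 'm, 'r) sllcat_scheme" (structure)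
begin

primrec tensors :: "'o list \<Rightarrow> 'o" where
  "tensors [] = \<one>"
| "tensors (A # As) = A \<otimes> tensors As"

primrec tensors_arr :: "'m list \<Rightarrow> 'm" where
  "tensors_arr [] = Id C \<one>"
| "tensors_arr (f # fs) = f \<boxtimes> tensors_arr fs"

primrec qs :: "'o list \<Rightarrow> 'm" where
  \<comment> \<open>\<open>!A\<^sub>1 \<otimes> \<dots> \<otimes> !A\<^sub>k \<rightarrow> !(A\<^sub>1 \<otimes> \<dots> \<otimes> A\<^sub>k)\<close>\<close>
  "qs [] = qmon_unit C"
| "qs (A # As) = qmon C A (tensors As) \<cdot> (Id C (bang C A) \<boxtimes> qs As)"

primrec tsplit :: "'o list \<Rightarrow> 'o list \<Rightarrow> 'm" where
  \<comment> \<open>\<open>tensors (As @ Bs) \<rightarrow> tensors As \<otimes> tensors Bs\<close>\<close>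
  "tsplit [] Bs = lunit' C (tensors Bs)"
| "tsplit (A # As) Bs = assoc' C A (tensors As) (tensors Bs) \<cdot> (Id C A \<boxtimes> tsplit As Bs)"

primrec tjoin :: "'o list \<Rightarrow> 'o list \<Rightarrow> 'm" where
  \<comment> \<open>\<open>tensors As \<otimes> tensors Bs \<rightarrow> tensors (As @ Bs)\<close>\<close>
  "tjoin [] Bs = lunit C (tensors Bs)"
| "tjoin (A # As) Bs = (Id C A \<boxtimes> tjoin As Bs) \<cdot> assoc C A (tensors As) (tensors Bs)"

definition tunsnoc :: "'o list \<Rightarrow> 'o \<Rightarrow> 'm" where
  \<comment> \<open>\<open>tensors (As @ [A]) \<rightarrow> tensors As \<otimes> A\<close>\<close>
  "tunsnoc As A = (Id C (tensors As) \<boxtimes> runit C A) \<cdot> tsplit As [A]"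

definition tsnoc :: "'o list \<Rightarrow> 'o \<Rightarrow> 'm" where
  \<comment> \<open>\<open>tensors As \<otimes> A \<rightarrow> tensors (As @ [A])\<close>\<close>
  "tsnoc As A = tjoin As [A] \<cdot> (Id C (tensors As) \<boxtimes> runit' C A)"

primrec ty_obj :: "ty \<Rightarrow> 'o" where
  "ty_obj Iota = nat_obj C"
| "ty_obj (Lolli \<sigma> \<tau>) = ty_obj \<sigma> \<leadsto> ty_obj \<tau>"

fun var_obj :: "var \<Rightarrow> 'o" where
  "var_obj (Gnd k) = nat_obj C"
| "var_obj (Hov k \<sigma> \<tau>) = ty_obj (Lolli \<sigma> \<tau>)"
| "var_obj (Stb k \<sigma>) = bang C (ty_obj \<sigma>)"

abbreviation objs :: "var list \<Rightarrow> 'o list" where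
  "objs \<Gamma> \<equiv> map var_obj \<Gamma>"

definition basis_obj :: "var list \<Rightarrow> 'o" where
  "basis_obj \<Gamma> = tensors (objs \<Gamma>)"

definition promote :: "var list \<Rightarrow> var list \<Rightarrow> 'm" where
  \<comment> \<open>\<open>q \<circ> (p\<^sub>\<Gamma> \<otimes> \<delta>\<^sub>\<Delta>)\<close> for ground \<open>\<Gamma>\<close> and stable \<open>\<Delta>\<close>\<close>
  "promote \<Gamma> \<Delta> = qs (objs (\<Gamma> @ \<Delta>))
     \<cdot> tensors_arr (map (\<lambda>_. p_N C) \<Gamma> @ map (\<lambda>v. dig C (ty_obj (var_ty v))) \<Delta>)"

text \<open>\<open>interp \<Gamma> M \<sigma> m\<close>: some derivation of \<open>\<Gamma> \<turnstile> M \<Colon> \<sigma>\<close> has interpretation \<open>m\<close>. The rules are those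
  of \<^const>\<open>typing\<close>.\<close>

inductive interp :: "var list \<Rightarrow> trm \<Rightarrow> ty \<Rightarrow> 'm \<Rightarrow> bool" where
  I_zero: "interp [] Zero Iota (zero_arr C)"
| I_succ: "interp [] Succ (Lolli Iota Iota) (cur C \<one> (nat_obj C) (nat_obj C) (succ_arr C \<cdot> lunit C (nat_obj C)))"
| I_pred: "interp [] Pred (Lolli Iota Iota) (cur C \<one> (nat_obj C) (nat_obj C) (pred_arr C \<cdot> lunit C (nat_obj C)))"
| I_lif: "\<lbrakk>interp \<Gamma> M Iota m; interp \<Delta> L Iota l; interp \<Delta> R Iota r; set \<Gamma> \<inter> set \<Delta> = {}\<rbrakk>
    \<Longrightarrow> interp (\<Gamma> @ \<Delta>) (Lif M L R) Iota
      (lif_arr C \<cdot> (m \<boxtimes> pair C l r) \<cdot> tsplit (objs \<Gamma>) (objs \<Delta>))"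
| I_exchange: "interp (\<Gamma> @ [v, u] @ \<Delta>) M \<tau> m
    \<Longrightarrow> interp (\<Gamma> @ [u, v] @ \<Delta>) M \<tau>
      (m \<cdot> tjoin (objs \<Gamma>) (objs ([v, u] @ \<Delta>))
         \<cdot> (Id C (basis_obj \<Gamma>) \<boxtimes>
              (assoc C (var_obj v) (var_obj u) (basis_obj \<Delta>)
               \<cdot> (braid C (var_obj u) (var_obj v) \<boxtimes> Id C (basis_obj \<Delta>))
               \<cdot> assoc' C (var_obj u) (var_obj v) (basis_obj \<Delta>)))
         \<cdot> tsplit (objs \<Gamma>) (objs ([u, v] @ \<Delta>)))"
| I_ground: "interp [Gnd k] (Fv (Gnd k)) Iota (runit C (nat_obj C))"
| I_ground_weak: "\<lbrakk>interp \<Gamma> M \<tau> m; Gnd k \<notin> set \<Gamma>\<rbrakk>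
    \<Longrightarrow> interp (\<Gamma> @ [Gnd k]) M \<tau>
      (m \<cdot> runit C (basis_obj \<Gamma>) \<cdot> (Id C (basis_obj \<Gamma>) \<boxtimes> w_N C) \<cdot> tunsnoc (objs \<Gamma>) (nat_obj C))"
| I_ground_contr: "\<lbrakk>interp (\<Gamma> @ [Gnd k1, Gnd k2]) M \<tau> m; Gnd k \<notin> set \<Gamma>\<rbrakk>
    \<Longrightarrow> interp (\<Gamma> @ [Gnd k]) (M[Gnd k1 ::= Fv (Gnd k)][Gnd k2 ::= Fv (Gnd k)]) \<tau>
      (m \<cdot> tjoin (objs \<Gamma>) [nat_obj C, nat_obj C]
         \<cdot> (Id C (basis_obj \<Gamma>) \<boxtimes> ((Id C (nat_obj C) \<boxtimes> runit' C (nat_obj C)) \<cdot> c_N C))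
         \<cdot> tunsnoc (objs \<Gamma>) (nat_obj C))"
| I_higher: "interp [Hov k \<sigma> \<tau>] (Fv (Hov k \<sigma> \<tau>)) (Lolli \<sigma> \<tau>) (runit C (ty_obj (Lolli \<sigma> \<tau>)))"
| I_app: "\<lbrakk>interp \<Gamma> M (Lolli \<sigma> \<tau>) m; interp \<Delta> N \<sigma> n; set \<Gamma> \<inter> set \<Delta> = {}\<rbrakk>
    \<Longrightarrow> interp (\<Gamma> @ \<Delta>) (App M N) \<tau>
      (ev C (ty_obj \<sigma>) (ty_obj \<tau>) \<cdot> (m \<boxtimes> n) \<cdot> tsplit (objs \<Gamma>) (objs \<Delta>))"
| I_lam: "\<lbrakk>interp (\<Gamma> @ [x]) M \<tau> m; \<not> stable [x]\<rbrakk>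
    \<Longrightarrow> interp \<Gamma> (LAM x M) (Lolli (var_ty x) \<tau>)
      (cur C (basis_obj \<Gamma>) (ty_obj (var_ty x)) (ty_obj \<tau>) (m \<cdot> tsnoc (objs \<Gamma>) (var_obj x)))"
| I_stable: "interp [Stb k \<sigma>] (Fv (Stb k \<sigma>)) \<sigma> (der C (ty_obj \<sigma>) \<cdot> runit C (bang C (ty_obj \<sigma>)))"
| I_stable_weak: "\<lbrakk>interp \<Gamma> M \<tau> m; Stb k \<sigma> \<notin> set \<Gamma>\<rbrakk>
    \<Longrightarrow> interp (\<Gamma> @ [Stb k \<sigma>]) M \<tau>
      (m \<cdot> runit C (basis_obj \<Gamma>) \<cdot> (Id C (basis_obj \<Gamma>) \<boxtimes> erase C (ty_obj \<sigma>))
         \<cdot> tunsnoc (objs \<Gamma>) (bang C (ty_obj \<sigma>)))"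
| I_stable_contr: "\<lbrakk>interp (\<Gamma> @ [Stb k1 \<sigma>, Stb k2 \<sigma>]) M \<tau> m; Stb k \<sigma> \<notin> set \<Gamma>\<rbrakk>
    \<Longrightarrow> interp (\<Gamma> @ [Stb k \<sigma>]) (M[Stb k1 \<sigma> ::= Fv (Stb k \<sigma>)][Stb k2 \<sigma> ::= Fv (Stb k \<sigma>)]) \<tau>
      (m \<cdot> tjoin (objs \<Gamma>) [bang C (ty_obj \<sigma>), bang C (ty_obj \<sigma>)]
         \<cdot> (Id C (basis_obj \<Gamma>) \<boxtimes>
              ((Id C (bang C (ty_obj \<sigma>)) \<boxtimes> runit' C (bang C (ty_obj \<sigma>))) \<cdot> dupl C (ty_obj \<sigma>)))
         \<cdot> tunsnoc (objs \<Gamma>) (bang C (ty_obj \<sigma>)))"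
| I_mu: "\<lbrakk>interp (\<Gamma> @ \<Delta> @ [Stb k \<sigma>]) M \<sigma> m; ground \<Gamma>; stable \<Delta>\<rbrakk>
    \<Longrightarrow> interp (\<Gamma> @ \<Delta>) (MU (Stb k \<sigma>) M) \<sigma>
      (fix_arr C (ty_obj \<sigma>)
         \<cdot> bang_arr C (cur C (basis_obj (\<Gamma> @ \<Delta>)) (bang C (ty_obj \<sigma>)) (ty_obj \<sigma>)
                        (m \<cdot> tsnoc (objs (\<Gamma> @ \<Delta>)) (bang C (ty_obj \<sigma>))))
         \<cdot> promote \<Gamma> \<Delta>)"

text \<open>The interpretation of a judgment is the common interpretation of all its derivations; an
  equation between such values therefore also rests on the independence of the derivation.\<close>

definition den :: "var list \<Rightarrow> trm \<Rightarrow> ty \<Rightarrow> 'm" where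
  "den \<Gamma> M \<sigma> = (THE m. interp \<Gamma> M \<sigma> m)"

lemma typing_iff_interp: "\<Gamma> \<turnstile> M \<Colon> \<sigma> \<longleftrightarrow> (\<exists>m. interp \<Gamma> M \<sigma> m)"
proof
  show "\<Gamma> \<turnstile> M \<Colon> \<sigma> \<Longrightarrow> \<exists>m. interp \<Gamma> M \<sigma> m"
    by (induction rule: typing.induct) (blast intro: interp.intros)+
  show "\<exists>m. interp \<Gamma> M \<sigma> m \<Longrightarrow> \<Gamma> \<turnstile> M \<Colon> \<sigma>"
  proof (erule exE)
    fix m assume "interp \<Gamma> M \<sigma> m"
    then show "\<Gamma> \<turnstile> M \<Colon> \<sigma>"
      by (induction rule: interp.induct) (blast intro: typing.intros)+
  qed
qed

end

end

theory Submission
  imports Defs "HOL-Library.Multiset"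
begin

text \<open>The denotation \<open>den\<close> is well defined only if all derivations of a judgment have the same
  interpretation, although exchange, weakening and contraction are not syntax-directed. Both this coherence
  and the substitution property come from a second, syntax-directed semantics of terms over
  generalised elements. A stage is a \<open>!\<close>-coalgebra \<open>x\<close>; every free coalgebra and \<open>(N, p)\<close> carry a
  comonoid structure natural in coalgebra morphisms, so arrows parametrised by \<open>x\<close> can be
  duplicated and discarded. An environment assigns to each variable such an arrow, which may also
  consume linear resources. The semantics of a term in an environment is unique, and the
  interpretation of any derivation, evaluated at the environment, agrees with it up to the
  permutation of resources that the rules induce. In this semantics substitution is a change of
  environment. Each basis has a generic environment, whose generalised element is split epi, so
  equations between denotations may be checked there.\<close>

section \<open>Typed arrows and coherence of the units\<close>

text \<open>A direct induction on the derivation of \<open>M\<close> gets stuck: M[N/x] has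
  derivations unrelated to those of \<open>M\<close> and \<open>N\<close>, because a contraction
  leaves no trace of the occurrences it merged and the copies of \<open>N\<close> would need renamed
  bases. Three things are wanted: a unique value for each judgment, a value for M[N/x], and a typing
  of M[N/x]. The typing is extracted from the semantics too: the list of resources that a term
  consumes shows whether each linear variable is used exactly once, and \<open>S_typing\<close>
  reads a derivation off it. Resources carry numbers as labels since two resources with the same
  object could otherwise be exchanged unnoticed. The calculations run in a strictified category
  because the associators would otherwise swamp every equation. What may be put in for a ground or
  stable variable must be a coalgebra morphism. This gives the theorem its shape: numerals are such
  morphisms by the axioms on zero and successor, an arbitrary arrow becomes one by promotion, and
  for a higher-order variable any arrow will do.\<close>

text \<open>Arrows that carry their endpoints, so that equations of arrows become rewrite rules.\<close>

datatype ('o, 'm) tri = Tri (src: 'o) (mor: 'm) (tgt: 'o)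

context sym_monoidal_closed_category
begin

definition ok :: "('o, 'm) tri \<Rightarrow> bool" where
  "ok t \<longleftrightarrow> mor t \<in> Hom C (src t) (tgt t)"

definition cmp :: "('o, 'm) tri \<Rightarrow> ('o, 'm) tri \<Rightarrow> ('o, 'm) tri"  (infixr "\<circ>\<^sub>t" 55) where
  "g \<circ>\<^sub>t f = Tri (src f) (mor g \<cdot> mor f) (tgt g)"

definition tns :: "('o, 'm) tri \<Rightarrow> ('o, 'm) tri \<Rightarrow> ('o, 'm) tri"  (infixr "\<otimes>\<^sub>t" 70) where
  "f \<otimes>\<^sub>t g = Tri (src f \<otimes> src g) (mor f \<boxtimes> mor g) (tgt f \<otimes> tgt g)"

definition "idt A = Tri A (Id C A) A"
definition "asc A B D = Tri ((A \<otimes> B) \<otimes> D) (assoc C A B D) (A \<otimes> (B \<otimes> D))"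
definition "asc' A B D = Tri (A \<otimes> (B \<otimes> D)) (assoc' C A B D) ((A \<otimes> B) \<otimes> D)"
definition "lun A = Tri (\<one> \<otimes> A) (lunit C A) A"
definition "lun' A = Tri A (lunit' C A) (\<one> \<otimes> A)"
definition "run A = Tri (A \<otimes> \<one>) (runit C A) A"
definition "run' A = Tri A (runit' C A) (A \<otimes> \<one>)"
definition "brd A B = Tri (A \<otimes> B) (braid C A B) (B \<otimes> A)"

lemmas tri_defs = cmp_def tns_def idt_def asc_def asc'_def lun_def lun'_def run_def run'_def brd_def

lemma src_tgt [simp]:
  "src (g \<circ>\<^sub>t f) = src f" "tgt (g \<circ>\<^sub>t f) = tgt g"
  "src (f \<otimes>\<^sub>t g) = src f \<otimes> src g" "tgt (f \<otimes>\<^sub>t g) = tgt f \<otimes> tgt g"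
  "src (idt A) = A" "tgt (idt A) = A"
  "src (asc A B D) = (A \<otimes> B) \<otimes> D" "tgt (asc A B D) = A \<otimes> (B \<otimes> D)"
  "src (asc' A B D) = A \<otimes> (B \<otimes> D)" "tgt (asc' A B D) = (A \<otimes> B) \<otimes> D"
  "src (lun A) = \<one> \<otimes> A" "tgt (lun A) = A" "src (lun' A) = A" "tgt (lun' A) = \<one> \<otimes> A"
  "src (run A) = A \<otimes> \<one>" "tgt (run A) = A" "src (run' A) = A" "tgt (run' A) = A \<otimes> \<one>"
  "src (brd A B) = A \<otimes> B" "tgt (brd A B) = B \<otimes> A"
  by (auto simp: tri_defs)

lemma mor_simps:
  "mor (g \<circ>\<^sub>t f) = mor g \<cdot> mor f" "mor (f \<otimes>\<^sub>t g) = mor f \<boxtimes> mor g"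
  "mor (idt A) = Id C A" "mor (asc A B D) = assoc C A B D" "mor (asc' A B D) = assoc' C A B D"
  "mor (lun A) = lunit C A" "mor (lun' A) = lunit' C A"
  "mor (run A) = runit C A" "mor (run' A) = runit' C A" "mor (brd A B) = braid C A B"
  by (auto simp: tri_defs)

lemma ok_cmp [simp]: "ok f \<Longrightarrow> ok g \<Longrightarrow> src g = tgt f \<Longrightarrow> ok (g \<circ>\<^sub>t f)"
  by (auto simp: ok_def mor_simps intro: Comp_hom)

lemma ok_tns [simp]: "ok f \<Longrightarrow> ok g \<Longrightarrow> ok (f \<otimes>\<^sub>t g)"
  by (auto simp: ok_def mor_simps intro: tensor_hom)

lemma ok_simps [simp]:
  "ok (idt A)" "ok (asc A B D)" "ok (asc' A B D)" "ok (lun A)" "ok (lun' A)" "ok (run A)"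
  "ok (run' A)" "ok (brd A B)"
  by (auto simp: ok_def mor_simps Id_hom assoc_hom assoc'_hom lunit_hom lunit'_hom runit_hom
      runit'_hom braid_hom)

lemma tri_eqI: "src f = src g \<Longrightarrow> tgt f = tgt g \<Longrightarrow> mor f = mor g \<Longrightarrow> f = g"
  by (cases f; cases g) auto

lemma ok_Tri [simp]: "ok (Tri A f B) \<longleftrightarrow> f \<in> Hom C A B"
  by (simp add: ok_def)

lemma cmp_assoc [simp]:
  "\<lbrakk>ok f; ok g; ok h; src g = tgt f; src h = tgt g\<rbrakk> \<Longrightarrow> (h \<circ>\<^sub>t g) \<circ>\<^sub>t f = h \<circ>\<^sub>t g \<circ>\<^sub>t f"
  by (rule tri_eqI) (auto simp: mor_simps ok_def intro: Comp_assoc)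

lemma cmp_id [simp]:
  "ok f \<Longrightarrow> A = tgt f \<Longrightarrow> idt A \<circ>\<^sub>t f = f" "ok f \<Longrightarrow> A = src f \<Longrightarrow> f \<circ>\<^sub>t idt A = f"
  by (auto intro!: tri_eqI simp: mor_simps ok_def intro: Comp_Id_left Comp_Id_right)

lemma tns_id [simp]: "idt A \<otimes>\<^sub>t idt B = idt (A \<otimes> B)"
  by (rule tri_eqI) (auto simp: mor_simps tensor_Id)

lemma tns_cmp:
  "\<lbrakk>ok f; ok g; ok f'; ok g'; src g = tgt f; src g' = tgt f'\<rbrakk>
    \<Longrightarrow> (g \<otimes>\<^sub>t g') \<circ>\<^sub>t (f \<otimes>\<^sub>t f') = (g \<circ>\<^sub>t f) \<otimes>\<^sub>t (g' \<circ>\<^sub>t f')"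
  by (rule tri_eqI) (auto simp: mor_simps ok_def intro: tensor_Comp[symmetric])

lemma tns_cmp_tail:
  "\<lbrakk>ok f; ok g; ok f'; ok g'; src g = tgt f; src g' = tgt f'; ok k; tgt k = src f \<otimes> src f'\<rbrakk>
    \<Longrightarrow> (g \<otimes>\<^sub>t g') \<circ>\<^sub>t (f \<otimes>\<^sub>t f') \<circ>\<^sub>t k = ((g \<circ>\<^sub>t f) \<otimes>\<^sub>t (g' \<circ>\<^sub>t f')) \<circ>\<^sub>t k"
  by (simp add: tns_cmp[symmetric])

text \<open>Composites are kept nested to the right, so a law about
  \<open>g \<circ>\<^sub>t f\<close> does not match when further arrows follow. This form and
  \<open>tail2\<close> apply such a law inside a longer composite.\<close>

lemma tail:
  "\<lbrakk>g \<circ>\<^sub>t f = h; ok f; ok g; src g = tgt f; ok k; tgt k = src f\<rbrakk> \<Longrightarrow> g \<circ>\<^sub>t f \<circ>\<^sub>t k = h \<circ>\<^sub>t k"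
  by (simp flip: cmp_assoc)

lemma tail2:
  "\<lbrakk>g \<circ>\<^sub>t f = h \<circ>\<^sub>t l; ok f; ok g; src g = tgt f; ok h; ok l; src h = tgt l; ok k; tgt k = src f\<rbrakk>
    \<Longrightarrow> g \<circ>\<^sub>t f \<circ>\<^sub>t k = h \<circ>\<^sub>t l \<circ>\<^sub>t k"
  by (metis cmp_assoc src_tgt(1))

lemma iso_simps [simp]:
  "asc' A B D \<circ>\<^sub>t asc A B D = idt ((A \<otimes> B) \<otimes> D)" "asc A B D \<circ>\<^sub>t asc' A B D = idt (A \<otimes> (B \<otimes> D))"
  "lun' A \<circ>\<^sub>t lun A = idt (\<one> \<otimes> A)" "lun A \<circ>\<^sub>t lun' A = idt A"
  "run' A \<circ>\<^sub>t run A = idt (A \<otimes> \<one>)" "run A \<circ>\<^sub>t run' A = idt A"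
  "brd B A \<circ>\<^sub>t brd A B = idt (A \<otimes> B)"
  by (auto intro!: tri_eqI simp: mor_simps assoc_iso lunit_iso runit_iso braid_inv)

lemma iso_tails [simp]:
  assumes "ok k"
  shows "tgt k = (A \<otimes> B) \<otimes> D \<Longrightarrow> asc' A B D \<circ>\<^sub>t asc A B D \<circ>\<^sub>t k = k"
    "tgt k = A \<otimes> (B \<otimes> D) \<Longrightarrow> asc A B D \<circ>\<^sub>t asc' A B D \<circ>\<^sub>t k = k"
    "tgt k = \<one> \<otimes> A \<Longrightarrow> lun' A \<circ>\<^sub>t lun A \<circ>\<^sub>t k = k" "tgt k = A \<Longrightarrow> lun A \<circ>\<^sub>t lun' A \<circ>\<^sub>t k = k"
    "tgt k = A \<otimes> \<one> \<Longrightarrow> run' A \<circ>\<^sub>t run A \<circ>\<^sub>t k = k" "tgt k = A \<Longrightarrow> run A \<circ>\<^sub>t run' A \<circ>\<^sub>t k = k"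
    "tgt k = A \<otimes> B \<Longrightarrow> brd B A \<circ>\<^sub>t brd A B \<circ>\<^sub>t k = k"
  using assms by (simp_all flip: cmp_assoc)

lemma asc_nat:
  "\<lbrakk>ok f; ok g; ok h; A = tgt f; B = tgt g; D = tgt h\<rbrakk>
    \<Longrightarrow> asc A B D \<circ>\<^sub>t ((f \<otimes>\<^sub>t g) \<otimes>\<^sub>t h) = (f \<otimes>\<^sub>t (g \<otimes>\<^sub>t h)) \<circ>\<^sub>t asc (src f) (src g) (src h)"
  by (rule tri_eqI) (auto simp: mor_simps ok_def intro: assoc_nat)

lemma asc'_nat:
  "\<lbrakk>ok f; ok g; ok h; A = tgt f; B = tgt g; D = tgt h\<rbrakk>
    \<Longrightarrow> asc' A B D \<circ>\<^sub>t (f \<otimes>\<^sub>t (g \<otimes>\<^sub>t h)) = ((f \<otimes>\<^sub>t g) \<otimes>\<^sub>t h) \<circ>\<^sub>t asc' (src f) (src g) (src h)"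
proof -
  assume a: "ok f" "ok g" "ok h" "A = tgt f" "B = tgt g" "D = tgt h"
  have "asc' A B D \<circ>\<^sub>t (f \<otimes>\<^sub>t (g \<otimes>\<^sub>t h))
      = asc' A B D \<circ>\<^sub>t ((f \<otimes>\<^sub>t (g \<otimes>\<^sub>t h)) \<circ>\<^sub>t asc (src f) (src g) (src h)) \<circ>\<^sub>t asc' (src f) (src g) (src h)"
    using a by simp
  also have "\<dots> = ((f \<otimes>\<^sub>t g) \<otimes>\<^sub>t h) \<circ>\<^sub>t asc' (src f) (src g) (src h)"
    using a by (simp flip: asc_nat)
  finally show ?thesis .
qed

lemma lun_nat: "ok f \<Longrightarrow> A = tgt f \<Longrightarrow> lun A \<circ>\<^sub>t (idt \<one> \<otimes>\<^sub>t f) = f \<circ>\<^sub>t lun (src f)"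
  by (rule tri_eqI) (auto simp: mor_simps ok_def intro: lunit_nat)

lemma run_nat: "ok f \<Longrightarrow> A = tgt f \<Longrightarrow> run A \<circ>\<^sub>t (f \<otimes>\<^sub>t idt \<one>) = f \<circ>\<^sub>t run (src f)"
  by (rule tri_eqI) (auto simp: mor_simps ok_def intro: runit_nat)

lemma brd_nat:
  "\<lbrakk>ok f; ok g; A = tgt f; B = tgt g\<rbrakk> \<Longrightarrow> brd A B \<circ>\<^sub>t (f \<otimes>\<^sub>t g) = (g \<otimes>\<^sub>t f) \<circ>\<^sub>t brd (src f) (src g)"
  by (rule tri_eqI) (auto simp: mor_simps ok_def intro: braid_nat)

lemma pentagon_t: "asc A B (D \<otimes> E) \<circ>\<^sub>t asc (A \<otimes> B) D E
    = (idt A \<otimes>\<^sub>t asc B D E) \<circ>\<^sub>t asc A (B \<otimes> D) E \<circ>\<^sub>t (asc A B D \<otimes>\<^sub>t idt E)"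
  by (rule tri_eqI) (auto simp: mor_simps pentagon)

lemma triangle_t: "(idt A \<otimes>\<^sub>t lun B) \<circ>\<^sub>t asc A \<one> B = run A \<otimes>\<^sub>t idt B"
  by (rule tri_eqI) (auto simp: mor_simps triangle)

lemma hexagon_t: "asc B D A \<circ>\<^sub>t brd A (B \<otimes> D) \<circ>\<^sub>t asc A B D
      = (idt B \<otimes>\<^sub>t brd A D) \<circ>\<^sub>t asc B A D \<circ>\<^sub>t (brd A B \<otimes>\<^sub>t idt D)"
  by (rule tri_eqI) (auto simp: mor_simps hexagon)

lemma epi_cancel:
  "\<lbrakk>f \<circ>\<^sub>t i = g \<circ>\<^sub>t i; i \<circ>\<^sub>t j = idt (tgt i); ok f; ok g; ok i; ok j; src i = tgt j; src f = tgt i; src g = tgt i\<rbrakk> \<Longrightarrow> f = g"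
  by (metis cmp_assoc cmp_id(2))

lemma mono_cancel:
  "\<lbrakk>i \<circ>\<^sub>t f = i \<circ>\<^sub>t g; j \<circ>\<^sub>t i = idt (src i); ok f; ok g; ok i; ok j; src j = tgt i; src i = tgt f; src i = tgt g\<rbrakk> \<Longrightarrow> f = g"
  by (metis cmp_assoc cmp_id(1))

text \<open>By naturality the isomorphism \<open>lun\<close> conjugates
  \<open>idt \<one> \<otimes>\<^sub>t f\<close> to \<open>f\<close>, so tensoring with the unit
  loses nothing.\<close>

lemma unit_faithful_left:
  assumes "idt \<one> \<otimes>\<^sub>t f = idt \<one> \<otimes>\<^sub>t g" "ok f" "ok g" "src f = src g" "tgt f = tgt g"
  shows "f = g"
proof (rule epi_cancel)
  show "f \<circ>\<^sub>t lun (src f) = g \<circ>\<^sub>t lun (src f)" using assms by (metis lun_nat)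
  show "lun (src f) \<circ>\<^sub>t lun' (src f) = idt (tgt (lun (src f)))" by simp
qed (use assms in simp_all)

lemma unit_faithful_right:
  assumes "f \<otimes>\<^sub>t idt \<one> = g \<otimes>\<^sub>t idt \<one>" "ok f" "ok g" "src f = src g" "tgt f = tgt g"
  shows "f = g"
proof (rule epi_cancel)
  show "f \<circ>\<^sub>t run (src f) = g \<circ>\<^sub>t run (src f)" using assms by (metis run_nat)
  show "run (src f) \<circ>\<^sub>t run' (src f) = idt (tgt (run (src f)))" by simp
qed (use assms in simp_all)

text \<open>Kelly's argument: the remaining unit coherences follow from the pentagon and the triangle.\<close>

lemma lun_tensor: "lun (A \<otimes> B) \<circ>\<^sub>t asc \<one> A B = lun A \<otimes>\<^sub>t idt B"
proof (rule unit_faithful_left, rule epi_cancel)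
  \<comment> \<open>These are the last two factors of the pentagon at \<one>, \<one>,
    \<open>A\<close>, \<open>B\<close>. Precomposed with this isomorphism, both sides become paths
    around that pentagon, closed by the triangle and by naturality of \<open>asc\<close>.\<close>
  let ?i = "asc \<one> (\<one> \<otimes> A) B \<circ>\<^sub>t (asc \<one> \<one> A \<otimes>\<^sub>t idt B)"
  have "(idt \<one> \<otimes>\<^sub>t (lun (A \<otimes> B) \<circ>\<^sub>t asc \<one> A B)) \<circ>\<^sub>t ?i
    = (idt \<one> \<otimes>\<^sub>t lun (A \<otimes> B)) \<circ>\<^sub>t (idt \<one> \<otimes>\<^sub>t asc \<one> A B) \<circ>\<^sub>t ?i"
    by (simp add: tns_cmp tns_cmp_tail)
  also have "\<dots> = (idt \<one> \<otimes>\<^sub>t lun (A \<otimes> B)) \<circ>\<^sub>t asc \<one> \<one> (A \<otimes> B) \<circ>\<^sub>t asc (\<one> \<otimes> \<one>) A B"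
    by (simp add: pentagon_t)
  also have "\<dots> = (run \<one> \<otimes>\<^sub>t idt (A \<otimes> B)) \<circ>\<^sub>t asc (\<one> \<otimes> \<one>) A B"
    by (simp add: tail[OF triangle_t])
  also have "\<dots> = asc \<one> A B \<circ>\<^sub>t ((run \<one> \<otimes>\<^sub>t idt A) \<otimes>\<^sub>t idt B)"
    by (simp add: asc_nat)
  also have "\<dots> = asc \<one> A B \<circ>\<^sub>t ((idt \<one> \<otimes>\<^sub>t lun A) \<otimes>\<^sub>t idt B) \<circ>\<^sub>t (asc \<one> \<one> A \<otimes>\<^sub>t idt B)"
    by (simp add: tns_cmp triangle_t)
  also have "\<dots> = (idt \<one> \<otimes>\<^sub>t lun A \<otimes>\<^sub>t idt B) \<circ>\<^sub>t ?i"
    by (simp add: tail2[OF asc_nat])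
  finally show "(idt \<one> \<otimes>\<^sub>t (lun (A \<otimes> B) \<circ>\<^sub>t asc \<one> A B)) \<circ>\<^sub>t ?i = (idt \<one> \<otimes>\<^sub>t lun A \<otimes>\<^sub>t idt B) \<circ>\<^sub>t ?i" .
  show "?i \<circ>\<^sub>t (asc' \<one> \<one> A \<otimes>\<^sub>t idt B) \<circ>\<^sub>t asc' \<one> (\<one> \<otimes> A) B = idt (tgt ?i)"
    by (simp add: tns_cmp tns_cmp_tail)
qed simp_all

lemma run_tensor: "(idt A \<otimes>\<^sub>t run B) \<circ>\<^sub>t asc A B \<one> = run (A \<otimes> B)"
proof (rule unit_faithful_right, rule mono_cancel)
  have "asc A B \<one> \<circ>\<^sub>t ((idt A \<otimes>\<^sub>t run B) \<circ>\<^sub>t asc A B \<one>) \<otimes>\<^sub>t idt \<one>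
     = asc A B \<one> \<circ>\<^sub>t ((idt A \<otimes>\<^sub>t run B) \<otimes>\<^sub>t idt \<one>) \<circ>\<^sub>t (asc A B \<one> \<otimes>\<^sub>t idt \<one>)"
    by (simp add: tns_cmp)
  also have "\<dots> = (idt A \<otimes>\<^sub>t (run B \<otimes>\<^sub>t idt \<one>)) \<circ>\<^sub>t asc A (B \<otimes> \<one>) \<one> \<circ>\<^sub>t (asc A B \<one> \<otimes>\<^sub>t idt \<one>)"
    by (simp add: tail2[OF asc_nat])
  also have "\<dots> = (idt A \<otimes>\<^sub>t (idt B \<otimes>\<^sub>t lun \<one>)) \<circ>\<^sub>t (idt A \<otimes>\<^sub>t asc B \<one> \<one>) \<circ>\<^sub>t asc A (B \<otimes> \<one>) \<one> \<circ>\<^sub>t (asc A B \<one> \<otimes>\<^sub>t idt \<one>)"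
    by (simp add: tns_cmp_tail triangle_t)
  also have "\<dots> = (idt A \<otimes>\<^sub>t (idt B \<otimes>\<^sub>t lun \<one>)) \<circ>\<^sub>t asc A B (\<one> \<otimes> \<one>) \<circ>\<^sub>t asc (A \<otimes> B) \<one> \<one>"
    by (simp add: pentagon_t)
  also have "\<dots> = asc A B \<one> \<circ>\<^sub>t (idt (A \<otimes> B) \<otimes>\<^sub>t lun \<one>) \<circ>\<^sub>t asc (A \<otimes> B) \<one> \<one>"
    by (simp add: tail2[OF asc_nat] flip: tns_id)
  also have "\<dots> = asc A B \<one> \<circ>\<^sub>t (run (A \<otimes> B) \<otimes>\<^sub>t idt \<one>)"
    by (simp add: triangle_t)
  finally show "asc A B \<one> \<circ>\<^sub>t ((idt A \<otimes>\<^sub>t run B) \<circ>\<^sub>t asc A B \<one>) \<otimes>\<^sub>t idt \<one>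
    = asc A B \<one> \<circ>\<^sub>t (run (A \<otimes> B) \<otimes>\<^sub>t idt \<one>)" .
  show "asc' A B \<one> \<circ>\<^sub>t asc A B \<one> = idt (src (asc A B \<one>))" by simp
qed simp_all

text \<open>Naturality of \<open>lun\<close> at its own component gives \<open>idt \<one>
  \<otimes>\<^sub>t lun \<one> = lun (\<one> \<otimes> \<one>)\<close>. The triangle and
  \<open>lun_tensor\<close> then evaluate the same composite once with \<open>run\<close> and once
  with \<open>lun\<close>.\<close>

lemma lun_unit: "lun \<one> = run \<one>"
proof (rule unit_faithful_right)
  have "idt \<one> \<otimes>\<^sub>t lun \<one> = lun (\<one> \<otimes> \<one>)"
  proof (rule mono_cancel[where i = "lun \<one>" and j = "lun' \<one>"])
    show "lun \<one> \<circ>\<^sub>t (idt \<one> \<otimes>\<^sub>t lun \<one>) = lun \<one> \<circ>\<^sub>t lun (\<one> \<otimes> \<one>)" by (simp add: lun_nat)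
  qed simp_all
  then show "lun \<one> \<otimes>\<^sub>t idt \<one> = run \<one> \<otimes>\<^sub>t idt \<one>"
    using triangle_t[of \<one> \<one>] lun_tensor[of \<one> \<one>] by simp
qed simp_all

end

section \<open>Arrows between lists of objects\<close>

text \<open>The strictification of \<open>C\<close>: arrows between iterated tensor products, with strictly associative composition of bases.\<close>

datatype ('o, 'm) sarr = SA (dm: "'o list") (ar: 'm) (cd: "'o list")

context sll_category
begin

abbreviation "ten \<equiv> tensors C"

definition "J as bs = Tri (ten as \<otimes> ten bs) (tjoin C as bs) (ten (as @ bs))"
definition "J' as bs = Tri (ten (as @ bs)) (tsplit C as bs) (ten as \<otimes> ten bs)"

lemma J_rec [simp]:
  "J [] bs = lun (ten bs)" "J (A # as) bs = (idt A \<otimes>\<^sub>t J as bs) \<circ>\<^sub>t asc A (ten as) (ten bs)"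
  "J' [] bs = lun' (ten bs)" "J' (A # as) bs = asc' A (ten as) (ten bs) \<circ>\<^sub>t (idt A \<otimes>\<^sub>t J' as bs)"
  by (simp_all add: J_def J'_def tri_defs)

lemma J_src_tgt [simp]:
  "src (J as bs) = ten as \<otimes> ten bs" "tgt (J as bs) = ten (as @ bs)"
  "tgt (J' as bs) = ten as \<otimes> ten bs" "src (J' as bs) = ten (as @ bs)"
  by (simp_all add: J_def J'_def)

lemma ok_J [simp]: "ok (J as bs)" "ok (J' as bs)"
  by (induction as) (simp_all del: append.simps add: append_Cons)

lemma J_iso [simp]: "J as bs \<circ>\<^sub>t J' as bs = idt (ten (as @ bs))"
  "J' as bs \<circ>\<^sub>t J as bs = idt (ten as \<otimes> ten bs)"
  by (induction as) (simp_all add: tns_cmp tns_cmp_tail)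

lemma J_iso_tail [simp]:
  "ok k \<Longrightarrow> tgt k = ten (as @ bs) \<Longrightarrow> J as bs \<circ>\<^sub>t J' as bs \<circ>\<^sub>t k = k"
  "ok k \<Longrightarrow> tgt k = ten as \<otimes> ten bs \<Longrightarrow> J' as bs \<circ>\<^sub>t J as bs \<circ>\<^sub>t k = k"
  by (simp_all flip: cmp_assoc)

text \<open>This coherence is what makes the tensor of list arrows strictly associative. Each step
  of the induction is one pentagon.\<close>

lemma J_assoc: "J (as @ bs) cs \<circ>\<^sub>t (J as bs \<otimes>\<^sub>t idt (ten cs))
    = J as (bs @ cs) \<circ>\<^sub>t (idt (ten as) \<otimes>\<^sub>t J bs cs) \<circ>\<^sub>t asc (ten as) (ten bs) (ten cs)"
proof (induction as)
  case Nil
  show ?case by (simp add: tail[OF lun_nat] lun_tensor)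
next
  case (Cons A as)
  have "J ((A # as) @ bs) cs \<circ>\<^sub>t (J (A # as) bs \<otimes>\<^sub>t idt (ten cs))
    = (idt A \<otimes>\<^sub>t J (as @ bs) cs) \<circ>\<^sub>t asc A (ten (as @ bs)) (ten cs)
      \<circ>\<^sub>t ((idt A \<otimes>\<^sub>t J as bs) \<otimes>\<^sub>t idt (ten cs)) \<circ>\<^sub>t (asc A (ten as) (ten bs) \<otimes>\<^sub>t idt (ten cs))"
    by (simp add: tns_cmp)
  also have "\<dots> = (idt A \<otimes>\<^sub>t (J (as @ bs) cs \<circ>\<^sub>t (J as bs \<otimes>\<^sub>t idt (ten cs))))
      \<circ>\<^sub>t asc A (ten as \<otimes> ten bs) (ten cs) \<circ>\<^sub>t (asc A (ten as) (ten bs) \<otimes>\<^sub>t idt (ten cs))"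
    by (simp add: tail2[OF asc_nat] tns_cmp_tail)
  also have "\<dots> = (idt A \<otimes>\<^sub>t J as (bs @ cs)) \<circ>\<^sub>t (idt A \<otimes>\<^sub>t (idt (ten as) \<otimes>\<^sub>t J bs cs))
      \<circ>\<^sub>t (idt A \<otimes>\<^sub>t asc (ten as) (ten bs) (ten cs))
      \<circ>\<^sub>t asc A (ten as \<otimes> ten bs) (ten cs) \<circ>\<^sub>t (asc A (ten as) (ten bs) \<otimes>\<^sub>t idt (ten cs))"
    unfolding Cons.IH by (simp add: tns_cmp_tail)
  also have "\<dots> = (idt A \<otimes>\<^sub>t J as (bs @ cs)) \<circ>\<^sub>t (idt A \<otimes>\<^sub>t (idt (ten as) \<otimes>\<^sub>t J bs cs))
      \<circ>\<^sub>t asc A (ten as) (ten bs \<otimes> ten cs) \<circ>\<^sub>t asc (A \<otimes> ten as) (ten bs) (ten cs)"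
    by (simp add: pentagon_t)
  also have "\<dots> = (idt A \<otimes>\<^sub>t J as (bs @ cs)) \<circ>\<^sub>t asc A (ten as) (ten (bs @ cs))
      \<circ>\<^sub>t (idt (A \<otimes> ten as) \<otimes>\<^sub>t J bs cs) \<circ>\<^sub>t asc (A \<otimes> ten as) (ten bs) (ten cs)"
    by (simp add: tail2[OF asc_nat] flip: tns_id)
  finally show ?case by simp
qed

lemma J'_assoc: "(J' as bs \<otimes>\<^sub>t idt (ten cs)) \<circ>\<^sub>t J' (as @ bs) cs
    = asc' (ten as) (ten bs) (ten cs) \<circ>\<^sub>t (idt (ten as) \<otimes>\<^sub>t J' bs cs) \<circ>\<^sub>t J' as (bs @ cs)"
proof (rule epi_cancel[where i = "J (as @ bs) cs \<circ>\<^sub>t (J as bs \<otimes>\<^sub>t idt (ten cs))"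
      and j = "(J' as bs \<otimes>\<^sub>t idt (ten cs)) \<circ>\<^sub>t J' (as @ bs) cs"])
  show "((J' as bs \<otimes>\<^sub>t idt (ten cs)) \<circ>\<^sub>t J' (as @ bs) cs) \<circ>\<^sub>t J (as @ bs) cs \<circ>\<^sub>t (J as bs \<otimes>\<^sub>t idt (ten cs))
    = (asc' (ten as) (ten bs) (ten cs) \<circ>\<^sub>t (idt (ten as) \<otimes>\<^sub>t J' bs cs) \<circ>\<^sub>t J' as (bs @ cs))
      \<circ>\<^sub>t J (as @ bs) cs \<circ>\<^sub>t (J as bs \<otimes>\<^sub>t idt (ten cs))"
    by (simp add: tns_cmp) (simp add: J_assoc tns_cmp_tail)
qed (simp_all add: tns_cmp_tail)

lemma J_nil: "J as [] = run (ten as)"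
  by (induction as) (simp_all add: lun_unit run_tensor)

lemma J'_nil: "J' as [] = run' (ten as)"
  by (rule epi_cancel[where i = "J as []" and j = "J' as []"]) (simp_all, simp add: J_nil)

definition tr :: "('o, 'm) sarr \<Rightarrow> ('o, 'm) tri" where
  "tr f = Tri (ten (dm f)) (ar f) (ten (cd f))"

definition arr :: "('o, 'm) sarr \<Rightarrow> bool" where "arr f \<longleftrightarrow> ok (tr f)"

definition scomp :: "('o, 'm) sarr \<Rightarrow> ('o, 'm) sarr \<Rightarrow> ('o, 'm) sarr"  (infixr "\<circ>\<^sub>s" 55) where
  "g \<circ>\<^sub>s f = SA (dm f) (ar g \<cdot> ar f) (cd g)"

definition stens :: "('o, 'm) sarr \<Rightarrow> ('o, 'm) sarr \<Rightarrow> ('o, 'm) sarr"  (infixr "\<otimes>\<^sub>s" 70) where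
  "f \<otimes>\<^sub>s g = SA (dm f @ dm g) (mor (J (cd f) (cd g) \<circ>\<^sub>t (tr f \<otimes>\<^sub>t tr g) \<circ>\<^sub>t J' (dm f) (dm g))) (cd f @ cd g)"

definition "ids as = SA as (Id C (ten as)) as"
definition "sw as bs = SA (as @ bs) (mor (J bs as \<circ>\<^sub>t brd (ten as) (ten bs) \<circ>\<^sub>t J' as bs)) (bs @ as)"

lemma sdefs [simp]:
  "dm (g \<circ>\<^sub>s f) = dm f" "cd (g \<circ>\<^sub>s f) = cd g" "dm (f \<otimes>\<^sub>s g) = dm f @ dm g" "cd (f \<otimes>\<^sub>s g) = cd f @ cd g"
  "dm (ids as) = as" "cd (ids as) = as" "dm (sw as bs) = as @ bs" "cd (sw as bs) = bs @ as"
  by (simp_all add: scomp_def stens_def ids_def sw_def)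

lemma src_tr [simp]: "src (tr f) = ten (dm f)" "tgt (tr f) = ten (cd f)"
  by (simp_all add: tr_def)

lemma Tri_mor: "A = src f \<Longrightarrow> B = tgt f \<Longrightarrow> Tri A (mor f) B = f" by (cases f) simp

lemma tr_simps:
  "tr (g \<circ>\<^sub>s f) = tr g \<circ>\<^sub>t tr f"
  "tr (f \<otimes>\<^sub>s g) = J (cd f) (cd g) \<circ>\<^sub>t (tr f \<otimes>\<^sub>t tr g) \<circ>\<^sub>t J' (dm f) (dm g)"
  "tr (ids as) = idt (ten as)"
  "tr (sw as bs) = J bs as \<circ>\<^sub>t brd (ten as) (ten bs) \<circ>\<^sub>t J' as bs"
  by (simp_all add: tr_def scomp_def stens_def ids_def sw_def Tri_mor, simp_all add: tri_defs)

lemma sarr_eqI: "dm f = dm g \<Longrightarrow> cd f = cd g \<Longrightarrow> tr f = tr g \<Longrightarrow> f = g"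
  by (cases f; cases g) (simp add: tr_def)

lemma arr_simps [simp]:
  "arr f \<Longrightarrow> arr g \<Longrightarrow> dm g = cd f \<Longrightarrow> arr (g \<circ>\<^sub>s f)"
  "arr f \<Longrightarrow> arr g \<Longrightarrow> arr (f \<otimes>\<^sub>s g)"
  "arr (ids as)" "arr (sw as bs)"
  by (simp_all add: arr_def tr_simps)

lemma scomp_assoc [simp]:
  "\<lbrakk>arr f; arr g; arr h; dm g = cd f; dm h = cd g\<rbrakk> \<Longrightarrow> (h \<circ>\<^sub>s g) \<circ>\<^sub>s f = h \<circ>\<^sub>s g \<circ>\<^sub>s f"
  by (rule sarr_eqI) (auto simp: tr_simps arr_def)

lemma scomp_id [simp]:
  "arr f \<Longrightarrow> as = cd f \<Longrightarrow> ids as \<circ>\<^sub>s f = f" "arr f \<Longrightarrow> as = dm f \<Longrightarrow> f \<circ>\<^sub>s ids as = f"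
  by (auto intro!: sarr_eqI simp: tr_simps arr_def)

lemma stens_id [simp]: "ids as \<otimes>\<^sub>s ids bs = ids (as @ bs)"
  by (rule sarr_eqI) (auto simp: tr_simps)

lemma stens_comp:
  "\<lbrakk>arr f; arr g; arr f'; arr g'; dm g = cd f; dm g' = cd f'\<rbrakk>
    \<Longrightarrow> (g \<otimes>\<^sub>s g') \<circ>\<^sub>s (f \<otimes>\<^sub>s f') = (g \<circ>\<^sub>s f) \<otimes>\<^sub>s (g' \<circ>\<^sub>s f')"
  by (rule sarr_eqI) (auto simp: tr_simps arr_def tns_cmp_tail)

lemma stail:
  "\<lbrakk>g \<circ>\<^sub>s f = h; arr f; arr g; dm g = cd f; arr k; cd k = dm f\<rbrakk> \<Longrightarrow> g \<circ>\<^sub>s f \<circ>\<^sub>s k = h \<circ>\<^sub>s k"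
  by (simp flip: scomp_assoc)

lemma stail2:
  "\<lbrakk>g \<circ>\<^sub>s f = h \<circ>\<^sub>s l; arr f; arr g; dm g = cd f; arr h; arr l; dm h = cd l; arr k; cd k = dm f\<rbrakk>
    \<Longrightarrow> g \<circ>\<^sub>s f \<circ>\<^sub>s k = h \<circ>\<^sub>s l \<circ>\<^sub>s k"
  by (metis scomp_assoc sdefs(1))

lemma stens_comp_tail:
  "\<lbrakk>arr f; arr g; arr f'; arr g'; dm g = cd f; dm g' = cd f'; arr k; cd k = dm f @ dm f'\<rbrakk>
    \<Longrightarrow> (g \<otimes>\<^sub>s g') \<circ>\<^sub>s (f \<otimes>\<^sub>s f') \<circ>\<^sub>s k = ((g \<circ>\<^sub>s f) \<otimes>\<^sub>s (g' \<circ>\<^sub>s f')) \<circ>\<^sub>s k"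
  by (simp add: stens_comp[symmetric])

text \<open>\<open>J_assoc\<close> and \<open>J'_assoc\<close> turn the two bracketings into an
  \<open>asc\<close> after and an \<open>asc'\<close> before the arrows; naturality brings these
  together and they cancel.\<close>

lemma stens_assoc:
  assumes "arr f" "arr g" "arr h"
  shows "(f \<otimes>\<^sub>s g) \<otimes>\<^sub>s h = f \<otimes>\<^sub>s g \<otimes>\<^sub>s h"
proof (rule sarr_eqI)
  let ?j = "idt (ten (dm h))"
  have "tr ((f \<otimes>\<^sub>s g) \<otimes>\<^sub>s h) = J (cd f @ cd g) (cd h) \<circ>\<^sub>t (J (cd f) (cd g) \<otimes>\<^sub>t idt (ten (cd h)))
      \<circ>\<^sub>t ((tr f \<otimes>\<^sub>t tr g) \<otimes>\<^sub>t tr h) \<circ>\<^sub>t (J' (dm f) (dm g) \<otimes>\<^sub>t ?j) \<circ>\<^sub>t J' (dm f @ dm g) (dm h)"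
    using assms by (simp add: tr_simps tns_cmp_tail arr_def)
  also have "\<dots> = J (cd f) (cd g @ cd h) \<circ>\<^sub>t (idt (ten (cd f)) \<otimes>\<^sub>t J (cd g) (cd h))
      \<circ>\<^sub>t (asc (ten (cd f)) (ten (cd g)) (ten (cd h)) \<circ>\<^sub>t ((tr f \<otimes>\<^sub>t tr g) \<otimes>\<^sub>t tr h))
      \<circ>\<^sub>t asc' (ten (dm f)) (ten (dm g)) (ten (dm h)) \<circ>\<^sub>t (idt (ten (dm f)) \<otimes>\<^sub>t J' (dm g) (dm h))
      \<circ>\<^sub>t J' (dm f) (dm g @ dm h)"
    using assms by (simp add: tail[OF J_assoc] J'_assoc arr_def)
  also have "\<dots> = tr (f \<otimes>\<^sub>s g \<otimes>\<^sub>s h)"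
    using assms by (simp add: asc_nat arr_def tns_cmp_tail tr_simps)
  finally show "tr ((f \<otimes>\<^sub>s g) \<otimes>\<^sub>s h) = tr (f \<otimes>\<^sub>s g \<otimes>\<^sub>s h)" .
qed simp_all

lemma stens_unit [simp]: "arr f \<Longrightarrow> ids [] \<otimes>\<^sub>s f = f" "arr f \<Longrightarrow> f \<otimes>\<^sub>s ids [] = f"
  by (rule sarr_eqI; simp add: tr_simps arr_def tail[OF lun_nat] tail[OF run_nat] J_nil J'_nil)+

lemma sw_nat:
  "\<lbrakk>arr f; arr g; as = cd f; bs = cd g\<rbrakk> \<Longrightarrow> sw as bs \<circ>\<^sub>s (f \<otimes>\<^sub>s g) = (g \<otimes>\<^sub>s f) \<circ>\<^sub>s sw (dm f) (dm g)"
  by (rule sarr_eqI) (simp_all add: tr_simps arr_def tail2[OF brd_nat])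

lemma sw_sw [simp]: "sw bs as \<circ>\<^sub>s sw as bs = ids (as @ bs)"
  by (rule sarr_eqI) (simp_all add: tr_simps)

text \<open>This is the hexagon: the joins supply exactly its associators, and \<open>hex\<close> is
  the axiom solved for the braiding past a tensor.\<close>

lemma sw_append_right: "sw as (bs @ cs) = (ids bs \<otimes>\<^sub>s sw as cs) \<circ>\<^sub>s (sw as bs \<otimes>\<^sub>s ids cs)"
proof (rule sarr_eqI)
  let ?a = "ten as" and ?b = "ten bs" and ?c = "ten cs"
  have hex: "asc ?b ?c ?a \<circ>\<^sub>t brd ?a (?b \<otimes> ?c) = (idt ?b \<otimes>\<^sub>t brd ?a ?c) \<circ>\<^sub>t asc ?b ?a ?c
      \<circ>\<^sub>t (brd ?a ?b \<otimes>\<^sub>t idt ?c) \<circ>\<^sub>t asc' ?a ?b ?c"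
    using arg_cong[of _ _ "\<lambda>x. x \<circ>\<^sub>t asc' ?a ?b ?c", OF hexagon_t[of ?b ?c ?a]]
    by simp
  have mid: "J' bs (as @ cs) \<circ>\<^sub>t J (bs @ as) cs \<circ>\<^sub>t (J bs as \<otimes>\<^sub>t idt ?c)
      = (idt ?b \<otimes>\<^sub>t J as cs) \<circ>\<^sub>t asc ?b ?a ?c"
    by (simp add: J_assoc)
  have "tr ((ids bs \<otimes>\<^sub>s sw as cs) \<circ>\<^sub>s (sw as bs \<otimes>\<^sub>s ids cs))
    = J bs (cs @ as) \<circ>\<^sub>t (idt ?b \<otimes>\<^sub>t (J cs as \<circ>\<^sub>t brd ?a ?c \<circ>\<^sub>t J' as cs))
      \<circ>\<^sub>t (J' bs (as @ cs) \<circ>\<^sub>t J (bs @ as) cs \<circ>\<^sub>t (J bs as \<otimes>\<^sub>t idt ?c)) \<circ>\<^sub>t (brd ?a ?b \<otimes>\<^sub>t idt ?c)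
      \<circ>\<^sub>t (J' as bs \<otimes>\<^sub>t idt ?c) \<circ>\<^sub>t J' (as @ bs) cs"
    by (simp add: tr_simps tns_cmp_tail)
  also have "\<dots> = J bs (cs @ as) \<circ>\<^sub>t (idt ?b \<otimes>\<^sub>t J cs as) \<circ>\<^sub>t (idt ?b \<otimes>\<^sub>t brd ?a ?c) \<circ>\<^sub>t asc ?b ?a ?c
      \<circ>\<^sub>t (brd ?a ?b \<otimes>\<^sub>t idt ?c) \<circ>\<^sub>t asc' ?a ?b ?c \<circ>\<^sub>t (idt ?a \<otimes>\<^sub>t J' bs cs) \<circ>\<^sub>t J' as (bs @ cs)"
    unfolding mid by (simp add: J'_assoc tns_cmp_tail)
  also have "\<dots> = J bs (cs @ as) \<circ>\<^sub>t (idt ?b \<otimes>\<^sub>t J cs as) \<circ>\<^sub>t asc ?b ?c ?a \<circ>\<^sub>t brd ?a (?b \<otimes> ?c)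
      \<circ>\<^sub>t (idt ?a \<otimes>\<^sub>t J' bs cs) \<circ>\<^sub>t J' as (bs @ cs)"
    by (simp add: tail[OF hex])
  also have "\<dots> = J (bs @ cs) as \<circ>\<^sub>t (J bs cs \<otimes>\<^sub>t idt ?a) \<circ>\<^sub>t brd ?a (?b \<otimes> ?c)
      \<circ>\<^sub>t (idt ?a \<otimes>\<^sub>t J' bs cs) \<circ>\<^sub>t J' as (bs @ cs)"
    by (simp add: tail[OF J_assoc])
  also have "\<dots> = tr (sw as (bs @ cs))"
    by (simp add: tail2[OF brd_nat] tr_simps tns_cmp_tail)
  finally show "tr (sw as (bs @ cs)) = tr ((ids bs \<otimes>\<^sub>s sw as cs) \<circ>\<^sub>s (sw as bs \<otimes>\<^sub>s ids cs))" by simp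
qed simp_all

lemma s_epi_cancel:
  "\<lbrakk>f \<circ>\<^sub>s i = g \<circ>\<^sub>s i; i \<circ>\<^sub>s j = ids (cd i); arr f; arr g; arr i; arr j; dm i = cd j; dm f = cd i; dm g = cd i\<rbrakk> \<Longrightarrow> f = g"
  by (metis scomp_assoc scomp_id(2))

text \<open>The mirror image needs no second hexagon, because both sides are inverse to the same
  instance of \<open>sw_append_right\<close>.\<close>

lemma sw_append_left: "sw (as @ bs) cs = (sw as cs \<otimes>\<^sub>s ids bs) \<circ>\<^sub>s (ids as \<otimes>\<^sub>s sw bs cs)"
  by (rule s_epi_cancel[where i = "sw cs (as @ bs)" and j = "sw (as @ bs) cs"])
    (simp_all, simp add: sw_append_right stens_comp stens_comp_tail)

text \<open>Splitting the empty list into two empty lists makes this swap idempotent, and an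
  invertible idempotent is the identity. The unit laws of the braiding, \<open>brd_unit\<close> and
  \<open>brd_runit\<close>, are read back from here.\<close>

lemma sw_nil [simp]: "sw as [] = ids as" "sw [] as = ids as"
proof -
  have *: "sw as [] \<circ>\<^sub>s sw as [] = sw as []" using sw_append_right[of as "[]" "[]"] by simp
  show "sw as [] = ids as"
    by (rule s_epi_cancel[where i = "sw as []" and j = "sw [] as"]) (simp_all add: *)
  have *: "sw [] as \<circ>\<^sub>s sw [] as = sw [] as" using sw_append_left[of "[]" "[]" as] by simp
  show "sw [] as = ids as"
    by (rule s_epi_cancel[where i = "sw [] as" and j = "sw as []"]) (simp_all add: *)
qed

section \<open>Permutations of resources\<close>

declare stens_assoc [simp]

lemma stens_id_tail [simp]: "arr f \<Longrightarrow> ids as \<otimes>\<^sub>s ids bs \<otimes>\<^sub>s f = ids (as @ bs) \<otimes>\<^sub>s f"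
  by (simp flip: stens_assoc)

abbreviation obs :: "(nat \<times> 'o) list \<Rightarrow> 'o list" where "obs ts \<equiv> map snd ts"

text \<open>The labels of resources keep equal objects apart, so that the endpoints determine a permutation.\<close>

inductive prm :: "(nat \<times> 'o) list \<Rightarrow> (nat \<times> 'o) list \<Rightarrow> ('o, 'm) sarr \<Rightarrow> bool" where
  prm_id: "os = obs ts \<Longrightarrow> prm ts ts (ids os)"
| prm_step: "prm ts (A @ u # v # B) f
    \<Longrightarrow> prm ts (A @ v # u # B) ((ids (obs A) \<otimes>\<^sub>s sw [snd u] [snd v] \<otimes>\<^sub>s ids (obs B)) \<circ>\<^sub>s f)"

lemma prm_arr: "prm ts us f \<Longrightarrow> arr f \<and> dm f = obs ts \<and> cd f = obs us \<and> mset ts = mset us"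
  by (induction rule: prm.induct) auto

lemma prm_comp: "prm us vs g \<Longrightarrow> prm ts us f \<Longrightarrow> prm ts vs (g \<circ>\<^sub>s f)"
proof (induction rule: prm.induct)
  case (prm_id os us)
  then show ?case using prm_arr[OF prm_id(2)] by simp
next
  case (prm_step us A u v B g)
  then have "prm ts (A @ v # u # B) ((ids (obs A) \<otimes>\<^sub>s sw [snd u] [snd v] \<otimes>\<^sub>s ids (obs B)) \<circ>\<^sub>s g \<circ>\<^sub>s f)"
    by (blast intro: prm.intros)
  then show ?case using prm_arr[OF prm_step(1)] prm_arr[OF prm_step(3)] by simp
qed

lemma prm_left: "prm us vs g \<Longrightarrow> prm (ts @ us) (ts @ vs) (ids (obs ts) \<otimes>\<^sub>s g)"
proof (induction rule: prm.induct)
  case (prm_id os us)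
  then show ?case by (simp add: prm.prm_id)
next
  case (prm_step us A u v B g)
  from prm.prm_step[of "ts @ us" "ts @ A", simplified, OF prm_step(2)]
  show ?case using prm_arr[OF prm_step(1)]
    by (simp add: stens_comp[where f = "ids x" and g = "ids x" for x, simplified, symmetric])
qed

lemma prm_right: "prm us vs g \<Longrightarrow> prm (us @ ts) (vs @ ts) (g \<otimes>\<^sub>s ids (obs ts))"
proof (induction rule: prm.induct)
  case (prm_id os us)
  then show ?case by (simp add: prm.prm_id)
next
  case (prm_step us A u v B g)
  from prm.prm_step[of "us @ ts" "A" u v "B @ ts", simplified, OF prm_step(2)[simplified]]
  show ?case using prm_arr[OF prm_step(1)]
    by (simp add: stens_comp[where f' = "ids x" and g' = "ids x" for x, simplified, symmetric])
qed

lemma prm_tens: "prm ts us f \<Longrightarrow> prm ts' us' g \<Longrightarrow> prm (ts @ ts') (us @ us') (f \<otimes>\<^sub>s g)"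
proof -
  assume *: "prm ts us f" "prm ts' us' g"
  have "prm (ts @ ts') (us @ us') ((ids (obs us) \<otimes>\<^sub>s g) \<circ>\<^sub>s (f \<otimes>\<^sub>s ids (obs ts')))"
    by (rule prm_comp[OF prm_left[OF *(2)] prm_right[OF *(1)]])
  then show ?thesis using prm_arr[OF *(1)] prm_arr[OF *(2)] by (simp add: stens_comp)
qed

lemma prm_sw1: "prm (a # B) (B @ [a]) (sw [snd a] (obs B))"
proof (induction B)
  case Nil
  then show ?case by (simp add: prm_id)
next
  case (Cons b B)
  have "prm ([a, b] @ B) ([b, a] @ B) (sw [snd a] [snd b] \<otimes>\<^sub>s ids (obs B))"
    using prm_step[OF prm_id[OF refl], of "[]" a b B] by simp
  moreover have "prm ([b] @ (a # B)) ([b] @ (B @ [a])) (ids [snd b] \<otimes>\<^sub>s sw [snd a] (obs B))"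
    using prm_left[OF Cons, of "[b]"] by simp
  ultimately show ?case using sw_append_right[of "[snd a]" "[snd b]" "obs B"] prm_comp by fastforce
qed

lemma prm_sw: "as = obs A \<Longrightarrow> bs = obs B \<Longrightarrow> prm (A @ B) (B @ A) (sw as bs)"
proof (induction A arbitrary: as)
  case Nil
  then show ?case by (simp add: prm_id)
next
  case (Cons a A)
  have "prm ((a # B) @ A) ((B @ [a]) @ A) (sw [snd a] (obs B) \<otimes>\<^sub>s ids (obs A))"
    by (rule prm_right[OF prm_sw1])
  moreover have "prm ([a] @ (A @ B)) ([a] @ (B @ A)) (ids [snd a] \<otimes>\<^sub>s sw (obs A) (obs B))"
    using prm_left[OF Cons.IH[OF refl], of "[a]"] Cons by simp
  ultimately show ?case using sw_append_left[of "[snd a]" "obs A" "obs B"] prm_comp Cons by fastforce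
qed

text \<open>Selection sort of \<open>ts\<close> into the order \<open>us\<close>: each target token
  is carried to the front across everything before it. Being computed from the endpoints alone, it
  serves as the normal form of all permutations between them.\<close>

primrec pm :: "(nat \<times> 'o) list \<Rightarrow> (nat \<times> 'o) list \<Rightarrow> ('o, 'm) sarr" where
  "pm ts [] = ids []"
| "pm ts (u # us) = (ids [snd u] \<otimes>\<^sub>s pm (takeWhile (\<lambda>t. t \<noteq> u) ts @ tl (dropWhile (\<lambda>t. t \<noteq> u) ts)) us)
     \<circ>\<^sub>s (sw (obs (takeWhile (\<lambda>t. t \<noteq> u) ts)) [snd u] \<otimes>\<^sub>s ids (obs (tl (dropWhile (\<lambda>t. t \<noteq> u) ts))))"

lemma pm_Cons: "u \<notin> set A \<Longrightarrow> pm (A @ u # B) (u # us)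
    = (ids [snd u] \<otimes>\<^sub>s pm (A @ B) us) \<circ>\<^sub>s (sw (obs A) [snd u] \<otimes>\<^sub>s ids (obs B))"
proof -
  assume "u \<notin> set A"
  then have "takeWhile (\<lambda>t. t \<noteq> u) (A @ u # B) = A" "dropWhile (\<lambda>t. t \<noteq> u) (A @ u # B) = u # B"
    by (subst takeWhile_append2 dropWhile_append2, auto)+
  then show ?thesis by simp
qed

lemma prm_pm: "mset ts = mset us \<Longrightarrow> prm ts us (pm ts us)"
proof (induction us arbitrary: ts)
  case Nil
  then show ?case by (simp add: prm_id)
next
  case (Cons u us)
  then have "u \<in> set ts" by (metis list.set_intros(1) set_mset_mset)
  then obtain A B where ts: "ts = A @ u # B" "u \<notin> set A" by (meson split_list_first)
  then have "mset (A @ B) = mset us" using Cons.prems by simp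
  from prm_left[OF Cons.IH[OF this], of "[u]"]
  have "prm ((u # A) @ B) (u # us) (ids [snd u] \<otimes>\<^sub>s pm (A @ B) us)" by simp
  moreover have "prm ((A @ [u]) @ B) (([u] @ A) @ B) (sw (obs A) [snd u] \<otimes>\<^sub>s ids (obs B))"
    by (intro prm_right prm_sw) simp_all
  ultimately show ?case unfolding ts pm_Cons[OF ts(2)] using prm_comp by fastforce
qed

lemma pm_arr: "mset ts = mset us \<Longrightarrow> arr (pm ts us)"
  "mset ts = mset us \<Longrightarrow> dm (pm ts us) = obs ts" "mset ts = mset us \<Longrightarrow> cd (pm ts us) = obs us"
  using prm_arr[OF prm_pm] by auto

lemma pm_refl: "pm ts ts = ids (obs ts)"
  by (induction ts) simp_all

declare pm.simps(2) [simp del]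

text \<open>The normal form absorbs an adjacent swap. If the next target token is one of the two
  swapped, its passage to the front either cancels the swap or takes it in as its first crossing;
  otherwise the swap slides past by naturality. Distinct labels decide which case applies.\<close>

lemma pm_step:
  assumes "distinct (A @ u # v # B)" "mset us = mset (A @ u # v # B)"
  shows "pm (A @ v # u # B) us \<circ>\<^sub>s (ids (obs A) \<otimes>\<^sub>s sw [snd u] [snd v] \<otimes>\<^sub>s ids (obs B)) = pm (A @ u # v # B) us"
  using assms
proof (induction us arbitrary: A B)
  case Nil
  then show ?case by simp
next
  case (Cons w us)
  let ?X = "sw [snd u] [snd v]"
  have "w \<in> set (A @ u # v # B)" using Cons.prems(2) by (metis list.set_intros(1) set_mset_mset)
  then consider "w \<in> set A" | "w = u" | "w = v" | "w \<in> set B" by auto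
  then show ?case
  proof cases
    case 1
    then obtain A1 A2 where A: "A = A1 @ w # A2" by (meson split_list)
    have w: "w \<notin> set A1" using Cons.prems(1) A by auto
    have m: "mset us = mset ((A1 @ A2) @ u # v # B)" using Cons.prems A by simp
    have IH: "pm ((A1 @ A2) @ v # u # B) us \<circ>\<^sub>s (ids (obs (A1 @ A2)) \<otimes>\<^sub>s ?X \<otimes>\<^sub>s ids (obs B))
      = pm ((A1 @ A2) @ u # v # B) us"
      using Cons.prems A by (intro Cons.IH m) auto
    let ?Y = "ids (obs A2) \<otimes>\<^sub>s ?X \<otimes>\<^sub>s ids (obs B)"
    have *: "arr (pm (A1 @ A2 @ v # u # B) us)" "dm (pm (A1 @ A2 @ v # u # B) us) = obs (A1 @ A2 @ v # u # B)"
      using m by (simp_all add: pm_arr)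
    have "(sw (obs A1) [snd w] \<otimes>\<^sub>s ids (obs (A2 @ v # u # B))) \<circ>\<^sub>s (ids (obs (A1 @ [w])) \<otimes>\<^sub>s ?Y)
       = (ids (obs (w # A1)) \<otimes>\<^sub>s ?Y) \<circ>\<^sub>s (sw (obs A1) [snd w] \<otimes>\<^sub>s ids (obs (A2 @ u # v # B)))"
      by (subst (1 2) stens_comp) simp_all
    moreover have "(ids [snd w] \<otimes>\<^sub>s pm (A1 @ A2 @ v # u # B) us)
        \<circ>\<^sub>s (ids [snd w] \<otimes>\<^sub>s (ids (obs (A1 @ A2)) \<otimes>\<^sub>s ?X \<otimes>\<^sub>s ids (obs B)))
       = ids [snd w] \<otimes>\<^sub>s pm (A1 @ A2 @ u # v # B) us"
      using IH * by (subst stens_comp) simp_all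
    ultimately show ?thesis
      unfolding A using w * by (simp add: pm_Cons) (simp flip: scomp_assoc)
  next
    case 2
    then have w: "u \<notin> set (A @ [v])" "u \<notin> set A" using Cons.prems(1) by auto
    have m: "mset (A @ v # B) = mset us" using Cons.prems 2 by simp
    have e: "pm ((A @ [v]) @ u # B) (u # us) = (ids [snd u] \<otimes>\<^sub>s pm (A @ v # B) us)
       \<circ>\<^sub>s (((sw (obs A) [snd u] \<otimes>\<^sub>s ids [snd v]) \<circ>\<^sub>s (ids (obs A) \<otimes>\<^sub>s sw [snd v] [snd u])) \<otimes>\<^sub>s ids (obs B))"
      using pm_Cons[OF w(1)] by (simp add: sw_append_left)
    have "pm (A @ v # u # B) (u # us) \<circ>\<^sub>s (ids (obs A) \<otimes>\<^sub>s ?X \<otimes>\<^sub>s ids (obs B))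
      = (ids [snd u] \<otimes>\<^sub>s pm (A @ v # B) us)
       \<circ>\<^sub>s (((sw (obs A) [snd u] \<otimes>\<^sub>s ids [snd v]) \<circ>\<^sub>s (ids (obs A) \<otimes>\<^sub>s sw [snd v] [snd u])) \<otimes>\<^sub>s ids (obs B))
       \<circ>\<^sub>s ((ids (obs A) \<otimes>\<^sub>s ?X) \<otimes>\<^sub>s ids (obs B))"
      using m e by (simp add: pm_arr)
    also have "\<dots> = (ids [snd u] \<otimes>\<^sub>s pm (A @ v # B) us)
       \<circ>\<^sub>s (((sw (obs A) [snd u] \<otimes>\<^sub>s ids [snd v]) \<circ>\<^sub>s (ids (obs A) \<otimes>\<^sub>s (sw [snd v] [snd u] \<circ>\<^sub>s ?X))) \<otimes>\<^sub>s ids (obs B))"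
      by (subst stens_comp[where f' = "ids (obs B)" and g' = "ids (obs B)"]) (simp_all add: stens_comp)
    also have "\<dots> = pm (A @ u # v # B) (u # us)"
      using w(2) by (simp add: pm_Cons)
    finally show ?thesis using 2 by simp
  next
    case 3
    then have w: "v \<notin> set (A @ [u])" "v \<notin> set A" using Cons.prems(1) by auto
    have m: "mset (A @ u # B) = mset us" using Cons.prems 3 by simp
    have "pm (A @ v # u # B) (v # us) \<circ>\<^sub>s (ids (obs A) \<otimes>\<^sub>s ?X \<otimes>\<^sub>s ids (obs B))
      = (ids [snd v] \<otimes>\<^sub>s pm (A @ u # B) us)
       \<circ>\<^sub>s ((sw (obs A) [snd v] \<otimes>\<^sub>s ids [snd u]) \<otimes>\<^sub>s ids (obs B))
       \<circ>\<^sub>s ((ids (obs A) \<otimes>\<^sub>s ?X) \<otimes>\<^sub>s ids (obs B))"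
      using w(2) m by (simp add: pm_Cons pm_arr)
    also have "\<dots> = (ids [snd v] \<otimes>\<^sub>s pm (A @ u # B) us) \<circ>\<^sub>s (sw (obs (A @ [u])) [snd v] \<otimes>\<^sub>s ids (obs B))"
      by (subst stens_comp) (simp_all add: sw_append_left)
    also have "\<dots> = pm ((A @ [u]) @ v # B) (v # us)" using pm_Cons[OF w(1)] by simp
    finally show ?thesis using 3 by simp
  next
    case 4
    then obtain B1 B2 where B: "B = B1 @ w # B2" by (meson split_list)
    have w: "w \<notin> set (A @ v # u # B1)" "w \<notin> set (A @ u # v # B1)" using Cons.prems(1) B by auto
    have m: "mset us = mset (A @ u # v # B1 @ B2)" using Cons.prems B by simp
    have IH: "pm (A @ v # u # B1 @ B2) us \<circ>\<^sub>s (ids (obs A) \<otimes>\<^sub>s ?X \<otimes>\<^sub>s ids (obs (B1 @ B2)))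
      = pm (A @ u # v # B1 @ B2) us"
      using Cons.prems B by (intro Cons.IH m) auto
    let ?Y = "ids (obs A) \<otimes>\<^sub>s ?X \<otimes>\<^sub>s ids (obs B1)"
    have *: "arr (pm (A @ v # u # B1 @ B2) us)" "dm (pm (A @ v # u # B1 @ B2) us) = obs (A @ v # u # B1 @ B2)"
      using m by (simp_all add: pm_arr)
    have "sw (obs (A @ v # u # B1)) [snd w] \<circ>\<^sub>s (?Y \<otimes>\<^sub>s ids [snd w])
       = (ids [snd w] \<otimes>\<^sub>s ?Y) \<circ>\<^sub>s sw (obs (A @ u # v # B1)) [snd w]"
      by (subst sw_nat) simp_all
    then have "(sw (obs (A @ v # u # B1)) [snd w] \<otimes>\<^sub>s ids (obs B2)) \<circ>\<^sub>s ((?Y \<otimes>\<^sub>s ids [snd w]) \<otimes>\<^sub>s ids (obs B2))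
       = ((ids [snd w] \<otimes>\<^sub>s ?Y) \<otimes>\<^sub>s ids (obs B2)) \<circ>\<^sub>s (sw (obs (A @ u # v # B1)) [snd w] \<otimes>\<^sub>s ids (obs B2))"
      by (subst (1 2) stens_comp) simp_all
    moreover have "(ids [snd w] \<otimes>\<^sub>s pm (A @ v # u # B1 @ B2) us) \<circ>\<^sub>s (ids [snd w] \<otimes>\<^sub>s (?Y \<otimes>\<^sub>s ids (obs B2)))
       = ids [snd w] \<otimes>\<^sub>s pm (A @ u # v # B1 @ B2) us"
      using IH * by (subst stens_comp) simp_all
    ultimately show ?thesis
      unfolding B using pm_Cons[OF w(1), of B2 us] pm_Cons[OF w(2), of B2 us] *
      by simp (simp flip: scomp_assoc)
  qed
qed

lemma prm_pm_comp:
  "prm ts us f \<Longrightarrow> distinct ts \<Longrightarrow> mset vs = mset ts \<Longrightarrow> pm us vs \<circ>\<^sub>s f = pm ts vs"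
proof (induction rule: prm.induct)
  case (prm_id os ts)
  then show ?case by (simp add: pm_arr)
next
  case (prm_step ts A u v B f)
  note * = prm_arr[OF prm_step(1)]
  have "distinct (A @ u # v # B)" "mset vs = mset (A @ u # v # B)"
    using * prm_step.prems by (metis mset_eq_imp_distinct_iff)+
  from pm_step[OF this] show ?case using prm_step *
    by (subst scomp_assoc[symmetric]) (simp_all add: pm_arr)
qed

text \<open>Coherence for symmetries: both arrows followed by \<open>pm us us\<close>, which is the
  identity, equal \<open>pm ts us\<close>. Equations between purely structural arrows are settled
  this way below.\<close>

lemma prm_unique: "prm ts us f \<Longrightarrow> prm ts us g \<Longrightarrow> distinct ts \<Longrightarrow> f = g"
  using prm_pm_comp[of ts us f us] prm_pm_comp[of ts us g us] prm_arr[of ts us f] prm_arr[of ts us g]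
  by (simp add: pm_refl)

lemma prm_eq_pm: "prm ts us f \<Longrightarrow> distinct ts \<Longrightarrow> pm ts us = f"
  using prm_unique prm_pm prm_arr by blast

lemma pm_comp: "\<lbrakk>mset ts = mset us; mset us = mset vs; distinct ts\<rbrakk> \<Longrightarrow> pm us vs \<circ>\<^sub>s pm ts us = pm ts vs"
  by (simp add: prm_pm prm_pm_comp)

lemma pm_tens: "\<lbrakk>mset ts = mset us; mset ts' = mset us'; distinct (ts @ ts')\<rbrakk>
    \<Longrightarrow> pm (ts @ ts') (us @ us') = pm ts us \<otimes>\<^sub>s pm ts' us'"
  by (intro prm_eq_pm prm_tens prm_pm)

text \<open>An injective relabelling that keeps the objects preserves which token is found first,
  and the arrow depends on the objects only.\<close>

lemma pm_map: "inj f \<Longrightarrow> (\<And>t. snd (f t) = snd t) \<Longrightarrow> pm (map f ts) (map f us) = pm ts us"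
proof (induction us arbitrary: ts)
  case Nil
  show ?case by simp
next
  case (Cons u us)
  let ?a = "takeWhile (\<lambda>t. t \<noteq> u) ts" and ?b = "tl (dropWhile (\<lambda>t. t \<noteq> u) ts)"
  have *: "(\<lambda>t. t \<noteq> f u) \<circ> f = (\<lambda>t. t \<noteq> u)" by (rule ext) (simp add: inj_eq[OF Cons.prems(1)])
  have o: "snd \<circ> f = snd" by (rule ext) (simp only: comp_apply Cons.prems(2))
  have "takeWhile (\<lambda>t. t \<noteq> f u) (map f ts) = map f ?a"
    unfolding takeWhile_map * ..
  moreover have "tl (dropWhile (\<lambda>t. t \<noteq> f u) (map f ts)) = map f ?b"
    unfolding dropWhile_map * by (rule map_tl[symmetric])
  moreover have "pm (map f ?a @ map f ?b) (map f us) = pm (?a @ ?b) us"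
    using Cons.IH[OF Cons.prems, of "?a @ ?b"] by simp
  ultimately show ?case by (simp add: pm.simps(2) o Cons.prems(2))
qed

text \<open>Positions serve as labels. An equation between permutations of a plain list of objects
  is proved by labelling the list and applying \<open>prm_unique\<close>.\<close>

lemma tokens_exist:
  obtains ts :: "(nat \<times> 'o) list" where "distinct ts" "obs ts = os"
  by (rule that[of "zip [0..<length os] os"]) (simp_all add: distinct_zipI1)

section \<open>Coalgebras as comonoids\<close>

definition "bng t = Tri (bang C (src t)) (bang_arr C (mor t)) (bang C (tgt t))"
definition "digt A = Tri (bang C A) (dig C A) (bang C (bang C A))"
definition "dert A = Tri (bang C A) (der C A) A"
definition "qt A B = Tri (bang C A \<otimes> bang C B) (qmon C A B) (bang C (A \<otimes> B))"
definition "qut = Tri \<one> (qmon_unit C) (bang C \<one>)"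
definition "dupt A = Tri (bang C A) (dupl C A) (bang C A \<otimes> bang C A)"
definition "erat A = Tri (bang C A) (erase C A) \<one>"
definition "midt A B D E = asc' A D (B \<otimes> E)
     \<circ>\<^sub>t (idt A \<otimes>\<^sub>t (asc D B E \<circ>\<^sub>t (brd B D \<otimes>\<^sub>t idt E) \<circ>\<^sub>t asc' B D E)) \<circ>\<^sub>t asc A B (D \<otimes> E)"

lemmas btri_defs = bng_def digt_def dert_def qt_def qut_def dupt_def erat_def

lemma bsrc_tgt [simp]:
  "src (bng t) = bang C (src t)" "tgt (bng t) = bang C (tgt t)"
  "src (digt A) = bang C A" "tgt (digt A) = bang C (bang C A)" "src (dert A) = bang C A" "tgt (dert A) = A"
  "src (qt A B) = bang C A \<otimes> bang C B" "tgt (qt A B) = bang C (A \<otimes> B)"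
  "src qut = \<one>" "tgt qut = bang C \<one>" "src (dupt A) = bang C A" "tgt (dupt A) = bang C A \<otimes> bang C A"
  "src (erat A) = bang C A" "tgt (erat A) = \<one>"
  "src (midt A B D E) = (A \<otimes> B) \<otimes> (D \<otimes> E)" "tgt (midt A B D E) = (A \<otimes> D) \<otimes> (B \<otimes> E)"
  by (simp_all add: btri_defs midt_def)

lemma bmor:
  "mor (bng t) = bang_arr C (mor t)" "mor (digt A) = dig C A" "mor (dert A) = der C A"
  "mor (qt A B) = qmon C A B" "mor qut = qmon_unit C" "mor (dupt A) = dupl C A" "mor (erat A) = erase C A"
  "mor (midt A B D E) = mid C A B D E"
  by (simp_all add: btri_defs midt_def mid_def mor_simps)

lemma bok [simp]: "ok t \<Longrightarrow> ok (bng t)" "ok (digt A)" "ok (dert A)" "ok (qt A B)" "ok qut"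
  "ok (dupt A)" "ok (erat A)" "ok (midt A B D E)"
proof -
  show "ok t \<Longrightarrow> ok (bng t)" by (simp add: bng_def bang_hom ok_def)
  show "ok (digt A)" "ok (dert A)" "ok (qt A B)" "ok qut"
    by (simp_all add: btri_defs dig_hom der_hom q_hom q_unit_hom)
  show "ok (dupt A)" "ok (erat A)"
    using bang_comonoid[of A] by (simp_all add: btri_defs comm_comonoid_def)
  show "ok (midt A B D E)" by (simp add: midt_def)
qed

lemma bng_id [simp]: "bng (idt A) = idt (bang C A)"
  by (rule tri_eqI) (auto simp: bmor mor_simps bang_Id)

lemma bng_cmp: "\<lbrakk>ok f; ok g; src g = tgt f\<rbrakk> \<Longrightarrow> bng (g \<circ>\<^sub>t f) = bng g \<circ>\<^sub>t bng f"
  by (rule tri_eqI) (auto simp: bmor mor_simps ok_def intro!: bang_Comp)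

lemma digt_nat: "ok f \<Longrightarrow> B = tgt f \<Longrightarrow> digt B \<circ>\<^sub>t bng f = bng (bng f) \<circ>\<^sub>t digt (src f)"
  by (rule tri_eqI) (auto simp: bmor mor_simps ok_def dig_nat)

lemma dert_nat: "ok f \<Longrightarrow> B = tgt f \<Longrightarrow> dert B \<circ>\<^sub>t bng f = f \<circ>\<^sub>t dert (src f)"
  by (rule tri_eqI) (auto simp: bmor mor_simps ok_def der_nat)

lemma qt_nat: "\<lbrakk>ok f; ok g; A = tgt f; B = tgt g\<rbrakk>
    \<Longrightarrow> qt A B \<circ>\<^sub>t (bng f \<otimes>\<^sub>t bng g) = bng (f \<otimes>\<^sub>t g) \<circ>\<^sub>t qt (src f) (src g)"
  by (rule tri_eqI) (auto simp: bmor mor_simps ok_def q_nat)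

lemma dupt_nat: "ok f \<Longrightarrow> B = tgt f \<Longrightarrow> dupt B \<circ>\<^sub>t bng f = (bng f \<otimes>\<^sub>t bng f) \<circ>\<^sub>t dupt (src f)"
  by (rule tri_eqI) (auto simp: bmor mor_simps ok_def dupl_nat)

lemma erat_nat: "ok f \<Longrightarrow> B = tgt f \<Longrightarrow> erat B \<circ>\<^sub>t bng f = erat (src f)"
  by (rule tri_eqI) (auto simp: bmor mor_simps ok_def erase_nat)

lemma digt_coassoc: "digt (bang C A) \<circ>\<^sub>t digt A = bng (digt A) \<circ>\<^sub>t digt A"
  by (rule tri_eqI) (auto simp: bmor mor_simps dig_coassoc)

lemma dert_digt: "dert (bang C A) \<circ>\<^sub>t digt A = idt (bang C A)" "bng (dert A) \<circ>\<^sub>t digt A = idt (bang C A)"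
  by (rule tri_eqI; auto simp: bmor mor_simps der_dig)+

lemma digt_q: "digt (A \<otimes> B) \<circ>\<^sub>t qt A B
    = bng (qt A B) \<circ>\<^sub>t qt (bang C A) (bang C B) \<circ>\<^sub>t (digt A \<otimes>\<^sub>t digt B)"
  "digt \<one> \<circ>\<^sub>t qut = bng qut \<circ>\<^sub>t qut"
  by (rule tri_eqI; auto simp: bmor mor_simps dig_q dig_q_unit)+

lemma dert_q: "dert (A \<otimes> B) \<circ>\<^sub>t qt A B = dert A \<otimes>\<^sub>t dert B" "dert \<one> \<circ>\<^sub>t qut = idt \<one>"
  by (rule tri_eqI; auto simp: bmor mor_simps der_q der_q_unit)+

lemma qt_unit: "bng (lun A) \<circ>\<^sub>t qt \<one> A \<circ>\<^sub>t (qut \<otimes>\<^sub>t idt (bang C A)) = lun (bang C A)"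
  "bng (run A) \<circ>\<^sub>t qt A \<one> \<circ>\<^sub>t (idt (bang C A) \<otimes>\<^sub>t qut) = run (bang C A)"
  by (rule tri_eqI; auto simp: bmor mor_simps q_lunit q_runit)+

lemma dupt_q: "dupt (A \<otimes> B) \<circ>\<^sub>t qt A B = (qt A B \<otimes>\<^sub>t qt A B)
    \<circ>\<^sub>t midt (bang C A) (bang C A) (bang C B) (bang C B) \<circ>\<^sub>t (dupt A \<otimes>\<^sub>t dupt B)"
  by (rule tri_eqI) (auto simp: bmor mor_simps dupl_q)

lemma dupt_coassoc: "asc (bang C A) (bang C A) (bang C A) \<circ>\<^sub>t (dupt A \<otimes>\<^sub>t idt (bang C A)) \<circ>\<^sub>t dupt A
    = (idt (bang C A) \<otimes>\<^sub>t dupt A) \<circ>\<^sub>t dupt A"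
  and dupt_lunit: "lun (bang C A) \<circ>\<^sub>t (erat A \<otimes>\<^sub>t idt (bang C A)) \<circ>\<^sub>t dupt A = idt (bang C A)"
  and dupt_runit: "run (bang C A) \<circ>\<^sub>t (idt (bang C A) \<otimes>\<^sub>t erat A) \<circ>\<^sub>t dupt A = idt (bang C A)"
  and dupt_comm: "brd (bang C A) (bang C A) \<circ>\<^sub>t dupt A = dupt A"
proof -
  note * = bang_comonoid[of A, unfolded comm_comonoid_def]
  show "asc (bang C A) (bang C A) (bang C A) \<circ>\<^sub>t (dupt A \<otimes>\<^sub>t idt (bang C A)) \<circ>\<^sub>t dupt A
    = (idt (bang C A) \<otimes>\<^sub>t dupt A) \<circ>\<^sub>t dupt A"
    by (rule tri_eqI) (simp_all only: src_tgt bsrc_tgt bmor mor_simps *)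
  show "lun (bang C A) \<circ>\<^sub>t (erat A \<otimes>\<^sub>t idt (bang C A)) \<circ>\<^sub>t dupt A = idt (bang C A)"
    by (rule tri_eqI) (simp_all only: src_tgt bsrc_tgt bmor mor_simps *)
  show "run (bang C A) \<circ>\<^sub>t (idt (bang C A) \<otimes>\<^sub>t erat A) \<circ>\<^sub>t dupt A = idt (bang C A)"
    by (rule tri_eqI) (simp_all only: src_tgt bsrc_tgt bmor mor_simps *)
  show "brd (bang C A) (bang C A) \<circ>\<^sub>t dupt A = dupt A"
    by (rule tri_eqI) (simp_all only: src_tgt bsrc_tgt bmor mor_simps *)
qed

section \<open>Coalgebras, their morphisms and the comonoids they carry\<close>

definition coal :: "('o, 'm) tri \<Rightarrow> bool" where
  "coal x \<longleftrightarrow> ok x \<and> tgt x = bang C (src x) \<and> dert (src x) \<circ>\<^sub>t x = idt (src x)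
     \<and> digt (src x) \<circ>\<^sub>t x = bng x \<circ>\<^sub>t x"

definition cmor :: "('o, 'm) tri \<Rightarrow> ('o, 'm) tri \<Rightarrow> ('o, 'm) tri \<Rightarrow> bool" where
  "cmor x y h \<longleftrightarrow> ok h \<and> src h = src x \<and> tgt h = src y \<and> y \<circ>\<^sub>t h = bng h \<circ>\<^sub>t x"

text \<open>The comonoid structure that a coalgebra inherits from the free one: enter
  \<open>!\<close> by \<open>x\<close>, duplicate or erase there, and derelict the copies.
  \<open>ct\<close> is the tensor product of coalgebras.\<close>

definition "cc x = (dert (src x) \<otimes>\<^sub>t dert (src x)) \<circ>\<^sub>t dupt (src x) \<circ>\<^sub>t x"
definition "ww x = erat (src x) \<circ>\<^sub>t x"
definition "ct x y = qt (src x) (src y) \<circ>\<^sub>t (x \<otimes>\<^sub>t y)"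

lemma coalD [simp]: "coal x \<Longrightarrow> ok x" "coal x \<Longrightarrow> tgt x = bang C (src x)"
  "coal x \<Longrightarrow> A = src x \<Longrightarrow> dert A \<circ>\<^sub>t x = idt A"
  by (simp_all add: coal_def)

lemma coal_dig: "coal x \<Longrightarrow> digt (src x) \<circ>\<^sub>t x = bng x \<circ>\<^sub>t x" unfolding coal_def by blast

lemma cmorD: "cmor x y h \<Longrightarrow> ok h" "cmor x y h \<Longrightarrow> src h = src x" "cmor x y h \<Longrightarrow> tgt h = src y"
  "cmor x y h \<Longrightarrow> y \<circ>\<^sub>t h = bng h \<circ>\<^sub>t x"
  by (simp_all add: cmor_def)

lemma cc_simps [simp]:
  "src (cc x) = src x" "tgt (cc x) = src x \<otimes> src x" "src (ww x) = src x" "tgt (ww x) = \<one>"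
  "src (ct x y) = src x \<otimes> src y" "tgt (ct x y) = bang C (src x \<otimes> src y)"
  "coal x \<Longrightarrow> ok (cc x)" "coal x \<Longrightarrow> ok (ww x)" "coal x \<Longrightarrow> coal y \<Longrightarrow> ok (ct x y)"
  by (simp_all add: cc_def ww_def ct_def)

lemma cmor_digt_comonoid:
  assumes "cmor (digt A) (digt B) f"
  shows "dupt B \<circ>\<^sub>t f = (f \<otimes>\<^sub>t f) \<circ>\<^sub>t dupt A" "erat B \<circ>\<^sub>t f = erat A"
proof -
  have "coalgebra_mor C (bang C A) (dig C A) (bang C B) (dig C B) (mor f)"
    using assms unfolding cmor_def coalgebra_mor_def
    by (auto simp: ok_def bmor mor_simps dest!: arg_cong[of _ _ mor])
  from free_coalgebra_mor[OF this]
  show "dupt B \<circ>\<^sub>t f = (f \<otimes>\<^sub>t f) \<circ>\<^sub>t dupt A" "erat B \<circ>\<^sub>t f = erat A" using assms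
    by (auto intro!: tri_eqI simp: comonoid_mor_def bmor mor_simps cmor_def)
qed

lemma coal_digt [simp]: "coal (digt A)"
  unfolding coal_def by (simp add: dert_digt digt_coassoc)

text \<open>\<open>dig\<close> is a morphism of free coalgebras, hence by axiom of comonoids;
  dereliction then removes the extra layer of \<open>!\<close> from each copy.\<close>

lemma cc_digt: "cc (digt A) = dupt A" "ww (digt A) = erat A"
proof -
  have c: "cmor (digt A) (digt (bang C A)) (digt A)"
    by (simp add: cmor_def digt_coassoc)
  show "cc (digt A) = dupt A" "ww (digt A) = erat A"
    by (simp_all add: cc_def ww_def cmor_digt_comonoid[OF c] tns_cmp_tail dert_digt)
qed

text \<open>So \<open>x\<close> is a comonoid morphism from the inherited structure to that of the
  free coalgebra. As dereliction is a retraction of \<open>x\<close>, the comonoid laws of the free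
  coalgebra descend to \<open>cc\<close> and \<open>ww\<close>.\<close>

lemma cc_dup: assumes x: "coal x" shows "(x \<otimes>\<^sub>t x) \<circ>\<^sub>t cc x = dupt (src x) \<circ>\<^sub>t x"
proof -
  let ?X = "src x"
  have "(x \<otimes>\<^sub>t x) \<circ>\<^sub>t cc x = ((x \<circ>\<^sub>t dert ?X) \<otimes>\<^sub>t (x \<circ>\<^sub>t dert ?X)) \<circ>\<^sub>t dupt ?X \<circ>\<^sub>t x"
    using x by (simp add: cc_def tns_cmp_tail)
  also have "\<dots> = ((dert (bang C ?X) \<circ>\<^sub>t bng x) \<otimes>\<^sub>t (dert (bang C ?X) \<circ>\<^sub>t bng x)) \<circ>\<^sub>t dupt ?X \<circ>\<^sub>t x"
    using x by (simp add: dert_nat)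
  also have "\<dots> = (dert (bang C ?X) \<otimes>\<^sub>t dert (bang C ?X)) \<circ>\<^sub>t dupt (bang C ?X) \<circ>\<^sub>t bng x \<circ>\<^sub>t x"
    using x by (simp add: tail[OF dupt_nat] tns_cmp_tail)
  also have "\<dots> = cc (digt ?X) \<circ>\<^sub>t x"
    using x by (simp add: cc_def flip: coal_dig)
  finally show ?thesis by (simp add: cc_digt)
qed

lemma cmor_comonoid:
  assumes "coal x" "coal y" "cmor x y h"
  shows "cc y \<circ>\<^sub>t h = (h \<otimes>\<^sub>t h) \<circ>\<^sub>t cc x" "ww y \<circ>\<^sub>t h = ww x"
  using assms cmorD[OF assms(3)]
  by (simp_all add: cc_def ww_def tail2[OF dupt_nat] tns_cmp_tail dert_nat tail[OF erat_nat])

lemma cmor_id: "coal x \<Longrightarrow> cmor x x (idt (src x))"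
  by (simp add: cmor_def)

lemma cmor_cmp: "\<lbrakk>cmor x y f; cmor y z g; ok x; ok y; ok z; tgt x = bang C (src x); tgt y = bang C (src y); tgt z = bang C (src z)\<rbrakk> \<Longrightarrow> cmor x z (g \<circ>\<^sub>t f)"
  by (auto simp: cmor_def bng_cmp) (metis bok(1) bsrc_tgt(1,2) tail2 cmp_assoc)

lemma coal_qut [simp]: "coal qut"
  unfolding coal_def by (simp add: dert_q digt_q)

lemma coal_ct [simp]:
  assumes "coal x" "coal y" shows "coal (ct x y)"
proof -
  have q: "qt (bang C (src x)) (bang C (src y)) \<circ>\<^sub>t (bng x \<otimes>\<^sub>t bng y) = bng (x \<otimes>\<^sub>t y) \<circ>\<^sub>t qt (src x) (src y)"
    using assms by (simp add: qt_nat)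
  have "digt (src x \<otimes> src y) \<circ>\<^sub>t ct x y
     = bng (qt (src x) (src y)) \<circ>\<^sub>t qt (bang C (src x)) (bang C (src y))
       \<circ>\<^sub>t (digt (src x) \<otimes>\<^sub>t digt (src y)) \<circ>\<^sub>t (x \<otimes>\<^sub>t y)"
    using assms by (simp add: ct_def tail[OF digt_q(1)])
  also have "(digt (src x) \<otimes>\<^sub>t digt (src y)) \<circ>\<^sub>t (x \<otimes>\<^sub>t y) = (bng x \<otimes>\<^sub>t bng y) \<circ>\<^sub>t (x \<otimes>\<^sub>t y)"
    using assms by (simp add: tns_cmp coal_dig)
  also have "bng (qt (src x) (src y)) \<circ>\<^sub>t qt (bang C (src x)) (bang C (src y)) \<circ>\<^sub>t \<dots>
     = bng (ct x y) \<circ>\<^sub>t ct x y"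
    using assms by (simp add: tail2[OF q] ct_def bng_cmp)
  finally have 1: "digt (src (ct x y)) \<circ>\<^sub>t ct x y = bng (ct x y) \<circ>\<^sub>t ct x y" by simp
  have "dert (src x \<otimes> src y) \<circ>\<^sub>t ct x y = idt (src x \<otimes> src y)"
    using assms by (simp add: ct_def tail[OF dert_q(1)] tns_cmp)
  then show ?thesis unfolding coal_def using assms 1 by simp
qed

lemma cmor_tns:
  assumes "coal x" "coal y" "coal x'" "coal y'" "cmor x y h" "cmor x' y' h'"
  shows "cmor (ct x x') (ct y y') (h \<otimes>\<^sub>t h')"
proof -
  note * = assms cmorD[OF assms(5)] cmorD[OF assms(6)]
  have q: "qt (src y) (src y') \<circ>\<^sub>t (bng h \<otimes>\<^sub>t bng h') = bng (h \<otimes>\<^sub>t h') \<circ>\<^sub>t qt (src x) (src x')"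
    using * by (simp add: qt_nat)
  have "ct y y' \<circ>\<^sub>t (h \<otimes>\<^sub>t h') = qt (src y) (src y') \<circ>\<^sub>t (bng h \<otimes>\<^sub>t bng h') \<circ>\<^sub>t (x \<otimes>\<^sub>t x')"
    using * by (simp add: ct_def tns_cmp)
  also have "\<dots> = bng (h \<otimes>\<^sub>t h') \<circ>\<^sub>t ct x x'"
    using * by (simp add: tail2[OF q] ct_def)
  finally show ?thesis using * by (simp add: cmor_def)
qed

lemma cmor_dup: "cmor (digt A) (ct (digt A) (digt A)) (dupt A)"
proof -
  have "ct (digt A) (digt A) = Tri (bang C A \<otimes> bang C A) (qmon C (bang C A) (bang C A) \<cdot> (dig C A \<boxtimes> dig C A)) (bang C (bang C A \<otimes> bang C A))"
    by (rule tri_eqI) (simp_all add: ct_def bmor mor_simps)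
  then have "ct (digt A) (digt A) \<circ>\<^sub>t dupt A = bng (dupt A) \<circ>\<^sub>t digt A"
    using dupl_coalgebra_mor[of A] unfolding coalgebra_mor_def
    by (intro tri_eqI) (simp_all add: bmor mor_simps)
  then show ?thesis by (simp add: cmor_def)
qed

lemma cmor_era: "cmor (digt A) qut (erat A)"
  using erase_coalgebra_mor[of A] unfolding coalgebra_mor_def
  by (auto simp: cmor_def intro!: tri_eqI simp: ct_def bmor mor_simps)

lemma cmor_self: "coal x \<Longrightarrow> cmor x (digt (src x)) x"
  by (simp add: cmor_def coal_dig)

lemma cmor_bng: "coal x \<Longrightarrow> ok t \<Longrightarrow> src t = src x \<Longrightarrow> cmor x (digt (tgt t)) (bng t \<circ>\<^sub>t x)"
  by (simp add: cmor_def bng_cmp tail[OF digt_nat] coal_dig)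

text \<open>Uniqueness half of the universal property of a free coalgebra: a morphism into it is the
  promotion of its own dereliction.\<close>

lemma cmor_dert: "cmor x (digt A) h \<Longrightarrow> coal x \<Longrightarrow> bng (dert A \<circ>\<^sub>t h) \<circ>\<^sub>t x = h"
  by (frule cmorD(1), frule cmorD(2), frule cmorD(3), frule cmorD(4))
    (simp add: bng_cmp flip: cmorD(4), simp add: tail[OF dert_digt(2)])

lemma cmor_ww: "coal x \<Longrightarrow> cmor x qut (ww x)"
  unfolding ww_def by (rule cmor_cmp[OF cmor_self cmor_era]) simp_all

text \<open>Needed to combine the values of several variables into one coalgebra morphism. It holds
  for free coalgebras by axiom and is pulled back along \<open>x\<close>.\<close>

lemma cmor_cc:
  assumes "coal x" shows "cmor x (ct x x) (cc x)"
proof -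
  let ?X = "src x"
  have q: "qt ?X ?X \<circ>\<^sub>t (bng (dert ?X) \<otimes>\<^sub>t bng (dert ?X)) = bng (dert ?X \<otimes>\<^sub>t dert ?X) \<circ>\<^sub>t qt (bang C ?X) (bang C ?X)"
    by (simp add: qt_nat)
  have d: "ct (digt ?X) (digt ?X) \<circ>\<^sub>t dupt ?X = bng (dupt ?X) \<circ>\<^sub>t digt ?X"
    using cmor_dup[of ?X] by (simp add: cmor_def)
  have "bng (cc x) \<circ>\<^sub>t x = bng (dert ?X \<otimes>\<^sub>t dert ?X) \<circ>\<^sub>t (bng (dupt ?X) \<circ>\<^sub>t digt ?X) \<circ>\<^sub>t x"
    using assms by (simp add: cc_def bng_cmp coal_dig)
  also have "\<dots> = bng (dert ?X \<otimes>\<^sub>t dert ?X) \<circ>\<^sub>t qt (bang C ?X) (bang C ?X) \<circ>\<^sub>t (digt ?X \<otimes>\<^sub>t digt ?X) \<circ>\<^sub>t dupt ?X \<circ>\<^sub>t x"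
    unfolding d[symmetric] using assms by (simp add: ct_def)
  also have "\<dots> = qt ?X ?X \<circ>\<^sub>t (bng (dert ?X) \<otimes>\<^sub>t bng (dert ?X)) \<circ>\<^sub>t (digt ?X \<otimes>\<^sub>t digt ?X) \<circ>\<^sub>t dupt ?X \<circ>\<^sub>t x"
    using assms by (simp add: tail2[OF q[symmetric]])
  also have "\<dots> = qt ?X ?X \<circ>\<^sub>t (x \<otimes>\<^sub>t x) \<circ>\<^sub>t cc x"
    using assms by (simp add: tns_cmp_tail dert_digt cc_dup)
  finally show ?thesis using assms by (simp add: cmor_def ct_def)
qed

text \<open>The tensor of coalgebras behaves as their product, with these as projections and
  \<open>(f \<otimes>\<^sub>t g) \<circ>\<^sub>t cc x\<close> as the pairing of \<open>f\<close> and
  \<open>g\<close>. Extending a stage by a variable means forming such a product.\<close>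

definition "p1 x y = run (src x) \<circ>\<^sub>t (idt (src x) \<otimes>\<^sub>t ww y)"
definition "p2 x y = lun (src y) \<circ>\<^sub>t (ww x \<otimes>\<^sub>t idt (src y))"

lemma p12_simps [simp]:
  "src (p1 x y) = src x \<otimes> src y" "tgt (p1 x y) = src x" "src (p2 x y) = src x \<otimes> src y" "tgt (p2 x y) = src y"
  "coal x \<Longrightarrow> coal y \<Longrightarrow> ok (p1 x y)" "coal x \<Longrightarrow> coal y \<Longrightarrow> ok (p2 x y)"
  by (simp_all add: p1_def p2_def)

lemma cmor_run: assumes "coal x" shows "cmor (ct x qut) x (run (src x))"
proof -
  have "bng (run (src x)) \<circ>\<^sub>t ct x qut = bng (run (src x)) \<circ>\<^sub>t qt (src x) \<one>
     \<circ>\<^sub>t (idt (bang C (src x)) \<otimes>\<^sub>t qut) \<circ>\<^sub>t (x \<otimes>\<^sub>t idt \<one>)"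
    using assms by (simp add: ct_def tns_cmp)
  also have "\<dots> = x \<circ>\<^sub>t run (src x)"
    using assms tail[OF qt_unit(2)[of "src x"], of "x \<otimes>\<^sub>t idt \<one>"] by (simp add: run_nat)
  finally show ?thesis using assms by (simp add: cmor_def)
qed

lemma cmor_lun: assumes "coal x" shows "cmor (ct qut x) x (lun (src x))"
proof -
  have "bng (lun (src x)) \<circ>\<^sub>t ct qut x = bng (lun (src x)) \<circ>\<^sub>t qt \<one> (src x)
     \<circ>\<^sub>t (qut \<otimes>\<^sub>t idt (bang C (src x))) \<circ>\<^sub>t (idt \<one> \<otimes>\<^sub>t x)"
    using assms by (simp add: ct_def tns_cmp)
  also have "\<dots> = x \<circ>\<^sub>t lun (src x)"
    using assms tail[OF qt_unit(1)[of "src x"], of "idt \<one> \<otimes>\<^sub>t x"] by (simp add: lun_nat)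
  finally show ?thesis using assms by (simp add: cmor_def)
qed

lemma cmor_p1: "coal x \<Longrightarrow> coal y \<Longrightarrow> cmor (ct x y) x (p1 x y)"
  unfolding p1_def
  by (rule cmor_cmp[OF cmor_tns[OF _ _ _ _ cmor_id cmor_ww] cmor_run]) simp_all

lemma cmor_p2: "coal x \<Longrightarrow> coal y \<Longrightarrow> cmor (ct x y) y (p2 x y)"
  unfolding p2_def
  by (rule cmor_cmp[OF cmor_tns[OF _ _ _ _ cmor_ww cmor_id] cmor_lun]) simp_all

lemma cc_lunit: assumes "coal x" shows "(ww x \<otimes>\<^sub>t idt (src x)) \<circ>\<^sub>t cc x = lun' (src x)"
proof -
  have "(ww x \<otimes>\<^sub>t idt (src x)) \<circ>\<^sub>t cc x = (erat (src x) \<otimes>\<^sub>t dert (src x)) \<circ>\<^sub>t (x \<otimes>\<^sub>t x) \<circ>\<^sub>t cc x"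
    using assms by (simp add: ww_def tns_cmp_tail)
  also have "\<dots> = lun' (src x) \<circ>\<^sub>t lun (src x) \<circ>\<^sub>t (idt \<one> \<otimes>\<^sub>t dert (src x)) \<circ>\<^sub>t (erat (src x) \<otimes>\<^sub>t idt (bang C (src x))) \<circ>\<^sub>t dupt (src x) \<circ>\<^sub>t x"
    using assms by (simp add: cc_dup tns_cmp_tail)
  also have "\<dots> = lun' (src x) \<circ>\<^sub>t dert (src x) \<circ>\<^sub>t (lun (bang C (src x)) \<circ>\<^sub>t (erat (src x) \<otimes>\<^sub>t idt (bang C (src x))) \<circ>\<^sub>t dupt (src x)) \<circ>\<^sub>t x"
    using assms by (simp add: tail2[OF lun_nat])
  also have "\<dots> = lun' (src x)" using assms by (simp add: dupt_lunit)
  finally show ?thesis .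
qed

lemma cc_comm: assumes "coal x" shows "brd (src x) (src x) \<circ>\<^sub>t cc x = cc x"
  using assms by (simp add: cc_def tail2[OF brd_nat] tail[OF dupt_comm])

text \<open>The swap of two empty lists, read outside the list calculus.\<close>

lemma brd_unit: "brd \<one> \<one> = idt (\<one> \<otimes> \<one>)"
proof (rule epi_cancel[where i = "lun' \<one>" and j = "lun \<one>"], rule mono_cancel[where i = "lun \<one>" and j = "lun' \<one>"])
  show "lun \<one> \<circ>\<^sub>t brd \<one> \<one> \<circ>\<^sub>t lun' \<one> = lun \<one> \<circ>\<^sub>t idt (\<one> \<otimes> \<one>) \<circ>\<^sub>t lun' \<one>"
    using arg_cong[OF sw_nil(1)[of "[]"], of tr] by (simp add: tr_simps del: sw_nil)
qed simp_all

lemma brd_runit: "lun A \<circ>\<^sub>t brd A \<one> = run A"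
proof -
  have "J [] [A] \<circ>\<^sub>t brd (A \<otimes> \<one>) \<one> = J [A] []"
    using arg_cong[OF sw_nil(1)[of "[A]"], of "\<lambda>f. tr f \<circ>\<^sub>t J [A] []"] by (simp del: J_rec sw_nil add: tr_simps)
  then have "lun (A \<otimes> \<one>) \<circ>\<^sub>t brd (A \<otimes> \<one>) \<one> \<circ>\<^sub>t (run' A \<otimes>\<^sub>t idt \<one>) = run (A \<otimes> \<one>) \<circ>\<^sub>t (run' A \<otimes>\<^sub>t idt \<one>)"
    using J_nil[of "[A]"] by (simp del: J_rec(2,4) flip: cmp_assoc)
  then have *: "run' A \<circ>\<^sub>t lun A \<circ>\<^sub>t brd A \<one> = run' A \<circ>\<^sub>t run A"
    by (simp add: brd_nat run_nat tail2[OF lun_nat])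
  show ?thesis by (rule mono_cancel[OF *, where j = "run A"]) simp_all
qed

lemma cc_runit: assumes "coal x" shows "(idt (src x) \<otimes>\<^sub>t ww x) \<circ>\<^sub>t cc x = run' (src x)"
proof -
  have "run (src x) \<circ>\<^sub>t (idt (src x) \<otimes>\<^sub>t ww x) \<circ>\<^sub>t cc x
     = lun (src x) \<circ>\<^sub>t (brd (src x) \<one> \<circ>\<^sub>t (idt (src x) \<otimes>\<^sub>t ww x)) \<circ>\<^sub>t cc x"
    using assms by (simp add: tail[OF brd_runit])
  also have "\<dots> = lun (src x) \<circ>\<^sub>t (ww x \<otimes>\<^sub>t idt (src x)) \<circ>\<^sub>t brd (src x) (src x) \<circ>\<^sub>t cc x"
    using assms by (simp add: brd_nat)
  also have "\<dots> = idt (src x)"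
    using assms by (simp add: cc_comm cc_lunit)
  finally have "run' (src x) \<circ>\<^sub>t run (src x) \<circ>\<^sub>t (idt (src x) \<otimes>\<^sub>t ww x) \<circ>\<^sub>t cc x = run' (src x)"
    using assms by simp
  then show ?thesis using assms by simp
qed

lemma cc_coassoc:
  assumes x: "coal x"
  shows "asc (src x) (src x) (src x) \<circ>\<^sub>t (cc x \<otimes>\<^sub>t idt (src x)) \<circ>\<^sub>t cc x = (idt (src x) \<otimes>\<^sub>t cc x) \<circ>\<^sub>t cc x"
proof (rule mono_cancel[where i = "x \<otimes>\<^sub>t (x \<otimes>\<^sub>t x)"
      and j = "dert (src x) \<otimes>\<^sub>t (dert (src x) \<otimes>\<^sub>t dert (src x))"])
  let ?X = "src x" and ?B = "bang C (src x)"
  have "(x \<otimes>\<^sub>t (x \<otimes>\<^sub>t x)) \<circ>\<^sub>t asc ?X ?X ?X \<circ>\<^sub>t (cc x \<otimes>\<^sub>t idt ?X) \<circ>\<^sub>t cc x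
    = asc ?B ?B ?B \<circ>\<^sub>t ((x \<otimes>\<^sub>t x) \<otimes>\<^sub>t x) \<circ>\<^sub>t (cc x \<otimes>\<^sub>t idt ?X) \<circ>\<^sub>t cc x"
    using x by (simp add: tail2[OF asc_nat])
  also have "\<dots> = asc ?B ?B ?B \<circ>\<^sub>t ((dupt ?X \<circ>\<^sub>t x) \<otimes>\<^sub>t x) \<circ>\<^sub>t cc x"
    using x by (simp add: tns_cmp_tail cc_dup)
  also have "\<dots> = asc ?B ?B ?B \<circ>\<^sub>t (dupt ?X \<otimes>\<^sub>t idt ?B) \<circ>\<^sub>t (x \<otimes>\<^sub>t x) \<circ>\<^sub>t cc x"
    using x by (simp add: tns_cmp_tail)
  also have "\<dots> = (asc ?B ?B ?B \<circ>\<^sub>t (dupt ?X \<otimes>\<^sub>t idt ?B) \<circ>\<^sub>t dupt ?X) \<circ>\<^sub>t x"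
    using x by (simp add: cc_dup)
  also have "\<dots> = (idt ?B \<otimes>\<^sub>t dupt ?X) \<circ>\<^sub>t (x \<otimes>\<^sub>t x) \<circ>\<^sub>t cc x"
    unfolding dupt_coassoc using x by (simp add: cc_dup)
  also have "\<dots> = (x \<otimes>\<^sub>t (dupt ?X \<circ>\<^sub>t x)) \<circ>\<^sub>t cc x"
    using x by (simp add: tns_cmp_tail)
  also have "\<dots> = (x \<otimes>\<^sub>t (x \<otimes>\<^sub>t x)) \<circ>\<^sub>t (idt ?X \<otimes>\<^sub>t cc x) \<circ>\<^sub>t cc x"
    using x by (simp add: tns_cmp_tail cc_dup)
  finally show "(x \<otimes>\<^sub>t (x \<otimes>\<^sub>t x)) \<circ>\<^sub>t asc ?X ?X ?X \<circ>\<^sub>t (cc x \<otimes>\<^sub>t idt ?X) \<circ>\<^sub>t cc x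
    = (x \<otimes>\<^sub>t (x \<otimes>\<^sub>t x)) \<circ>\<^sub>t (idt ?X \<otimes>\<^sub>t cc x) \<circ>\<^sub>t cc x" .
qed (use x in \<open>simp_all add: tns_cmp\<close>)

lemma midt_nat: assumes "ok f" "ok g" "ok h" "ok k" "A = tgt f" "B = tgt g" "D = tgt h" "E = tgt k"
  shows "midt A B D E \<circ>\<^sub>t ((f \<otimes>\<^sub>t g) \<otimes>\<^sub>t (h \<otimes>\<^sub>t k))
      = ((f \<otimes>\<^sub>t h) \<otimes>\<^sub>t (g \<otimes>\<^sub>t k)) \<circ>\<^sub>t midt (src f) (src g) (src h) (src k)"
proof -
  let ?r = "\<lambda>B D E. asc D B E \<circ>\<^sub>t (brd B D \<otimes>\<^sub>t idt E) \<circ>\<^sub>t asc' B D E"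
  have "?r B D E \<circ>\<^sub>t (g \<otimes>\<^sub>t (h \<otimes>\<^sub>t k)) = asc D B E \<circ>\<^sub>t ((h \<otimes>\<^sub>t g) \<otimes>\<^sub>t k)
      \<circ>\<^sub>t (brd (src g) (src h) \<otimes>\<^sub>t idt (src k)) \<circ>\<^sub>t asc' (src g) (src h) (src k)"
    using assms by (simp add: asc'_nat tns_cmp_tail brd_nat)
  also have "\<dots> = (h \<otimes>\<^sub>t (g \<otimes>\<^sub>t k)) \<circ>\<^sub>t ?r (src g) (src h) (src k)"
    using assms by (simp add: tail2[OF asc_nat])
  finally have r: "?r B D E \<circ>\<^sub>t (g \<otimes>\<^sub>t (h \<otimes>\<^sub>t k)) = (h \<otimes>\<^sub>t (g \<otimes>\<^sub>t k)) \<circ>\<^sub>t ?r (src g) (src h) (src k)" .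
  have "midt A B D E \<circ>\<^sub>t ((f \<otimes>\<^sub>t g) \<otimes>\<^sub>t (h \<otimes>\<^sub>t k))
    = asc' A D (B \<otimes> E) \<circ>\<^sub>t (idt A \<otimes>\<^sub>t ?r B D E) \<circ>\<^sub>t (f \<otimes>\<^sub>t (g \<otimes>\<^sub>t (h \<otimes>\<^sub>t k)))
      \<circ>\<^sub>t asc (src f) (src g) (src h \<otimes> src k)"
    using assms by (simp add: midt_def asc_nat)
  also have "\<dots> = asc' A D (B \<otimes> E) \<circ>\<^sub>t (f \<otimes>\<^sub>t (?r B D E \<circ>\<^sub>t (g \<otimes>\<^sub>t (h \<otimes>\<^sub>t k))))
      \<circ>\<^sub>t asc (src f) (src g) (src h \<otimes> src k)"
    using assms by (subst tns_cmp_tail) simp_all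
  also have "\<dots> = asc' A D (B \<otimes> E) \<circ>\<^sub>t (f \<otimes>\<^sub>t (h \<otimes>\<^sub>t (g \<otimes>\<^sub>t k)))
      \<circ>\<^sub>t (idt (src f) \<otimes>\<^sub>t ?r (src g) (src h) (src k)) \<circ>\<^sub>t asc (src f) (src g) (src h \<otimes> src k)"
    unfolding r using assms by (subst tns_cmp_tail) simp_all
  also have "\<dots> = ((f \<otimes>\<^sub>t h) \<otimes>\<^sub>t (g \<otimes>\<^sub>t k)) \<circ>\<^sub>t midt (src f) (src g) (src h) (src k)"
    using assms by (subst tail2[OF asc'_nat]) (simp_all add: midt_def)
  finally show ?thesis .
qed

lemma midt_unit: "midt A \<one> \<one> B = idt ((A \<otimes> \<one>) \<otimes> (\<one> \<otimes> B))"
  by (simp add: midt_def brd_unit)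

lemma cc_ct: assumes "coal x" "coal y"
  shows "cc (ct x y) = midt (src x) (src x) (src y) (src y) \<circ>\<^sub>t (cc x \<otimes>\<^sub>t cc y)"
proof -
  let ?X = "src x" and ?Y = "src y"
  have "cc (ct x y) = (dert (?X \<otimes> ?Y) \<otimes>\<^sub>t dert (?X \<otimes> ?Y)) \<circ>\<^sub>t (qt ?X ?Y \<otimes>\<^sub>t qt ?X ?Y)
    \<circ>\<^sub>t midt (bang C ?X) (bang C ?X) (bang C ?Y) (bang C ?Y) \<circ>\<^sub>t (dupt ?X \<otimes>\<^sub>t dupt ?Y) \<circ>\<^sub>t (x \<otimes>\<^sub>t y)"
    using assms by (simp add: cc_def) (simp add: ct_def tail[OF dupt_q])
  also have "\<dots> = ((dert ?X \<otimes>\<^sub>t dert ?Y) \<otimes>\<^sub>t (dert ?X \<otimes>\<^sub>t dert ?Y))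
    \<circ>\<^sub>t midt (bang C ?X) (bang C ?X) (bang C ?Y) (bang C ?Y) \<circ>\<^sub>t (dupt ?X \<otimes>\<^sub>t dupt ?Y) \<circ>\<^sub>t (x \<otimes>\<^sub>t y)"
    using assms by (simp add: tns_cmp_tail dert_q)
  also have "\<dots> = midt ?X ?X ?Y ?Y \<circ>\<^sub>t ((dert ?X \<otimes>\<^sub>t dert ?X) \<otimes>\<^sub>t (dert ?Y \<otimes>\<^sub>t dert ?Y))
    \<circ>\<^sub>t (dupt ?X \<otimes>\<^sub>t dupt ?Y) \<circ>\<^sub>t (x \<otimes>\<^sub>t y)"
    using assms by (simp add: tail2[OF midt_nat])
  finally show ?thesis using assms by (simp add: cc_def tns_cmp)
qed

text \<open>Surjective pairing. Duplication of a product duplicates both factors and exchanges the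
  inner two; once these inner copies are discarded, the exchange acts on units, where it is trivial,
  and the counit laws remain.\<close>

lemma p12_cc: assumes "coal x" "coal y"
  shows "(p1 x y \<otimes>\<^sub>t p2 x y) \<circ>\<^sub>t cc (ct x y) = idt (src x \<otimes> src y)"
proof -
  let ?X = "src x" and ?Y = "src y"
  have "(p1 x y \<otimes>\<^sub>t p2 x y) \<circ>\<^sub>t cc (ct x y) = (run ?X \<otimes>\<^sub>t lun ?Y)
     \<circ>\<^sub>t ((idt ?X \<otimes>\<^sub>t ww y) \<otimes>\<^sub>t (ww x \<otimes>\<^sub>t idt ?Y)) \<circ>\<^sub>t midt ?X ?X ?Y ?Y \<circ>\<^sub>t (cc x \<otimes>\<^sub>t cc y)"
    using assms by (simp add: cc_ct p1_def p2_def tns_cmp_tail)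
  also have "\<dots> = (run ?X \<otimes>\<^sub>t lun ?Y) \<circ>\<^sub>t midt ?X \<one> \<one> ?Y
     \<circ>\<^sub>t ((idt ?X \<otimes>\<^sub>t ww x) \<otimes>\<^sub>t (ww y \<otimes>\<^sub>t idt ?Y)) \<circ>\<^sub>t (cc x \<otimes>\<^sub>t cc y)"
    using assms by (simp add: tail2[OF midt_nat])
  also have "\<dots> = idt (?X \<otimes> ?Y)"
    using assms by (simp add: midt_unit tns_cmp cc_lunit cc_runit)
  finally show ?thesis .
qed

definition "pt = Tri (nat_obj C) (p_N C) (bang C (nat_obj C))"

lemma pt_simps [simp]: "src pt = nat_obj C" "tgt pt = bang C (nat_obj C)" "coal pt"
  and mor_pt: "mor pt = p_N C"
  using p_coalgebra
  by (auto simp: pt_def coal_def coalgebra_def intro!: tri_eqI simp: bmor mor_simps)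

text \<open>As \<open>p\<close> is a comonoid morphism with a retraction, the given structure on
  \<open>N\<close> is forced to be the inherited one. Ground and stable contraction can therefore
  share a single argument.\<close>

lemma cc_pt: "mor (cc pt) = c_N C" "mor (ww pt) = w_N C"
proof -
  let ?N = "nat_obj C"
  have h: "ok (Tri ?N (c_N C) (?N \<otimes> ?N))" "ok (Tri ?N (w_N C) \<one>)"
    using N_comonoid by (simp_all add: comm_comonoid_def)
  have "dupt ?N \<circ>\<^sub>t pt = (pt \<otimes>\<^sub>t pt) \<circ>\<^sub>t Tri ?N (c_N C) (?N \<otimes> ?N)"
    using p_comonoid_mor by (auto simp: comonoid_mor_def intro!: tri_eqI simp: mor_simps bmor mor_pt)
  then have "cc pt = Tri ?N (c_N C) (?N \<otimes> ?N)"
    using h by (simp add: cc_def tns_cmp_tail)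
  moreover have "ww pt = Tri ?N (w_N C) \<one>"
    using p_comonoid_mor by (auto simp: ww_def comonoid_mor_def intro!: tri_eqI simp: mor_simps bmor mor_pt)
  ultimately show "mor (cc pt) = c_N C" "mor (ww pt) = w_N C" by simp_all
qed

section \<open>Arrows parametrised by a coalgebra\<close>

lemma J_single: "J [A] bs = run A \<otimes>\<^sub>t idt (ten bs)" "J' [A] bs = run' A \<otimes>\<^sub>t idt (ten bs)"
proof -
  show *: "J [A] bs = run A \<otimes>\<^sub>t idt (ten bs)" by (simp add: triangle_t)
  show "J' [A] bs = run' A \<otimes>\<^sub>t idt (ten bs)"
  proof (rule epi_cancel[where i = "J [A] bs" and j = "J' [A] bs"])
    show "J' [A] bs \<circ>\<^sub>t J [A] bs = (run' A \<otimes>\<^sub>t idt (ten bs)) \<circ>\<^sub>t J [A] bs"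
      by (subst (2) *) (simp add: tns_cmp del: J_rec)
  qed (simp_all del: J_rec)
qed

text \<open>Joins over longer lists stay folded from here on; unfolding them would bring the
  associators back.\<close>

declare J_rec(2,4) [simp del]
lemmas J_single [simp]

text \<open>A one-element list stands for \<open>A \<otimes> \<one>\<close>, so arrows into
  \<open>A\<close> and arrows into \<open>[A]\<close> differ by a unit: \<open>up\<close>,
  \<open>dn\<close> and \<open>em\<close> convert between them. \<open>pk\<close>,
  \<open>upk\<close> and \<open>unu\<close> mediate between a tensor or unit as a single list entry
  and the corresponding list.\<close>

definition "up as f = SA as (mor (run' (tgt f) \<circ>\<^sub>t f)) [tgt f]"
definition "dn g = run (hd (cd g)) \<circ>\<^sub>t tr g"
definition "em f = up [src f] (f \<circ>\<^sub>t run (src f))"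
definition "pk A B = up [A, B] (idt A \<otimes>\<^sub>t run B)"
definition "upk A B = SA [A \<otimes> B] (mor ((idt A \<otimes>\<^sub>t run' B) \<circ>\<^sub>t run (A \<otimes> B))) [A, B]"
definition "unu = SA [\<one>] (mor (run \<one>)) []"

lemma up_simps [simp]: "dm (up as f) = as" "cd (up as f) = [tgt f]" "dm (em f) = [src f]" "cd (em f) = [tgt f]"
  "dm (pk A B) = [A, B]" "cd (pk A B) = [A \<otimes> B]" "dm (upk A B) = [A \<otimes> B]" "cd (upk A B) = [A, B]"
  "dm unu = [\<one>]" "cd unu = []"
  "src (dn g) = ten (dm g)" "tgt (dn g) = hd (cd g)"
  by (simp_all add: up_def em_def pk_def upk_def unu_def dn_def)

lemma tr_up: "src f = ten as \<Longrightarrow> tr (up as f) = run' (tgt f) \<circ>\<^sub>t f"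
  by (rule tri_eqI) (simp_all add: tr_def up_def)

lemma tr_em: "tr (em f) = run' (tgt f) \<circ>\<^sub>t f \<circ>\<^sub>t run (src f)"
  by (simp add: em_def tr_up)

lemma tr_pk: "tr (pk A B) = run' (A \<otimes> B) \<circ>\<^sub>t (idt A \<otimes>\<^sub>t run B)"
  by (simp add: pk_def tr_up)

lemma tr_upk: "tr (upk A B) = (idt A \<otimes>\<^sub>t run' B) \<circ>\<^sub>t run (A \<otimes> B)"
  by (rule tri_eqI) (simp_all add: tr_def upk_def)

lemma tr_unu: "tr unu = run \<one>"
  by (rule tri_eqI) (simp_all add: tr_def unu_def)

lemma arr_up [simp]: "ok f \<Longrightarrow> src f = ten as \<Longrightarrow> arr (up as f)" "ok f \<Longrightarrow> arr (em f)"
  "arr (pk A B)" "arr (upk A B)" "arr unu"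
  by (simp_all add: arr_def tr_up tr_em tr_pk tr_upk tr_unu)

lemma ok_dn [simp]: "arr g \<Longrightarrow> cd g = [A] \<Longrightarrow> ok (dn g)"
  by (simp add: dn_def arr_def)

lemma ok_tr [simp]: "arr g \<Longrightarrow> ok (tr g)" by (simp add: arr_def)

lemma dn_up [simp]: "ok f \<Longrightarrow> src f = ten as \<Longrightarrow> dn (up as f) = f"
  by (simp add: dn_def tr_up)

lemma up_dn [simp]: "arr g \<Longrightarrow> cd g = [A] \<Longrightarrow> as = dm g \<Longrightarrow> up as (dn g) = g"
  by (rule sarr_eqI) (simp_all add: tr_up, simp add: dn_def)

lemma up_inj: "\<lbrakk>up as f = up as g; ok f; ok g; src f = ten as; src g = ten as\<rbrakk> \<Longrightarrow> f = g"
  by (metis dn_up)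

lemma up_scomp: "\<lbrakk>ok f; src f = ten as; arr h; cd h = as; cs = dm h\<rbrakk> \<Longrightarrow> up as f \<circ>\<^sub>s h = up cs (f \<circ>\<^sub>t tr h)"
  by (rule sarr_eqI) (simp_all add: tr_up tr_simps)

lemma dn_scomp: "\<lbrakk>arr f; arr h; cd h = dm f; cd f = [A]\<rbrakk> \<Longrightarrow> dn (f \<circ>\<^sub>s h) = dn f \<circ>\<^sub>t tr h"
  by (simp add: dn_def tr_simps)

lemma em_cmp: "\<lbrakk>ok f; ok g; src g = tgt f\<rbrakk> \<Longrightarrow> em (g \<circ>\<^sub>t f) = em g \<circ>\<^sub>s em f"
  by (rule sarr_eqI) (simp_all add: tr_simps tr_em)

lemma em_id [simp]: "em (idt A) = ids [A]"
  by (rule sarr_eqI) (simp_all add: tr_simps tr_em)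

lemma pk_upk [simp]: "pk A B \<circ>\<^sub>s upk A B = ids [A \<otimes> B]" "upk A B \<circ>\<^sub>s pk A B = ids [A, B]"
  by (rule sarr_eqI; simp add: tr_simps tr_pk tr_upk tns_cmp tns_cmp_tail)+

lemma pk_upk_tail [simp]: "arr k \<Longrightarrow> cd k = [A \<otimes> B] \<Longrightarrow> pk A B \<circ>\<^sub>s upk A B \<circ>\<^sub>s k = k"
  "arr k \<Longrightarrow> cd k = [A, B] \<Longrightarrow> upk A B \<circ>\<^sub>s pk A B \<circ>\<^sub>s k = k"
  by (simp_all flip: scomp_assoc)

lemma em_tns: "ok f \<Longrightarrow> ok g \<Longrightarrow> upk (tgt f) (tgt g) \<circ>\<^sub>s em (f \<otimes>\<^sub>t g) = (em f \<otimes>\<^sub>s em g) \<circ>\<^sub>s upk (src f) (src g)"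
  by (rule sarr_eqI) (simp_all add: tr_simps tr_em tr_upk tns_cmp tns_cmp_tail)

text \<open>On fully unpacked lists the associator disappears. With \<open>em_lun\<close> and
  \<open>em_brd\<close> this carries the comonoid laws over to list arrows in strict form.\<close>

lemma em_asc: "(ids [A] \<otimes>\<^sub>s upk B D) \<circ>\<^sub>s upk A (B \<otimes> D) \<circ>\<^sub>s em (asc A B D) = (upk A B \<otimes>\<^sub>s ids [D]) \<circ>\<^sub>s upk (A \<otimes> B) D"
proof (rule sarr_eqI)
  have J2: "J [A, B] [D] = (idt A \<otimes>\<^sub>t (run B \<otimes>\<^sub>t idt (D \<otimes> \<one>))) \<circ>\<^sub>t asc A (B \<otimes> \<one>) (D \<otimes> \<one>)"
    by (simp add: J_rec(2)[of A "[B]"])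
  have "tr ((ids [A] \<otimes>\<^sub>s upk B D) \<circ>\<^sub>s upk A (B \<otimes> D) \<circ>\<^sub>s em (asc A B D))
    = (idt A \<otimes>\<^sub>t (idt B \<otimes>\<^sub>t run' D)) \<circ>\<^sub>t asc A B D \<circ>\<^sub>t run ((A \<otimes> B) \<otimes> D)"
    by (simp add: tr_simps tr_em tr_upk tns_cmp_tail)
  moreover have "tr ((upk A B \<otimes>\<^sub>s ids [D]) \<circ>\<^sub>s upk (A \<otimes> B) D)
    = (idt A \<otimes>\<^sub>t (run B \<otimes>\<^sub>t idt (D \<otimes> \<one>))) \<circ>\<^sub>t (asc A (B \<otimes> \<one>) (D \<otimes> \<one>)
       \<circ>\<^sub>t ((idt A \<otimes>\<^sub>t run' B) \<otimes>\<^sub>t run' D)) \<circ>\<^sub>t run ((A \<otimes> B) \<otimes> D)"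
    by (simp add: tr_simps tr_em tr_upk J2 tns_cmp_tail tns_cmp)
  ultimately show "tr ((ids [A] \<otimes>\<^sub>s upk B D) \<circ>\<^sub>s upk A (B \<otimes> D) \<circ>\<^sub>s em (asc A B D)) = tr ((upk A B \<otimes>\<^sub>s ids [D]) \<circ>\<^sub>s upk (A \<otimes> B) D)"
    by (simp add: asc_nat tns_cmp_tail tns_cmp)
qed simp_all

lemma em_lun: "em (lun A) = (unu \<otimes>\<^sub>s ids [A]) \<circ>\<^sub>s upk \<one> A"
proof (rule sarr_eqI)
  have n: "lun (A \<otimes> \<one>) \<circ>\<^sub>t (idt \<one> \<otimes>\<^sub>t run' A) = run' A \<circ>\<^sub>t lun A" by (simp add: lun_nat)
  have "tr ((unu \<otimes>\<^sub>s ids [A]) \<circ>\<^sub>s upk \<one> A) = lun (A \<otimes> \<one>) \<circ>\<^sub>t (idt \<one> \<otimes>\<^sub>t run' A) \<circ>\<^sub>t run (\<one> \<otimes> A)"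
    by (simp add: tr_simps tr_upk tr_unu tns_cmp_tail)
  also have "\<dots> = (run' A \<circ>\<^sub>t lun A) \<circ>\<^sub>t run (\<one> \<otimes> A)"
    by (simp add: tail2[OF n])
  finally show "tr (em (lun A)) = tr ((unu \<otimes>\<^sub>s ids [A]) \<circ>\<^sub>s upk \<one> A)"
    by (simp add: tr_em)
qed simp_all

lemma em_brd: "upk B A \<circ>\<^sub>s em (brd A B) = sw [A] [B] \<circ>\<^sub>s upk A B"
proof (rule sarr_eqI)
  have n: "brd (A \<otimes> \<one>) (B \<otimes> \<one>) \<circ>\<^sub>t (run' A \<otimes>\<^sub>t run' B) = (run' B \<otimes>\<^sub>t run' A) \<circ>\<^sub>t brd A B"
    by (simp add: brd_nat)
  show "tr (upk B A \<circ>\<^sub>s em (brd A B)) = tr (sw [A] [B] \<circ>\<^sub>s upk A B)"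
    by (simp add: tr_simps tr_em tr_upk tns_cmp_tail tail2[OF n])
qed simp_all

section \<open>The comonoid of a stage as list arrows\<close>

definition "scc x = upk (src x) (src x) \<circ>\<^sub>s em (cc x)"
definition "sww x = unu \<circ>\<^sub>s em (ww x)"

lemma scc_simps [simp]: "dm (scc x) = [src x]" "cd (scc x) = [src x, src x]" "coal x \<Longrightarrow> arr (scc x)"
  "dm (sww x) = [src x]" "cd (sww x) = []" "coal x \<Longrightarrow> arr (sww x)"
  by (simp_all add: scc_def sww_def)

lemma em_inv: "\<lbrakk>f \<circ>\<^sub>t g = idt (src g); ok f; ok g; src f = tgt g\<rbrakk> \<Longrightarrow> em f \<circ>\<^sub>s em g = ids [src g]"
  by (simp flip: em_cmp)

lemma scc_coassoc:
  assumes "coal x"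
  shows "(scc x \<otimes>\<^sub>s ids [src x]) \<circ>\<^sub>s scc x = (ids [src x] \<otimes>\<^sub>s scc x) \<circ>\<^sub>s scc x"
proof -
  let ?X = "src x"
  have t: "(em (cc x) \<otimes>\<^sub>s ids [?X]) \<circ>\<^sub>s upk ?X ?X = upk (?X \<otimes> ?X) ?X \<circ>\<^sub>s em (cc x \<otimes>\<^sub>t idt ?X)"
    using em_tns[of "cc x" "idt ?X"] assms by simp
  have t': "(ids [?X] \<otimes>\<^sub>s em (cc x)) \<circ>\<^sub>s upk ?X ?X = upk ?X (?X \<otimes> ?X) \<circ>\<^sub>s em (idt ?X \<otimes>\<^sub>t cc x)"
    using em_tns[of "idt ?X" "cc x"] assms by simp
  have "(scc x \<otimes>\<^sub>s ids [?X]) \<circ>\<^sub>s scc x = (upk ?X ?X \<otimes>\<^sub>s ids [?X]) \<circ>\<^sub>s ((em (cc x) \<otimes>\<^sub>s ids [?X]) \<circ>\<^sub>s upk ?X ?X) \<circ>\<^sub>s em (cc x)"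
    using assms by (simp add: scc_def stens_comp_tail)
  also have "\<dots> = ((upk ?X ?X \<otimes>\<^sub>s ids [?X]) \<circ>\<^sub>s upk (?X \<otimes> ?X) ?X) \<circ>\<^sub>s em (cc x \<otimes>\<^sub>t idt ?X) \<circ>\<^sub>s em (cc x)"
    unfolding t using assms by simp
  also have "\<dots> = (ids [?X] \<otimes>\<^sub>s upk ?X ?X) \<circ>\<^sub>s upk ?X (?X \<otimes> ?X) \<circ>\<^sub>s em (asc ?X ?X ?X \<circ>\<^sub>t (cc x \<otimes>\<^sub>t idt ?X) \<circ>\<^sub>t cc x)"
    unfolding em_asc[symmetric] using assms by (simp add: em_cmp)
  also have "\<dots> = (ids [?X] \<otimes>\<^sub>s upk ?X ?X) \<circ>\<^sub>s (upk ?X (?X \<otimes> ?X) \<circ>\<^sub>s em (idt ?X \<otimes>\<^sub>t cc x)) \<circ>\<^sub>s em (cc x)"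
    unfolding cc_coassoc[OF assms] using assms by (simp add: em_cmp)
  also have "\<dots> = (ids [?X] \<otimes>\<^sub>s scc x) \<circ>\<^sub>s scc x"
    unfolding t'[symmetric] using assms by (simp add: scc_def stens_comp_tail)
  finally show ?thesis .
qed

lemma scc_lunit: assumes "coal x" shows "(sww x \<otimes>\<^sub>s ids [src x]) \<circ>\<^sub>s scc x = ids [src x]"
proof -
  let ?X = "src x"
  have t: "(em (ww x) \<otimes>\<^sub>s ids [?X]) \<circ>\<^sub>s upk ?X ?X = upk \<one> ?X \<circ>\<^sub>s em (ww x \<otimes>\<^sub>t idt ?X)"
    using em_tns[of "ww x" "idt ?X"] assms by simp
  have "(sww x \<otimes>\<^sub>s ids [?X]) \<circ>\<^sub>s scc x = (unu \<otimes>\<^sub>s ids [?X]) \<circ>\<^sub>s ((em (ww x) \<otimes>\<^sub>s ids [?X]) \<circ>\<^sub>s upk ?X ?X) \<circ>\<^sub>s em (cc x)"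
    using assms by (simp add: scc_def sww_def stens_comp_tail)
  also have "\<dots> = em (lun ?X) \<circ>\<^sub>s em ((ww x \<otimes>\<^sub>t idt ?X) \<circ>\<^sub>t cc x)"
    unfolding t using assms by (simp add: em_lun em_cmp)
  also have "\<dots> = ids [?X]"
    using assms by (simp add: cc_lunit em_inv)
  finally show ?thesis .
qed

lemma scc_comm: assumes "coal x" shows "sw [src x] [src x] \<circ>\<^sub>s scc x = scc x"
proof -
  have "sw [src x] [src x] \<circ>\<^sub>s scc x = (upk (src x) (src x) \<circ>\<^sub>s em (brd (src x) (src x))) \<circ>\<^sub>s em (cc x)"
    unfolding em_brd using assms by (simp add: scc_def)
  also have "\<dots> = scc x" using assms cc_comm by (simp add: scc_def flip: em_cmp)
  finally show ?thesis .
qed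

lemma scc_cmor: assumes "coal x" "coal y" "cmor x y h"
  shows "scc y \<circ>\<^sub>s em h = (em h \<otimes>\<^sub>s em h) \<circ>\<^sub>s scc x" "sww y \<circ>\<^sub>s em h = sww x"
proof -
  note h = cmorD[OF assms(3)]
  have n: "upk (src y) (src y) \<circ>\<^sub>s em (h \<otimes>\<^sub>t h) = (em h \<otimes>\<^sub>s em h) \<circ>\<^sub>s upk (src x) (src x)"
    using em_tns[of h h] h by simp
  have "scc y \<circ>\<^sub>s em h = upk (src y) (src y) \<circ>\<^sub>s em (cc y \<circ>\<^sub>t h)"
    using assms h by (simp add: scc_def em_cmp)
  also have "\<dots> = upk (src y) (src y) \<circ>\<^sub>s em (h \<otimes>\<^sub>t h) \<circ>\<^sub>s em (cc x)"
    using assms h by (simp add: cmor_comonoid em_cmp)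
  also have "\<dots> = (em h \<otimes>\<^sub>s em h) \<circ>\<^sub>s scc x"
    using assms h by (simp add: stail2[OF n] scc_def)
  finally show "scc y \<circ>\<^sub>s em h = (em h \<otimes>\<^sub>s em h) \<circ>\<^sub>s scc x" .
  have "sww y \<circ>\<^sub>s em h = unu \<circ>\<^sub>s em (ww y \<circ>\<^sub>t h)"
    using assms h by (simp add: sww_def em_cmp)
  then show "sww y \<circ>\<^sub>s em h = sww x"
    using assms h by (simp add: cmor_comonoid sww_def)
qed

lemma p12_scc: assumes "coal x" "coal y"
  shows "(em (p1 x y) \<otimes>\<^sub>s em (p2 x y)) \<circ>\<^sub>s scc (ct x y) = upk (src x) (src y)"
proof -
  have "(em (p1 x y) \<otimes>\<^sub>s em (p2 x y)) \<circ>\<^sub>s scc (ct x y)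
    = (upk (src x) (src y) \<circ>\<^sub>s em (p1 x y \<otimes>\<^sub>t p2 x y)) \<circ>\<^sub>s em (cc (ct x y))"
    using assms em_tns[of "p1 x y" "p2 x y"] by (simp add: scc_def)
  also have "\<dots> = upk (src x) (src y)"
    using assms by (simp add: p12_cc flip: em_cmp)
  finally show ?thesis .
qed

text \<open>Tensor product in the category of arrows parametrised by the comonoid \<open>x\<close>.\<close>

definition "tens2 x f g = (f \<otimes>\<^sub>s g)
  \<circ>\<^sub>s (ids [src x] \<otimes>\<^sub>s sw [src x] (tl (dm f)) \<otimes>\<^sub>s ids (tl (dm g)))
  \<circ>\<^sub>s (scc x \<otimes>\<^sub>s ids (tl (dm f) @ tl (dm g)))"

lemma tens2_simps [simp]:
  "dm (tens2 x f g) = src x # tl (dm f) @ tl (dm g)" "cd (tens2 x f g) = cd f @ cd g"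
  "\<lbrakk>coal x; arr f; arr g; dm f = src x # as; dm g = src x # bs\<rbrakk> \<Longrightarrow> arr (tens2 x f g)"
  by (simp_all add: tens2_def)

lemma prm_id': "os = obs ts \<Longrightarrow> ts = us \<Longrightarrow> prm ts us (ids os)" by (simp add: prm_id)

text \<open>Both sides bring the same four blocks into the same order. In the application
  \<open>X\<close> and \<open>X'\<close> are the same object, and the labels keep the two copies of
  the stage apart.\<close>

lemma sw_struct1: "sw (X # as) (X' # cs) \<circ>\<^sub>s (ids [X] \<otimes>\<^sub>s sw [X'] as \<otimes>\<^sub>s ids cs)
    = (ids [X'] \<otimes>\<^sub>s sw [X] cs \<otimes>\<^sub>s ids as) \<circ>\<^sub>s (sw [X] [X'] \<otimes>\<^sub>s sw as cs)"
proof -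
  obtain ts where ts: "distinct ts" "obs ts = [X, X'] @ as @ cs" using tokens_exist .
  then obtain t t' a c where e: "ts = t # t' # a @ c" "snd t = X" "snd t' = X'" "obs a = as" "obs c = cs"
    by (auto simp: map_eq_Cons_conv map_eq_append_conv)
  show ?thesis
  proof (rule prm_unique)
    have "prm ([t] @ (a @ [t']) @ c) (([t'] @ c) @ ([t] @ a)) (sw (X # as) (X' # cs))"
      using prm_sw[of "X # as" "[t] @ a" "X' # cs" "[t'] @ c"] e by simp
    moreover have "prm ([t] @ ([t'] @ a) @ c) ([t] @ (a @ [t']) @ c) (ids [X] \<otimes>\<^sub>s sw [X'] as \<otimes>\<^sub>s ids cs)"
      using e by (intro prm_tens prm_id' prm_sw) auto
    ultimately show "prm (t # t' # a @ c) (t' # c @ t # a) (sw (X # as) (X' # cs) \<circ>\<^sub>s (ids [X] \<otimes>\<^sub>s sw [X'] as \<otimes>\<^sub>s ids cs))"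
      using prm_comp by fastforce
    have "prm ([t'] @ ([t] @ c) @ a) ([t'] @ (c @ [t]) @ a) (ids [X'] \<otimes>\<^sub>s sw [X] cs \<otimes>\<^sub>s ids as)"
      using e by (intro prm_tens prm_id' prm_sw) auto
    moreover have "prm (([t] @ [t']) @ (a @ c)) (([t'] @ [t]) @ (c @ a)) (sw [X] [X'] \<otimes>\<^sub>s sw as cs)"
      using e by (intro prm_tens prm_id' prm_sw) auto
    ultimately show "prm (t # t' # a @ c) (t' # c @ t # a) ((ids [X'] \<otimes>\<^sub>s sw [X] cs \<otimes>\<^sub>s ids as) \<circ>\<^sub>s (sw [X] [X'] \<otimes>\<^sub>s sw as cs))"
      using prm_comp by fastforce
  qed (use ts e in auto)
qed

text \<open>The braiding moves both copies of the stage as well as the resources; cocommutativity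
  absorbs the exchange of the two copies.\<close>

lemma tens2_comm:
  assumes "coal x" "arr f" "arr g" "dm f = src x # as" "dm g = src x # cs" "bs = cd f" "ds = cd g"
  shows "sw bs ds \<circ>\<^sub>s tens2 x f g = tens2 x g f \<circ>\<^sub>s (ids [src x] \<otimes>\<^sub>s sw as cs)"
proof -
  let ?X = "src x"
  have n: "sw (cd f) (cd g) \<circ>\<^sub>s (f \<otimes>\<^sub>s g) = (g \<otimes>\<^sub>s f) \<circ>\<^sub>s sw (?X # as) (?X # cs)"
    using assms by (simp add: sw_nat)
  have c: "(sw [?X] [?X] \<otimes>\<^sub>s sw as cs) \<circ>\<^sub>s (scc x \<otimes>\<^sub>s ids (as @ cs)) = scc x \<otimes>\<^sub>s sw as cs"
    using assms by (simp add: stens_comp scc_comm)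
  have "sw bs ds \<circ>\<^sub>s tens2 x f g = (g \<otimes>\<^sub>s f) \<circ>\<^sub>s (sw (?X # as) (?X # cs)
     \<circ>\<^sub>s (ids [?X] \<otimes>\<^sub>s sw [?X] as \<otimes>\<^sub>s ids cs)) \<circ>\<^sub>s (scc x \<otimes>\<^sub>s ids (as @ cs))"
    using assms by (simp add: tens2_def stail2[OF n])
  also have "\<dots> = (g \<otimes>\<^sub>s f) \<circ>\<^sub>s (ids [?X] \<otimes>\<^sub>s sw [?X] cs \<otimes>\<^sub>s ids as) \<circ>\<^sub>s (scc x \<otimes>\<^sub>s sw as cs)"
    unfolding sw_struct1 using assms c by simp
  also have "scc x \<otimes>\<^sub>s sw as cs = (scc x \<otimes>\<^sub>s ids (cs @ as)) \<circ>\<^sub>s (ids [?X] \<otimes>\<^sub>s sw as cs)"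
    using assms by (simp add: stens_comp)
  finally show ?thesis using assms by (simp add: tens2_def)
qed

lemma tens2_unit_left: assumes "coal x" "arr f" "dm f = src x # as" shows "tens2 x (sww x) f = f"
proof -
  have "tens2 x (sww x) f = (sww x \<otimes>\<^sub>s f) \<circ>\<^sub>s (scc x \<otimes>\<^sub>s ids as)"
    using assms by (simp add: tens2_def)
  also have "sww x \<otimes>\<^sub>s f = f \<circ>\<^sub>s ((sww x \<otimes>\<^sub>s ids [src x]) \<otimes>\<^sub>s ids as)"
    using assms stens_comp[of "sww x" "ids []" "ids (src x # as)" f] by simp
  also have "(f \<circ>\<^sub>s ((sww x \<otimes>\<^sub>s ids [src x]) \<otimes>\<^sub>s ids as)) \<circ>\<^sub>s (scc x \<otimes>\<^sub>s ids as)
    = f \<circ>\<^sub>s (((sww x \<otimes>\<^sub>s ids [src x]) \<circ>\<^sub>s scc x) \<otimes>\<^sub>s ids as)"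
    using assms stens_comp[of "scc x" "sww x \<otimes>\<^sub>s ids [src x]" "ids as" "ids as"] by simp
  also have "\<dots> = f" using assms by (simp add: scc_lunit)
  finally show ?thesis .
qed

lemma tens2_unit_right: assumes "coal x" "arr f" "dm f = src x # as" shows "tens2 x f (sww x) = f"
  using tens2_comm[of x "sww x" f "[]" as "[]" "cd f"] tens2_unit_left[of x f as] assms by simp

lemma tens2_comp:
  assumes "coal x" "arr f" "arr g" "dm f = src x # as" "dm g = src x # cs" "arr m" "arr n" "dm m = cd f" "dm n = cd g"
  shows "(m \<otimes>\<^sub>s n) \<circ>\<^sub>s tens2 x f g = tens2 x (m \<circ>\<^sub>s f) (n \<circ>\<^sub>s g)"
  using assms by (simp add: tens2_def stens_comp_tail)

lemma tens2_pre:
  assumes "coal x" "arr f" "arr g" "dm f = src x # as" "dm g = src x # cs" "arr p" "arr q" "cd p = as" "cd q = cs"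
  shows "tens2 x f g \<circ>\<^sub>s (ids [src x] \<otimes>\<^sub>s p \<otimes>\<^sub>s q) = tens2 x (f \<circ>\<^sub>s (ids [src x] \<otimes>\<^sub>s p)) (g \<circ>\<^sub>s (ids [src x] \<otimes>\<^sub>s q))"
proof -
  let ?X = "src x"
  have s: "sw [?X] as \<circ>\<^sub>s (ids [?X] \<otimes>\<^sub>s p) = (p \<otimes>\<^sub>s ids [?X]) \<circ>\<^sub>s sw [?X] (dm p)"
    using assms by (simp add: sw_nat)
  have "tens2 x f g \<circ>\<^sub>s (ids [?X] \<otimes>\<^sub>s p \<otimes>\<^sub>s q)
    = (f \<otimes>\<^sub>s g) \<circ>\<^sub>s (ids [?X] \<otimes>\<^sub>s sw [?X] as \<otimes>\<^sub>s ids cs) \<circ>\<^sub>s (scc x \<otimes>\<^sub>s p \<otimes>\<^sub>s q)"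
    using assms stens_comp[of "ids [?X]" "scc x" "p \<otimes>\<^sub>s q" "ids (as @ cs)"] by (simp add: tens2_def)
  also have "scc x \<otimes>\<^sub>s p \<otimes>\<^sub>s q = (ids [?X] \<otimes>\<^sub>s (ids [?X] \<otimes>\<^sub>s p) \<otimes>\<^sub>s q) \<circ>\<^sub>s (scc x \<otimes>\<^sub>s ids (dm p @ dm q))"
    using assms stens_comp[of "scc x" "ids [?X,?X]" "ids (dm p @ dm q)" "p \<otimes>\<^sub>s q"] by simp
  also have "(ids [?X] \<otimes>\<^sub>s sw [?X] as \<otimes>\<^sub>s ids cs) \<circ>\<^sub>s \<dots>
    = (ids [?X] \<otimes>\<^sub>s (sw [?X] as \<circ>\<^sub>s (ids [?X] \<otimes>\<^sub>s p)) \<otimes>\<^sub>s q) \<circ>\<^sub>s (scc x \<otimes>\<^sub>s ids (dm p @ dm q))"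
    using assms by (subst scomp_assoc[symmetric]) (simp_all add: stens_comp[of _ _ "_ \<otimes>\<^sub>s _" "_ \<otimes>\<^sub>s _"] stens_comp[of _ _ q "ids cs"] del: stens_assoc stens_id_tail)
  also have "ids [?X] \<otimes>\<^sub>s (sw [?X] as \<circ>\<^sub>s (ids [?X] \<otimes>\<^sub>s p)) \<otimes>\<^sub>s q
    = ((ids [?X] \<otimes>\<^sub>s p) \<otimes>\<^sub>s (ids [?X] \<otimes>\<^sub>s q)) \<circ>\<^sub>s (ids [?X] \<otimes>\<^sub>s sw [?X] (dm p) \<otimes>\<^sub>s ids (dm q))"
    unfolding s using assms stens_comp[of "sw [?X] (dm p)" "p \<otimes>\<^sub>s ids [?X]" "ids (dm q)" q]
      stens_comp[of "ids [?X]" "ids [?X]" "sw [?X] (dm p) \<otimes>\<^sub>s ids (dm q)" "p \<otimes>\<^sub>s ids [?X] \<otimes>\<^sub>s q"] by simp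
  finally have "tens2 x f g \<circ>\<^sub>s (ids [?X] \<otimes>\<^sub>s p \<otimes>\<^sub>s q) = ((f \<otimes>\<^sub>s g) \<circ>\<^sub>s ((ids [?X] \<otimes>\<^sub>s p) \<otimes>\<^sub>s (ids [?X] \<otimes>\<^sub>s q)))
      \<circ>\<^sub>s (ids [?X] \<otimes>\<^sub>s sw [?X] (dm p) \<otimes>\<^sub>s ids (dm q)) \<circ>\<^sub>s (scc x \<otimes>\<^sub>s ids (dm p @ dm q))"
    using assms by simp
  also have "(f \<otimes>\<^sub>s g) \<circ>\<^sub>s ((ids [?X] \<otimes>\<^sub>s p) \<otimes>\<^sub>s (ids [?X] \<otimes>\<^sub>s q)) = (f \<circ>\<^sub>s (ids [?X] \<otimes>\<^sub>s p)) \<otimes>\<^sub>s (g \<circ>\<^sub>s (ids [?X] \<otimes>\<^sub>s q))"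
    using assms by (intro stens_comp) simp_all
  finally show ?thesis using assms by (simp add: tens2_def)
qed

text \<open>A coalgebra morphism commutes with duplication, so changing the stage before splitting
  it equals changing it separately in both factors.\<close>

lemma tens2_base:
  assumes "coal x" "coal y" "cmor y x h" "arr f" "arr g" "dm f = src x # as" "dm g = src x # cs"
  shows "tens2 x f g \<circ>\<^sub>s (em h \<otimes>\<^sub>s ids (as @ cs)) = tens2 y (f \<circ>\<^sub>s (em h \<otimes>\<^sub>s ids as)) (g \<circ>\<^sub>s (em h \<otimes>\<^sub>s ids cs))"
proof -
  let ?X = "src x" and ?Y = "src y"
  note h = cmorD[OF assms(3)]
  have s: "sw [?X] as \<circ>\<^sub>s (em h \<otimes>\<^sub>s ids as) = (ids as \<otimes>\<^sub>s em h) \<circ>\<^sub>s sw [?Y] as"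
    using assms h by (simp add: sw_nat)
  have "tens2 x f g \<circ>\<^sub>s (em h \<otimes>\<^sub>s ids (as @ cs))
    = (f \<otimes>\<^sub>s g) \<circ>\<^sub>s (ids [?X] \<otimes>\<^sub>s sw [?X] as \<otimes>\<^sub>s ids cs) \<circ>\<^sub>s (((em h \<otimes>\<^sub>s em h) \<circ>\<^sub>s scc y) \<otimes>\<^sub>s ids (as @ cs))"
    using assms h by (simp add: tens2_def stens_comp scc_cmor)
  also have "((em h \<otimes>\<^sub>s em h) \<circ>\<^sub>s scc y) \<otimes>\<^sub>s ids (as @ cs) = (em h \<otimes>\<^sub>s (em h \<otimes>\<^sub>s ids as) \<otimes>\<^sub>s ids cs) \<circ>\<^sub>s (scc y \<otimes>\<^sub>s ids (as @ cs))"
    using assms h stens_comp[of "scc y" "em h \<otimes>\<^sub>s em h" "ids (as @ cs)" "ids (as @ cs)"] by simp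
  also have "(ids [?X] \<otimes>\<^sub>s sw [?X] as \<otimes>\<^sub>s ids cs) \<circ>\<^sub>s \<dots>
    = (em h \<otimes>\<^sub>s (sw [?X] as \<circ>\<^sub>s (em h \<otimes>\<^sub>s ids as)) \<otimes>\<^sub>s ids cs) \<circ>\<^sub>s (scc y \<otimes>\<^sub>s ids (as @ cs))"
    using assms h by (subst scomp_assoc[symmetric]) (simp_all add: stens_comp[of _ _ "_ \<otimes>\<^sub>s _" "_ \<otimes>\<^sub>s _"] stens_comp[of _ _ "ids cs" "ids cs"] del: stens_assoc stens_id_tail stens_id)
  also have "em h \<otimes>\<^sub>s (sw [?X] as \<circ>\<^sub>s (em h \<otimes>\<^sub>s ids as)) \<otimes>\<^sub>s ids cs
    = ((em h \<otimes>\<^sub>s ids as) \<otimes>\<^sub>s (em h \<otimes>\<^sub>s ids cs)) \<circ>\<^sub>s (ids [?Y] \<otimes>\<^sub>s sw [?Y] as \<otimes>\<^sub>s ids cs)"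
    unfolding s using assms h stens_comp[of "sw [?Y] as" "ids as \<otimes>\<^sub>s em h" "ids cs" "ids cs"]
      stens_comp[of "ids [?Y]" "em h" "sw [?Y] as \<otimes>\<^sub>s ids cs" "ids as \<otimes>\<^sub>s em h \<otimes>\<^sub>s ids cs"] by simp
  finally have "tens2 x f g \<circ>\<^sub>s (em h \<otimes>\<^sub>s ids (as @ cs)) = ((f \<otimes>\<^sub>s g) \<circ>\<^sub>s ((em h \<otimes>\<^sub>s ids as) \<otimes>\<^sub>s (em h \<otimes>\<^sub>s ids cs)))
      \<circ>\<^sub>s (ids [?Y] \<otimes>\<^sub>s sw [?Y] as \<otimes>\<^sub>s ids cs) \<circ>\<^sub>s (scc y \<otimes>\<^sub>s ids (as @ cs))"
    using assms h by simp
  also have "(f \<otimes>\<^sub>s g) \<circ>\<^sub>s ((em h \<otimes>\<^sub>s ids as) \<otimes>\<^sub>s (em h \<otimes>\<^sub>s ids cs)) = (f \<circ>\<^sub>s (em h \<otimes>\<^sub>s ids as)) \<otimes>\<^sub>s (g \<circ>\<^sub>s (em h \<otimes>\<^sub>s ids cs))"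
    using assms h by (intro stens_comp) simp_all
  finally show ?thesis using assms h by (simp add: tens2_def)
qed

end

definition nonlin :: "var \<Rightarrow> bool" where "nonlin v \<longleftrightarrow> (case v of Hov k \<sigma> \<tau> \<Rightarrow> False | _ \<Rightarrow> True)"

context sll_category
begin

lemma assoc_struct: "(ids [X] \<otimes>\<^sub>s sw [X] as \<otimes>\<^sub>s ids (cs @ X # es)) \<circ>\<^sub>s (ids [X, X] \<otimes>\<^sub>s sw [X] (as @ cs) \<otimes>\<^sub>s ids es)
    = (ids (X # as @ [X]) \<otimes>\<^sub>s sw [X] cs \<otimes>\<^sub>s ids es) \<circ>\<^sub>s (ids [X] \<otimes>\<^sub>s sw [X, X] as \<otimes>\<^sub>s ids (cs @ es))"
proof -
  obtain ts where ts: "distinct ts" "obs ts = [X, X, X] @ as @ cs @ es" using tokens_exist .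
  then obtain t u v r where r: "ts = t # u # v # r" "snd t = X" "snd u = X" "snd v = X" "obs r = as @ cs @ es"
    by (auto simp: map_eq_Cons_conv)
  then obtain a r' where r': "r = a @ r'" "obs a = as" "obs r' = cs @ es"
    using map_eq_append_conv[of snd r as "cs @ es"] by auto
  then obtain c d where "r' = c @ d" "obs c = cs" "obs d = es"
    using map_eq_append_conv[of snd r' cs es] by auto
  with r r' have e: "ts = t # u # v # a @ c @ d" "snd t = X" "snd u = X" "snd v = X"
      "obs a = as" "obs c = cs" "obs d = es" by auto
  show ?thesis
  proof (rule prm_unique)
    have "prm ([t, u] @ ([v] @ (a @ c)) @ d) ([t, u] @ ((a @ c) @ [v]) @ d) (ids [X, X] \<otimes>\<^sub>s sw [X] (as @ cs) \<otimes>\<^sub>s ids es)"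
      using e by (intro prm_tens prm_id' prm_sw) auto
    moreover have "prm ([t] @ ([u] @ a) @ (c @ [v] @ d)) ([t] @ (a @ [u]) @ (c @ [v] @ d)) (ids [X] \<otimes>\<^sub>s sw [X] as \<otimes>\<^sub>s ids (cs @ X # es))"
      using e by (intro prm_tens prm_id' prm_sw) auto
    ultimately show "prm (t # u # v # a @ c @ d) (t # a @ u # c @ v # d)
      ((ids [X] \<otimes>\<^sub>s sw [X] as \<otimes>\<^sub>s ids (cs @ X # es)) \<circ>\<^sub>s (ids [X, X] \<otimes>\<^sub>s sw [X] (as @ cs) \<otimes>\<^sub>s ids es))"
      using prm_comp by fastforce
    have "prm ([t] @ ([u, v] @ a) @ (c @ d)) ([t] @ (a @ [u, v]) @ (c @ d)) (ids [X] \<otimes>\<^sub>s sw [X, X] as \<otimes>\<^sub>s ids (cs @ es))"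
      using e by (intro prm_tens prm_id' prm_sw) auto
    moreover have "prm ((t # a @ [u]) @ ([v] @ c) @ d) ((t # a @ [u]) @ (c @ [v]) @ d) (ids (X # as @ [X]) \<otimes>\<^sub>s sw [X] cs \<otimes>\<^sub>s ids es)"
      using e by (intro prm_tens prm_id' prm_sw) auto
    ultimately show "prm (t # u # v # a @ c @ d) (t # a @ u # c @ v # d)
      ((ids (X # as @ [X]) \<otimes>\<^sub>s sw [X] cs \<otimes>\<^sub>s ids es) \<circ>\<^sub>s (ids [X] \<otimes>\<^sub>s sw [X, X] as \<otimes>\<^sub>s ids (cs @ es)))"
      using prm_comp by fastforce
  qed (use ts e in auto)
qed

text \<open>Both sides become \<open>f \<otimes>\<^sub>s g \<otimes>\<^sub>s h\<close> after a
  permutation after a threefold duplication of the stage. The permutations agree by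
  \<open>assoc_struct\<close>, the duplications by coassociativity.\<close>

lemma tens2_assoc:
  assumes "coal x" "arr f" "arr g" "arr h" "dm f = src x # as" "dm g = src x # cs" "dm h = src x # es"
  shows "tens2 x (tens2 x f g) h = tens2 x f (tens2 x g h)"
proof -
  let ?X = "src x" and ?s = "scc x"
  let ?A = "ids [?X] \<otimes>\<^sub>s sw [?X] as \<otimes>\<^sub>s ids cs" and ?B = "ids [?X] \<otimes>\<^sub>s sw [?X] cs \<otimes>\<^sub>s ids es"
  have a: "arr ?s" "dm ?s = [?X]" "cd ?s = [?X, ?X]" using assms by simp_all
  have 1: "tens2 x f g \<otimes>\<^sub>s h = ((f \<otimes>\<^sub>s g) \<otimes>\<^sub>s h) \<circ>\<^sub>s (?A \<otimes>\<^sub>s ids (?X # es)) \<circ>\<^sub>s ((?s \<otimes>\<^sub>s ids (as @ cs)) \<otimes>\<^sub>s ids (?X # es))"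
    using assms stens_comp[of "?A \<circ>\<^sub>s (?s \<otimes>\<^sub>s ids (as @ cs))" "f \<otimes>\<^sub>s g" "ids (?X # es)" h]
      stens_comp[of "?s \<otimes>\<^sub>s ids (as @ cs)" "?A" "ids (?X # es)" "ids (?X # es)"]
    by (simp add: tens2_def)
  have 2: "(?s \<otimes>\<^sub>s ids (as @ cs @ ?X # es)) \<circ>\<^sub>s (ids [?X] \<otimes>\<^sub>s sw [?X] (as @ cs) \<otimes>\<^sub>s ids es)
     = (ids [?X, ?X] \<otimes>\<^sub>s sw [?X] (as @ cs) \<otimes>\<^sub>s ids es) \<circ>\<^sub>s (?s \<otimes>\<^sub>s ids (?X # as @ cs @ es))"
    using a by (simp add: stens_comp)
  have 3: "(?s \<otimes>\<^sub>s ids (?X # as @ cs @ es)) \<circ>\<^sub>s (?s \<otimes>\<^sub>s ids (as @ cs @ es))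
     = ((?s \<otimes>\<^sub>s ids [?X]) \<circ>\<^sub>s ?s) \<otimes>\<^sub>s ids (as @ cs @ es)"
    using a stens_comp[of ?s "?s \<otimes>\<^sub>s ids [?X]" "ids (as @ cs @ es)" "ids (as @ cs @ es)"] by simp
  have L: "tens2 x (tens2 x f g) h = (f \<otimes>\<^sub>s g \<otimes>\<^sub>s h)
     \<circ>\<^sub>s ((ids [?X] \<otimes>\<^sub>s sw [?X] as \<otimes>\<^sub>s ids (cs @ ?X # es)) \<circ>\<^sub>s (ids [?X, ?X] \<otimes>\<^sub>s sw [?X] (as @ cs) \<otimes>\<^sub>s ids es))
     \<circ>\<^sub>s (((?s \<otimes>\<^sub>s ids [?X]) \<circ>\<^sub>s ?s) \<otimes>\<^sub>s ids (as @ cs @ es))"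
    unfolding tens2_def[of x "tens2 x f g" h] 1 using assms by (simp add: stail2[OF 2] 3)
  have 4: "f \<otimes>\<^sub>s tens2 x g h = (f \<otimes>\<^sub>s (g \<otimes>\<^sub>s h)) \<circ>\<^sub>s (ids (?X # as) \<otimes>\<^sub>s ?B) \<circ>\<^sub>s (ids (?X # as) \<otimes>\<^sub>s (?s \<otimes>\<^sub>s ids (cs @ es)))"
    using assms stens_comp[of "ids (?X # as)" f "?B \<circ>\<^sub>s (?s \<otimes>\<^sub>s ids (cs @ es))" "g \<otimes>\<^sub>s h"]
      stens_comp[of "ids (?X # as)" "ids (?X # as)" "?s \<otimes>\<^sub>s ids (cs @ es)" ?B]
    by (simp add: tens2_def)
  have n: "(ids as \<otimes>\<^sub>s ?s) \<circ>\<^sub>s sw [?X] as = sw [?X, ?X] as \<circ>\<^sub>s (?s \<otimes>\<^sub>s ids as)"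
    using a by (simp add: sw_nat)
  have 5: "(ids (?X # as) \<otimes>\<^sub>s (?s \<otimes>\<^sub>s ids (cs @ es))) \<circ>\<^sub>s (ids [?X] \<otimes>\<^sub>s sw [?X] as \<otimes>\<^sub>s ids (cs @ es))
    = (ids [?X] \<otimes>\<^sub>s sw [?X, ?X] as \<otimes>\<^sub>s ids (cs @ es)) \<circ>\<^sub>s (ids [?X] \<otimes>\<^sub>s ?s \<otimes>\<^sub>s ids (as @ cs @ es))"
  proof -
    have "(ids (?X # as) \<otimes>\<^sub>s (?s \<otimes>\<^sub>s ids (cs @ es))) \<circ>\<^sub>s (ids [?X] \<otimes>\<^sub>s sw [?X] as \<otimes>\<^sub>s ids (cs @ es))
      = ids [?X] \<otimes>\<^sub>s (((ids as \<otimes>\<^sub>s ?s) \<circ>\<^sub>s sw [?X] as) \<otimes>\<^sub>s ids (cs @ es))"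
      using a stens_comp[of "sw [?X] as" "ids as \<otimes>\<^sub>s ?s" "ids (cs @ es)" "ids (cs @ es)"]
        stens_comp[of "ids [?X]" "ids [?X]" "sw [?X] as \<otimes>\<^sub>s ids (cs @ es)" "ids as \<otimes>\<^sub>s ?s \<otimes>\<^sub>s ids (cs @ es)"] by simp
    also have "\<dots> = (ids [?X] \<otimes>\<^sub>s sw [?X, ?X] as \<otimes>\<^sub>s ids (cs @ es)) \<circ>\<^sub>s (ids [?X] \<otimes>\<^sub>s ?s \<otimes>\<^sub>s ids (as @ cs @ es))"
      unfolding n using a stens_comp[of "?s \<otimes>\<^sub>s ids as" "sw [?X, ?X] as" "ids (cs @ es)" "ids (cs @ es)"]
      by (simp add: stens_comp)
    finally show ?thesis .
  qed
  have 6: "(ids [?X] \<otimes>\<^sub>s ?s \<otimes>\<^sub>s ids (as @ cs @ es)) \<circ>\<^sub>s (?s \<otimes>\<^sub>s ids (as @ cs @ es))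
     = ((ids [?X] \<otimes>\<^sub>s ?s) \<circ>\<^sub>s ?s) \<otimes>\<^sub>s ids (as @ cs @ es)"
    using a stens_comp[of ?s "ids [?X] \<otimes>\<^sub>s ?s" "ids (as @ cs @ es)" "ids (as @ cs @ es)"] by simp
  have R: "tens2 x f (tens2 x g h) = (f \<otimes>\<^sub>s g \<otimes>\<^sub>s h)
     \<circ>\<^sub>s ((ids (?X # as @ [?X]) \<otimes>\<^sub>s sw [?X] cs \<otimes>\<^sub>s ids es) \<circ>\<^sub>s (ids [?X] \<otimes>\<^sub>s sw [?X, ?X] as \<otimes>\<^sub>s ids (cs @ es)))
     \<circ>\<^sub>s (((ids [?X] \<otimes>\<^sub>s ?s) \<circ>\<^sub>s ?s) \<otimes>\<^sub>s ids (as @ cs @ es))"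
    unfolding tens2_def[of x f "tens2 x g h"] 4 using assms by (simp add: stail2[OF 5[simplified]] 6[simplified])
  show ?thesis unfolding L R assoc_struct scc_coassoc[OF assms(1)] ..
qed

lemma tens2_ids: assumes "coal x" "arr f" "arr g" "dm f = src x # as" "dm g = src x # cs"
  shows "tens2 x f (g \<otimes>\<^sub>s ids bs) = tens2 x f g \<otimes>\<^sub>s ids bs"
proof -
  have "(f \<otimes>\<^sub>s g \<otimes>\<^sub>s ids bs) \<circ>\<^sub>s (ids [src x] \<otimes>\<^sub>s sw [src x] as \<otimes>\<^sub>s ids (cs @ bs)) \<circ>\<^sub>s (scc x \<otimes>\<^sub>s ids (as @ cs @ bs))
    = ((f \<otimes>\<^sub>s g) \<circ>\<^sub>s (ids [src x] \<otimes>\<^sub>s sw [src x] as \<otimes>\<^sub>s ids cs) \<circ>\<^sub>s (scc x \<otimes>\<^sub>s ids (as @ cs))) \<otimes>\<^sub>s ids bs"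
    using assms stens_comp[of "(ids [src x] \<otimes>\<^sub>s sw [src x] as \<otimes>\<^sub>s ids cs) \<circ>\<^sub>s (scc x \<otimes>\<^sub>s ids (as @ cs))" "f \<otimes>\<^sub>s g" "ids bs" "ids bs"]
      stens_comp[of "scc x \<otimes>\<^sub>s ids (as @ cs)" "ids [src x] \<otimes>\<^sub>s sw [src x] as \<otimes>\<^sub>s ids cs" "ids bs" "ids bs"]
    by simp
  then show ?thesis using assms by (simp add: tens2_def)
qed

text \<open>\<open>sww x \<otimes>\<^sub>s ids bs\<close> is the parametrised identity: it discards
  the stage and passes its resources on. This is the value of a linear variable.\<close>

lemma tens2_var_right: assumes "coal x" "arr f" "dm f = src x # as"
  shows "tens2 x f (sww x \<otimes>\<^sub>s ids bs) = f \<otimes>\<^sub>s ids bs"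
  using assms by (simp add: tens2_ids tens2_unit_right)

lemma tens2_var_left: assumes "coal x" "arr f" "dm f = src x # as"
  shows "tens2 x (sww x \<otimes>\<^sub>s ids [A]) f = (ids [A] \<otimes>\<^sub>s f) \<circ>\<^sub>s (sw [src x] [A] \<otimes>\<^sub>s ids as)"
proof -
  have n: "sw (cd f) [A] \<circ>\<^sub>s (f \<otimes>\<^sub>s ids [A]) = (ids [A] \<otimes>\<^sub>s f) \<circ>\<^sub>s sw (src x # as) [A]"
    using assms by (simp add: sw_nat)
  have s: "sw (src x # as) [A] = (sw [src x] [A] \<otimes>\<^sub>s ids as) \<circ>\<^sub>s (ids [src x] \<otimes>\<^sub>s sw as [A])"
    using sw_append_left[of "[src x]" as "[A]"] by simp
  have "sw (cd f) [A] \<circ>\<^sub>s (f \<otimes>\<^sub>s ids [A]) = tens2 x (sww x \<otimes>\<^sub>s ids [A]) f \<circ>\<^sub>s (ids [src x] \<otimes>\<^sub>s sw as [A])"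
    using tens2_comm[of x f "sww x \<otimes>\<^sub>s ids [A]" as "[A]" "cd f" "[A]"] assms by (simp add: tens2_var_right)
  then have "tens2 x (sww x \<otimes>\<^sub>s ids [A]) f \<circ>\<^sub>s (ids [src x] \<otimes>\<^sub>s sw as [A])
     = ((ids [A] \<otimes>\<^sub>s f) \<circ>\<^sub>s (sw [src x] [A] \<otimes>\<^sub>s ids as)) \<circ>\<^sub>s (ids [src x] \<otimes>\<^sub>s sw as [A])"
    using assms by (simp add: n s)
  then show ?thesis
    by (rule s_epi_cancel[where j = "ids [src x] \<otimes>\<^sub>s sw [A] as"]) (use assms in \<open>simp_all add: stens_comp\<close>)
qed

text \<open>How an environment looks under a ground or stable binder: old values are read through
  the first projection, the new variable is the second one. Surjective pairing reduces this to the
  old environment beside an identity, up to unpacking the stage.\<close>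

lemma tens2_binder: assumes "coal x" "coal y" "arr f" "dm f = src x # as"
  shows "tens2 (ct x y) (f \<circ>\<^sub>s (em (p1 x y) \<otimes>\<^sub>s ids as)) (em (p2 x y))
    = (f \<otimes>\<^sub>s ids [src y]) \<circ>\<^sub>s (ids [src x] \<otimes>\<^sub>s sw [src y] as) \<circ>\<^sub>s (upk (src x) (src y) \<otimes>\<^sub>s ids as)"
proof -
  let ?p = "em (p1 x y)" and ?q = "em (p2 x y)" and ?X = "src x" and ?Y = "src y"
  have s: "(ids as \<otimes>\<^sub>s ?q) \<circ>\<^sub>s sw [?X \<otimes> ?Y] as = sw [?Y] as \<circ>\<^sub>s (?q \<otimes>\<^sub>s ids as)"
    using assms by (simp add: sw_nat)
  have "tens2 (ct x y) (f \<circ>\<^sub>s (?p \<otimes>\<^sub>s ids as)) ?q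
     = ((f \<circ>\<^sub>s (?p \<otimes>\<^sub>s ids as)) \<otimes>\<^sub>s (ids [?Y] \<circ>\<^sub>s ?q)) \<circ>\<^sub>s (ids [?X \<otimes> ?Y] \<otimes>\<^sub>s sw [?X \<otimes> ?Y] as) \<circ>\<^sub>s (scc (ct x y) \<otimes>\<^sub>s ids as)"
    using assms by (simp add: tens2_def)
  also have "(f \<circ>\<^sub>s (?p \<otimes>\<^sub>s ids as)) \<otimes>\<^sub>s (ids [?Y] \<circ>\<^sub>s ?q) = (f \<otimes>\<^sub>s ids [?Y]) \<circ>\<^sub>s (?p \<otimes>\<^sub>s ids as \<otimes>\<^sub>s ?q)"
    using assms stens_comp[of "?p \<otimes>\<^sub>s ids as" f ?q "ids [?Y]"] by simp
  also have "\<dots> \<circ>\<^sub>s (ids [?X \<otimes> ?Y] \<otimes>\<^sub>s sw [?X \<otimes> ?Y] as) \<circ>\<^sub>s (scc (ct x y) \<otimes>\<^sub>s ids as)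
     = (f \<otimes>\<^sub>s ids [?Y]) \<circ>\<^sub>s (?p \<otimes>\<^sub>s (sw [?Y] as \<circ>\<^sub>s (?q \<otimes>\<^sub>s ids as))) \<circ>\<^sub>s (scc (ct x y) \<otimes>\<^sub>s ids as)"
    using assms by (simp add: stens_comp_tail s)
  also have "?p \<otimes>\<^sub>s (sw [?Y] as \<circ>\<^sub>s (?q \<otimes>\<^sub>s ids as)) = (ids [?X] \<otimes>\<^sub>s sw [?Y] as) \<circ>\<^sub>s ((?p \<otimes>\<^sub>s ?q) \<otimes>\<^sub>s ids as)"
    using assms by (simp add: stens_comp)
  also have "(f \<otimes>\<^sub>s ids [?Y]) \<circ>\<^sub>s ((ids [?X] \<otimes>\<^sub>s sw [?Y] as) \<circ>\<^sub>s ((?p \<otimes>\<^sub>s ?q) \<otimes>\<^sub>s ids as)) \<circ>\<^sub>s (scc (ct x y) \<otimes>\<^sub>s ids as)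
    = (f \<otimes>\<^sub>s ids [?Y]) \<circ>\<^sub>s (ids [?X] \<otimes>\<^sub>s sw [?Y] as) \<circ>\<^sub>s (((?p \<otimes>\<^sub>s ?q) \<circ>\<^sub>s scc (ct x y)) \<otimes>\<^sub>s ids as)"
    using assms stens_comp[of "scc (ct x y)" "?p \<otimes>\<^sub>s ?q" "ids as" "ids as"] by simp
  finally show ?thesis using assms by (simp add: p12_scc)
qed

text \<open>The same with the new variable in front, which is the order in which generic
  environments are built.\<close>

lemma tens2_cons: assumes "coal x" "coal y" "arr f" "dm f = src x # as"
  shows "tens2 (ct y x) (em (p1 y x)) (f \<circ>\<^sub>s (em (p2 y x) \<otimes>\<^sub>s ids as))
    = (ids [src y] \<otimes>\<^sub>s f) \<circ>\<^sub>s (upk (src y) (src x) \<otimes>\<^sub>s ids as)"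
proof -
  let ?p = "em (p1 y x)" and ?q = "em (p2 y x)" and ?X = "src x" and ?Y = "src y"
  have "tens2 (ct y x) ?p (f \<circ>\<^sub>s (?q \<otimes>\<^sub>s ids as)) = ((ids [?Y] \<circ>\<^sub>s ?p) \<otimes>\<^sub>s (f \<circ>\<^sub>s (?q \<otimes>\<^sub>s ids as))) \<circ>\<^sub>s (scc (ct y x) \<otimes>\<^sub>s ids as)"
    using assms by (simp add: tens2_def)
  also have "(ids [?Y] \<circ>\<^sub>s ?p) \<otimes>\<^sub>s (f \<circ>\<^sub>s (?q \<otimes>\<^sub>s ids as)) = (ids [?Y] \<otimes>\<^sub>s f) \<circ>\<^sub>s (?p \<otimes>\<^sub>s ?q \<otimes>\<^sub>s ids as)"
    using assms by (intro stens_comp[symmetric]) simp_all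
  also have "\<dots> \<circ>\<^sub>s (scc (ct y x) \<otimes>\<^sub>s ids as) = (ids [?Y] \<otimes>\<^sub>s f) \<circ>\<^sub>s (((?p \<otimes>\<^sub>s ?q) \<circ>\<^sub>s scc (ct y x)) \<otimes>\<^sub>s ids as)"
    using assms stens_comp[of "scc (ct y x)" "?p \<otimes>\<^sub>s ?q" "ids as" "ids as"] by simp
  finally show ?thesis using assms by (simp add: p12_scc)
qed

section \<open>Currying, pairing and the coalgebras of variables\<close>

definition "curt X A f = Tri X (cur C X A (tgt f) (mor f)) (A \<leadsto> tgt f)"

lemma curt_simps [simp]: "src (curt X A f) = X" "tgt (curt X A f) = A \<leadsto> tgt f"
  "ok f \<Longrightarrow> src f = X \<otimes> A \<Longrightarrow> ok (curt X A f)"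
  by (simp_all add: curt_def) (simp add: ok_def cur_hom)

definition "evt A B = Tri ((A \<leadsto> B) \<otimes> A) (ev C A B) B"

lemma evt_simps [simp]: "src (evt A B) = (A \<leadsto> B) \<otimes> A" "tgt (evt A B) = B" "ok (evt A B)"
  by (simp_all add: evt_def ev_hom)

lemma evt_curt: "ok f \<Longrightarrow> src f = X \<otimes> A \<Longrightarrow> B = tgt f \<Longrightarrow> evt A B \<circ>\<^sub>t (curt X A f \<otimes>\<^sub>t idt A) = f"
  by (rule tri_eqI) (auto simp: mor_simps evt_def curt_def ok_def ev_cur)

lemma curt_nat: assumes "ok f" "src f = X \<otimes> A" "ok g" "tgt g = X" "Y = src g"
  shows "curt Y A (f \<circ>\<^sub>t (g \<otimes>\<^sub>t idt A)) = curt X A f \<circ>\<^sub>t g"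
proof -
  have "evt A (tgt f) \<circ>\<^sub>t ((curt X A f \<circ>\<^sub>t g) \<otimes>\<^sub>t idt A) = f \<circ>\<^sub>t (g \<otimes>\<^sub>t idt A)"
  proof -
    have "evt A (tgt f) \<circ>\<^sub>t ((curt X A f \<circ>\<^sub>t g) \<otimes>\<^sub>t idt A) = (evt A (tgt f) \<circ>\<^sub>t (curt X A f \<otimes>\<^sub>t idt A)) \<circ>\<^sub>t (g \<otimes>\<^sub>t idt A)"
      using assms by (simp add: tns_cmp)
    then show ?thesis using assms by (simp add: evt_curt)
  qed
  moreover have "ok (curt X A f \<circ>\<^sub>t g)" using assms by simp
  ultimately show ?thesis using assms cur_ev[of "mor (curt X A f \<circ>\<^sub>t g)" Y A "tgt f"]
    by (intro tri_eqI) (auto simp: ok_def curt_def evt_def mor_simps dest!: arg_cong[of _ _ mor])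
qed

definition "scur as A f = up as (curt (ten as) A (dn f \<circ>\<^sub>t J as [A] \<circ>\<^sub>t (idt (ten as) \<otimes>\<^sub>t run' A)))"

lemma scur_simps [simp]: "dm (scur as A f) = as" "cd (scur as A f) = [A \<leadsto> hd (cd f)]"
  "\<lbrakk>arr f; dm f = as @ [A]; cd f = [B]\<rbrakk> \<Longrightarrow> arr (scur as A f)"
  by (simp_all add: scur_def)

lemma scur_nat: assumes "arr f" "dm f = as @ [A]" "cd f = [B]" "arr g" "cd g = as" "cs = dm g"
  shows "scur cs A (f \<circ>\<^sub>s (g \<otimes>\<^sub>s ids [A])) = scur as A f \<circ>\<^sub>s g"
proof -
  have "dn (f \<circ>\<^sub>s (g \<otimes>\<^sub>s ids [A])) \<circ>\<^sub>t J cs [A] \<circ>\<^sub>t (idt (ten cs) \<otimes>\<^sub>t run' A)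
     = (dn f \<circ>\<^sub>t J as [A] \<circ>\<^sub>t (idt (ten as) \<otimes>\<^sub>t run' A)) \<circ>\<^sub>t (tr g \<otimes>\<^sub>t idt A)"
    using assms by (simp add: dn_scomp tr_simps tns_cmp)
  then show ?thesis using assms by (simp add: scur_def curt_nat up_scomp del: cmp_assoc)
qed

definition "pairt f g = Tri (src f) (pair C (mor f) (mor g)) (cprod C (tgt f) (tgt g))"

lemma pairt_simps [simp]: "src (pairt f g) = src f" "tgt (pairt f g) = cprod C (tgt f) (tgt g)"
  "ok f \<Longrightarrow> ok g \<Longrightarrow> src f = src g \<Longrightarrow> ok (pairt f g)"
  by (simp_all add: pairt_def) (simp add: ok_def pair_hom)

lemma pairt_nat: assumes "ok f" "ok g" "src f = src g" "ok h" "tgt h = src f"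
  shows "pairt f g \<circ>\<^sub>t h = pairt (f \<circ>\<^sub>t h) (g \<circ>\<^sub>t h)"
proof (rule tri_eqI)
  have "mor f \<in> Hom C (src f) (tgt f)" "mor g \<in> Hom C (src f) (tgt g)" "mor h \<in> Hom C (src h) (src f)"
    using assms by (auto simp: ok_def)
  note * = this pair_hom[OF this(1,2)]
  have "proj1 C (tgt f) (tgt g) \<cdot> pair C (mor f) (mor g) \<cdot> mor h = mor f \<cdot> mor h"
    "proj2 C (tgt f) (tgt g) \<cdot> pair C (mor f) (mor g) \<cdot> mor h = mor g \<cdot> mor h"
    using Comp_assoc[OF *(3) *(4) proj1_hom] Comp_assoc[OF *(3) *(4) proj2_hom]
      proj1_pair[OF *(1,2)] proj2_pair[OF *(1,2)] by simp_all
  with pair_proj[OF Comp_hom[OF *(3,4)]]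
  show "mor (pairt f g \<circ>\<^sub>t h) = mor (pairt (f \<circ>\<^sub>t h) (g \<circ>\<^sub>t h))"
    by (simp add: pairt_def mor_simps)
qed simp_all

definition "spair f g = up (dm f) (pairt (dn f) (dn g))"

lemma spair_simps [simp]: "dm (spair f g) = dm f" "cd (spair f g) = [cprod C (hd (cd f)) (hd (cd g))]"
  "\<lbrakk>arr f; arr g; dm f = dm g; cd f = [A]; cd g = [B]\<rbrakk> \<Longrightarrow> arr (spair f g)"
  by (simp_all add: spair_def)

lemma spair_nat: "\<lbrakk>arr f; arr g; dm f = dm g; cd f = [A]; cd g = [B]; arr h; cd h = dm f\<rbrakk>
    \<Longrightarrow> spair f g \<circ>\<^sub>s h = spair (f \<circ>\<^sub>s h) (g \<circ>\<^sub>s h)"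
  by (simp add: spair_def up_scomp pairt_nat dn_scomp)

definition "ue t = dn t \<circ>\<^sub>t run' (hd (dm t))"

lemma ue_simps [simp]: "src (ue t) = hd (dm t)" "tgt (ue t) = hd (cd t)"
  "\<lbrakk>arr t; dm t = [A]; cd t = [B]\<rbrakk> \<Longrightarrow> ok (ue t)"
  "\<lbrakk>arr t; dm t = [A]; cd t = [B]\<rbrakk> \<Longrightarrow> em (ue t) = t"
  "ok f \<Longrightarrow> ue (em f) = f"
  by (simp_all add: ue_def em_def)

lemma ue_comp: "\<lbrakk>arr t; dm t = [A]; cd t = [B]; ok h; tgt h = A\<rbrakk> \<Longrightarrow> ue (t \<circ>\<^sub>s em h) = ue t \<circ>\<^sub>t h"
  by (simp add: ue_def dn_scomp tr_em)

text \<open>The coalgebra by which a variable may be duplicated and discarded. Higher-order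
  variables are linear and have none; facts about \<open>vc\<close> assume
  \<open>nonlin\<close>.\<close>

definition "vc v = (case v of Gnd k \<Rightarrow> pt | Hov k \<sigma> \<tau> \<Rightarrow> undefined | Stb k \<sigma> \<Rightarrow> digt (ty_obj C \<sigma>))"

lemma vc_simps [simp]: "nonlin v \<Longrightarrow> coal (vc v)" "nonlin v \<Longrightarrow> src (vc v) = var_obj C v"
  by (cases v; simp add: nonlin_def vc_def)+

primrec pc where
  "pc [] = qut"
| "pc (v # \<Gamma>) = ct (vc v) (pc \<Gamma>)"

lemma pc_simps [simp]: "\<forall>v\<in>set \<Gamma>. nonlin v \<Longrightarrow> coal (pc \<Gamma>)"
  "\<forall>v\<in>set \<Gamma>. nonlin v \<Longrightarrow> src (pc \<Gamma>) = ten (objs C \<Gamma>)"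
  by (induction \<Gamma>) simp_all

text \<open>The two hom-set memberships travel with the equation because interchange and
  associativity hold only for composable arrows.\<close>

lemma qs_pc: "\<forall>v\<in>set \<Gamma>. nonlin v \<Longrightarrow> qs C (objs C \<Gamma>) \<in> Hom C (ten (map (bang C) (objs C \<Gamma>))) (bang C (ten (objs C \<Gamma>)))
    \<and> tensors_arr C (map (\<lambda>v. mor (vc v)) \<Gamma>) \<in> Hom C (ten (objs C \<Gamma>)) (ten (map (bang C) (objs C \<Gamma>)))
    \<and> mor (pc \<Gamma>) = qs C (objs C \<Gamma>) \<cdot> tensors_arr C (map (\<lambda>v. mor (vc v)) \<Gamma>)"
proof (induction \<Gamma>)
  case Nil
  then show ?case by (simp add: Id_hom q_unit_hom Comp_Id_right[OF q_unit_hom] bmor)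
next
  case (Cons v \<Gamma>)
  let ?A = "var_obj C v"
  have v: "mor (vc v) \<in> Hom C ?A (bang C ?A)" using Cons.prems coalD(1)[of "vc v"] by (simp add: ok_def)
  have i: "Id C (bang C ?A) \<in> Hom C (bang C ?A) (bang C ?A)" by (rule Id_hom)
  from Cons have IH: "qs C (objs C \<Gamma>) \<in> Hom C (ten (map (bang C) (objs C \<Gamma>))) (bang C (ten (objs C \<Gamma>)))"
    "tensors_arr C (map (\<lambda>v. mor (vc v)) \<Gamma>) \<in> Hom C (ten (objs C \<Gamma>)) (ten (map (bang C) (objs C \<Gamma>)))"
    "mor (pc \<Gamma>) = qs C (objs C \<Gamma>) \<cdot> tensors_arr C (map (\<lambda>v. mor (vc v)) \<Gamma>)" by auto
  have "mor (pc (v # \<Gamma>)) = qmon C ?A (ten (objs C \<Gamma>)) \<cdot> (mor (vc v) \<boxtimes> mor (pc \<Gamma>))"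
    using Cons.prems by (simp add: ct_def mor_simps bmor)
  also have "\<dots> = qmon C ?A (ten (objs C \<Gamma>)) \<cdot> ((Id C (bang C ?A) \<boxtimes> qs C (objs C \<Gamma>)) \<cdot> (mor (vc v) \<boxtimes> tensors_arr C (map (\<lambda>v. mor (vc v)) \<Gamma>)))"
    using tensor_Comp[OF v i IH(2,1)] Comp_Id_left[OF v] IH(3) by simp
  also have "\<dots> = qs C (objs C (v # \<Gamma>)) \<cdot> tensors_arr C (map (\<lambda>v. mor (vc v)) (v # \<Gamma>))"
    using Comp_assoc[OF tensor_hom[OF v IH(2)] tensor_hom[OF i IH(1)] q_hom] by simp
  finally show ?case using Comp_hom[OF tensor_hom[OF i IH(1)] q_hom] tensor_hom[OF v IH(2)] by simp
qed

lemma nonlin_ground: "ground \<Gamma> \<Longrightarrow> \<forall>v\<in>set \<Gamma>. nonlin v" "stable \<Gamma> \<Longrightarrow> \<forall>v\<in>set \<Gamma>. nonlin v"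
  by (auto simp: ground_def stable_def nonlin_def)

text \<open>The map through which fixpoints and stable substitution promote is thus the coalgebra
  structure of the basis, and coalgebra morphisms into the basis can be moved across it.\<close>

lemma promote_pc: assumes "ground \<Gamma>" "stable \<Delta>" shows "promote C \<Gamma> \<Delta> = mor (pc (\<Gamma> @ \<Delta>))"
proof -
  have "\<forall>v\<in>set (\<Gamma> @ \<Delta>). nonlin v" using assms nonlin_ground by auto
  then have "mor (pc (\<Gamma> @ \<Delta>)) = qs C (objs C (\<Gamma> @ \<Delta>)) \<cdot> tensors_arr C (map (\<lambda>v. mor (vc v)) (\<Gamma> @ \<Delta>))"
    using qs_pc by blast
  moreover have "map (\<lambda>v. mor (vc v)) (\<Gamma> @ \<Delta>) = map (\<lambda>_. p_N C) \<Gamma> @ map (\<lambda>v. dig C (ty_obj C (var_ty v))) \<Delta>"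
    using assms by (auto simp: ground_def stable_def vc_def mor_pt bmor)
  ultimately show ?thesis by (simp only: promote_def)
qed

end

section \<open>Syntax-directed semantics\<close>

primrec lc :: "nat \<Rightarrow> trm \<Rightarrow> bool" where
  "lc k Zero = True" | "lc k Succ = True" | "lc k Pred = True"
| "lc k (Lif M L R) = (lc k M \<and> lc k L \<and> lc k R)"
| "lc k (Fv v) = True"
| "lc k (Bv i) = (i < k)"
| "lc k (App M N) = (lc k M \<and> lc k N)"
| "lc k (Lam \<sigma> M) = lc (Suc k) M"
| "lc k (Mu \<sigma> M) = lc (Suc k) M"

lemma lc_close: "lc k M \<Longrightarrow> lc (Suc k) (close k x M)"
  by (induction M arbitrary: k) auto

lemma lc_subst: "lc k M \<Longrightarrow> (\<And>k. lc k N) \<Longrightarrow> lc k (M[x::=N])"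
  by (induction M arbitrary: k) auto

lemma lc_mono: "lc k M \<Longrightarrow> k \<le> j \<Longrightarrow> lc j M"
  by (induction M arbitrary: k j) auto

lemma typing_lc: "\<Gamma> \<turnstile> M \<Colon> \<sigma> \<Longrightarrow> lc 0 M"
  by (induction rule: typing.induct) (auto simp: LAM_def MU_def intro!: lc_close lc_subst)

text \<open>An entry gives the type of a variable, the tokens it consumes and an arrow out of the
  stage and these tokens. Environments have terms as keys so that named variables and de Bruijn
  indices are looked up in one map; only such atoms are ever looked up.\<close>

type_synonym ('o, 'm) entry = "ty \<times> (nat \<times> 'o) list \<times> ('o, 'm) sarr"
type_synonym ('o, 'm) env = "trm \<Rightarrow> ('o, 'm) entry option"

text \<open>Entering a binder puts \<open>new\<close> at index \<open>0\<close>, while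
  \<open>\<phi>\<close> carries the existing entries to the larger stage or past the new
  token.\<close>

definition shift :: "(('o, 'm) entry \<Rightarrow> ('o, 'm) entry) \<Rightarrow> ('o, 'm) entry \<Rightarrow> ('o, 'm) env \<Rightarrow> ('o, 'm) env" where
  "shift \<phi> new e a = (case a of Bv 0 \<Rightarrow> Some new | Bv (Suc i) \<Rightarrow> map_option \<phi> (e (Bv i)) | _ \<Rightarrow> map_option \<phi> (e a))"

lemma shift_simps [simp]: "shift \<phi> new e (Fv v) = map_option \<phi> (e (Fv v))"
  "shift \<phi> new e (Bv 0) = Some new" "shift \<phi> new e (Bv (Suc i)) = map_option \<phi> (e (Bv i))"
  by (simp_all add: shift_def)

definition tmap :: "(nat \<Rightarrow> nat) \<Rightarrow> ('o, 'm) entry \<Rightarrow> ('o, 'm) entry" where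
  "tmap g = (\<lambda>(\<sigma>, L, f). (\<sigma>, map (apfst g) L, f))"

lemma tmap_simp [simp]: "tmap g (\<sigma>, L, f) = (\<sigma>, map (apfst g) L, f)" by (simp add: tmap_def)

context sll_category
begin

definition "bmap h = (\<lambda>(\<sigma> :: ty, L :: (nat \<times> 'o) list, f). (\<sigma>, L, f \<circ>\<^sub>s (em h \<otimes>\<^sub>s ids (obs L))))"

lemma bmap_simp [simp]: "bmap h (\<sigma>, L, f) = (\<sigma>, L, f \<circ>\<^sub>s (em h \<otimes>\<^sub>s ids (obs L)))" by (simp add: bmap_def)

abbreviation "N0 \<equiv> nat_obj C"
abbreviation "tob \<equiv> ty_obj C"

definition "zerot = Tri \<one> (zero_arr C) N0"
definition "succt = Tri N0 (succ_arr C) N0"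
definition "predt = Tri N0 (pred_arr C) N0"
definition "fixt A = Tri (bang C (bang C A \<leadsto> A)) (fix_arr C A) A"
definition "evs A B = up [A \<leadsto> B, A] (evt A B \<circ>\<^sub>t (idt (A \<leadsto> B) \<otimes>\<^sub>t run A))"
definition "lift = Tri (N0 \<otimes> cprod C N0 N0) (lif_arr C) N0"
definition "lifs = up [N0, cprod C N0 N0] (lift \<circ>\<^sub>t (idt N0 \<otimes>\<^sub>t run (cprod C N0 N0)))"

lemma const_simps [simp]:
  "src zerot = \<one>" "tgt zerot = N0" "ok zerot" "src succt = N0" "tgt succt = N0" "ok succt"
  "src predt = N0" "tgt predt = N0" "ok predt" "src (fixt A) = bang C (bang C A \<leadsto> A)" "tgt (fixt A) = A" "ok (fixt A)"
  "dm (evs A B) = [A \<leadsto> B, A]" "cd (evs A B) = [B]" "arr (evs A B)"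
  "src lift = N0 \<otimes> cprod C N0 N0" "tgt lift = N0" "ok lift"
  "dm lifs = [N0, cprod C N0 N0]" "cd lifs = [N0]" "arr lifs"
  by (simp_all add: zerot_def succt_def predt_def fixt_def evs_def lift_def lifs_def zero_hom succ_hom pred_hom fix_hom lif_hom)

text \<open>Syntax-directed semantics. A stage is a coalgebra \<open>x\<close>; the environment assigns to every free
  or bound variable an arrow parametrised by the stage and by a list of linear resources
  (tokens). The tokens of a term are listed in the order of their use, so that no permutation is
  needed for applications. Under a linear binder the new token is \<open>0\<close> and all others are shifted.\<close>

inductive S :: "('o, 'm) tri \<Rightarrow> ('o, 'm) env \<Rightarrow> trm \<Rightarrow> ty \<Rightarrow> (nat \<times> 'o) list \<Rightarrow> ('o, 'm) sarr \<Rightarrow> bool" where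
  S_fv: "e (Fv v) = Some (\<sigma>, L, f) \<Longrightarrow> S x e (Fv v) \<sigma> L f"
| S_bv: "e (Bv i) = Some (\<sigma>, L, f) \<Longrightarrow> S x e (Bv i) \<sigma> L f"
| S_zero: "S x e Zero Iota [] (up [] zerot \<circ>\<^sub>s sww x)"
| S_succ: "S x e Succ (Lolli Iota Iota) [] (up [] (curt \<one> N0 (succt \<circ>\<^sub>t lun N0)) \<circ>\<^sub>s sww x)"
| S_pred: "S x e Pred (Lolli Iota Iota) [] (up [] (curt \<one> N0 (predt \<circ>\<^sub>t lun N0)) \<circ>\<^sub>s sww x)"
| S_app: "\<lbrakk>S x e M (Lolli \<sigma> \<tau>) L1 f1; S x e N \<sigma> L2 f2\<rbrakk>
    \<Longrightarrow> S x e (App M N) \<tau> (L1 @ L2) (evs (tob \<sigma>) (tob \<tau>) \<circ>\<^sub>s tens2 x f1 f2)"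
| S_lif: "\<lbrakk>S x e M Iota L1 f1; S x e L Iota L2 f2; S x e R Iota L3 f3; mset L2 = mset L3\<rbrakk>
    \<Longrightarrow> S x e (Lif M L R) Iota (L1 @ L2)
      (lifs \<circ>\<^sub>s tens2 x f1 (spair f2 (f3 \<circ>\<^sub>s (ids [src x] \<otimes>\<^sub>s pm L2 L3))))"
| S_lam_ground: "S (ct x pt) (shift (bmap (p1 x pt)) (Iota, [], em (p2 x pt)) e) M \<tau> L f
    \<Longrightarrow> S x e (Lam Iota M) (Lolli Iota \<tau>) L
      (scur (src x # obs L) N0 (f \<circ>\<^sub>s (pk (src x) N0 \<otimes>\<^sub>s ids (obs L)) \<circ>\<^sub>s (ids [src x] \<otimes>\<^sub>s sw (obs L) [N0])))"
| S_lam_higher: "\<lbrakk>S x (shift (tmap Suc) (\<sigma>, [(0, tob \<sigma>)], sww x \<otimes>\<^sub>s ids [tob \<sigma>]) e) M \<tau>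
      (map (apfst Suc) A @ (0, tob \<sigma>) # map (apfst Suc) B) f; \<sigma> = Lolli \<sigma>1 \<sigma>2\<rbrakk>
    \<Longrightarrow> S x e (Lam \<sigma> M) (Lolli \<sigma> \<tau>) (A @ B)
      (scur (src x # obs (A @ B)) (tob \<sigma>) (f \<circ>\<^sub>s (ids (src x # obs A) \<otimes>\<^sub>s sw (obs B) [tob \<sigma>])))"
| S_mu: "S (ct x (digt (tob \<sigma>))) (shift (bmap (p1 x (digt (tob \<sigma>)))) (\<sigma>, [], em (dert (tob \<sigma>) \<circ>\<^sub>t p2 x (digt (tob \<sigma>)))) e) M \<sigma> [] f
    \<Longrightarrow> S x e (Mu \<sigma> M) \<sigma> [] (em (fixt (tob \<sigma>) \<circ>\<^sub>t bng (curt (src x) (bang C (tob \<sigma>)) (ue f)) \<circ>\<^sub>t x))"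

definition wfe :: "('o, 'm) tri \<Rightarrow> ('o, 'm) env \<Rightarrow> bool" where
  "wfe x e \<longleftrightarrow> (\<forall>a \<sigma> L f. e a = Some (\<sigma>, L, f) \<longrightarrow> arr f \<and> dm f = src x # obs L \<and> cd f = [tob \<sigma>])"

lemma wfeD: "wfe x e \<Longrightarrow> e a = Some (\<sigma>, L, f) \<Longrightarrow> arr f \<and> dm f = src x # obs L \<and> cd f = [tob \<sigma>]"
  by (auto simp: wfe_def)

lemma shift_cases:
  assumes "shift \<phi> new e a = Some E"
  obtains "a = Bv 0" "E = new" | b E' where "e b = Some E'" "E = \<phi> E'"
  using assms by (auto simp: shift_def split: trm.splits nat.splits)

lemma wfe_shift:
  assumes "wfe x e" "\<And>\<sigma> L f. \<lbrakk>arr f; dm f = src x # obs L; cd f = [tob \<sigma>]\<rbrakk> \<Longrightarrow>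
      case \<phi> (\<sigma>, L, f) of (\<sigma>', L', f') \<Rightarrow> arr f' \<and> dm f' = src y # obs L' \<and> cd f' = [tob \<sigma>']"
    and "case new of (\<sigma>', L', f') \<Rightarrow> arr f' \<and> dm f' = src y # obs L' \<and> cd f' = [tob \<sigma>']"
  shows "wfe y (shift \<phi> new e)"
  unfolding wfe_def
proof (intro allI impI)
  fix a \<sigma> L f assume "shift \<phi> new e a = Some (\<sigma>, L, f)"
  then show "arr f \<and> dm f = src y # obs L \<and> cd f = [tob \<sigma>]"
  proof (cases rule: shift_cases)
    case 1
    then show ?thesis using assms(3) by auto
  next
    case (2 b E')
    obtain \<sigma>' L' f' where E': "E' = (\<sigma>', L', f')" by (cases E') auto
    show ?thesis using assms(2)[of f' L' \<sigma>'] wfeD[OF assms(1), of b] 2 E' by (auto split: prod.splits)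
  qed
qed

lemma wfe_binders:
  assumes "wfe x e" "coal x"
  shows "wfe (ct x pt) (shift (bmap (p1 x pt)) (Iota, [], em (p2 x pt)) e)"
    "wfe x (shift (tmap Suc) (\<sigma>, [(0, tob \<sigma>)], sww x \<otimes>\<^sub>s ids [tob \<sigma>]) e)"
    "wfe (ct x (digt (tob \<sigma>))) (shift (bmap (p1 x (digt (tob \<sigma>)))) (\<sigma>, [], em (dert (tob \<sigma>) \<circ>\<^sub>t p2 x (digt (tob \<sigma>)))) e)"
  using assms by (auto intro!: wfe_shift[OF assms(1)])

lemma S_arr: "S x e M \<sigma> L f \<Longrightarrow> wfe x e \<Longrightarrow> coal x \<Longrightarrow> arr f \<and> dm f = src x # obs L \<and> cd f = [tob \<sigma>]"
proof (induction rule: S.induct)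
  case (S_lif x e M L1 f1 L L2 f2 R L3 f3)
  then show ?case using pm_arr[OF S_lif(4)] by simp
next
  case (S_lam_ground x e M \<tau> L f)
  then show ?case using wfe_binders(1)[of x e] by simp
next
  case (S_lam_higher x \<sigma> e M \<tau> A B f \<sigma>1 \<sigma>2)
  then show ?case using wfe_binders(2)[of x e \<sigma>] by simp
next
  case (S_mu x \<sigma> e M f)
  then show ?case using wfe_binders(3)[of x e \<sigma>] by simp
qed (auto dest: wfeD)

section \<open>Uniqueness of the semantics, renaming of tokens and binding\<close>

lemma apfst_Suc [simp]: "apfst Suc a = apfst Suc b \<longleftrightarrow> a = b" "apfst Suc a \<noteq> (0, o1)" "(0, o1) \<noteq> apfst Suc a"
  by (cases a; cases b; auto)+

text \<open>All other tokens are shifted, so the bound token \<open>0\<close> occurs exactly once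
  and its position determines the split. Without this the rule for linear abstraction would not be
  deterministic.\<close>

lemma map_Suc_split:
  "map (apfst Suc) A @ (0, o1) # map (apfst Suc) B = map (apfst Suc) A' @ (0, o2) # map (apfst Suc) B'
    \<Longrightarrow> A = A' \<and> B = B'"
proof (induction A arbitrary: A')
  case Nil
  have "inj (apfst Suc :: nat \<times> 'o \<Rightarrow> _)" by (rule injI) simp
  then show ?case using Nil by (cases A') (auto simp: inj_map_eq_map)
next
  case (Cons a A)
  then show ?case by (cases A') auto
qed

lemma S_lam_higherD: "S x e (Lam \<sigma> M) \<rho> L f \<Longrightarrow> \<sigma> = Lolli a b \<Longrightarrow> \<exists>\<tau> A B g. \<rho> = Lolli \<sigma> \<tau> \<and> L = A @ B \<and>
    f = scur (src x # obs (A @ B)) (tob \<sigma>) (g \<circ>\<^sub>s (ids (src x # obs A) \<otimes>\<^sub>s sw (obs B) [tob \<sigma>])) \<and>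
    S x (shift (tmap Suc) (\<sigma>, [(0, tob \<sigma>)], sww x \<otimes>\<^sub>s ids [tob \<sigma>]) e) M \<tau>
      (map (apfst Suc) A @ (0, tob \<sigma>) # map (apfst Suc) B) g"
  by (erule S.cases)
    (simp_all only: trm.distinct trm.inject ty.distinct, clarify, intro exI conjI, (rule refl | assumption)+)

text \<open>Each term former has one rule, and the two rules for \<open>Lam\<close> exclude each
  other by the argument type. As no rule inspects a basis, two derivations of a judgment can be
  compared through this value.\<close>

lemma S_det: "S x e M \<sigma> L f \<Longrightarrow> S x e M \<sigma>' L' f' \<Longrightarrow> \<sigma>' = \<sigma> \<and> L' = L \<and> f' = f"
proof (induction arbitrary: \<sigma>' L' f' rule: S.induct)
  case (S_lam_ground x e M \<tau> L f)
  show ?case by (rule S.cases[OF S_lam_ground.prems]) (auto dest!: S_lam_ground.IH)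
next
  case (S_lam_higher x \<sigma> e M \<tau> A B f \<sigma>1 \<sigma>2)
  obtain \<tau>' A' B' f'' where *: "\<sigma>' = Lolli \<sigma> \<tau>'" "L' = A' @ B'"
      "f' = scur (src x # obs (A' @ B')) (tob \<sigma>) (f'' \<circ>\<^sub>s (ids (src x # obs A') \<otimes>\<^sub>s sw (obs B') [tob \<sigma>]))"
      "S x (shift (tmap Suc) (\<sigma>, [(0, tob \<sigma>)], sww x \<otimes>\<^sub>s ids [tob \<sigma>]) e) M \<tau>'
         (map (apfst Suc) A' @ (0, tob \<sigma>) # map (apfst Suc) B') f''"
    using S_lam_higherD[OF S_lam_higher.prems S_lam_higher.hyps(2)] by blast
  from S_lam_higher.IH[OF *(4)] map_Suc_split[of A' "tob \<sigma>" B' A "tob \<sigma>" B] show ?case using * by auto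
next
  case (S_mu x \<sigma> e M f)
  show ?case by (rule S.cases[OF S_mu.prems]) (auto dest!: S_mu.IH)
next
  case (S_app x e M \<sigma> \<tau> L1 f1 N L2 f2)
  show ?case by (rule S.cases[OF S_app.prems]) (auto dest!: S_app.IH)
next
  case (S_lif x e M L1 f1 L L2 f2 R L3 f3)
  show ?case by (rule S.cases[OF S_lif.prems]) (auto dest!: S_lif.IH)
qed (auto elim: S.cases)

text \<open>Only indices below \<open>k\<close> are ever looked up in a term with
  \<open>lc k\<close>; with \<open>k = 0\<close> the entries of indices are irrelevant, as when a
  closed-off term is carried under a binder.\<close>

lemma S_cong: "S x e M \<sigma> L f \<Longrightarrow> lc k M \<Longrightarrow> (\<And>v. e' (Fv v) = e (Fv v)) \<Longrightarrow> (\<And>i. i < k \<Longrightarrow> e' (Bv i) = e (Bv i))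
    \<Longrightarrow> S x e' M \<sigma> L f"
proof (induction arbitrary: k e' rule: S.induct)
  case (S_lam_ground x e M \<tau> L f)
  show ?case
    by (intro S.S_lam_ground S_lam_ground.IH[of "Suc k"])
      (use S_lam_ground.prems in \<open>auto simp: less_Suc_eq_0_disj\<close>)
next
  case (S_lam_higher x \<sigma> e M \<tau> A B f \<sigma>1 \<sigma>2)
  show ?case
    by (intro S.S_lam_higher[OF _ S_lam_higher.hyps(2)] S_lam_higher.IH[of "Suc k"])
      (use S_lam_higher.prems in \<open>auto simp: less_Suc_eq_0_disj\<close>)
next
  case (S_mu x \<sigma> e M f)
  show ?case
    by (intro S.S_mu S_mu.IH[of "Suc k"])
      (use S_mu.prems in \<open>auto simp: less_Suc_eq_0_disj\<close>)
qed (auto intro: S.intros)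

lemma shift_comp: "(\<And>a E. e a = Some E \<Longrightarrow> \<phi>' (\<psi> E) = \<psi>' (\<phi> E)) \<Longrightarrow> new' = \<psi>' new \<Longrightarrow>
    shift \<phi>' new' (map_option \<psi> \<circ> e) = map_option \<psi>' \<circ> shift \<phi> new e"
  by (rule ext) (auto simp: shift_def option.map_comp comp_def split: trm.splits nat.splits intro!: option.map_cong0 map_option_cong)

text \<open>Arrows see only the objects of tokens, so an injective renaming changes the list of
  tokens but not the arrow.\<close>

lemma S_ren: "inj g \<Longrightarrow> S x e M \<sigma> L f \<Longrightarrow> S x (map_option (tmap g) \<circ> e) M \<sigma> (map (apfst g) L) f"
proof (rotate_tac, induction arbitrary: g rule: S.induct)
  case (S_lif x e M L1 f1 L L2 f2 R L3 f3)
  have "pm (map (apfst g) L2) (map (apfst g) L3) = pm L2 L3"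
    using S_lif.prems by (intro pm_map) (auto simp: inj_def)
  with S.S_lif[OF S_lif.IH(1)[OF S_lif.prems] S_lif.IH(2)[OF S_lif.prems] S_lif.IH(3)[OF S_lif.prems]] S_lif.hyps(4)
  show ?case by simp
next
  case (S_lam_ground x e M \<tau> L f)
  have "shift (bmap (p1 x pt)) (Iota, [], em (p2 x pt)) (map_option (tmap g) \<circ> e)
     = map_option (tmap g) \<circ> shift (bmap (p1 x pt)) (Iota, [], em (p2 x pt)) e"
    by (rule shift_comp) auto
  note eq = this
  show ?case using S.S_lam_ground[OF S_lam_ground.IH[OF S_lam_ground.prems, folded eq]] by (simp add: comp_def)
next
  case (S_lam_higher x \<sigma> e M \<tau> A B f \<sigma>1 \<sigma>2)
  \<comment> \<open>Under the binder the new token \<open>0\<close> stays fixed and \<open>g\<close>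
    acts on the shifted ones.\<close>
  let ?g = "case_nat 0 (Suc \<circ> g)"
  have i: "inj ?g" by (rule injI) (auto split: nat.splits dest: injD[OF S_lam_higher.prems])
  have c: "apfst ?g (apfst Suc t) = apfst Suc (apfst g t)" for t :: "nat \<times> 'o" by (cases t) simp
  have "shift (tmap Suc) (\<sigma>, [(0, tob \<sigma>)], sww x \<otimes>\<^sub>s ids [tob \<sigma>]) (map_option (tmap g) \<circ> e)
     = map_option (tmap ?g) \<circ> shift (tmap Suc) (\<sigma>, [(0, tob \<sigma>)], sww x \<otimes>\<^sub>s ids [tob \<sigma>]) e"
    by (rule shift_comp) (auto simp: tmap_def c)
  note eq = this
  have "S x (shift (tmap Suc) (\<sigma>, [(0, tob \<sigma>)], sww x \<otimes>\<^sub>s ids [tob \<sigma>]) (map_option (tmap g) \<circ> e)) M \<tau>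
     (map (apfst Suc) (map (apfst g) A) @ (0, tob \<sigma>) # map (apfst Suc) (map (apfst g) B)) f"
    using S_lam_higher.IH[OF i, folded eq] by (simp add: comp_def c)
  from S.S_lam_higher[OF this S_lam_higher.hyps(2)] show ?case by (simp add: comp_def)
next
  case (S_mu x \<sigma> e M f)
  have "shift (bmap (p1 x (digt (tob \<sigma>)))) (\<sigma>, [], em (dert (tob \<sigma>) \<circ>\<^sub>t p2 x (digt (tob \<sigma>)))) (map_option (tmap g) \<circ> e)
     = map_option (tmap g) \<circ> shift (bmap (p1 x (digt (tob \<sigma>)))) (\<sigma>, [], em (dert (tob \<sigma>) \<circ>\<^sub>t p2 x (digt (tob \<sigma>)))) e"
    by (rule shift_comp) auto
  note eq = this
  have "S (ct x (digt (tob \<sigma>))) (shift (bmap (p1 x (digt (tob \<sigma>)))) (\<sigma>, [], em (dert (tob \<sigma>) \<circ>\<^sub>t p2 x (digt (tob \<sigma>)))) (map_option (tmap g) \<circ> e)) M \<sigma> [] f"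
    unfolding eq using S_mu.IH[OF S_mu.prems] by (simp only: list.map)
  from S.S_mu[OF this] show ?case by (simp only: list.map)
qed (auto intro: S.intros)

text \<open>Binding a name moves its entry to index \<open>k\<close>. This connects
  \<open>LAM\<close> and \<open>MU\<close>, which close a named body, with the binder rules of
  \<open>S\<close>.\<close>

lemma S_close: "S x e M \<sigma> L f \<Longrightarrow> lc k M \<Longrightarrow> (\<And>y. y \<noteq> v \<Longrightarrow> e' (Fv y) = e (Fv y)) \<Longrightarrow> (\<And>i. i < k \<Longrightarrow> e' (Bv i) = e (Bv i))
    \<Longrightarrow> e' (Bv k) = e (Fv v) \<Longrightarrow> S x e' (close k v M) \<sigma> L f"
proof (induction arbitrary: k e' rule: S.induct)
  case (S_lam_ground x e M \<tau> L f)
  show ?case unfolding close.simps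
    by (intro S.S_lam_ground S_lam_ground.IH)
      (use S_lam_ground.prems in \<open>auto simp: less_Suc_eq_0_disj\<close>)
next
  case (S_lam_higher x \<sigma> e M \<tau> A B f \<sigma>1 \<sigma>2)
  show ?case unfolding close.simps
    by (intro S.S_lam_higher[OF _ S_lam_higher.hyps(2)] S_lam_higher.IH)
      (use S_lam_higher.prems in \<open>auto simp: less_Suc_eq_0_disj\<close>)
next
  case (S_mu x \<sigma> e M f)
  show ?case unfolding close.simps
    by (intro S.S_mu S_mu.IH)
      (use S_mu.prems in \<open>auto simp: less_Suc_eq_0_disj\<close>)
qed (auto intro: S.intros)

section \<open>Change of stage and substitution in the semantics\<close>

lemma p12_nat: assumes "coal x" "coal x'" "coal y" "coal y'" "cmor x' x h" "cmor y' y k"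
  shows "p1 x y \<circ>\<^sub>t (h \<otimes>\<^sub>t k) = h \<circ>\<^sub>t p1 x' y'" "p2 x y \<circ>\<^sub>t (h \<otimes>\<^sub>t k) = k \<circ>\<^sub>t p2 x' y'"
proof -
  note c = cmorD[OF assms(5)] cmorD[OF assms(6)]
  note w = cmor_comonoid(2)[OF assms(2,1,5)] cmor_comonoid(2)[OF assms(4,3,6)]
  have n: "run (src x) \<circ>\<^sub>t (h \<otimes>\<^sub>t idt \<one>) = h \<circ>\<^sub>t run (src x')" "lun (src y) \<circ>\<^sub>t (idt \<one> \<otimes>\<^sub>t k) = k \<circ>\<^sub>t lun (src y')"
    using c by (simp_all add: run_nat lun_nat)
  have "p1 x y \<circ>\<^sub>t (h \<otimes>\<^sub>t k) = run (src x) \<circ>\<^sub>t (h \<otimes>\<^sub>t idt \<one>) \<circ>\<^sub>t (idt (src x') \<otimes>\<^sub>t ww y')"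
    using assms(1-4) c by (simp add: p1_def tns_cmp w)
  then show "p1 x y \<circ>\<^sub>t (h \<otimes>\<^sub>t k) = h \<circ>\<^sub>t p1 x' y'"
    using assms(1-4) c by (simp add: p1_def tail2[OF n(1)])
  have "p2 x y \<circ>\<^sub>t (h \<otimes>\<^sub>t k) = lun (src y) \<circ>\<^sub>t (idt \<one> \<otimes>\<^sub>t k) \<circ>\<^sub>t (ww x' \<otimes>\<^sub>t idt (src y'))"
    using assms(1-4) c by (simp add: p2_def tns_cmp w)
  then show "p2 x y \<circ>\<^sub>t (h \<otimes>\<^sub>t k) = k \<circ>\<^sub>t p2 x' y'"
    using assms(1-4) c by (simp add: p2_def tail2[OF n(2)])
qed

lemma em_tens_ids: "\<lbrakk>ok f; ok g; src g = tgt f\<rbrakk> \<Longrightarrow> (em g \<otimes>\<^sub>s ids as) \<circ>\<^sub>s (em f \<otimes>\<^sub>s ids as) = em (g \<circ>\<^sub>t f) \<otimes>\<^sub>s ids as"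
  by (simp add: stens_comp em_cmp)

text \<open>Naturality of the semantics in the stage. It is the semantic form of weakening that
  substitution under a binder calls for.\<close>

lemma S_base:
  "S x e M \<sigma> L f \<Longrightarrow> coal x \<Longrightarrow> coal y \<Longrightarrow> cmor y x h \<Longrightarrow> wfe x e
    \<Longrightarrow> S y (map_option (bmap h) \<circ> e) M \<sigma> L (f \<circ>\<^sub>s (em h \<otimes>\<^sub>s ids (obs L)))"
proof (induction arbitrary: y h rule: S.induct)
  case (S_fv e v \<sigma> L f x)
  then show ?case by (auto intro!: S.S_fv)
next
  case (S_bv e i \<sigma> L f x)
  then show ?case by (auto intro!: S.S_bv)
next
  case (S_zero x e)
  then show ?case using cmorD[OF S_zero(3)] S.S_zero[of y] by (simp add: scc_cmor)
next
  case (S_succ x e)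
  then show ?case using cmorD[OF S_succ(3)] S.S_succ[of y] by (simp add: scc_cmor)
next
  case (S_pred x e)
  then show ?case using cmorD[OF S_pred(3)] S.S_pred[of y] by (simp add: scc_cmor)
next
  case (S_app x e M \<sigma> \<tau> L1 f1 N L2 f2)
  note h = cmorD[OF S_app.prems(3)]
  have a: "arr f1" "dm f1 = src x # obs L1" "cd f1 = [tob (Lolli \<sigma> \<tau>)]" "arr f2" "dm f2 = src x # obs L2" "cd f2 = [tob \<sigma>]"
    using S_arr[OF S_app.hyps(1)] S_arr[OF S_app.hyps(2)] S_app.prems by auto
  show ?case
    using S.S_app[OF S_app.IH(1)[OF S_app.prems] S_app.IH(2)[OF S_app.prems]] h a S_app.prems
      tens2_base[OF S_app.prems(1,2,3) a(1,4,2,5)]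
    by simp
next
  case (S_lif x e M L1 f1 L L2 f2 R L3 f3)
  note h = cmorD[OF S_lif.prems(3)]
  have a: "arr f1" "dm f1 = src x # obs L1" "cd f1 = [N0]" "arr f2" "dm f2 = src x # obs L2" "cd f2 = [N0]"
    "arr f3" "dm f3 = src x # obs L3" "cd f3 = [N0]"
    using S_arr[OF S_lif.hyps(1)] S_arr[OF S_lif.hyps(2)] S_arr[OF S_lif.hyps(3)] S_lif.prems by auto
  note p = pm_arr[OF S_lif.hyps(4)]
  let ?s = "spair f2 (f3 \<circ>\<^sub>s (ids [src x] \<otimes>\<^sub>s pm L2 L3))"
  have "?s \<circ>\<^sub>s (em h \<otimes>\<^sub>s ids (obs L2)) = spair (f2 \<circ>\<^sub>s (em h \<otimes>\<^sub>s ids (obs L2))) ((f3 \<circ>\<^sub>s (em h \<otimes>\<^sub>s ids (obs L3))) \<circ>\<^sub>s (ids [src y] \<otimes>\<^sub>s pm L2 L3))"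
    using a p h by (simp add: spair_nat[of _ _ N0 N0] stens_comp)
  with tens2_base[OF S_lif.prems(1,2,3) a(1) _ a(2), of ?s "obs L2"]
    S.S_lif[OF S_lif.IH(1)[OF S_lif.prems] S_lif.IH(2)[OF S_lif.prems] S_lif.IH(3)[OF S_lif.prems] S_lif.hyps(4)]
  show ?case using a p h S_lif.prems by simp
next
  case (S_lam_ground x e M \<tau> L f)
  note h = cmorD[OF S_lam_ground.prems(3)]
  let ?h = "h \<otimes>\<^sub>t idt N0"
  have pid: "cmor pt pt (idt N0)" using cmor_id[of pt] by simp
  have ch: "cmor (ct y pt) (ct x pt) ?h"
    using cmor_tns[OF S_lam_ground.prems(2,1) _ _ S_lam_ground.prems(3) pid] by simp
  have a: "arr f" "dm f = (src x \<otimes> N0) # obs L" "cd f = [tob \<tau>]"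
    using S_arr[OF S_lam_ground.hyps] S_lam_ground.prems wfe_binders(1) by auto
  note pn = p12_nat[OF S_lam_ground.prems(1,2) _ _ S_lam_ground.prems(3) pid, simplified]
  have eq: "shift (bmap (p1 y pt)) (Iota, [], em (p2 y pt)) (map_option (bmap h) \<circ> e)
    = map_option (bmap ?h) \<circ> shift (bmap (p1 x pt)) (Iota, [], em (p2 x pt)) e"
  proof (rule shift_comp)
    fix a E assume "e a = Some E"
    then show "bmap (p1 y pt) (bmap h E) = bmap ?h (bmap (p1 x pt) E)"
      using wfeD[OF S_lam_ground.prems(4)] S_lam_ground.prems h by (cases E) (simp add: em_tens_ids pn)
  qed (use S_lam_ground.prems h pn in \<open>simp flip: em_cmp\<close>)
  have n: "em ?h \<circ>\<^sub>s pk (src y) N0 = pk (src x) N0 \<circ>\<^sub>s (em h \<otimes>\<^sub>s ids [N0])"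
  proof -
    have "em ?h \<circ>\<^sub>s pk (src y) N0 = pk (src x) N0 \<circ>\<^sub>s (upk (src x) N0 \<circ>\<^sub>s em ?h) \<circ>\<^sub>s pk (src y) N0" using h by simp
    also have "upk (src x) N0 \<circ>\<^sub>s em ?h = (em h \<otimes>\<^sub>s ids [N0]) \<circ>\<^sub>s upk (src y) N0" using em_tns[of h "idt N0"] h by simp
    finally show ?thesis using h by simp
  qed
  let ?g = "f \<circ>\<^sub>s (pk (src x) N0 \<otimes>\<^sub>s ids (obs L)) \<circ>\<^sub>s (ids [src x] \<otimes>\<^sub>s sw (obs L) [N0])"
  have g: "?g \<circ>\<^sub>s ((em h \<otimes>\<^sub>s ids (obs L)) \<otimes>\<^sub>s ids [N0])
    = (f \<circ>\<^sub>s (em ?h \<otimes>\<^sub>s ids (obs L))) \<circ>\<^sub>s (pk (src y) N0 \<otimes>\<^sub>s ids (obs L)) \<circ>\<^sub>s (ids [src y] \<otimes>\<^sub>s sw (obs L) [N0])"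
  proof -
    have 1: "(ids [src x] \<otimes>\<^sub>s sw (obs L) [N0]) \<circ>\<^sub>s (em h \<otimes>\<^sub>s ids (obs L @ [N0]))
      = (em h \<otimes>\<^sub>s ids (N0 # obs L)) \<circ>\<^sub>s (ids [src y] \<otimes>\<^sub>s sw (obs L) [N0])"
      using h by (simp add: stens_comp)
    have "(pk (src x) N0 \<otimes>\<^sub>s ids (obs L)) \<circ>\<^sub>s ((em h \<otimes>\<^sub>s ids [N0]) \<otimes>\<^sub>s ids (obs L))
      = (em ?h \<otimes>\<^sub>s ids (obs L)) \<circ>\<^sub>s (pk (src y) N0 \<otimes>\<^sub>s ids (obs L))"
      using h by (subst (1 2) stens_comp) (simp_all add: n)
    then have 2: "(pk (src x) N0 \<otimes>\<^sub>s ids (obs L)) \<circ>\<^sub>s (em h \<otimes>\<^sub>s ids (N0 # obs L))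
      = (em ?h \<otimes>\<^sub>s ids (obs L)) \<circ>\<^sub>s (pk (src y) N0 \<otimes>\<^sub>s ids (obs L))"
      using h by simp
    show ?thesis using h a by (simp add: 1 stail2[OF 2])
  qed
  have "scur (src y # obs L) N0 (?g \<circ>\<^sub>s ((em h \<otimes>\<^sub>s ids (obs L)) \<otimes>\<^sub>s ids [N0])) = scur (src x # obs L) N0 ?g \<circ>\<^sub>s (em h \<otimes>\<^sub>s ids (obs L))"
    using h a by (intro scur_nat) simp_all
  then show ?case using S.S_lam_ground[OF S_lam_ground.IH[OF _ _ ch, folded eq]] S_lam_ground.prems wfe_binders(1)
    by (simp only: g) (simp add: comp_def)
next
  case (S_lam_higher x \<sigma> e M \<tau> A B f \<sigma>1 \<sigma>2)
  note h = cmorD[OF S_lam_higher.prems(3)]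
  let ?t = "[tob \<sigma>]"
  have eq: "shift (tmap Suc) (\<sigma>, [(0, tob \<sigma>)], sww y \<otimes>\<^sub>s ids ?t) (map_option (bmap h) \<circ> e)
    = map_option (bmap h) \<circ> shift (tmap Suc) (\<sigma>, [(0, tob \<sigma>)], sww x \<otimes>\<^sub>s ids ?t) e"
    by (rule shift_comp)
      (use S_lam_higher.prems h in \<open>auto simp: tmap_def bmap_def stens_comp scc_cmor split: prod.splits\<close>)
  have a: "arr f" "dm f = src x # obs A @ tob \<sigma> # obs B" "cd f = [tob \<tau>]"
    using S_arr[OF S_lam_higher.hyps(1)] S_lam_higher.prems wfe_binders(2) by auto
  let ?g = "f \<circ>\<^sub>s (ids (src x # obs A) \<otimes>\<^sub>s sw (obs B) ?t)"
  have g: "?g \<circ>\<^sub>s ((em h \<otimes>\<^sub>s ids (obs (A @ B))) \<otimes>\<^sub>s ids ?t)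
    = (f \<circ>\<^sub>s (em h \<otimes>\<^sub>s ids (obs A @ ?t @ obs B))) \<circ>\<^sub>s (ids (src y # obs A) \<otimes>\<^sub>s sw (obs B) ?t)"
  proof -
    have "(ids (src x # obs A) \<otimes>\<^sub>s sw (obs B) ?t) \<circ>\<^sub>s (em h \<otimes>\<^sub>s ids (obs (A @ B) @ ?t)) = em h \<otimes>\<^sub>s ids (obs A) \<otimes>\<^sub>s sw (obs B) ?t"
      using h stens_comp[of "em h" "ids [src x]" "ids (obs (A @ B) @ ?t)" "ids (obs A) \<otimes>\<^sub>s sw (obs B) ?t"] by simp
    moreover have "(em h \<otimes>\<^sub>s ids (obs A @ ?t @ obs B)) \<circ>\<^sub>s (ids (src y # obs A) \<otimes>\<^sub>s sw (obs B) ?t) = em h \<otimes>\<^sub>s ids (obs A) \<otimes>\<^sub>s sw (obs B) ?t"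
      using h stens_comp[of "ids [src y]" "em h" "ids (obs A) \<otimes>\<^sub>s sw (obs B) ?t" "ids (obs A @ ?t @ obs B)"] by simp
    ultimately show ?thesis using h a by simp
  qed
  have "scur (src y # obs (A @ B)) (tob \<sigma>) (?g \<circ>\<^sub>s ((em h \<otimes>\<^sub>s ids (obs (A @ B))) \<otimes>\<^sub>s ids ?t))
     = scur (src x # obs (A @ B)) (tob \<sigma>) ?g \<circ>\<^sub>s (em h \<otimes>\<^sub>s ids (obs (A @ B)))"
    using h a by (intro scur_nat) simp_all
  moreover have "S y (shift (tmap Suc) (\<sigma>, [(0, tob \<sigma>)], sww y \<otimes>\<^sub>s ids ?t) (map_option (bmap h) \<circ> e)) M \<tau>
    (map (apfst Suc) A @ (0, tob \<sigma>) # map (apfst Suc) B) (f \<circ>\<^sub>s (em h \<otimes>\<^sub>s ids (obs A @ ?t @ obs B)))"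
    unfolding eq using S_lam_higher.IH[OF S_lam_higher.prems(1-3) wfe_binders(2)[OF S_lam_higher.prems(4,1)]] by (simp add: comp_def)
  ultimately show ?case using S.S_lam_higher[OF _ S_lam_higher.hyps(2)] g by metis
next
  case (S_mu x \<sigma> e M f)
  note h = cmorD[OF S_mu.prems(3)]
  let ?A = "bang C (tob \<sigma>)" and ?d = "digt (tob \<sigma>)"
  let ?h = "h \<otimes>\<^sub>t idt ?A"
  have pid: "cmor ?d ?d (idt ?A)" using cmor_id[of ?d] by simp
  have ch: "cmor (ct y ?d) (ct x ?d) ?h"
    using cmor_tns[OF S_mu.prems(2,1) _ _ S_mu.prems(3) pid] by simp
  have a: "arr f" "dm f = [src x \<otimes> ?A]" "cd f = [tob \<sigma>]"
    using S_arr[OF S_mu.hyps] S_mu.prems wfe_binders(3) by auto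
  note pn = p12_nat[OF S_mu.prems(1,2) _ _ S_mu.prems(3) pid, simplified]
  have eq: "shift (bmap (p1 y ?d)) (\<sigma>, [], em (dert (tob \<sigma>) \<circ>\<^sub>t p2 y ?d)) (map_option (bmap h) \<circ> e)
    = map_option (bmap ?h) \<circ> shift (bmap (p1 x ?d)) (\<sigma>, [], em (dert (tob \<sigma>) \<circ>\<^sub>t p2 x ?d)) e"
  proof (rule shift_comp)
    fix a E assume "e a = Some E"
    then show "bmap (p1 y ?d) (bmap h E) = bmap ?h (bmap (p1 x ?d) E)"
      using wfeD[OF S_mu.prems(4)] S_mu.prems h by (cases E) (simp add: em_tens_ids pn)
  qed (use S_mu.prems h pn in \<open>simp flip: em_cmp\<close>)
  have "S (ct y ?d) (shift (bmap (p1 y ?d)) (\<sigma>, [], em (dert (tob \<sigma>) \<circ>\<^sub>t p2 y ?d)) (map_option (bmap h) \<circ> e)) M \<sigma> [] (f \<circ>\<^sub>s em ?h)"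
    unfolding eq using S_mu.IH[OF _ _ ch wfe_binders(3)[OF S_mu.prems(4,1)]] S_mu.prems h by (simp add: comp_def)
  moreover have "curt (src y) ?A (ue (f \<circ>\<^sub>s em ?h)) = curt (src x) ?A (ue f) \<circ>\<^sub>t h"
    using a h by (simp add: ue_comp curt_nat)
  ultimately have "S y (map_option (bmap h) \<circ> e) (Mu \<sigma> M) \<sigma> [] (em (fixt (tob \<sigma>) \<circ>\<^sub>t bng (curt (src x) ?A (ue f) \<circ>\<^sub>t h) \<circ>\<^sub>t y))"
    using S.S_mu by metis
  \<comment> \<open>It is here that \<open>h\<close> has to be a coalgebra morphism:
    \<open>bng h \<circ>\<^sub>t y\<close> is exchanged for
    \<open>x \<circ>\<^sub>t h\<close>.\<close>
  moreover have "fixt (tob \<sigma>) \<circ>\<^sub>t bng (curt (src x) ?A (ue f) \<circ>\<^sub>t h) \<circ>\<^sub>t y = (fixt (tob \<sigma>) \<circ>\<^sub>t bng (curt (src x) ?A (ue f)) \<circ>\<^sub>t x) \<circ>\<^sub>t h"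
    using a h S_mu.prems by (simp add: bng_cmp)
  ultimately have 1: "S y (map_option (bmap h) \<circ> e) (Mu \<sigma> M) \<sigma> [] (em ((fixt (tob \<sigma>) \<circ>\<^sub>t bng (curt (src x) ?A (ue f)) \<circ>\<^sub>t x) \<circ>\<^sub>t h))"
    by (simp only:)
  have 2: "em ((fixt (tob \<sigma>) \<circ>\<^sub>t bng (curt (src x) ?A (ue f)) \<circ>\<^sub>t x) \<circ>\<^sub>t h)
     = em (fixt (tob \<sigma>) \<circ>\<^sub>t bng (curt (src x) ?A (ue f)) \<circ>\<^sub>t x) \<circ>\<^sub>s (em h \<otimes>\<^sub>s ids (obs []))"
    using a h S_mu.prems by (simp only: em_cmp ok_cmp const_simps curt_simps bok bsrc_tgt src_tgt ue_simps list.sel coalD list.map stens_unit arr_up)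
  show ?case by (rule 1[unfolded 2])
qed

lemma shift_upd: "shift \<phi> new (e(Fv v := Some E)) = (shift \<phi> new e)(Fv v := Some (\<phi> E))"
  by (rule ext) (auto simp: shift_def split: trm.splits nat.splits)

text \<open>Every occurrence of the variable already has the arrow of \<open>N\<close> as its value,
  so replacing it by \<open>N\<close> changes nothing. Linearity is not at issue here; it is
  expressed by multisets of tokens in \<open>adq\<close>.\<close>

lemma S_subst: "S x e' M \<tau> L f \<Longrightarrow> e' = e(Fv v := Some (\<sigma>, L', n)) \<Longrightarrow> S x e N \<sigma> L' n \<Longrightarrow> lc 0 N
    \<Longrightarrow> coal x \<Longrightarrow> wfe x e \<Longrightarrow> S x e (M[v::=N]) \<tau> L f"
proof (induction arbitrary: e L' n rule: S.induct)
  case (S_fv e' u \<sigma>' L f x)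
  then show ?case by (auto intro: S.S_fv split: if_splits)
next
  case (S_bv e' i \<sigma>' L f x)
  then show ?case by (auto intro!: S.S_bv split: if_splits)
next
  case (S_lam_ground x e' M \<tau> L f)
  let ?e = "shift (bmap (p1 x pt)) (Iota, [], em (p2 x pt)) e"
  \<comment> \<open>The value of \<open>N\<close> reaches the body by change of stage along the
    first projection. Since \<open>N\<close> has no dangling index, the shifted environment serves
    as well as the transported one.\<close>
  have "S (ct x pt) ?e N \<sigma> L' (n \<circ>\<^sub>s (em (p1 x pt) \<otimes>\<^sub>s ids (obs L')))"
    using S_base[OF S_lam_ground.prems(2,4) _ cmor_p1 S_lam_ground.prems(5)] S_lam_ground.prems
    by (intro S_cong[where k = 0 and e' = ?e and e = "map_option (bmap (p1 x pt)) \<circ> e"]) simp_all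
  moreover have "shift (bmap (p1 x pt)) (Iota, [], em (p2 x pt)) e' = ?e(Fv v := Some (\<sigma>, L', n \<circ>\<^sub>s (em (p1 x pt) \<otimes>\<^sub>s ids (obs L'))))"
    unfolding S_lam_ground.prems(1) shift_upd by simp
  ultimately show ?case unfolding subst.simps
    using S_lam_ground.prems wfe_binders(1)[OF S_lam_ground.prems(5,4)]
    by (intro S.S_lam_ground S_lam_ground.IH) simp_all
next
  case (S_lam_higher x \<sigma>' e' M \<tau> A B f \<sigma>1 \<sigma>2)
  let ?e = "shift (tmap Suc) (\<sigma>', [(0, tob \<sigma>')], sww x \<otimes>\<^sub>s ids [tob \<sigma>']) e"
  have "S x ?e N \<sigma> (map (apfst Suc) L') n"
    using S_ren[OF _ S_lam_higher.prems(2), of Suc] S_lam_higher.prems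
    by (intro S_cong[where k = 0 and e' = ?e and e = "map_option (tmap Suc) \<circ> e"]) simp_all
  moreover have "shift (tmap Suc) (\<sigma>', [(0, tob \<sigma>')], sww x \<otimes>\<^sub>s ids [tob \<sigma>']) e' = ?e(Fv v := Some (\<sigma>, map (apfst Suc) L', n))"
    unfolding S_lam_higher.prems(1) shift_upd by simp
  ultimately show ?case unfolding subst.simps
    using S_lam_higher.prems wfe_binders(2)[OF S_lam_higher.prems(5,4)]
    by (intro S.S_lam_higher[OF _ S_lam_higher.hyps(2)] S_lam_higher.IH) simp_all
next
  case (S_mu x \<sigma>' e' M f)
  let ?d = "digt (tob \<sigma>')"
  let ?e = "shift (bmap (p1 x ?d)) (\<sigma>', [], em (dert (tob \<sigma>') \<circ>\<^sub>t p2 x ?d)) e"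
  have "S (ct x ?d) ?e N \<sigma> L' (n \<circ>\<^sub>s (em (p1 x ?d) \<otimes>\<^sub>s ids (obs L')))"
    using S_base[OF S_mu.prems(2,4) _ cmor_p1 S_mu.prems(5)] S_mu.prems
    by (intro S_cong[where k = 0 and e' = ?e and e = "map_option (bmap (p1 x ?d)) \<circ> e"]) simp_all
  moreover have "shift (bmap (p1 x ?d)) (\<sigma>', [], em (dert (tob \<sigma>') \<circ>\<^sub>t p2 x ?d)) e' = ?e(Fv v := Some (\<sigma>, L', n \<circ>\<^sub>s (em (p1 x ?d) \<otimes>\<^sub>s ids (obs L'))))"
    unfolding S_mu.prems(1) shift_upd by simp
  ultimately show ?case unfolding subst.simps
    using S_mu.prems wfe_binders(3)[OF S_mu.prems(5,4)]
    by (intro S.S_mu S_mu.IH) simp_all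
qed (auto intro: S.intros)

section \<open>Interpretations evaluated in an environment\<close>

lemma mor_J: "mor (J as bs) = tjoin C as bs" "mor (J' as bs) = tsplit C as bs"
  by (simp_all add: J_def J'_def)

abbreviation "bob \<Gamma> \<equiv> ten (objs C \<Gamma>)"

definition "um \<Gamma> m \<sigma> = Tri (bob \<Gamma>) m (tob \<sigma>)"

lemma um_simps [simp]: "src (um \<Gamma> m \<sigma>) = bob \<Gamma>" "tgt (um \<Gamma> m \<sigma>) = tob \<sigma>" "mor (um \<Gamma> m \<sigma>) = m"
  by (simp_all add: um_def)

lemma um_zero: "um [] (zero_arr C) Iota = zerot" by (rule tri_eqI) (simp_all add: zerot_def)

lemma um_succ: "um [] (cur C \<one> N0 N0 (succ_arr C \<cdot> lunit C N0)) (Lolli Iota Iota) = curt \<one> N0 (succt \<circ>\<^sub>t lun N0)"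
  "um [] (cur C \<one> N0 N0 (pred_arr C \<cdot> lunit C N0)) (Lolli Iota Iota) = curt \<one> N0 (predt \<circ>\<^sub>t lun N0)"
  by (rule tri_eqI; simp add: succt_def predt_def curt_def mor_simps)+

lemma um_lif: "um (\<Gamma> @ \<Delta>) (lif_arr C \<cdot> (m \<boxtimes> pair C l r) \<cdot> tsplit C (objs C \<Gamma>) (objs C \<Delta>)) Iota
    = lift \<circ>\<^sub>t (um \<Gamma> m Iota \<otimes>\<^sub>t pairt (um \<Delta> l Iota) (um \<Delta> r Iota)) \<circ>\<^sub>t J' (objs C \<Gamma>) (objs C \<Delta>)"
  by (rule tri_eqI) (simp_all add: mor_simps mor_J lift_def pairt_def)

lemma um_app: "um (\<Gamma> @ \<Delta>) (ev C (tob \<sigma>) (tob \<tau>) \<cdot> (m \<boxtimes> n) \<cdot> tsplit C (objs C \<Gamma>) (objs C \<Delta>)) \<tau>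
    = evt (tob \<sigma>) (tob \<tau>) \<circ>\<^sub>t (um \<Gamma> m (Lolli \<sigma> \<tau>) \<otimes>\<^sub>t um \<Delta> n \<sigma>) \<circ>\<^sub>t J' (objs C \<Gamma>) (objs C \<Delta>)"
  by (rule tri_eqI) (simp_all add: mor_simps mor_J evt_def)

lemma um_exchange: "um (\<Gamma> @ [u, v] @ \<Delta>) (m \<cdot> tjoin C (objs C \<Gamma>) (objs C ([v, u] @ \<Delta>))
         \<cdot> (Id C (basis_obj C \<Gamma>) \<boxtimes>
              (assoc C (var_obj C v) (var_obj C u) (basis_obj C \<Delta>)
               \<cdot> (braid C (var_obj C u) (var_obj C v) \<boxtimes> Id C (basis_obj C \<Delta>))
               \<cdot> assoc' C (var_obj C u) (var_obj C v) (basis_obj C \<Delta>)))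
         \<cdot> tsplit C (objs C \<Gamma>) (objs C ([u, v] @ \<Delta>))) \<tau>
    = um (\<Gamma> @ [v, u] @ \<Delta>) m \<tau> \<circ>\<^sub>t J (objs C \<Gamma>) (objs C ([v, u] @ \<Delta>))
      \<circ>\<^sub>t (idt (bob \<Gamma>) \<otimes>\<^sub>t (asc (var_obj C v) (var_obj C u) (bob \<Delta>)
         \<circ>\<^sub>t (brd (var_obj C u) (var_obj C v) \<otimes>\<^sub>t idt (bob \<Delta>)) \<circ>\<^sub>t asc' (var_obj C u) (var_obj C v) (bob \<Delta>)))
      \<circ>\<^sub>t J' (objs C \<Gamma>) (objs C ([u, v] @ \<Delta>))"
  by (rule tri_eqI) (simp_all add: mor_simps mor_J basis_obj_def)

lemma um_weak: "um (\<Gamma> @ [v]) (m \<cdot> runit C (basis_obj C \<Gamma>) \<cdot> (Id C (basis_obj C \<Gamma>) \<boxtimes> w) \<cdot> tunsnoc C (objs C \<Gamma>) (var_obj C v)) \<tau>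
    = um \<Gamma> m \<tau> \<circ>\<^sub>t run (bob \<Gamma>) \<circ>\<^sub>t (idt (bob \<Gamma>) \<otimes>\<^sub>t Tri (var_obj C v) w \<one>)
      \<circ>\<^sub>t (idt (bob \<Gamma>) \<otimes>\<^sub>t run (var_obj C v)) \<circ>\<^sub>t J' (objs C \<Gamma>) [var_obj C v]"
  by (rule tri_eqI) (simp_all add: mor_simps mor_J basis_obj_def tunsnoc_def)

lemma um_contr: "um (\<Gamma> @ [v]) (m \<cdot> tjoin C (objs C \<Gamma>) [var_obj C v, var_obj C v]
     \<cdot> (Id C (basis_obj C \<Gamma>) \<boxtimes> ((Id C (var_obj C v) \<boxtimes> runit' C (var_obj C v)) \<cdot> c))
     \<cdot> tunsnoc C (objs C \<Gamma>) (var_obj C v)) \<tau>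
    = Tri (ten (objs C \<Gamma> @ [var_obj C v, var_obj C v])) m (tob \<tau>) \<circ>\<^sub>t J (objs C \<Gamma>) [var_obj C v, var_obj C v]
      \<circ>\<^sub>t (idt (bob \<Gamma>) \<otimes>\<^sub>t ((idt (var_obj C v) \<otimes>\<^sub>t run' (var_obj C v)) \<circ>\<^sub>t Tri (var_obj C v) c (var_obj C v \<otimes> var_obj C v)))
      \<circ>\<^sub>t (idt (bob \<Gamma>) \<otimes>\<^sub>t run (var_obj C v)) \<circ>\<^sub>t J' (objs C \<Gamma>) [var_obj C v]"
  by (rule tri_eqI) (simp_all add: mor_simps mor_J basis_obj_def tunsnoc_def)

lemma um_lam: "var_obj C x = tob \<sigma> \<Longrightarrow> um \<Gamma> (cur C (basis_obj C \<Gamma>) (tob \<sigma>) (tob \<tau>) (m \<cdot> tsnoc C (objs C \<Gamma>) (var_obj C x))) (Lolli \<sigma> \<tau>)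
    = curt (bob \<Gamma>) (tob \<sigma>) (um (\<Gamma> @ [x]) m \<tau> \<circ>\<^sub>t J (objs C \<Gamma>) [tob \<sigma>] \<circ>\<^sub>t (idt (bob \<Gamma>) \<otimes>\<^sub>t run' (tob \<sigma>)))"
  by (rule tri_eqI) (simp_all add: mor_simps mor_J basis_obj_def tsnoc_def curt_def)

lemma um_mu: assumes "ground \<Gamma>" "stable \<Delta>"
  shows "um (\<Gamma> @ \<Delta>) (fix_arr C (tob \<sigma>) \<cdot> bang_arr C (cur C (basis_obj C (\<Gamma> @ \<Delta>)) (bang C (tob \<sigma>)) (tob \<sigma>)
                        (m \<cdot> tsnoc C (objs C (\<Gamma> @ \<Delta>)) (bang C (tob \<sigma>)))) \<cdot> promote C \<Gamma> \<Delta>) \<sigma>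
    = fixt (tob \<sigma>) \<circ>\<^sub>t bng (curt (bob (\<Gamma> @ \<Delta>)) (bang C (tob \<sigma>))
        (um (\<Gamma> @ \<Delta> @ [Stb k \<sigma>]) m \<sigma> \<circ>\<^sub>t J (objs C (\<Gamma> @ \<Delta>)) [bang C (tob \<sigma>)] \<circ>\<^sub>t (idt (bob (\<Gamma> @ \<Delta>)) \<otimes>\<^sub>t run' (bang C (tob \<sigma>))))) \<circ>\<^sub>t pc (\<Gamma> @ \<Delta>)"
proof -
  have "\<forall>v\<in>set (\<Gamma> @ \<Delta>). nonlin v" using assms nonlin_ground by auto
  from pc_simps(2)[OF this] show ?thesis
    by (intro tri_eqI) (simp_all add: mor_simps mor_J basis_obj_def tsnoc_def curt_def fixt_def bmor promote_pc[OF assms])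
qed

lemma ok_cw [simp]: "ok (Tri N0 (w_N C) \<one>)" "ok (Tri N0 (c_N C) (N0 \<otimes> N0))"
  "ok (Tri (bang C A) (erase C A) \<one>)" "ok (Tri (bang C A) (dupl C A) (bang C A \<otimes> bang C A))"
  "w_N C \<in> Hom C N0 \<one>" "c_N C \<in> Hom C N0 (N0 \<otimes> N0)"
  "erase C A \<in> Hom C (bang C A) \<one>" "dupl C A \<in> Hom C (bang C A) (bang C A \<otimes> bang C A)"
  using N_comonoid bang_comonoid[of A] by (simp_all add: comm_comonoid_def)

lemma var_obj_lam: "\<not> stable [x] \<Longrightarrow> var_obj C x = tob (var_ty x)"
  by (cases x) (auto simp: stable_def)

text \<open>The operations on arrows are total, so membership of an interpretation in its hom-set
  has to be established before any law can be applied to it.\<close>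

lemma interp_ok: "interp C \<Gamma> M \<sigma> m \<Longrightarrow> ok (um \<Gamma> m \<sigma>)"
proof (induction rule: interp.induct)
  case (I_zero)
  show ?case unfolding um_zero by simp
next
  case I_succ
  show ?case unfolding um_succ by simp
next
  case I_pred
  show ?case unfolding um_succ by simp
next
  case (I_lif \<Gamma> M m \<Delta> L l R r)
  then show ?case unfolding um_lif by simp
next
  case (I_exchange \<Gamma> v u \<Delta> M \<tau> m)
  then show ?case unfolding um_exchange by simp
next
  case (I_ground k)
  show ?case by (simp add: um_def runit_hom)
next
  case (I_ground_weak \<Gamma> M \<tau> m k)
  then show ?case using um_weak[of \<Gamma> "Gnd k" m "w_N C" \<tau>] by simp
next
  case (I_ground_contr \<Gamma> k1 k2 M \<tau> m k)
  then show ?case using um_contr[of \<Gamma> "Gnd k" m "c_N C" \<tau>] by (simp add: um_def del: ok_Tri)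
next
  case (I_higher k \<sigma> \<tau>)
  show ?case by (simp add: um_def runit_hom)
next
  case (I_app \<Gamma> M \<sigma> \<tau> m \<Delta> N n)
  then show ?case unfolding um_app by simp
next
  case (I_lam \<Gamma> x M \<tau> m)
  then show ?case unfolding um_lam[OF var_obj_lam[OF I_lam(2)]] by (simp add: var_obj_lam)
next
  case (I_stable k \<sigma>)
  have "um [Stb k \<sigma>] (der C (tob \<sigma>) \<cdot> runit C (bang C (tob \<sigma>))) \<sigma> = dert (tob \<sigma>) \<circ>\<^sub>t run (bang C (tob \<sigma>))"
    by (rule tri_eqI) (simp_all add: mor_simps bmor)
  then show ?case by simp
next
  case (I_stable_weak \<Gamma> M \<tau> m k \<sigma>)
  then show ?case using um_weak[of \<Gamma> "Stb k \<sigma>" m "erase C (tob \<sigma>)" \<tau>] by simp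
next
  case (I_stable_contr \<Gamma> k1 \<sigma> k2 M \<tau> m k)
  then show ?case using um_contr[of \<Gamma> "Stb k \<sigma>" m "dupl C (tob \<sigma>)" \<tau>] by (simp add: um_def del: ok_Tri)
next
  case (I_mu \<Gamma> \<Delta> k \<sigma> M m)
  have "\<forall>v\<in>set (\<Gamma> @ \<Delta>). nonlin v" using I_mu nonlin_ground by auto
  from pc_simps[OF this] I_mu.IH show ?case unfolding um_mu[OF I_mu(2,3), where k = k] by simp
qed

abbreviation "\<Theta> \<Gamma> m \<sigma> \<equiv> up (objs C \<Gamma>) (um \<Gamma> m \<sigma>)"

lemma U_app: "\<lbrakk>ok m; ok n; src m = ten as; src n = ten bs; tgt m = (A \<leadsto> B); tgt n = A\<rbrakk>
    \<Longrightarrow> up (as @ bs) (evt A B \<circ>\<^sub>t (m \<otimes>\<^sub>t n) \<circ>\<^sub>t J' as bs) = evs A B \<circ>\<^sub>s (up as m \<otimes>\<^sub>s up bs n)"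
  by (rule sarr_eqI) (simp_all add: tr_simps tr_up evs_def tns_cmp_tail)

lemma U_lif: "\<lbrakk>ok m; ok n; src m = ten as; src n = ten bs; tgt m = N0; tgt n = cprod C N0 N0\<rbrakk>
    \<Longrightarrow> up (as @ bs) (lift \<circ>\<^sub>t (m \<otimes>\<^sub>t n) \<circ>\<^sub>t J' as bs) = lifs \<circ>\<^sub>s (up as m \<otimes>\<^sub>s up bs n)"
  by (rule sarr_eqI) (simp_all add: tr_simps tr_up lifs_def tns_cmp_tail)

text \<open>The swap of one-element lists braids \<open>A \<otimes> \<one>\<close> with
  \<open>B \<otimes> \<one>\<close>; the units are pushed outwards by naturality until the braiding
  of \<open>A\<close> with \<open>B\<close> from the exchange rule remains.\<close>

lemma U_exchange: assumes "ok m" "src m = ten (as @ [B, A] @ bs)"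
  shows "up (as @ [A, B] @ bs) (m \<circ>\<^sub>t J as ([B, A] @ bs)
      \<circ>\<^sub>t (idt (ten as) \<otimes>\<^sub>t (asc B A (ten bs) \<circ>\<^sub>t (brd A B \<otimes>\<^sub>t idt (ten bs)) \<circ>\<^sub>t asc' A B (ten bs))) \<circ>\<^sub>t J' as ([A, B] @ bs))
    = up (as @ [B, A] @ bs) m \<circ>\<^sub>s (ids as \<otimes>\<^sub>s sw [A] [B] \<otimes>\<^sub>s ids bs)"
proof -
  let ?b = "ten bs"
  have b: "brd (A \<otimes> \<one>) (B \<otimes> \<one>) = (run' B \<otimes>\<^sub>t run' A) \<circ>\<^sub>t brd A B \<circ>\<^sub>t (run A \<otimes>\<^sub>t run B)"
    by (simp add: brd_nat tns_cmp_tail)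
  have J2: "J [B, A] bs = (idt B \<otimes>\<^sub>t (run A \<otimes>\<^sub>t idt ?b)) \<circ>\<^sub>t asc B (A \<otimes> \<one>) ?b"
    "J' [A, B] bs = asc' A (B \<otimes> \<one>) ?b \<circ>\<^sub>t (idt A \<otimes>\<^sub>t (run' B \<otimes>\<^sub>t idt ?b))"
    by (simp_all add: J_rec(2)[of _ "[_]"] J_rec(4)[of _ "[_]"])
  have "tr (sw [A] [B] \<otimes>\<^sub>s ids bs) = J [B, A] bs \<circ>\<^sub>t (((idt B \<otimes>\<^sub>t run' A) \<circ>\<^sub>t brd A B \<circ>\<^sub>t (idt A \<otimes>\<^sub>t run B)) \<otimes>\<^sub>t idt ?b) \<circ>\<^sub>t J' [A, B] bs"
    by (simp add: tr_simps b tns_cmp_tail tns_cmp)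
  also have "\<dots> = (idt B \<otimes>\<^sub>t (run A \<otimes>\<^sub>t idt ?b)) \<circ>\<^sub>t (asc B (A \<otimes> \<one>) ?b \<circ>\<^sub>t ((idt B \<otimes>\<^sub>t run' A) \<otimes>\<^sub>t idt ?b)) \<circ>\<^sub>t (brd A B \<otimes>\<^sub>t idt ?b)
      \<circ>\<^sub>t ((idt A \<otimes>\<^sub>t run B) \<otimes>\<^sub>t idt ?b) \<circ>\<^sub>t asc' A (B \<otimes> \<one>) ?b \<circ>\<^sub>t (idt A \<otimes>\<^sub>t (run' B \<otimes>\<^sub>t idt ?b))"
    unfolding J2 by (simp add: tns_cmp_tail tns_cmp)
  also have "\<dots> = (idt B \<otimes>\<^sub>t (run A \<otimes>\<^sub>t idt ?b)) \<circ>\<^sub>t (idt B \<otimes>\<^sub>t (run' A \<otimes>\<^sub>t idt ?b)) \<circ>\<^sub>t asc B A ?b \<circ>\<^sub>t (brd A B \<otimes>\<^sub>t idt ?b)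
      \<circ>\<^sub>t ((idt A \<otimes>\<^sub>t run B) \<otimes>\<^sub>t idt ?b) \<circ>\<^sub>t ((idt A \<otimes>\<^sub>t run' B) \<otimes>\<^sub>t idt ?b) \<circ>\<^sub>t asc' A B ?b"
    by (simp add: asc_nat asc'_nat del: tns_id)
  also have "\<dots> = asc B A ?b \<circ>\<^sub>t (brd A B \<otimes>\<^sub>t idt ?b) \<circ>\<^sub>t asc' A B ?b"
    by (simp add: tns_cmp_tail tns_cmp)
  finally have s: "tr (sw [A] [B] \<otimes>\<^sub>s ids bs) = asc B A ?b \<circ>\<^sub>t (brd A B \<otimes>\<^sub>t idt ?b) \<circ>\<^sub>t asc' A B ?b" .
  show ?thesis using assms by (intro sarr_eqI) (simp_all add: tr_simps(1) tr_simps(2)[of "ids as"] s tr_simps(3) tr_up)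
qed

lemma U_weak: "\<lbrakk>ok m; src m = ten as; ok w; src w = A; tgt w = \<one>\<rbrakk>
    \<Longrightarrow> up (as @ [A]) (m \<circ>\<^sub>t run (ten as) \<circ>\<^sub>t (idt (ten as) \<otimes>\<^sub>t w) \<circ>\<^sub>t (idt (ten as) \<otimes>\<^sub>t run A) \<circ>\<^sub>t J' as [A])
      = up as m \<circ>\<^sub>s (ids as \<otimes>\<^sub>s (unu \<circ>\<^sub>s em w))"
  by (rule sarr_eqI) (simp_all add: tr_simps tr_up tr_em tr_unu J_nil tns_cmp_tail)

lemma U_contr: "\<lbrakk>ok m; src m = ten (as @ [A, A]); ok c; src c = A; tgt c = A \<otimes> A\<rbrakk>
    \<Longrightarrow> up (as @ [A]) (m \<circ>\<^sub>t J as [A, A] \<circ>\<^sub>t (idt (ten as) \<otimes>\<^sub>t ((idt A \<otimes>\<^sub>t run' A) \<circ>\<^sub>t c)) \<circ>\<^sub>t (idt (ten as) \<otimes>\<^sub>t run A) \<circ>\<^sub>t J' as [A])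
      = up (as @ [A, A]) m \<circ>\<^sub>s (ids as \<otimes>\<^sub>s (upk A A \<circ>\<^sub>s em c))"
  by (rule sarr_eqI) (simp_all add: tr_simps tr_up tr_em tr_upk tns_cmp_tail)

lemma U_lam: "\<lbrakk>ok m; src m = ten (as @ [A])\<rbrakk>
    \<Longrightarrow> up as (curt (ten as) A (m \<circ>\<^sub>t J as [A] \<circ>\<^sub>t (idt (ten as) \<otimes>\<^sub>t run' A))) = scur as A (up (as @ [A]) m)"
  by (simp add: scur_def)

text \<open>The generalised element of the interpretation of a basis that an environment determines.\<close>

definition "tk e v = fst (snd (the (e (Fv v))))"
text \<open>A stable variable occurs in a term through dereliction, so its entry holds an arrow into
  \<sigma>. Promotion along the stage turns it into the value in \<open>!\<sigma>\<close> that the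
  basis asks for.\<close>

definition "av x e v = (let t = snd (snd (the (e (Fv v)))) in case v of Stb k \<sigma> \<Rightarrow> em (bng (ue t) \<circ>\<^sub>t x) | _ \<Rightarrow> t)"

primrec asm where
  "asm x e [] = sww x"
| "asm x e (v # \<Gamma>) = tens2 x (av x e v) (asm x e \<Gamma>)"

abbreviation "tok e \<Gamma> \<equiv> concat (map (tk e) \<Gamma>)"

text \<open>A ground value must be a coalgebra morphism to be duplicated by \<open>c_N\<close>. A
  stable entry may be arbitrary, since \<open>av\<close> promotes it. Neither may consume tokens,
  which cannot be copied.\<close>

definition "good x e v \<longleftrightarrow> (\<exists>L t. e (Fv v) = Some (var_ty v, L, t) \<and> (nonlin v \<longrightarrow> L = []) \<and> (\<forall>k. v = Gnd k \<longrightarrow> cmor x pt (ue t)))"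
definition "cenv x e \<Gamma> \<longleftrightarrow> (\<forall>v\<in>set \<Gamma>. good x e v)"

lemma cenv_simps [simp]: "cenv x e []" "cenv x e (v # \<Gamma>) \<longleftrightarrow> good x e v \<and> cenv x e \<Gamma>"
  "cenv x e (\<Gamma> @ \<Delta>) \<longleftrightarrow> cenv x e \<Gamma> \<and> cenv x e \<Delta>"
  by (auto simp: cenv_def)

lemma av_simps [simp]:
  assumes "wfe x e" "coal x" "good x e v"
  shows "arr (av x e v)" "dm (av x e v) = src x # obs (tk e v)" "cd (av x e v) = [var_obj C v]"
proof -
  obtain L t where e: "e (Fv v) = Some (var_ty v, L, t)" "nonlin v \<longrightarrow> L = []" using assms(3) by (auto simp: good_def)
  note w = wfeD[OF assms(1) e(1)]
  have "arr (av x e v) \<and> dm (av x e v) = src x # obs (tk e v) \<and> cd (av x e v) = [var_obj C v]"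
    using e w assms(2) by (cases v) (auto simp: av_def tk_def nonlin_def)
  then show "arr (av x e v)" "dm (av x e v) = src x # obs (tk e v)" "cd (av x e v) = [var_obj C v]" by auto
qed

lemma asm_simps [simp]:
  assumes "wfe x e" "coal x" "cenv x e \<Gamma>"
  shows "arr (asm x e \<Gamma>)" "dm (asm x e \<Gamma>) = src x # obs (tok e \<Gamma>)" "cd (asm x e \<Gamma>) = objs C \<Gamma>"
  using assms by (induction \<Gamma>) auto

lemma asm_append: assumes "wfe x e" "coal x" "cenv x e \<Gamma>" "cenv x e \<Delta>"
  shows "asm x e (\<Gamma> @ \<Delta>) = tens2 x (asm x e \<Gamma>) (asm x e \<Delta>)"
  using assms
proof (induction \<Gamma>)
  case Nil
  then show ?case using tens2_unit_left[of x "asm x e \<Delta>"] by simp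
next
  case (Cons v \<Gamma>)
  then show ?case using tens2_assoc[of x "av x e v" "asm x e \<Gamma>" "asm x e \<Delta>"] by simp
qed

lemma asm_single: assumes "wfe x e" "coal x" "good x e v"
  shows "asm x e [v] = av x e v"
  using assms tens2_unit_right[of x "av x e v"] by simp

lemma asm_cong: "(\<And>v. v \<in> set \<Gamma> \<Longrightarrow> e' (Fv v) = e (Fv v)) \<Longrightarrow> asm x e' \<Gamma> = asm x e \<Gamma>"
  "(\<And>v. v \<in> set \<Gamma> \<Longrightarrow> e' (Fv v) = e (Fv v)) \<Longrightarrow> tok e' \<Gamma> = tok e \<Gamma>"
  "(\<And>v. v \<in> set \<Gamma> \<Longrightarrow> e' (Fv v) = e (Fv v)) \<Longrightarrow> cenv x e' \<Gamma> = cenv x e \<Gamma>"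
  by (induction \<Gamma>) (auto simp: av_def tk_def good_def)

lemma asm_ren: assumes "\<And>v. v \<in> set \<Gamma> \<Longrightarrow> e' (Fv v) = map_option (tmap g) (e (Fv v))" "cenv x e \<Gamma>"
  shows "asm x e' \<Gamma> = asm x e \<Gamma>" "tok e' \<Gamma> = map (apfst g) (tok e \<Gamma>)" "cenv x e' \<Gamma>"
  using assms by (induction \<Gamma>) (auto simp: av_def tk_def good_def)

lemma asm_base: assumes "\<And>v. v \<in> set \<Gamma> \<Longrightarrow> e' (Fv v) = map_option (bmap h) (e (Fv v))"
    "cenv x e \<Gamma>" "coal x" "coal y" "cmor y x h" "wfe x e"
  shows "tok e' \<Gamma> = tok e \<Gamma> \<and> cenv y e' \<Gamma> \<and> asm y e' \<Gamma> = asm x e \<Gamma> \<circ>\<^sub>s (em h \<otimes>\<^sub>s ids (obs (tok e \<Gamma>)))"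
  using assms(1,2)
proof (induction \<Gamma>)
  case Nil
  then show ?case using assms cmorD[OF assms(5)] by (simp add: scc_cmor)
next
  case (Cons v \<Gamma>)
  note h = cmorD[OF assms(5)]
  obtain L t where e: "e (Fv v) = Some (var_ty v, L, t)" "nonlin v \<longrightarrow> L = []" "\<forall>k. v = Gnd k \<longrightarrow> cmor x pt (ue t)"
    using Cons.prems by (auto simp: good_def)
  have e': "e' (Fv v) = Some (var_ty v, L, t \<circ>\<^sub>s (em h \<otimes>\<^sub>s ids (obs L)))" using Cons.prems(1)[of v] e by simp
  note w = wfeD[OF assms(6) e(1)]
  have u: "L = [] \<Longrightarrow> ue (t \<circ>\<^sub>s em h) = ue t \<circ>\<^sub>t h" using w h by (simp add: ue_comp)
  have g: "good y e' v"
  proof -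
    have "cmor y pt (ue t \<circ>\<^sub>t h)" if "v = Gnd k" for k
      using cmor_cmp[OF assms(5)] e(3) that assms by simp
    then show ?thesis using e' e u h by (auto simp: good_def nonlin_def)
  qed
  have a: "av y e' v = av x e v \<circ>\<^sub>s (em h \<otimes>\<^sub>s ids (obs (tk e v)))"
  proof (cases v)
    case (Stb k \<sigma>)
    then have L: "L = []" using e(2) by (simp add: nonlin_def)
    have "bng (ue t \<circ>\<^sub>t h) \<circ>\<^sub>t y = (bng (ue t) \<circ>\<^sub>t x) \<circ>\<^sub>t h" using w L h assms by (simp add: bng_cmp)
    then show ?thesis using Stb L e e' u w h assms by (simp add: av_def tk_def flip: em_cmp)
  qed (use e e' in \<open>simp_all add: av_def tk_def\<close>)
  have t: "tk e' v = tk e v" using e e' by (simp add: tk_def)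
  show ?case using Cons g a t assms
      tens2_base[OF assms(3,4,5), of "av x e v" "asm x e \<Gamma>" "obs (tk e v)" "obs (tok e \<Gamma>)"] by simp
qed

text \<open>On a basis without linear variables the environment is a tuple of coalgebra morphisms
  and hence one itself. This lets promotion be moved from the basis to the stage.\<close>

lemma asm_cmor: assumes "wfe x e" "coal x" "cenv x e \<Gamma>" "\<forall>v\<in>set \<Gamma>. nonlin v"
  shows "tok e \<Gamma> = [] \<and> cmor x (pc \<Gamma>) (tr (asm x e \<Gamma>) \<circ>\<^sub>t run' (src x))"
  using assms(3,4)
proof (induction \<Gamma>)
  case Nil
  then show ?case using cmor_ww[OF assms(2)] assms(2) by (simp add: sww_def tr_simps tr_unu tr_em)
next
  case (Cons v \<Gamma>)
  obtain t where e: "e (Fv v) = Some (var_ty v, [], t)" "\<forall>k. v = Gnd k \<longrightarrow> cmor x pt (ue t)"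
    using Cons.prems by (auto simp: good_def)
  note w = wfeD[OF assms(1) e(1)]
  have t: "tk e v = []" using e by (simp add: tk_def)
  have c: "cmor x (vc v) (ue (av x e v))"
  proof (cases v)
    case (Gnd k)
    then show ?thesis using e by (simp add: av_def vc_def)
  next
    case (Stb k \<sigma>)
    then show ?thesis using e w assms cmor_bng[of x "ue t"] by (simp add: av_def vc_def)
  qed (use Cons.prems in \<open>simp add: nonlin_def\<close>)
  let ?a = "tr (asm x e \<Gamma>) \<circ>\<^sub>t run' (src x)"
  have IH: "tok e \<Gamma> = []" "cmor x (pc \<Gamma>) ?a" using Cons by auto
  have v: "arr (av x e v)" "dm (av x e v) = [src x]" "cd (av x e v) = [var_obj C v]"
    using Cons.prems assms t by simp_all
  have asms: "arr (asm x e \<Gamma>)" "dm (asm x e \<Gamma>) = [src x]" "cd (asm x e \<Gamma>) = objs C \<Gamma>"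
    using asm_simps[OF assms(1,2), of \<Gamma>, unfolded IH(1)] Cons.prems by simp_all
  have "tr (asm x e (v # \<Gamma>)) \<circ>\<^sub>t run' (src x) = (ue (av x e v) \<otimes>\<^sub>t ?a) \<circ>\<^sub>t cc x"
    using v asms(1-3) assms(2)
    by (simp add: tens2_def t scc_def tr_simps tr_upk tr_em tns_cmp_tail) (simp add: ue_def dn_def)
  moreover have "cmor x (ct (vc v) (pc \<Gamma>)) ((ue (av x e v) \<otimes>\<^sub>t ?a) \<circ>\<^sub>t cc x)"
    using cmor_cmp[OF cmor_cc[OF assms(2)] cmor_tns[OF assms(2) _ assms(2) _ c IH(2)]] Cons.prems assms by simp
  ultimately show ?case using t IH(1) by simp
qed

section \<open>Agreement with the typing rules\<close>

lemma av_em: assumes "wfe x e" "coal x" "good x e v" "nonlin v"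
  shows "tk e v = []" "em (ue (av x e v)) = av x e v" "cmor x (vc v) (ue (av x e v))"
proof -
  have c: "cenv x e [v]" "\<forall>v\<in>set [v]. nonlin v" using assms by auto
  obtain t where e: "e (Fv v) = Some (var_ty v, [], t)" "\<forall>k. v = Gnd k \<longrightarrow> cmor x pt (ue t)"
    using assms by (auto simp: good_def)
  note w = wfeD[OF assms(1) e(1)]
  show t: "tk e v = []" using e by (simp add: tk_def)
  show "em (ue (av x e v)) = av x e v" using av_simps[OF assms(1-3)] t by simp
  show "cmor x (vc v) (ue (av x e v))"
    using e w assms cmor_bng[of x "ue t"] by (cases v) (auto simp: av_def vc_def nonlin_def)
qed

text \<open>Values of duplicable variables are coalgebra morphisms and so commute with discarding,
  and in \<open>scc_av\<close> with duplication. Weakening and contraction thereby become invisible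
  at the stage.\<close>

lemma sww_av: "\<lbrakk>wfe x e; coal x; good x e v; nonlin v\<rbrakk> \<Longrightarrow> sww (vc v) \<circ>\<^sub>s av x e v = sww x"
  using scc_cmor(2)[of x "vc v" "ue (av x e v)"] av_em[of x e v] by simp

lemma scc_av: assumes "wfe x e" "coal x" "good x e v" "nonlin v"
  shows "scc (vc v) \<circ>\<^sub>s av x e v = tens2 x (av x e v) (av x e v)"
proof -
  have "arr (av x e v)" "dm (av x e v) = [src x]" using av_simps[OF assms(1-3)] av_em[OF assms] by auto
  then show ?thesis using scc_cmor(1)[of x "vc v" "ue (av x e v)"] av_em[OF assms] assms by (simp add: tens2_def)
qed

text \<open>The invariant for induction on derivations. The two values may differ only by the
  permutation from the order of tokens in the basis to their order of use. Equal multisets of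
  distinct tokens mean that every resource is used exactly once.\<close>

definition "adq x e \<Gamma> M \<sigma> m \<longleftrightarrow> (\<exists>L f. S x e M \<sigma> L f \<and> mset (tok e \<Gamma>) = mset L \<and>
    \<Theta> \<Gamma> m \<sigma> \<circ>\<^sub>s asm x e \<Gamma> = f \<circ>\<^sub>s (ids [src x] \<otimes>\<^sub>s pm (tok e \<Gamma>) L))"

lemma adqI: "\<lbrakk>S x e M \<sigma> L f; mset (tok e \<Gamma>) = mset L;
    \<Theta> \<Gamma> m \<sigma> \<circ>\<^sub>s asm x e \<Gamma> = f \<circ>\<^sub>s (ids [src x] \<otimes>\<^sub>s pm (tok e \<Gamma>) L)\<rbrakk> \<Longrightarrow> adq x e \<Gamma> M \<sigma> m"
  unfolding adq_def by blast

text \<open>Swapping two variables of the basis becomes a swap of the tokens of their values by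
  \<open>tens2_comm\<close>, and the canonical permutation absorbs it. The semantics of the term
  stays the same.\<close>

lemma adq_exchange:
  assumes x: "coal x" "wfe x e" "cenv x e (\<Gamma> @ [u, v] @ \<Delta>)" "distinct (tok e (\<Gamma> @ [u, v] @ \<Delta>))"
    and ok: "ok (um (\<Gamma> @ [v, u] @ \<Delta>) m \<tau>)"
    and IH: "adq x e (\<Gamma> @ [v, u] @ \<Delta>) M \<tau> m"
    and m': "\<Theta> (\<Gamma> @ [u, v] @ \<Delta>) m' \<tau> = \<Theta> (\<Gamma> @ [v, u] @ \<Delta>) m \<tau> \<circ>\<^sub>s (ids (objs C \<Gamma>) \<otimes>\<^sub>s sw [var_obj C u] [var_obj C v] \<otimes>\<^sub>s ids (objs C \<Delta>))"
  shows "adq x e (\<Gamma> @ [u, v] @ \<Delta>) M \<tau> m'"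
proof -
  let ?a = "asm x e \<Gamma>" and ?d = "asm x e \<Delta>" and ?u = "av x e u" and ?v = "av x e v"
  let ?tu = "tk e u" and ?tv = "tk e v" and ?tg = "tok e \<Gamma>" and ?td = "tok e \<Delta>"
  let ?P = "ids (obs ?tg) \<otimes>\<^sub>s sw (obs ?tu) (obs ?tv) \<otimes>\<^sub>s ids (obs ?td)"
  obtain L f where S: "S x e M \<tau> L f" "mset (tok e (\<Gamma> @ [v, u] @ \<Delta>)) = mset L"
    "\<Theta> (\<Gamma> @ [v, u] @ \<Delta>) m \<tau> \<circ>\<^sub>s asm x e (\<Gamma> @ [v, u] @ \<Delta>) = f \<circ>\<^sub>s (ids [src x] \<otimes>\<^sub>s pm (tok e (\<Gamma> @ [v, u] @ \<Delta>)) L)"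
    using IH by (auto simp: adq_def)
  note f = S_arr[OF S(1) x(2,1)]
  have c: "cenv x e \<Gamma>" "good x e u" "good x e v" "cenv x e \<Delta>" using x(3) by auto
  note A = asm_simps[OF x(2,1) c(1)] asm_simps[OF x(2,1) c(4)] av_simps[OF x(2,1) c(2)] av_simps[OF x(2,1) c(3)]
  have s1: "asm x e (\<Gamma> @ [u, v] @ \<Delta>) = tens2 x ?a (tens2 x (tens2 x ?u ?v) ?d)"
    using x c A asm_append[OF x(2,1), of \<Gamma> "u # v # \<Delta>"] tens2_assoc[of x ?u ?v ?d] by simp
  have s2: "asm x e (\<Gamma> @ [v, u] @ \<Delta>) = tens2 x ?a (tens2 x (tens2 x ?v ?u) ?d)"
    using x c A asm_append[OF x(2,1), of \<Gamma> "v # u # \<Delta>"] tens2_assoc[of x ?v ?u ?d] by simp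
  have s3: "sw [var_obj C u] [var_obj C v] \<circ>\<^sub>s tens2 x ?u ?v = tens2 x ?v ?u \<circ>\<^sub>s (ids [src x] \<otimes>\<^sub>s sw (obs ?tu) (obs ?tv))"
    using x A by (intro tens2_comm) simp_all
  have "(ids (objs C \<Gamma>) \<otimes>\<^sub>s sw [var_obj C u] [var_obj C v] \<otimes>\<^sub>s ids (objs C \<Delta>)) \<circ>\<^sub>s asm x e (\<Gamma> @ [u, v] @ \<Delta>)
    = tens2 x ?a (tens2 x (sw [var_obj C u] [var_obj C v] \<circ>\<^sub>s tens2 x ?u ?v) ?d)"
    unfolding s1 using x A
      tens2_comp[of x ?a "tens2 x (tens2 x ?u ?v) ?d" "obs ?tg" "obs (?tu @ ?tv @ ?td)" "ids (objs C \<Gamma>)" "sw [var_obj C u] [var_obj C v] \<otimes>\<^sub>s ids (objs C \<Delta>)"]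
      tens2_comp[of x "tens2 x ?u ?v" ?d "obs (?tu @ ?tv)" "obs ?td" "sw [var_obj C u] [var_obj C v]" "ids (objs C \<Delta>)"]
    by simp
  also have "\<dots> = asm x e (\<Gamma> @ [v, u] @ \<Delta>) \<circ>\<^sub>s (ids [src x] \<otimes>\<^sub>s ?P)"
    unfolding s2 s3 using x A
      tens2_pre[of x ?a "tens2 x (tens2 x ?v ?u) ?d" "obs ?tg" "obs (?tv @ ?tu @ ?td)" "ids (obs ?tg)" "sw (obs ?tu) (obs ?tv) \<otimes>\<^sub>s ids (obs ?td)"]
      tens2_pre[of x "tens2 x ?v ?u" ?d "obs (?tv @ ?tu)" "obs ?td" "sw (obs ?tu) (obs ?tv)" "ids (obs ?td)"]
    by simp
  finally have e1: "(ids (objs C \<Gamma>) \<otimes>\<^sub>s sw [var_obj C u] [var_obj C v] \<otimes>\<^sub>s ids (objs C \<Delta>)) \<circ>\<^sub>s asm x e (\<Gamma> @ [u, v] @ \<Delta>)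
     = asm x e (\<Gamma> @ [v, u] @ \<Delta>) \<circ>\<^sub>s (ids [src x] \<otimes>\<^sub>s ?P)" .
  have "prm (?tg @ (?tu @ ?tv) @ ?td) (?tg @ (?tv @ ?tu) @ ?td) ?P"
    by (intro prm_tens prm_sw prm_id') simp_all
  then have P: "?P = pm (tok e (\<Gamma> @ [u, v] @ \<Delta>)) (tok e (\<Gamma> @ [v, u] @ \<Delta>))"
    using x(4) by (intro prm_eq_pm[symmetric]) simp_all
  have pp: "pm (tok e (\<Gamma> @ [v, u] @ \<Delta>)) L \<circ>\<^sub>s ?P = pm (tok e (\<Gamma> @ [u, v] @ \<Delta>)) L"
    unfolding P using S(2) x(4) by (intro pm_comp) (simp_all add: ac_simps)
  have "\<Theta> (\<Gamma> @ [u, v] @ \<Delta>) m' \<tau> \<circ>\<^sub>s asm x e (\<Gamma> @ [u, v] @ \<Delta>)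
    = \<Theta> (\<Gamma> @ [v, u] @ \<Delta>) m \<tau> \<circ>\<^sub>s (ids (objs C \<Gamma>) \<otimes>\<^sub>s sw [var_obj C u] [var_obj C v] \<otimes>\<^sub>s ids (objs C \<Delta>)) \<circ>\<^sub>s asm x e (\<Gamma> @ [u, v] @ \<Delta>)"
    unfolding m' using ok x asm_simps[OF x(2,1,3)] by (intro scomp_assoc) simp_all
  also have "\<dots> = (\<Theta> (\<Gamma> @ [v, u] @ \<Delta>) m \<tau> \<circ>\<^sub>s asm x e (\<Gamma> @ [v, u] @ \<Delta>)) \<circ>\<^sub>s (ids [src x] \<otimes>\<^sub>s ?P)"
    unfolding e1 using ok x c asm_simps[OF x(2,1), of "\<Gamma> @ [v, u] @ \<Delta>"] by (intro scomp_assoc[symmetric]) simp_all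
  also have "\<dots> = f \<circ>\<^sub>s (ids [src x] \<otimes>\<^sub>s pm (tok e (\<Gamma> @ [v, u] @ \<Delta>)) L) \<circ>\<^sub>s (ids [src x] \<otimes>\<^sub>s ?P)"
    unfolding S(3) using f pm_arr[OF S(2)] by (intro scomp_assoc) simp_all
  also have "(ids [src x] \<otimes>\<^sub>s pm (tok e (\<Gamma> @ [v, u] @ \<Delta>)) L) \<circ>\<^sub>s (ids [src x] \<otimes>\<^sub>s ?P)
     = ids [src x] \<otimes>\<^sub>s (pm (tok e (\<Gamma> @ [v, u] @ \<Delta>)) L \<circ>\<^sub>s ?P)"
    using pm_arr[OF S(2)] by (subst stens_comp) simp_all
  finally have "\<Theta> (\<Gamma> @ [u, v] @ \<Delta>) m' \<tau> \<circ>\<^sub>s asm x e (\<Gamma> @ [u, v] @ \<Delta>)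
    = f \<circ>\<^sub>s (ids [src x] \<otimes>\<^sub>s pm (tok e (\<Gamma> @ [u, v] @ \<Delta>)) L)" unfolding pp .
  moreover have "mset (tok e (\<Gamma> @ [u, v] @ \<Delta>)) = mset L" using S(2) by (simp add: ac_simps)
  ultimately show ?thesis using S(1) by (intro adqI)
qed

text \<open>The new value consumes no token and is discarded together with its copy of the
  stage.\<close>

lemma adq_weak:
  assumes x: "coal x" "wfe x e" "cenv x e (\<Gamma> @ [v])" and v: "nonlin v"
    and ok: "ok (um \<Gamma> m \<tau>)" and IH: "adq x e \<Gamma> M \<tau> m"
    and m': "\<Theta> (\<Gamma> @ [v]) m' \<tau> = \<Theta> \<Gamma> m \<tau> \<circ>\<^sub>s (ids (objs C \<Gamma>) \<otimes>\<^sub>s sww (vc v))"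
  shows "adq x e (\<Gamma> @ [v]) M \<tau> m'"
proof -
  have c: "cenv x e \<Gamma>" "good x e v" using x by auto
  note A = asm_simps[OF x(2,1) c(1)] av_simps[OF x(2,1) c(2)]
  have t: "tok e (\<Gamma> @ [v]) = tok e \<Gamma>" using av_em[OF x(2,1) c(2) v] by simp
  have "(ids (objs C \<Gamma>) \<otimes>\<^sub>s sww (vc v)) \<circ>\<^sub>s asm x e (\<Gamma> @ [v]) = tens2 x (asm x e \<Gamma>) (sww (vc v) \<circ>\<^sub>s av x e v)"
    using x c v A tens2_comp[of x "asm x e \<Gamma>" "av x e v" "obs (tok e \<Gamma>)" "obs (tk e v)" "ids (objs C \<Gamma>)" "sww (vc v)"]
    by (simp add: asm_append asm_single del: asm.simps(2))
  also have "\<dots> = asm x e \<Gamma>"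
    using x c v A by (simp add: sww_av tens2_unit_right)
  finally have "\<Theta> (\<Gamma> @ [v]) m' \<tau> \<circ>\<^sub>s asm x e (\<Gamma> @ [v]) = \<Theta> \<Gamma> m \<tau> \<circ>\<^sub>s asm x e \<Gamma>"
    unfolding m' using ok x v asm_simps[OF x(2,1,3)] by simp
  with IH show ?thesis unfolding adq_def t by simp
qed

text \<open>Giving both merged variables the value of \<open>v\<close> yields the value of the
  premise; duplicating the value of \<open>v\<close> in the basis has the same effect.\<close>

lemma adq_contr:
  assumes x: "coal x" "wfe x e" "cenv x e (\<Gamma> @ [v])" "distinct (tok e (\<Gamma> @ [v]))"
    and v: "nonlin v" "vc v1 = vc v" "vc v2 = vc v" "nonlin v1" "nonlin v2" "var_ty v1 = var_ty v" "var_ty v2 = var_ty v"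
      "(\<exists>k. v = Gnd k) \<longleftrightarrow> (\<exists>k. v1 = Gnd k)" "(\<exists>k. v = Gnd k) \<longleftrightarrow> (\<exists>k. v2 = Gnd k)"
    and d: "distinct (\<Gamma> @ [v1, v2])"
    and ok: "ok (um (\<Gamma> @ [v1, v2]) m \<tau>)"
    and IH: "\<And>e. wfe x e \<Longrightarrow> cenv x e (\<Gamma> @ [v1, v2]) \<Longrightarrow> distinct (tok e (\<Gamma> @ [v1, v2])) \<Longrightarrow> adq x e (\<Gamma> @ [v1, v2]) M \<tau> m"
    and m': "\<Theta> (\<Gamma> @ [v]) m' \<tau> = \<Theta> (\<Gamma> @ [v1, v2]) m \<tau> \<circ>\<^sub>s (ids (objs C \<Gamma>) \<otimes>\<^sub>s scc (vc v))"
  shows "adq x e (\<Gamma> @ [v]) (M[v1 ::= Fv v][v2 ::= Fv v]) \<tau> m'"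
proof -
  have c: "cenv x e \<Gamma>" "good x e v" using x by auto
  note A = asm_simps[OF x(2,1) c(1)] av_simps[OF x(2,1) c(2)]
  obtain t where t: "e (Fv v) = Some (var_ty v, [], t)" "\<forall>k. v = Gnd k \<longrightarrow> cmor x pt (ue t)"
    using c v by (auto simp: good_def)
  \<comment> \<open>The renaming of \<open>v1\<close> is carried out first and therefore removes the
    outer update. The entry of \<open>v\<close> is the same in all three environments, also when
    \<open>v\<close> is one of the merged variables.\<close>
  let ?e2 = "e(Fv v2 := e (Fv v))"
  let ?e1 = "?e2(Fv v1 := e (Fv v))"
  have w2: "wfe x ?e2" "wfe x ?e1" using x(2) by (auto simp: wfe_def split: if_splits)
  have g: "good x ?e1 v1" "good x ?e1 v2"
    using c t v d by (auto simp: good_def)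
  have ag: "u \<in> set \<Gamma> \<Longrightarrow> ?e1 (Fv u) = e (Fv u)" for u using d by auto
  note cg = asm_cong[of \<Gamma> ?e1 e, OF ag]
  have avs: "av x ?e1 v1 = av x e v" "av x ?e1 v2 = av x e v"
  proof -
    have "vc v1 = vc v" "vc v2 = vc v" using v by auto
    then have "(case v1 of Stb k \<sigma> \<Rightarrow> em (bng (ue t) \<circ>\<^sub>t x) | _ \<Rightarrow> t) = (case v of Stb k \<sigma> \<Rightarrow> em (bng (ue t) \<circ>\<^sub>t x) | _ \<Rightarrow> t)"
     "(case v2 of Stb k \<sigma> \<Rightarrow> em (bng (ue t) \<circ>\<^sub>t x) | _ \<Rightarrow> t) = (case v of Stb k \<sigma> \<Rightarrow> em (bng (ue t) \<circ>\<^sub>t x) | _ \<Rightarrow> t)"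
      using v by (auto simp: nonlin_def split: var.splits)
    then show "av x ?e1 v1 = av x e v" "av x ?e1 v2 = av x e v" using t d by (simp_all add: av_def)
  qed
  have tk0: "tk ?e1 v1 = []" "tk ?e1 v2 = []" "tk e v = []" using t d by (simp_all add: tk_def)
  have ce: "cenv x ?e1 (\<Gamma> @ [v1, v2])" using cg(3) c g by simp
  have tt: "tok ?e1 (\<Gamma> @ [v1, v2]) = tok e (\<Gamma> @ [v])" using cg(2) tk0 by simp
  obtain L f where S: "S x ?e1 M \<tau> L f" "mset (tok e (\<Gamma> @ [v])) = mset L"
    "\<Theta> (\<Gamma> @ [v1, v2]) m \<tau> \<circ>\<^sub>s asm x ?e1 (\<Gamma> @ [v1, v2]) = f \<circ>\<^sub>s (ids [src x] \<otimes>\<^sub>s pm (tok e (\<Gamma> @ [v])) L)"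
    using IH[OF w2(2) ce] x(4) unfolding adq_def tt by blast
  have "S x ?e2 (M[v1 ::= Fv v]) \<tau> L f"
    by (rule S_subst[OF S(1), where \<sigma> = "var_ty v" and L' = "[]" and n = t]) (use t x w2 in \<open>auto intro!: S_fv\<close>)
  then have S2: "S x e (M[v1 ::= Fv v][v2 ::= Fv v]) \<tau> L f"
    by (rule S_subst[where \<sigma> = "var_ty v" and L' = "[]" and n = t]) (use t x in \<open>auto intro!: S_fv\<close>)
  have "asm x ?e1 (\<Gamma> @ [v1, v2]) = tens2 x (asm x e \<Gamma>) (tens2 x (av x e v) (av x e v))"
  proof -
    have "asm x ?e1 [v1, v2] = tens2 x (av x ?e1 v1) (asm x ?e1 [v2])" by simp
    also have "asm x ?e1 [v2] = av x ?e1 v2" by (rule asm_single[OF w2(2) x(1) g(2)])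
    finally have "asm x ?e1 [v1, v2] = tens2 x (av x e v) (av x e v)" unfolding avs .
    then show ?thesis using asm_append[OF w2(2) x(1), of \<Gamma> "[v1, v2]"] ce cg(1) by simp
  qed
  also have "\<dots> = (ids (objs C \<Gamma>) \<otimes>\<^sub>s scc (vc v)) \<circ>\<^sub>s asm x e (\<Gamma> @ [v])"
    using x c v A tens2_comp[of x "asm x e \<Gamma>" "av x e v" "obs (tok e \<Gamma>)" "obs (tk e v)" "ids (objs C \<Gamma>)" "scc (vc v)"]
    by (simp add: asm_append asm_single scc_av del: asm.simps(2))
  finally have "\<Theta> (\<Gamma> @ [v1, v2]) m \<tau> \<circ>\<^sub>s asm x ?e1 (\<Gamma> @ [v1, v2]) = \<Theta> (\<Gamma> @ [v]) m' \<tau> \<circ>\<^sub>s asm x e (\<Gamma> @ [v])"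
    unfolding m' using ok x v asm_simps[OF x(2,1,3)] vc_simps(2)[of v1] vc_simps(2)[of v2] vc_simps(2)[of v] by simp
  then show ?thesis unfolding adq_def using S2 S by auto
qed

lemma adq_app:
  assumes x: "coal x" "wfe x e" "cenv x e (\<Gamma> @ \<Delta>)" "distinct (tok e (\<Gamma> @ \<Delta>))"
    and ok: "ok (um \<Gamma> m (Lolli \<sigma> \<tau>))" "ok (um \<Delta> n \<sigma>)"
    and IH: "adq x e \<Gamma> M (Lolli \<sigma> \<tau>) m" "adq x e \<Delta> N \<sigma> n"
    and m': "\<Theta> (\<Gamma> @ \<Delta>) m' \<tau> = evs (tob \<sigma>) (tob \<tau>) \<circ>\<^sub>s (\<Theta> \<Gamma> m (Lolli \<sigma> \<tau>) \<otimes>\<^sub>s \<Theta> \<Delta> n \<sigma>)"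
  shows "adq x e (\<Gamma> @ \<Delta>) (App M N) \<tau> m'"
proof -
  have c: "cenv x e \<Gamma>" "cenv x e \<Delta>" using x by auto
  note A = asm_simps[OF x(2,1) c(1)] asm_simps[OF x(2,1) c(2)]
  obtain L1 f1 where S1: "S x e M (Lolli \<sigma> \<tau>) L1 f1" "mset (tok e \<Gamma>) = mset L1"
    "\<Theta> \<Gamma> m (Lolli \<sigma> \<tau>) \<circ>\<^sub>s asm x e \<Gamma> = f1 \<circ>\<^sub>s (ids [src x] \<otimes>\<^sub>s pm (tok e \<Gamma>) L1)"
    using IH(1) by (auto simp: adq_def)
  obtain L2 f2 where S2: "S x e N \<sigma> L2 f2" "mset (tok e \<Delta>) = mset L2"
    "\<Theta> \<Delta> n \<sigma> \<circ>\<^sub>s asm x e \<Delta> = f2 \<circ>\<^sub>s (ids [src x] \<otimes>\<^sub>s pm (tok e \<Delta>) L2)"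
    using IH(2) by (auto simp: adq_def)
  note f = S_arr[OF S1(1) x(2,1)] S_arr[OF S2(1) x(2,1)]
  note p = pm_arr[OF S1(2)] pm_arr[OF S2(2)]
  \<comment> \<open>The semantics lists the tokens of the function before those of the argument, so
    no permutation mixes the two bases.\<close>
  have pt: "pm (tok e (\<Gamma> @ \<Delta>)) (L1 @ L2) = pm (tok e \<Gamma>) L1 \<otimes>\<^sub>s pm (tok e \<Delta>) L2"
    using x(4) S1(2) S2(2) by (simp add: pm_tens)
  have "(\<Theta> \<Gamma> m (Lolli \<sigma> \<tau>) \<otimes>\<^sub>s \<Theta> \<Delta> n \<sigma>) \<circ>\<^sub>s asm x e (\<Gamma> @ \<Delta>)
    = tens2 x (\<Theta> \<Gamma> m (Lolli \<sigma> \<tau>) \<circ>\<^sub>s asm x e \<Gamma>) (\<Theta> \<Delta> n \<sigma> \<circ>\<^sub>s asm x e \<Delta>)"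
    using x c A ok by (simp add: asm_append tens2_comp)
  also have "\<dots> = tens2 x f1 f2 \<circ>\<^sub>s (ids [src x] \<otimes>\<^sub>s pm (tok e \<Gamma>) L1 \<otimes>\<^sub>s pm (tok e \<Delta>) L2)"
    unfolding S1(3) S2(3) using x f p by (intro tens2_pre[symmetric]) auto
  finally have 1: "(\<Theta> \<Gamma> m (Lolli \<sigma> \<tau>) \<otimes>\<^sub>s \<Theta> \<Delta> n \<sigma>) \<circ>\<^sub>s asm x e (\<Gamma> @ \<Delta>)
     = tens2 x f1 f2 \<circ>\<^sub>s (ids [src x] \<otimes>\<^sub>s pm (tok e (\<Gamma> @ \<Delta>)) (L1 @ L2))" unfolding pt .
  have 2: "\<Theta> (\<Gamma> @ \<Delta>) m' \<tau> \<circ>\<^sub>s asm x e (\<Gamma> @ \<Delta>) = (evs (tob \<sigma>) (tob \<tau>) \<circ>\<^sub>s tens2 x f1 f2) \<circ>\<^sub>s (ids [src x] \<otimes>\<^sub>s pm (tok e (\<Gamma> @ \<Delta>)) (L1 @ L2))"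
    unfolding m' using ok x asm_simps[OF x(2,1,3)] f p pt 1 by simp
  show ?thesis by (rule adqI[OF S_app[OF S1(1) S2(1)] _ 2]) (simp add: S1(2) S2(2))
qed

text \<open>Both branches consume the tokens of \<Delta>, though perhaps in different orders. The
  order of the left branch is taken as the common one and the right branch is adapted by
  \<open>pm L2 L3\<close>, as pairing requires a common source.\<close>

lemma adq_lif:
  assumes x: "coal x" "wfe x e" "cenv x e (\<Gamma> @ \<Delta>)" "distinct (tok e (\<Gamma> @ \<Delta>))"
    and ok: "ok (um \<Gamma> m Iota)" "ok (um \<Delta> l Iota)" "ok (um \<Delta> r Iota)"
    and IH: "adq x e \<Gamma> M Iota m" "adq x e \<Delta> L Iota l" "adq x e \<Delta> R Iota r"
    and m': "\<Theta> (\<Gamma> @ \<Delta>) m' Iota = lifs \<circ>\<^sub>s (\<Theta> \<Gamma> m Iota \<otimes>\<^sub>s spair (\<Theta> \<Delta> l Iota) (\<Theta> \<Delta> r Iota))"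
  shows "adq x e (\<Gamma> @ \<Delta>) (Lif M L R) Iota m'"
proof -
  have c: "cenv x e \<Gamma>" "cenv x e \<Delta>" using x by auto
  note A = asm_simps[OF x(2,1) c(1)] asm_simps[OF x(2,1) c(2)]
  let ?s = "spair (\<Theta> \<Delta> l Iota) (\<Theta> \<Delta> r Iota)"
  obtain L1 f1 where S1: "S x e M Iota L1 f1" "mset (tok e \<Gamma>) = mset L1"
    "\<Theta> \<Gamma> m Iota \<circ>\<^sub>s asm x e \<Gamma> = f1 \<circ>\<^sub>s (ids [src x] \<otimes>\<^sub>s pm (tok e \<Gamma>) L1)"
    using IH(1) by (auto simp: adq_def)
  obtain L2 f2 where S2: "S x e L Iota L2 f2" "mset (tok e \<Delta>) = mset L2"
    "\<Theta> \<Delta> l Iota \<circ>\<^sub>s asm x e \<Delta> = f2 \<circ>\<^sub>s (ids [src x] \<otimes>\<^sub>s pm (tok e \<Delta>) L2)"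
    using IH(2) by (auto simp: adq_def)
  obtain L3 f3 where S3: "S x e R Iota L3 f3" "mset (tok e \<Delta>) = mset L3"
    "\<Theta> \<Delta> r Iota \<circ>\<^sub>s asm x e \<Delta> = f3 \<circ>\<^sub>s (ids [src x] \<otimes>\<^sub>s pm (tok e \<Delta>) L3)"
    using IH(3) by (auto simp: adq_def)
  have m23: "mset L2 = mset L3" using S2(2) S3(2) by simp
  note f = S_arr[OF S1(1) x(2,1)] S_arr[OF S2(1) x(2,1)] S_arr[OF S3(1) x(2,1)]
  note p = pm_arr[OF S1(2)] pm_arr[OF S2(2)] pm_arr[OF S3(2)] pm_arr[OF m23]
  have pt: "pm (tok e (\<Gamma> @ \<Delta>)) (L1 @ L2) = pm (tok e \<Gamma>) L1 \<otimes>\<^sub>s pm (tok e \<Delta>) L2"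
    using x(4) S1(2) S2(2) by (simp add: pm_tens)
  have pp: "pm L2 L3 \<circ>\<^sub>s pm (tok e \<Delta>) L2 = pm (tok e \<Delta>) L3"
    using x(4) S2(2) m23 by (intro pm_comp) auto
  let ?g = "spair f2 (f3 \<circ>\<^sub>s (ids [src x] \<otimes>\<^sub>s pm L2 L3))"
  have "?s \<circ>\<^sub>s asm x e \<Delta> = spair (\<Theta> \<Delta> l Iota \<circ>\<^sub>s asm x e \<Delta>) (\<Theta> \<Delta> r Iota \<circ>\<^sub>s asm x e \<Delta>)"
    using x c A ok by (intro spair_nat) simp_all
  also have "\<dots> = spair (f2 \<circ>\<^sub>s (ids [src x] \<otimes>\<^sub>s pm (tok e \<Delta>) L2)) ((f3 \<circ>\<^sub>s (ids [src x] \<otimes>\<^sub>s pm L2 L3)) \<circ>\<^sub>s (ids [src x] \<otimes>\<^sub>s pm (tok e \<Delta>) L2))"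
    unfolding S2(3) S3(3) pp[symmetric] using f p by (simp add: stens_comp)
  also have "\<dots> = ?g \<circ>\<^sub>s (ids [src x] \<otimes>\<^sub>s pm (tok e \<Delta>) L2)"
    using f p by (intro spair_nat[symmetric]) simp_all
  finally have sg: "?s \<circ>\<^sub>s asm x e \<Delta> = ?g \<circ>\<^sub>s (ids [src x] \<otimes>\<^sub>s pm (tok e \<Delta>) L2)" .
  have "(\<Theta> \<Gamma> m Iota \<otimes>\<^sub>s ?s) \<circ>\<^sub>s asm x e (\<Gamma> @ \<Delta>) = tens2 x (\<Theta> \<Gamma> m Iota \<circ>\<^sub>s asm x e \<Gamma>) (?s \<circ>\<^sub>s asm x e \<Delta>)"
    using x c A ok by (simp add: asm_append tens2_comp)
  also have "\<dots> = tens2 x f1 ?g \<circ>\<^sub>s (ids [src x] \<otimes>\<^sub>s pm (tok e \<Gamma>) L1 \<otimes>\<^sub>s pm (tok e \<Delta>) L2)"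
    unfolding S1(3) sg using x f p by (intro tens2_pre[symmetric]) auto
  finally have 1: "(\<Theta> \<Gamma> m Iota \<otimes>\<^sub>s ?s) \<circ>\<^sub>s asm x e (\<Gamma> @ \<Delta>)
     = tens2 x f1 ?g \<circ>\<^sub>s (ids [src x] \<otimes>\<^sub>s pm (tok e (\<Gamma> @ \<Delta>)) (L1 @ L2))" unfolding pt .
  have 2: "\<Theta> (\<Gamma> @ \<Delta>) m' Iota \<circ>\<^sub>s asm x e (\<Gamma> @ \<Delta>) = (lifs \<circ>\<^sub>s tens2 x f1 ?g) \<circ>\<^sub>s (ids [src x] \<otimes>\<^sub>s pm (tok e (\<Gamma> @ \<Delta>)) (L1 @ L2))"
    unfolding m' using ok x asm_simps[OF x(2,1,3)] f p pt 1 by simp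
  show ?thesis by (rule adqI[OF S_lif[OF S1(1) S2(1) S3(1) m23] _ 2]) (simp add: S1(2) S2(2))
qed

section \<open>Abstraction and fixpoint\<close>

lemma wfe_upd: "wfe x e \<Longrightarrow> arr f \<Longrightarrow> dm f = src x # obs L \<Longrightarrow> cd f = [tob \<sigma>] \<Longrightarrow> wfe x (e(a := Some (\<sigma>, L, f)))"
  by (auto simp: wfe_def)

lemma wfe_bmap: "wfe x e \<Longrightarrow> cmor y x h \<Longrightarrow> wfe y (map_option (bmap h) \<circ> e)"
  using cmorD[of y x h] by (auto simp: wfe_def bmap_def)

lemma wfe_tmap: "wfe x e \<Longrightarrow> wfe x (map_option (tmap g) \<circ> e)"
  by (auto simp: wfe_def tmap_def)

text \<open>A ground variable extends the stage by the coalgebra (N, p). The body is evaluated at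
  the larger stage, with the bound variable as second projection, and is curried over the new
  factor.\<close>

lemma adq_lam_ground:
  assumes x: "coal x" "wfe x e" "cenv x e \<Gamma>" "distinct (tok e \<Gamma>)"
    and d: "Gnd k \<notin> set \<Gamma>" and lc: "lc 0 M"
    and ok: "ok (um (\<Gamma> @ [Gnd k]) m \<tau>)"
    and IH: "\<And>x e. coal x \<Longrightarrow> wfe x e \<Longrightarrow> cenv x e (\<Gamma> @ [Gnd k]) \<Longrightarrow> distinct (tok e (\<Gamma> @ [Gnd k])) \<Longrightarrow> adq x e (\<Gamma> @ [Gnd k]) M \<tau> m"
    and m': "\<Theta> \<Gamma> m' (Lolli Iota \<tau>) = scur (objs C \<Gamma>) N0 (\<Theta> (\<Gamma> @ [Gnd k]) m \<tau>)"
  shows "adq x e \<Gamma> (LAM (Gnd k) M) (Lolli Iota \<tau>) m'"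
proof -
  let ?v = "Gnd k" and ?x = "ct x pt" and ?X = "src x" and ?t = "tok e \<Gamma>" and ?a = "asm x e \<Gamma>"
  let ?e0 = "map_option (bmap (p1 x pt)) \<circ> e"
  define e' where "e' = ?e0(Fv ?v := Some (Iota, [], em (p2 x pt)))"
  have cp: "cmor ?x x (p1 x pt)" "cmor ?x pt (p2 x pt)" using x cmor_p1 cmor_p2 by auto
  have w: "wfe ?x e'" using wfe_bmap[OF x(2) cp(1)] x(1) unfolding e'_def by (intro wfe_upd) auto
  have ag: "u \<in> set \<Gamma> \<Longrightarrow> e' (Fv u) = map_option (bmap (p1 x pt)) (e (Fv u))" for u using d by (auto simp: e'_def)
  note b = asm_base[OF ag x(3) x(1) _ cp(1) x(2)]
  have g: "good ?x e' ?v" using cp x by (simp add: good_def e'_def)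
  have tv: "tk e' ?v = []" by (simp add: tk_def e'_def)
  have ce: "cenv ?x e' (\<Gamma> @ [?v])" and tt: "tok e' (\<Gamma> @ [?v]) = ?t" using b x g tv by auto
  obtain L f where S: "S ?x e' M \<tau> L f" "mset ?t = mset L"
    "\<Theta> (\<Gamma> @ [?v]) m \<tau> \<circ>\<^sub>s asm ?x e' (\<Gamma> @ [?v]) = f \<circ>\<^sub>s (ids [?X \<otimes> N0] \<otimes>\<^sub>s pm ?t L)"
    using IH[OF _ w ce] x unfolding adq_def tt by auto
  have f: "arr f" "dm f = (?X \<otimes> N0) # obs L" "cd f = [tob \<tau>]" using S_arr[OF S(1) w] x by auto
  note p = pm_arr[OF S(2)] and A = asm_simps[OF x(2,1,3)]
  let ?pk = "pk ?X N0"
  let ?g = "f \<circ>\<^sub>s (?pk \<otimes>\<^sub>s ids (obs L)) \<circ>\<^sub>s (ids [?X] \<otimes>\<^sub>s sw (obs L) [N0])"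
  have Sl: "S x e (LAM ?v M) (Lolli Iota \<tau>) L (scur (?X # obs L) N0 ?g)"
    unfolding LAM_def var_ty.simps
    by (intro S_lam_ground S_close[OF S(1) lc]) (auto simp: e'_def)
  have avv: "av ?x e' ?v = em (p2 x pt)" by (simp add: av_def e'_def)
  have "asm ?x e' (\<Gamma> @ [?v]) = tens2 ?x (?a \<circ>\<^sub>s (em (p1 x pt) \<otimes>\<^sub>s ids (obs ?t))) (em (p2 x pt))"
    using asm_append[OF w, of \<Gamma> "[?v]"] ce b x asm_single[OF w _ g] avv by simp
  also have "\<dots> = (?a \<otimes>\<^sub>s ids [N0]) \<circ>\<^sub>s (ids [?X] \<otimes>\<^sub>s sw [N0] (obs ?t)) \<circ>\<^sub>s (upk ?X N0 \<otimes>\<^sub>s ids (obs ?t))"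
    using tens2_binder[of x pt ?a "obs ?t"] A x by simp
  \<comment> \<open>Repacking the stage and moving the new object to the end exhibits the
    environment of the body as the old one beside an identity, which is the shape in which currying
    is natural.\<close>
  finally have as: "asm ?x e' (\<Gamma> @ [?v]) \<circ>\<^sub>s (?pk \<otimes>\<^sub>s ids (obs ?t)) \<circ>\<^sub>s (ids [?X] \<otimes>\<^sub>s sw (obs ?t) [N0]) = ?a \<otimes>\<^sub>s ids [N0]"
    using A x by (simp add: stens_comp stens_comp_tail)
  have "\<Theta> (\<Gamma> @ [?v]) m \<tau> \<circ>\<^sub>s (?a \<otimes>\<^sub>s ids [N0])
     = (\<Theta> (\<Gamma> @ [?v]) m \<tau> \<circ>\<^sub>s asm ?x e' (\<Gamma> @ [?v])) \<circ>\<^sub>s (?pk \<otimes>\<^sub>s ids (obs ?t)) \<circ>\<^sub>s (ids [?X] \<otimes>\<^sub>s sw (obs ?t) [N0])"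
    unfolding as[symmetric] using ok x asm_simps[OF w _ ce, unfolded tt] by (intro scomp_assoc[symmetric]) simp_all
  also have "\<dots> = f \<circ>\<^sub>s ((ids [?X \<otimes> N0] \<otimes>\<^sub>s pm ?t L) \<circ>\<^sub>s (?pk \<otimes>\<^sub>s ids (obs ?t))) \<circ>\<^sub>s (ids [?X] \<otimes>\<^sub>s sw (obs ?t) [N0])"
    unfolding S(3) using f p by simp
  also have "(ids [?X \<otimes> N0] \<otimes>\<^sub>s pm ?t L) \<circ>\<^sub>s (?pk \<otimes>\<^sub>s ids (obs ?t)) = (?pk \<otimes>\<^sub>s ids (obs L)) \<circ>\<^sub>s (ids [?X] \<otimes>\<^sub>s ids [N0] \<otimes>\<^sub>s pm ?t L)"
    using p stens_comp[of "ids [?X, N0]" ?pk "pm ?t L" "ids (obs L)"] by (simp add: stens_comp)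
  also have "f \<circ>\<^sub>s ((?pk \<otimes>\<^sub>s ids (obs L)) \<circ>\<^sub>s (ids [?X] \<otimes>\<^sub>s ids [N0] \<otimes>\<^sub>s pm ?t L)) \<circ>\<^sub>s (ids [?X] \<otimes>\<^sub>s sw (obs ?t) [N0])
    = f \<circ>\<^sub>s (?pk \<otimes>\<^sub>s ids (obs L)) \<circ>\<^sub>s ((ids [?X] \<otimes>\<^sub>s (ids [N0] \<otimes>\<^sub>s pm ?t L)) \<circ>\<^sub>s (ids [?X] \<otimes>\<^sub>s sw (obs ?t) [N0]))"
    using f p by simp
  also have "(ids [?X] \<otimes>\<^sub>s (ids [N0] \<otimes>\<^sub>s pm ?t L)) \<circ>\<^sub>s (ids [?X] \<otimes>\<^sub>s sw (obs ?t) [N0]) = ids [?X] \<otimes>\<^sub>s (sw (obs L) [N0] \<circ>\<^sub>s (pm ?t L \<otimes>\<^sub>s ids [N0]))"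
    using p by (subst stens_comp) (simp_all add: sw_nat)
  also have "\<dots> = (ids [?X] \<otimes>\<^sub>s sw (obs L) [N0]) \<circ>\<^sub>s (ids [?X] \<otimes>\<^sub>s (pm ?t L \<otimes>\<^sub>s ids [N0]))"
    using p by (subst stens_comp) simp_all
  finally have eq: "\<Theta> (\<Gamma> @ [?v]) m \<tau> \<circ>\<^sub>s (?a \<otimes>\<^sub>s ids [N0]) = ?g \<circ>\<^sub>s ((ids [?X] \<otimes>\<^sub>s pm ?t L) \<otimes>\<^sub>s ids [N0])"
    using f p by simp
  have "\<Theta> \<Gamma> m' (Lolli Iota \<tau>) \<circ>\<^sub>s ?a = scur (?X # obs ?t) N0 (\<Theta> (\<Gamma> @ [?v]) m \<tau> \<circ>\<^sub>s (?a \<otimes>\<^sub>s ids [N0]))"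
    unfolding m' using ok A by (intro scur_nat[symmetric]) simp_all
  also have "\<dots> = scur (?X # obs L) N0 ?g \<circ>\<^sub>s (ids [?X] \<otimes>\<^sub>s pm ?t L)"
    unfolding eq using f p by (intro scur_nat) simp_all
  finally show ?thesis unfolding adq_def using Sl S(2) by blast
qed

text \<open>Existence of the decomposition whose uniqueness is \<open>map_Suc_split\<close>: a body
  that consumes the bound token together with shifted ones has the form that
  \<open>S_lam_higher\<close> expects.\<close>

lemma apfst_Suc_split:
  fixes ts :: "(nat \<times> 'o) list"
  assumes "mset (map (apfst Suc) ts @ [(0, o1)]) = mset L"
  obtains A B where "L = map (apfst Suc) A @ (0, o1) # map (apfst Suc) B" "mset ts = mset (A @ B)"
proof -
  have "(0, o1) \<in> set L" using assms by (metis in_set_conv_decomp set_mset_mset)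
  then obtain L1 L2 where L: "L = L1 @ (0, o1) # L2" by (meson split_list)
  have m: "mset (map (apfst Suc) ts) = mset (L1 @ L2)" using assms L by simp
  then have "set (L1 @ L2) \<subseteq> range (apfst Suc)" by (metis image_mono list.set_map mset_eq_setD subset_UNIV)
  then have "\<forall>y\<in>set L1. \<exists>t. y = apfst Suc t" "\<forall>y\<in>set L2. \<exists>t. y = apfst Suc t" by auto
  then obtain A B where AB: "L1 = map (apfst Suc) A" "L2 = map (apfst Suc) B"
    unfolding ex_map_conv[symmetric] by blast
  have e: "image_mset (apfst Suc) (mset ts) = image_mset (apfst Suc) (mset (A @ B))" using m AB by simp
  have i: "inj (apfst Suc :: nat \<times> 'o \<Rightarrow> _)" by (rule injI) simp
  have "mset ts = mset (A @ B)" by (rule injD[OF multiset.inj_map[OF i] e])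
  then show ?thesis using that L AB by blast
qed

text \<open>A linear variable must not be copied, so the stage stays as it is and the bound variable
  becomes the new token \<open>0\<close>.\<close>

lemma adq_lam_higher:
  assumes x: "coal x" "wfe x e" "cenv x e \<Gamma>" "distinct (tok e \<Gamma>)" and \<sigma>: "\<sigma> = Lolli \<sigma>1 \<sigma>2"
    and d: "Hov k \<sigma>1 \<sigma>2 \<notin> set \<Gamma>" and lc: "lc 0 M"
    and ok: "ok (um (\<Gamma> @ [Hov k \<sigma>1 \<sigma>2]) m \<tau>)"
    and IH: "\<And>e. wfe x e \<Longrightarrow> cenv x e (\<Gamma> @ [Hov k \<sigma>1 \<sigma>2]) \<Longrightarrow> distinct (tok e (\<Gamma> @ [Hov k \<sigma>1 \<sigma>2])) \<Longrightarrow> adq x e (\<Gamma> @ [Hov k \<sigma>1 \<sigma>2]) M \<tau> m"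
    and m': "\<Theta> \<Gamma> m' (Lolli \<sigma> \<tau>) = scur (objs C \<Gamma>) (tob \<sigma>) (\<Theta> (\<Gamma> @ [Hov k \<sigma>1 \<sigma>2]) m \<tau>)"
  shows "adq x e \<Gamma> (LAM (Hov k \<sigma>1 \<sigma>2) M) (Lolli \<sigma> \<tau>) m'"
proof -
  let ?v = "Hov k \<sigma>1 \<sigma>2" and ?X = "src x" and ?t = "tok e \<Gamma>" and ?a = "asm x e \<Gamma>" and ?o = "[tob \<sigma>]"
  let ?z = "(0, tob \<sigma>)"
  let ?e0 = "map_option (tmap Suc) \<circ> e"
  define e' where "e' = ?e0(Fv ?v := Some (\<sigma>, [?z], sww x \<otimes>\<^sub>s ids ?o))"
  have w: "wfe x e'" using wfe_tmap[OF x(2)] x(1) unfolding e'_def by (intro wfe_upd) auto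
  have ag: "u \<in> set \<Gamma> \<Longrightarrow> e' (Fv u) = map_option (tmap Suc) (e (Fv u))" for u using d by (auto simp: e'_def)
  have b: "asm x e' \<Gamma> = ?a" "tok e' \<Gamma> = map (apfst Suc) ?t" "cenv x e' \<Gamma>"
    using asm_ren[of \<Gamma> e' Suc e x, OF ag x(3)] by auto
  have g: "good x e' ?v" using \<sigma> by (simp add: good_def nonlin_def e'_def)
  have tv: "tk e' ?v = [?z]" by (simp add: tk_def e'_def)
  have ce: "cenv x e' (\<Gamma> @ [?v])" and tt: "tok e' (\<Gamma> @ [?v]) = map (apfst Suc) ?t @ [?z]" using b x g tv by auto
  have inj: "inj (apfst Suc :: nat \<times> 'o \<Rightarrow> _)" by (rule injI) simp
  have dt: "distinct (map (apfst Suc) ?t @ [?z])" using x(4) inj by (auto simp: distinct_map intro!: inj_on_subset[OF inj])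
  obtain L f where S: "S x e' M \<tau> L f" "mset (map (apfst Suc) ?t @ [?z]) = mset L"
    "\<Theta> (\<Gamma> @ [?v]) m \<tau> \<circ>\<^sub>s asm x e' (\<Gamma> @ [?v]) = f \<circ>\<^sub>s (ids [?X] \<otimes>\<^sub>s pm (map (apfst Suc) ?t @ [?z]) L)"
    using IH[OF w ce] dt unfolding adq_def tt by blast
  obtain A B where L: "L = map (apfst Suc) A @ ?z # map (apfst Suc) B" and m: "mset ?t = mset (A @ B)"
    using apfst_Suc_split[OF S(2)] .
  have f: "arr f" "dm f = ?X # obs A @ tob \<sigma> # obs B" "cd f = [tob \<tau>]" using S_arr[OF S(1) w x(1)] L by auto
  note p = pm_arr[OF m] and As = asm_simps[OF x(2,1,3)]
  \<comment> \<open>The outer tokens are sorted first; then the bound token, which comes last in the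
    basis, moves left across \<open>B\<close> to its place of use.\<close>
  have pml: "pm (map (apfst Suc) ?t @ [?z]) L = (ids (obs A) \<otimes>\<^sub>s sw (obs B) ?o) \<circ>\<^sub>s (pm ?t (A @ B) \<otimes>\<^sub>s ids ?o)"
  proof (rule prm_eq_pm[OF _ dt], rule prm_comp)
    have "prm (map (apfst Suc) ?t) (map (apfst Suc) (A @ B)) (pm (map (apfst Suc) ?t) (map (apfst Suc) (A @ B)))"
      using m by (intro prm_pm) simp
    also have "pm (map (apfst Suc) ?t) (map (apfst Suc) (A @ B)) = pm ?t (A @ B)"
      by (intro pm_map inj) simp
    finally show "prm (map (apfst Suc) ?t @ [?z]) (map (apfst Suc) (A @ B) @ [?z]) (pm ?t (A @ B) \<otimes>\<^sub>s ids ?o)"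
      by (intro prm_tens prm_id') simp_all
    have "prm (map (apfst Suc) A @ (map (apfst Suc) B @ [?z])) (map (apfst Suc) A @ ([?z] @ map (apfst Suc) B)) (ids (obs A) \<otimes>\<^sub>s sw (obs B) ?o)"
      by (intro prm_tens prm_id' prm_sw) simp_all
    then show "prm (map (apfst Suc) (A @ B) @ [?z]) L (ids (obs A) \<otimes>\<^sub>s sw (obs B) ?o)" using L by simp
  qed
  let ?g = "f \<circ>\<^sub>s (ids (?X # obs A) \<otimes>\<^sub>s sw (obs B) ?o)"
  have Sl: "S x e (LAM ?v M) (Lolli \<sigma> \<tau>) (A @ B) (scur (?X # obs (A @ B)) (tob \<sigma>) ?g)"
    unfolding LAM_def var_ty.simps \<sigma>[symmetric]
    by (intro S_lam_higher[OF _ \<sigma>] S_close[OF S(1)[unfolded L] lc]) (auto simp: e'_def)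
  have avv: "av x e' ?v = sww x \<otimes>\<^sub>s ids ?o" by (simp add: av_def e'_def)
  have as: "asm x e' (\<Gamma> @ [?v]) = ?a \<otimes>\<^sub>s ids ?o"
    using asm_append[OF w x(1), of \<Gamma> "[?v]"] ce b x asm_single[OF w x(1) g] As
      tens2_var_right[of x ?a "obs ?t" ?o] avv by simp
  have eq: "\<Theta> (\<Gamma> @ [?v]) m \<tau> \<circ>\<^sub>s (?a \<otimes>\<^sub>s ids ?o) = ?g \<circ>\<^sub>s ((ids [?X] \<otimes>\<^sub>s pm ?t (A @ B)) \<otimes>\<^sub>s ids ?o)"
  proof -
    have "(ids (?X # obs A) \<otimes>\<^sub>s sw (obs B) ?o) \<circ>\<^sub>s ((ids [?X] \<otimes>\<^sub>s pm ?t (A @ B)) \<otimes>\<^sub>s ids ?o)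
      = ids [?X] \<otimes>\<^sub>s ((ids (obs A) \<otimes>\<^sub>s sw (obs B) ?o) \<circ>\<^sub>s (pm ?t (A @ B) \<otimes>\<^sub>s ids ?o))"
      using p stens_comp[of "ids [?X]" "ids [?X]" "pm ?t (A @ B) \<otimes>\<^sub>s ids ?o" "ids (obs A) \<otimes>\<^sub>s sw (obs B) ?o"] by simp
    then show ?thesis using S(3) f p unfolding as pml by simp
  qed
  have "\<Theta> \<Gamma> m' (Lolli \<sigma> \<tau>) \<circ>\<^sub>s ?a = scur (?X # obs ?t) (tob \<sigma>) (\<Theta> (\<Gamma> @ [?v]) m \<tau> \<circ>\<^sub>s (?a \<otimes>\<^sub>s ids ?o))"
    unfolding m' using ok As \<sigma> by (intro scur_nat[symmetric]) simp_all
  also have "\<dots> = scur (?X # obs (A @ B)) (tob \<sigma>) ?g \<circ>\<^sub>s (ids [?X] \<otimes>\<^sub>s pm ?t (A @ B))"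
    unfolding eq using f p by (intro scur_nat) simp_all
  finally show ?thesis unfolding adq_def using Sl m by blast
qed

text \<open>The basis of a fixpoint has no linear variables, so there are no tokens and the
  environment is a coalgebra morphism. It therefore passes through the promotion of the basis,
  emerges inside the promoted arrow and leaves a promotion along the stage.\<close>

lemma adq_mu:
  assumes x: "coal x" "wfe x e" "cenv x e \<Gamma>" and n: "\<forall>v\<in>set \<Gamma>. nonlin v"
    and d: "Stb k \<sigma> \<notin> set \<Gamma>" and lc: "lc 0 M"
    and ok: "ok (um (\<Gamma> @ [Stb k \<sigma>]) m \<sigma>)"
    and IH: "\<And>x e. coal x \<Longrightarrow> wfe x e \<Longrightarrow> cenv x e (\<Gamma> @ [Stb k \<sigma>]) \<Longrightarrow> distinct (tok e (\<Gamma> @ [Stb k \<sigma>])) \<Longrightarrow> adq x e (\<Gamma> @ [Stb k \<sigma>]) M \<sigma> m"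
    and m': "um \<Gamma> m' \<sigma> = fixt (tob \<sigma>) \<circ>\<^sub>t bng (curt (bob \<Gamma>) (bang C (tob \<sigma>))
        (um (\<Gamma> @ [Stb k \<sigma>]) m \<sigma> \<circ>\<^sub>t J (objs C \<Gamma>) [bang C (tob \<sigma>)] \<circ>\<^sub>t (idt (bob \<Gamma>) \<otimes>\<^sub>t run' (bang C (tob \<sigma>))))) \<circ>\<^sub>t pc \<Gamma>"
  shows "adq x e \<Gamma> (MU (Stb k \<sigma>) M) \<sigma> m'"
proof -
  let ?A = "bang C (tob \<sigma>)" and ?d = "digt (tob \<sigma>)"
  let ?v = "Stb k \<sigma>" and ?x = "ct x ?d" and ?X = "src x" and ?a = "asm x e \<Gamma>"
  let ?e0 = "map_option (bmap (p1 x ?d)) \<circ> e"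
  define e' where "e' = ?e0(Fv ?v := Some (\<sigma>, [], em (dert (tob \<sigma>) \<circ>\<^sub>t p2 x ?d)))"
  have cp: "cmor ?x x (p1 x ?d)" "cmor ?x ?d (p2 x ?d)" using x cmor_p1 cmor_p2 by auto
  have w: "wfe ?x e'" using wfe_bmap[OF x(2) cp(1)] x(1) unfolding e'_def by (intro wfe_upd) auto
  have ag: "u \<in> set \<Gamma> \<Longrightarrow> e' (Fv u) = map_option (bmap (p1 x ?d)) (e (Fv u))" for u using d by (auto simp: e'_def)
  note b = asm_base[OF ag x(3) x(1) _ cp(1) x(2)]
  have g: "good ?x e' ?v" using x by (simp add: good_def e'_def)
  have tv: "tk e' ?v = []" by (simp add: tk_def e'_def)
  have t: "tok e \<Gamma> = []" and ca: "cmor x (pc \<Gamma>) (tr ?a \<circ>\<^sub>t run' ?X)" using asm_cmor[OF x(2,1,3) n] by auto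
  have ce: "cenv ?x e' (\<Gamma> @ [?v])" and tt: "tok e' (\<Gamma> @ [?v]) = []" using b x g tv t by auto
  obtain L f where S: "S ?x e' M \<sigma> L f" "mset [] = mset L"
    "\<Theta> (\<Gamma> @ [?v]) m \<sigma> \<circ>\<^sub>s asm ?x e' (\<Gamma> @ [?v]) = f \<circ>\<^sub>s (ids [?X \<otimes> ?A] \<otimes>\<^sub>s pm [] L)"
    using IH[OF _ w ce] x unfolding adq_def tt by auto
  have L: "L = []" using S(2) by simp
  have f: "arr f" "dm f = [?X \<otimes> ?A]" "cd f = [tob \<sigma>]" using S_arr[OF S(1) w] x L by auto
  have A: "arr ?a" "dm ?a = [?X]" "cd ?a = objs C \<Gamma>" using asm_simps[OF x(2,1,3)] unfolding t by simp_all
  \<comment> \<open>The entry of the bound variable is the derelicted projection; promoting it gives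
    the projection back, as it is a morphism into a free coalgebra.\<close>
  have "av ?x e' ?v = em (p2 x ?d)" using cmor_dert[OF cp(2)] x by (simp add: av_def e'_def)
  then have "asm ?x e' (\<Gamma> @ [?v]) = tens2 ?x (?a \<circ>\<^sub>s (em (p1 x ?d) \<otimes>\<^sub>s ids [])) (em (p2 x ?d))"
    using asm_append[OF w, of \<Gamma> "[?v]"] ce b x asm_single[OF w _ g] t by simp
  also have "\<dots> = (?a \<otimes>\<^sub>s ids [?A]) \<circ>\<^sub>s upk ?X ?A"
    using tens2_binder[of x ?d ?a "[]"] A x by simp
  finally have fe: "f = \<Theta> (\<Gamma> @ [?v]) m \<sigma> \<circ>\<^sub>s (?a \<otimes>\<^sub>s ids [?A]) \<circ>\<^sub>s upk ?X ?A"
    using S(3) f L by simp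
  let ?m = "um (\<Gamma> @ [?v]) m \<sigma> \<circ>\<^sub>t J (objs C \<Gamma>) [?A] \<circ>\<^sub>t (idt (bob \<Gamma>) \<otimes>\<^sub>t run' ?A)"
  let ?aa = "tr ?a \<circ>\<^sub>t run' ?X"
  note a0 = cmorD[OF ca] and pcs = pc_simps[OF n]
  have gen: "bng (curt (bob \<Gamma>) ?A ?m) \<circ>\<^sub>t bng h \<circ>\<^sub>t x = bng (curt (bob \<Gamma>) ?A ?m \<circ>\<^sub>t h) \<circ>\<^sub>t x"
    if "ok h" "src h = ?X" "tgt h = bob \<Gamma>" for h using that ok x by (simp add: bng_cmp)
  have uf: "ue f = ?m \<circ>\<^sub>t (?aa \<otimes>\<^sub>t idt ?A)"
    unfolding fe using A ok by (simp add: ue_def dn_scomp tr_simps tr_upk tns_cmp_tail tns_cmp)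
  have "\<Theta> \<Gamma> m' \<sigma> \<circ>\<^sub>s ?a = em (fixt (tob \<sigma>) \<circ>\<^sub>t bng (curt (bob \<Gamma>) ?A ?m) \<circ>\<^sub>t pc \<Gamma> \<circ>\<^sub>t ?aa)"
    unfolding m' using ok A pcs by (intro sarr_eqI) (simp_all add: tr_simps tr_up tr_em)
  also have "pc \<Gamma> \<circ>\<^sub>t ?aa = bng ?aa \<circ>\<^sub>t x" by (rule a0(4))
  also have "bng (curt (bob \<Gamma>) ?A ?m) \<circ>\<^sub>t bng ?aa \<circ>\<^sub>t x = bng (curt (bob \<Gamma>) ?A ?m \<circ>\<^sub>t ?aa) \<circ>\<^sub>t x"
    by (rule gen[OF a0(1,2) a0(3)[unfolded pcs(2)]])
  also have "curt (bob \<Gamma>) ?A ?m \<circ>\<^sub>t ?aa = curt ?X ?A (ue f)"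
    unfolding uf using ok A by (intro curt_nat[symmetric]) simp_all
  finally have "\<Theta> \<Gamma> m' \<sigma> \<circ>\<^sub>s ?a = em (fixt (tob \<sigma>) \<circ>\<^sub>t bng (curt ?X ?A (ue f)) \<circ>\<^sub>t x)" .
  moreover have "S x e (MU ?v M) \<sigma> [] (em (fixt (tob \<sigma>) \<circ>\<^sub>t bng (curt ?X ?A (ue f)) \<circ>\<^sub>t x))"
    unfolding MU_def var_ty.simps by (intro S_mu S_close[OF S(1)[unfolded L] lc]) (auto simp: e'_def)
  ultimately show ?thesis unfolding adq_def t using f x by (intro exI[of _ "[]"] exI[of _ "em (fixt (tob \<sigma>) \<circ>\<^sub>t bng (curt ?X ?A (ue f)) \<circ>\<^sub>t x)"]) simp
qed

end

section \<open>Recovering typings from the semantics\<close>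

lemma typing_move: "P @ A @ u # B \<turnstile> M \<Colon> \<tau> \<Longrightarrow> P @ u # A @ B \<turnstile> M \<Colon> \<tau>"
proof (induction A arbitrary: P)
  case Nil
  then show ?case by simp
next
  case (Cons a A)
  from Cons.IH[of "P @ [a]"] Cons.prems have "P @ [a, u] @ (A @ B) \<turnstile> M \<Colon> \<tau>" by simp
  from T_exchange[OF this] show ?case by simp
qed

lemma typing_perm_aux: "P @ \<Gamma> \<turnstile> M \<Colon> \<tau> \<Longrightarrow> mset \<Gamma> = mset \<Gamma>' \<Longrightarrow> P @ \<Gamma>' \<turnstile> M \<Colon> \<tau>"
proof (induction \<Gamma>' arbitrary: P \<Gamma>)
  case Nil
  then show ?case by simp
next
  case (Cons u \<Gamma>')
  then have "u \<in> set \<Gamma>" by (metis list.set_intros(1) mset_eq_setD)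
  then obtain A B where \<Gamma>: "\<Gamma> = A @ u # B" by (meson split_list)
  then have "(P @ [u]) @ (A @ B) \<turnstile> M \<Colon> \<tau>" using typing_move Cons.prems by simp
  from Cons.IH[OF this] \<Gamma> Cons.prems show ?case by simp
qed

lemma typing_perm: "\<Gamma> \<turnstile> M \<Colon> \<tau> \<Longrightarrow> mset \<Gamma>' = mset \<Gamma> \<Longrightarrow> \<Gamma>' \<turnstile> M \<Colon> \<tau>"
  using typing_perm_aux[of "[]"] by simp

lemma typing_weak: "\<Gamma> \<turnstile> M \<Colon> \<tau> \<Longrightarrow> \<forall>v\<in>set G. nonlin v \<Longrightarrow> distinct (\<Gamma> @ G) \<Longrightarrow> \<Gamma> @ G \<turnstile> M \<Colon> \<tau>"
proof (induction G arbitrary: \<Gamma>)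
  case Nil
  then show ?case by simp
next
  case (Cons v G)
  have "\<Gamma> @ [v] \<turnstile> M \<Colon> \<tau>"
    using Cons.prems T_ground_weak T_stable_weak by (cases v) (auto simp: nonlin_def)
  from Cons.IH[OF this] Cons.prems show ?case by simp
qed

text \<open>Both premises of an application may use the same ground or stable variable, whereas the typing
  rule wants disjoint bases: one premise receives fresh copies, which are contracted afterwards.\<close>

fun fresh_copy :: "nat \<Rightarrow> var \<Rightarrow> var" where
  "fresh_copy n (Gnd k) = Gnd (k + n)"
| "fresh_copy n (Hov k \<sigma> \<tau>) = Hov k \<sigma> \<tau>"
| "fresh_copy n (Stb k \<sigma>) = Stb (k + n) \<sigma>"

lemma fresh_copy_simps [simp]: "nonlin (fresh_copy n v) = nonlin v" "var_ty (fresh_copy n v) = var_ty v"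
  by (cases v; simp add: nonlin_def)+

lemma fresh_copy_inj [simp]: "fresh_copy n u = fresh_copy n v \<longleftrightarrow> u = v"
  by (cases u; cases v) auto

text \<open>Adding a number above all indices that occur in the finite set moves every duplicable
  variable out of it.\<close>

lemma fresh_copy_exists: "finite F \<Longrightarrow> \<exists>n. \<forall>v. nonlin v \<longrightarrow> fresh_copy n v \<notin> F"
proof -
  assume F: "finite F"
  let ?idx = "\<lambda>v. case v of Gnd k \<Rightarrow> k | Hov k \<sigma> \<tau> \<Rightarrow> k | Stb k \<sigma> \<Rightarrow> k"
  have "\<exists>n. \<forall>v\<in>F. ?idx v < n" using finite_nat_set_iff_bounded[of "?idx ` F"] F by auto
  then obtain n where n: "\<forall>v\<in>F. ?idx v < n" by blast
  have "fresh_copy n v \<notin> F" if "nonlin v" for v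
  proof
    assume "fresh_copy n v \<in> F"
    then have "?idx (fresh_copy n v) < n" using n by blast
    then show False using that by (cases v) (auto simp: nonlin_def)
  qed
  then show ?thesis by blast
qed

lemma fresh_exists: "finite F \<Longrightarrow> \<exists>k. Gnd k \<notin> F" "finite F \<Longrightarrow> \<exists>k. Hov k \<sigma> \<tau> \<notin> F" "finite F \<Longrightarrow> \<exists>k. Stb k \<sigma> \<notin> F"
proof -
  have inf: "finite F \<Longrightarrow> inj f \<Longrightarrow> \<exists>k. f k \<notin> F" for f :: "nat \<Rightarrow> var"
    by (metis finite_subset image_subsetI infinite_UNIV_nat finite_imageD rangeI range_subsetD)
  show "finite F \<Longrightarrow> \<exists>k. Gnd k \<notin> F" by (rule inf) (auto simp: inj_def)
  show "finite F \<Longrightarrow> \<exists>k. Hov k \<sigma> \<tau> \<notin> F" by (rule inf) (auto simp: inj_def)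
  show "finite F \<Longrightarrow> \<exists>k. Stb k \<sigma> \<notin> F" by (rule inf) (auto simp: inj_def)
qed

section \<open>Contracting fresh copies and naming dangling indices\<close>

primrec fv :: "trm \<Rightarrow> var set" where
  "fv Zero = {}" | "fv Succ = {}" | "fv Pred = {}"
| "fv (Lif M L R) = fv M \<union> fv L \<union> fv R"
| "fv (Fv v) = {v}"
| "fv (Bv i) = {}"
| "fv (App M N) = fv M \<union> fv N"
| "fv (Lam \<sigma> M) = fv M"
| "fv (Mu \<sigma> M) = fv M"

lemma finite_fv [simp]: "finite (fv M)" by (induction M) auto

lemma subst_fresh: "v \<notin> fv M \<Longrightarrow> M[v::=N] = M" by (induction M) auto

lemma subst_self: "M[v::=Fv v] = M" by (induction M) auto

lemma typing_contr: "\<Gamma> @ [v, u] \<turnstile> M \<Colon> \<tau> \<Longrightarrow> nonlin v \<Longrightarrow> u = fresh_copy n v \<Longrightarrow> \<Gamma> @ [v] \<turnstile> M[u::=Fv v] \<Colon> \<tau>"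
proof -
  assume a: "\<Gamma> @ [v, u] \<turnstile> M \<Colon> \<tau>" "nonlin v" "u = fresh_copy n v"
  have d: "v \<notin> set \<Gamma>" using typing_distinct[OF a(1)] by auto
  show ?thesis
  proof (cases v)
    case (Gnd k)
    \<comment> \<open>The variable and its copy are contracted to the variable itself, so the first
      renaming of the rule is trivial.\<close>
    then show ?thesis using T_ground_contr[of \<Gamma> k "k + n" M \<tau> k] a d by (simp add: subst_self)
  next
    case (Stb k \<sigma>)
    then show ?thesis using T_stable_contr[of \<Gamma> k \<sigma> "k + n" M \<tau> k] a d by (simp add: subst_self)
  qed (use a in \<open>simp add: nonlin_def\<close>)
qed

primrec merge :: "nat \<Rightarrow> var list \<Rightarrow> trm \<Rightarrow> trm" where
  "merge n [] M = M"
| "merge n (v # G) M = merge n G (M[fresh_copy n v::=Fv v])"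

lemma typing_merge: "\<Gamma> \<turnstile> M \<Colon> \<tau> \<Longrightarrow> mset \<Gamma> = mset (\<Gamma>0 @ G @ map (fresh_copy n) G) \<Longrightarrow> \<forall>v\<in>set G. nonlin v
    \<Longrightarrow> \<Gamma>0 @ G \<turnstile> merge n G M \<Colon> \<tau>"
proof (induction G arbitrary: \<Gamma> \<Gamma>0 M)
  case Nil
  then show ?case using typing_perm by simp
next
  case (Cons v G)
  have "(\<Gamma>0 @ G @ map (fresh_copy n) G) @ [v, fresh_copy n v] \<turnstile> M \<Colon> \<tau>"
    by (rule typing_perm[OF Cons.prems(1)]) (simp add: Cons.prems(2))
  then have "(\<Gamma>0 @ G @ map (fresh_copy n) G) @ [v] \<turnstile> M[fresh_copy n v::=Fv v] \<Colon> \<tau>"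
    by (rule typing_contr) (simp_all add: Cons.prems(3))
  from Cons.IH[OF this, of "\<Gamma>0 @ [v]"] Cons.prems show ?case by simp
qed

lemma merge_App [simp]: "merge n G (App M N) = App (merge n G M) (merge n G N)"
  by (induction G arbitrary: M N) auto

lemma merge_Lif [simp]: "merge n G (Lif M L R) = Lif (merge n G M) (merge n G L) (merge n G R)"
  by (induction G arbitrary: M L R) auto

lemma merge_fresh: "\<forall>v\<in>set G. fresh_copy n v \<notin> fv M \<Longrightarrow> merge n G M = M"
  by (induction G) (auto simp: subst_fresh)

text \<open>Opens all dangling indices at once, with \<open>r\<close> naming every key of an
  environment and \<open>k\<close> counting the binders passed. The semantics enters binders without
  opening them, whereas typing needs named variables.\<close>

primrec ren :: "nat \<Rightarrow> (trm \<Rightarrow> var) \<Rightarrow> trm \<Rightarrow> trm" where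
  "ren k r Zero = Zero" | "ren k r Succ = Succ" | "ren k r Pred = Pred"
| "ren k r (Lif M L R) = Lif (ren k r M) (ren k r L) (ren k r R)"
| "ren k r (Fv v) = Fv (r (Fv v))"
| "ren k r (Bv i) = (if i < k then Bv i else Fv (r (Bv (i - k))))"
| "ren k r (App M N) = App (ren k r M) (ren k r N)"
| "ren k r (Lam \<sigma> M) = Lam \<sigma> (ren (Suc k) r M)"
| "ren k r (Mu \<sigma> M) = Mu \<sigma> (ren (Suc k) r M)"

definition bind :: "(trm \<Rightarrow> var) \<Rightarrow> var \<Rightarrow> trm \<Rightarrow> var" where
  "bind r v a = (case a of Bv 0 \<Rightarrow> v | Bv (Suc i) \<Rightarrow> r (Bv i) | _ \<Rightarrow> r a)"

lemma bind_simps [simp]: "bind r v (Fv u) = r (Fv u)" "bind r v (Bv 0) = v" "bind r v (Bv (Suc i)) = r (Bv i)"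
  by (simp_all add: bind_def)

text \<open>Naming the innermost free index by a fresh \<open>v\<close> and closing over
  \<open>v\<close> restores that index, because freshness keeps every other name distinct from
  \<open>v\<close>.\<close>

lemma ren_bind: "v \<notin> fv (ren (Suc k) r M) \<Longrightarrow> close k v (ren k (bind r v) M) = ren (Suc k) r M"
proof (induction M arbitrary: k)
  case (Bv i)
  consider "i < k" | "i = k" | j where "i = Suc (k + j)" by (meson less_imp_Suc_add linorder_cases)
  then show ?case using Bv by cases auto
qed auto

lemma ren_lc: "lc k M \<Longrightarrow> (\<And>v. r (Fv v) = v) \<Longrightarrow> ren k r M = M"
  by (induction M arbitrary: k) auto

text \<open>Contracting the copies undoes the renaming that introduced them. Freshness guarantees
  that no genuine variable is mistaken for a copy.\<close>

lemma ren_merge: "\<forall>v\<in>set G. fresh_copy n v \<notin> fv (ren k r M) \<Longrightarrow> distinct G \<Longrightarrow>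
   merge n G (ren k (\<lambda>a. if r a \<in> set G then fresh_copy n (r a) else r a) M) = ren k r M"
proof (induction G)
  case Nil
  then show ?case by simp
next
  case (Cons v G)
  have "(ren k (\<lambda>a. if r a \<in> set (v # G) then fresh_copy n (r a) else r a) M)[fresh_copy n v::=Fv v]
    = ren k (\<lambda>a. if r a \<in> set G then fresh_copy n (r a) else r a) M"
    using Cons.prems by (induction M arbitrary: k) auto
  then show ?case using Cons by simp
qed

lemma distinct_insert_block:
  "distinct (A @ B @ D) \<Longrightarrow> distinct H \<Longrightarrow> set H \<inter> set (A @ B @ D) = {} \<Longrightarrow> distinct ((A @ B) @ H @ D)"
  by auto

context sll_category
begin

text \<open>The dictionary between semantics and bases: \<open>r\<close> names keys,
  \<open>R\<close> names tokens and \<open>G\<close> lists the duplicable variables. A linear entry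
  holds exactly one token, so the tokens of a term spell out the linear part of its basis.\<close>

definition sorted_by :: "('o, 'm) env \<Rightarrow> (trm \<Rightarrow> var) \<Rightarrow> (nat \<times> 'o \<Rightarrow> var) \<Rightarrow> var list \<Rightarrow> bool" where
  "sorted_by e r R G \<longleftrightarrow> (\<forall>a \<rho> L t. e a = Some (\<rho>, L, t) \<longrightarrow> var_ty (r a) = \<rho> \<and>
     (if nonlin (r a) then L = [] \<and> r a \<in> set G else (\<exists>t. L = [t] \<and> R t = r a)))"

lemma sorted_byD: "sorted_by e r R G \<Longrightarrow> e a = Some (\<rho>, L, t) \<Longrightarrow> var_ty (r a) = \<rho> \<and>
     (if nonlin (r a) then L = [] \<and> r a \<in> set G else (\<exists>t. L = [t] \<and> R t = r a))"
  unfolding sorted_by_def by blast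

lemma sorted_by_copy: "sorted_by e r R G \<Longrightarrow> \<forall>v\<in>set G. nonlin v \<Longrightarrow>
   sorted_by e (\<lambda>a. if r a \<in> set G then fresh_copy n (r a) else r a) R (map (fresh_copy n) G)"
  unfolding sorted_by_def[of e "\<lambda>a. if r a \<in> set G then fresh_copy n (r a) else r a"]
  by (intro allI impI, drule (1) sorted_byD) (auto split: if_splits)

lemma shift_bind_cases:
  assumes "shift \<phi> new e a = Some E"
  obtains "a = Bv 0" "E = new" | b E' where "e b = Some E'" "E = \<phi> E'" "bind r v a = r b"
  using assms by (auto simp: shift_def bind_def split: trm.splits nat.splits)

lemma sorted_by_bmap: assumes "sorted_by e r R G" "nonlin v" "var_ty v = \<sigma>"
  shows "sorted_by (shift (bmap h) (\<sigma>, [], t) e) (bind r v) R (v # G)"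
  unfolding sorted_by_def
proof (intro allI impI)
  fix a \<rho> L t' assume "shift (bmap h) (\<sigma>, [], t) e a = Some (\<rho>, L, t')"
  then show "var_ty (bind r v a) = \<rho> \<and> (if nonlin (bind r v a) then L = [] \<and> bind r v a \<in> set (v # G) else (\<exists>t. L = [t] \<and> R t = bind r v a))"
  proof (cases rule: shift_bind_cases[where r = r and v = v])
    case 1
    then show ?thesis using assms by simp
  next
    case (2 b E')
    then obtain t'' where "e b = Some (\<rho>, L, t'')" by (cases E') auto
    from sorted_byD[OF assms(1) this] show ?thesis using 2 by auto
  qed
qed

lemma sorted_by_tmap: assumes "sorted_by e r R G" "\<not> nonlin v" "var_ty v = \<sigma>"
  shows "sorted_by (shift (tmap Suc) (\<sigma>, [(0, ob)], t) e) (bind r v) (\<lambda>(n, o'). case n of 0 \<Rightarrow> v | Suc m \<Rightarrow> R (m, o')) G"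
    (is "sorted_by ?e _ ?R _")
  unfolding sorted_by_def
proof (intro allI impI)
  fix a \<rho> L t' assume "?e a = Some (\<rho>, L, t')"
  then show "var_ty (bind r v a) = \<rho> \<and> (if nonlin (bind r v a) then L = [] \<and> bind r v a \<in> set G
      else (\<exists>t. L = [t] \<and> ?R t = bind r v a))"
  proof (cases rule: shift_bind_cases[where r = r and v = v])
    case 1
    then show ?thesis using assms by simp
  next
    case (2 b E')
    then obtain L' t'' where e: "e b = Some (\<rho>, L', t'')" "L = map (apfst Suc) L'" by (cases E') auto
    have R: "?R (apfst Suc u) = R u" for u by (cases u) simp
    show ?thesis
    proof (cases "nonlin (r b)")
      case True
      then show ?thesis using sorted_byD[OF assms(1) e(1)] e(2) 2 by simp
    next
      case False
      then obtain u where "L' = [u]" "R u = r b" "var_ty (r b) = \<rho>" using sorted_byD[OF assms(1) e(1)] by auto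
      then show ?thesis using False e(2) 2 R[of u] by (simp del: split_paired_Ex)
    qed
  qed
qed

text \<open>Converse to \<open>interp_S\<close>. The token list tells how the linear variables are
  shared out among the premises, while the duplicable ones in \<open>G\<close> are offered to every
  premise and those left over are weakened in.\<close>

lemma S_typing:
  "S x e M \<sigma> L f \<Longrightarrow> sorted_by e r R G \<Longrightarrow> \<forall>v\<in>set G. nonlin v \<Longrightarrow> distinct \<Gamma> \<Longrightarrow> mset \<Gamma> = mset (G @ map R L)
    \<Longrightarrow> \<Gamma> \<turnstile> ren 0 r M \<Colon> \<sigma>"
proof (induction arbitrary: r R G \<Gamma> rule: S.induct)
  have var: "\<Gamma> \<turnstile> Fv (r a) \<Colon> \<sigma>" if "e a = Some (\<sigma>, L, f)" "sorted_by e r R G" "\<forall>v\<in>set G. nonlin v" "distinct \<Gamma>" "mset \<Gamma> = mset (G @ map R L)"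
    for e :: "('o, 'm) env" and a \<sigma> L f r R G \<Gamma>
  proof -
    note s = sorted_byD[OF that(2,1)]
    have v: "[r a] \<turnstile> Fv (r a) \<Colon> \<sigma>" using s T_ground T_higher T_stable by (cases "r a") auto
    obtain G' where G': "mset \<Gamma> = mset ([r a] @ G')" "\<forall>v\<in>set G'. nonlin v"
    proof (cases "nonlin (r a)")
      case True
      then obtain A B where "G = A @ r a # B" using s by (meson split_list)
      then show ?thesis using that[of "A @ B"] s True \<open>mset \<Gamma> = _\<close> \<open>\<forall>v\<in>set G. nonlin v\<close> by simp
    next
      case False
      then show ?thesis using that[of G] s \<open>mset \<Gamma> = _\<close> \<open>\<forall>v\<in>set G. nonlin v\<close> by auto
    qed
    have "distinct ([r a] @ G')" using that(4) G'(1) by (metis mset_eq_imp_distinct_iff)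
    from typing_perm[OF typing_weak[OF v G'(2) this] G'(1)] show ?thesis .
  qed
  {
    case (S_fv e v \<sigma> L f x)
    then show ?case using var[OF S_fv] by simp
  next
    case (S_bv e i \<sigma> L f x)
    then show ?case using var[OF S_bv] by simp
  }
  have const: "\<Gamma> \<turnstile> c \<Colon> \<sigma>" if "[] \<turnstile> c \<Colon> \<sigma>" "\<forall>v\<in>set G. nonlin v" "distinct \<Gamma>" "mset \<Gamma> = mset (G @ map R [])"
    for c \<sigma> G \<Gamma> and R :: "nat \<times> 'o \<Rightarrow> var"
  proof -
    have "distinct ([] @ G)" using that(3,4) mset_eq_imp_distinct_iff by fastforce
    from typing_perm[OF typing_weak[OF that(1,2) this]] that(4) show ?thesis by simp
  qed
  {
    case (S_zero x e)
    show ?case using const[OF T_zero S_zero(2,3,4)] by simp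
  next
    case (S_succ x e)
    show ?case using const[OF T_succ S_succ(2,3,4)] by simp
  next
    case (S_pred x e)
    show ?case using const[OF T_pred S_pred(2,3,4)] by simp
  }
next
  case (S_app x e M \<sigma> \<tau> L1 f1 N L2 f2)
  obtain n where n: "\<forall>v. nonlin v \<longrightarrow> fresh_copy n v \<notin> set \<Gamma> \<union> fv (ren 0 r M) \<union> fv (ren 0 r N)"
    using fresh_copy_exists[of "set \<Gamma> \<union> fv (ren 0 r M) \<union> fv (ren 0 r N)"] by auto
  let ?r = "\<lambda>a. if r a \<in> set G then fresh_copy n (r a) else r a"
  let ?G = "map (fresh_copy n) G"
  have s: "set \<Gamma> = set (G @ map R (L1 @ L2))" using S_app.prems(4) by (rule mset_eq_setD)
  have d: "distinct (G @ map R L1 @ map R L2)" using S_app.prems(3,4) by (metis map_append mset_eq_imp_distinct_iff)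
  have d2: "distinct ((G @ map R L1) @ ?G @ map R L2)"
  proof (rule distinct_insert_block[OF d])
    show "distinct ?G" using d by (simp add: distinct_map inj_on_def)
    show "set ?G \<inter> set (G @ map R L1 @ map R L2) = {}" using n S_app.prems(2) s by auto
  qed
  have "G @ map R L1 \<turnstile> ren 0 r M \<Colon> Lolli \<sigma> \<tau>"
    using d by (intro S_app.IH(1)[OF S_app.prems(1,2)]) auto
  moreover have "?G @ map R L2 \<turnstile> ren 0 ?r N \<Colon> \<sigma>"
    using d2 S_app.prems(2) by (intro S_app.IH(2)[OF sorted_by_copy[OF S_app.prems(1,2)]]) auto
  ultimately have "(G @ map R L1) @ (?G @ map R L2) \<turnstile> App (ren 0 r M) (ren 0 ?r N) \<Colon> \<tau>"
    using d2 by (intro T_app) auto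
  from typing_merge[OF this, of "map R L1 @ map R L2" G n]
  have "(map R L1 @ map R L2) @ G \<turnstile> merge n G (App (ren 0 r M) (ren 0 ?r N)) \<Colon> \<tau>"
    using S_app.prems(2) by (simp add: ac_simps)
  \<comment> \<open>Contraction restores the original names in the argument and leaves the function
    alone, the copies being fresh for it.\<close>
  moreover have "merge n G (App (ren 0 r M) (ren 0 ?r N)) = App (ren 0 r M) (ren 0 r N)"
    using n S_app.prems(2) d by (simp add: merge_fresh ren_merge)
  ultimately show ?case using typing_perm S_app.prems(4) by (simp add: ac_simps)
next
  case (S_lif x e M L1 f1 L L2 f2 R' L3 f3)
  let ?F = "set \<Gamma> \<union> fv (ren 0 r M) \<union> fv (ren 0 r L) \<union> fv (ren 0 r R')"
  obtain n where n: "\<forall>v. nonlin v \<longrightarrow> fresh_copy n v \<notin> ?F"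
    using fresh_copy_exists[of ?F] by auto
  let ?r = "\<lambda>a. if r a \<in> set G then fresh_copy n (r a) else r a"
  let ?G = "map (fresh_copy n) G"
  have s: "set \<Gamma> = set (G @ map R (L1 @ L2))" using S_lif.prems(4) by (rule mset_eq_setD)
  have d: "distinct (G @ map R L1 @ map R L2)" using S_lif.prems(3,4) by (metis map_append mset_eq_imp_distinct_iff)
  have d2: "distinct ((G @ map R L1) @ ?G @ map R L2)"
  proof (rule distinct_insert_block[OF d])
    show "distinct ?G" using d by (simp add: distinct_map inj_on_def)
    show "set ?G \<inter> set (G @ map R L1 @ map R L2) = {}" using n S_lif.prems(2) s by auto
  qed
  have "G @ map R L1 \<turnstile> ren 0 r M \<Colon> Iota"
    using d by (intro S_lif.IH(1)[OF S_lif.prems(1,2)]) auto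
  moreover have "?G @ map R L2 \<turnstile> ren 0 ?r L \<Colon> Iota"
    using d2 S_lif.prems(2) by (intro S_lif.IH(2)[OF sorted_by_copy[OF S_lif.prems(1,2)]]) auto
  moreover have "?G @ map R L2 \<turnstile> ren 0 ?r R' \<Colon> Iota"
    using d2 S_lif.prems(2) S_lif.hyps(4) by (intro S_lif.IH(3)[OF sorted_by_copy[OF S_lif.prems(1,2)]]) auto
  ultimately have "(G @ map R L1) @ (?G @ map R L2) \<turnstile> Lif (ren 0 r M) (ren 0 ?r L) (ren 0 ?r R') \<Colon> Iota"
    using d2 by (intro T_lif) auto
  from typing_merge[OF this, of "map R L1 @ map R L2" G n]
  have "(map R L1 @ map R L2) @ G \<turnstile> merge n G (Lif (ren 0 r M) (ren 0 ?r L) (ren 0 ?r R')) \<Colon> Iota"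
    using S_lif.prems(2) by (simp add: ac_simps)
  moreover have "merge n G (Lif (ren 0 r M) (ren 0 ?r L) (ren 0 ?r R')) = Lif (ren 0 r M) (ren 0 r L) (ren 0 r R')"
    using n S_lif.prems(2) d by (simp add: merge_fresh ren_merge)
  ultimately show ?case using typing_perm S_lif.prems(4) by (simp add: ac_simps)
next
  case (S_lam_ground x e M \<tau> L f)
  obtain k where k: "Gnd k \<notin> set \<Gamma> \<union> fv (ren 1 r M)" using fresh_exists(1)[of "set \<Gamma> \<union> fv (ren 1 r M)"] by auto
  have "\<Gamma> @ [Gnd k] \<turnstile> ren 0 (bind r (Gnd k)) M \<Colon> \<tau>"
    using S_lam_ground.prems k
    by (intro S_lam_ground.IH[OF sorted_by_bmap[OF S_lam_ground.prems(1)]]) (auto simp: nonlin_def)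
  from T_lam[OF this] show ?case using ren_bind[of "Gnd k" 0 r M] k by (simp add: LAM_def stable_def)
next
  case (S_lam_higher x \<sigma> e M \<tau> A B f \<sigma>1 \<sigma>2)
  obtain k where k: "Hov k \<sigma>1 \<sigma>2 \<notin> set \<Gamma> \<union> fv (ren 1 r M)" using fresh_exists(2)[of "set \<Gamma> \<union> fv (ren 1 r M)"] by auto
  have c: "map ((\<lambda>(n, o'). case n of 0 \<Rightarrow> Hov k \<sigma>1 \<sigma>2 | Suc m \<Rightarrow> R (m, o')) \<circ> apfst Suc) X = map R X" for X
    by (rule map_cong) auto
  have "\<Gamma> @ [Hov k \<sigma>1 \<sigma>2] \<turnstile> ren 0 (bind r (Hov k \<sigma>1 \<sigma>2)) M \<Colon> \<tau>"
    using S_lam_higher.prems S_lam_higher.hyps(2) k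
    by (intro S_lam_higher.IH[OF sorted_by_tmap[OF S_lam_higher.prems(1)]]) (auto simp: nonlin_def c)
  from T_lam[OF this] show ?case
    using ren_bind[of "Hov k \<sigma>1 \<sigma>2" 0 r M] k S_lam_higher.hyps(2) by (simp add: LAM_def stable_def)
next
  case (S_mu x \<sigma> e M f)
  obtain k where k: "Stb k \<sigma> \<notin> set \<Gamma> \<union> fv (ren 1 r M)" using fresh_exists(3)[of "set \<Gamma> \<union> fv (ren 1 r M)"] by auto
  let ?g = "\<lambda>v. \<exists>k. v = Gnd k"
  \<comment> \<open>The semantics of a fixpoint consumes no tokens, so the basis is a rearrangement
    of \<open>G\<close>; the rule for fixpoints wants its ground part before its stable
    part.\<close>
  let ?A = "filter ?g G" and ?B = "filter (\<lambda>v. \<not> ?g v) G"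
  have m: "mset \<Gamma> = mset (?A @ ?B)" "mset \<Gamma> = mset G" using S_mu.prems(4) by simp_all
  have d: "distinct (?A @ ?B)" using S_mu.prems(3) m(1) by (metis mset_eq_imp_distinct_iff)
  have st: "set (?A @ ?B) = set \<Gamma>" using m(1) by (metis mset_eq_setD)
  have "?A @ ?B @ [Stb k \<sigma>] \<turnstile> ren 0 (bind r (Stb k \<sigma>)) M \<Colon> \<sigma>"
    using S_mu.prems m k d st
    by (intro S_mu.IH[OF sorted_by_bmap[OF S_mu.prems(1)]]) (auto simp: nonlin_def)
  then have "?A @ ?B \<turnstile> MU (Stb k \<sigma>) (ren 0 (bind r (Stb k \<sigma>)) M) \<Colon> \<sigma>"
  proof (rule T_mu)
    show "stable ?B" unfolding stable_def
    proof
      fix v assume v: "v \<in> set ?B"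
      then have "nonlin v" using S_mu.prems(2) by simp
      show "\<exists>k \<sigma>. v = Stb k \<sigma>"
      proof (cases v)
        case (Hov k \<sigma> \<tau>)
        then show ?thesis using \<open>nonlin v\<close> by (simp add: nonlin_def)
      qed (use v in auto)
    qed
  qed (auto simp: ground_def)
  from typing_perm[OF this m(1)] show ?case using ren_bind[of "Stb k \<sigma>" 0 r M] k by (simp add: MU_def)
qed

section \<open>Generic environments and coherence of derivations\<close>

lemma adq_nil: "\<lbrakk>S x e M \<sigma> [] f; tok e \<Gamma> = []; \<Theta> \<Gamma> m \<sigma> \<circ>\<^sub>s asm x e \<Gamma> = f; wfe x e; coal x\<rbrakk> \<Longrightarrow> adq x e \<Gamma> M \<sigma> m"
  using S_arr[of x e M \<sigma> "[]" f] by (intro adqI[where L = "[]" and f = f]) simp_all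

lemma ww_vc: "ww (vc (Gnd k)) = Tri N0 (w_N C) \<one>" "cc (vc (Gnd k)) = Tri N0 (c_N C) (N0 \<otimes> N0)"
  "ww (vc (Stb k \<sigma>)) = Tri (bang C (tob \<sigma>)) (erase C (tob \<sigma>)) \<one>"
  "cc (vc (Stb k \<sigma>)) = Tri (bang C (tob \<sigma>)) (dupl C (tob \<sigma>)) (bang C (tob \<sigma>) \<otimes> bang C (tob \<sigma>))"
  by (rule tri_eqI; simp add: vc_def cc_pt cc_digt bmor)+

lemma \<Theta>_weak: assumes "nonlin v" "ok (um \<Gamma> m \<tau>)" "ww (vc v) = Tri (var_obj C v) w \<one>"
  shows "\<Theta> (\<Gamma> @ [v]) (m \<cdot> runit C (basis_obj C \<Gamma>) \<cdot> (Id C (basis_obj C \<Gamma>) \<boxtimes> w) \<cdot> tunsnoc C (objs C \<Gamma>) (var_obj C v)) \<tau>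
    = \<Theta> \<Gamma> m \<tau> \<circ>\<^sub>s (ids (objs C \<Gamma>) \<otimes>\<^sub>s sww (vc v))"
  unfolding um_weak assms(3)[symmetric] map_append list.map sww_def
  using assms(1,2) by (intro U_weak) simp_all

lemma \<Theta>_contr: assumes "nonlin v" "ok (um (\<Gamma> @ [v1, v2]) m \<tau>)" "var_obj C v1 = var_obj C v" "var_obj C v2 = var_obj C v"
    "cc (vc v) = Tri (var_obj C v) c (var_obj C v \<otimes> var_obj C v)"
  shows "\<Theta> (\<Gamma> @ [v]) (m \<cdot> tjoin C (objs C \<Gamma>) [var_obj C v, var_obj C v]
     \<cdot> (Id C (basis_obj C \<Gamma>) \<boxtimes> ((Id C (var_obj C v) \<boxtimes> runit' C (var_obj C v)) \<cdot> c))
     \<cdot> tunsnoc C (objs C \<Gamma>) (var_obj C v)) \<tau> = \<Theta> (\<Gamma> @ [v1, v2]) m \<tau> \<circ>\<^sub>s (ids (objs C \<Gamma>) \<otimes>\<^sub>s scc (vc v))"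
proof -
  have t: "Tri (ten (objs C \<Gamma> @ [var_obj C v, var_obj C v])) m (tob \<tau>) = um (\<Gamma> @ [v1, v2]) m \<tau>"
    using assms by (simp add: um_def)
  show ?thesis unfolding um_contr t assms(5)[symmetric] map_append list.map scc_def
    using assms(1-4) U_contr[of "um (\<Gamma> @ [v1, v2]) m \<tau>" "objs C \<Gamma>" "var_obj C v" "cc (vc v)"] by simp
qed

lemma \<Theta>_var: "\<Theta> [Gnd k] (runit C N0) Iota = ids [N0]"
  "\<Theta> [Hov k \<sigma> \<tau>] (runit C (tob (Lolli \<sigma> \<tau>))) (Lolli \<sigma> \<tau>) = ids [tob (Lolli \<sigma> \<tau>)]"
  "\<Theta> [Stb k \<sigma>] (der C (tob \<sigma>) \<cdot> runit C (bang C (tob \<sigma>))) \<sigma> = em (dert (tob \<sigma>))"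
proof -
  have 1: "um [Gnd k] (runit C N0) Iota = run N0" "um [Hov k \<sigma> \<tau>] (runit C (tob (Lolli \<sigma> \<tau>))) (Lolli \<sigma> \<tau>) = run (tob (Lolli \<sigma> \<tau>))"
    by (rule tri_eqI; simp add: mor_simps)+
  show "\<Theta> [Gnd k] (runit C N0) Iota = ids [N0]" "\<Theta> [Hov k \<sigma> \<tau>] (runit C (tob (Lolli \<sigma> \<tau>))) (Lolli \<sigma> \<tau>) = ids [tob (Lolli \<sigma> \<tau>)]"
    unfolding 1 by (rule sarr_eqI; simp add: tr_up tr_simps)+
  have "um [Stb k \<sigma>] (der C (tob \<sigma>) \<cdot> runit C (bang C (tob \<sigma>))) \<sigma> = dert (tob \<sigma>) \<circ>\<^sub>t run (bang C (tob \<sigma>))"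
    by (rule tri_eqI) (simp_all add: mor_simps bmor)
  then show "\<Theta> [Stb k \<sigma>] (der C (tob \<sigma>) \<cdot> runit C (bang C (tob \<sigma>))) \<sigma> = em (dert (tob \<sigma>))"
    by (simp add: em_def)
qed

lemma interp_typing: "interp C \<Gamma> M \<sigma> m \<Longrightarrow> \<Gamma> \<turnstile> M \<Colon> \<sigma>"
  by (rule typing_iff_interp[of \<Gamma> M \<sigma> C, THEN iffD2], rule exI)

lemma interp_distinct: "interp C \<Gamma> M \<sigma> m \<Longrightarrow> distinct \<Gamma>"
  by (rule typing_distinct, rule interp_typing)

lemma interp_lc: "interp C \<Gamma> M \<sigma> m \<Longrightarrow> lc 0 M"
  by (rule typing_lc, rule interp_typing)

text \<open>Stage and environment are left arbitrary because binders extend them and contraction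
  changes the environment.\<close>

lemma interp_S: "interp C \<Gamma> M \<sigma> m \<Longrightarrow> coal x \<Longrightarrow> wfe x e \<Longrightarrow> cenv x e \<Gamma> \<Longrightarrow> distinct (tok e \<Gamma>) \<Longrightarrow> adq x e \<Gamma> M \<sigma> m"
proof (induction arbitrary: x e rule: interp.induct)
  case I_zero
  then show ?case by (intro adq_nil[OF S_zero]) (simp_all add: um_zero)
next
  case I_succ
  then show ?case by (intro adq_nil[OF S_succ]) (simp_all add: um_succ)
next
  case I_pred
  then show ?case by (intro adq_nil[OF S_pred]) (simp_all add: um_succ)
next
  case (I_lif \<Gamma> M m \<Delta> L l R r)
  note ok = interp_ok[OF I_lif(1)] interp_ok[OF I_lif(2)] interp_ok[OF I_lif(3)]
  show ?case
  proof (rule adq_lif[OF I_lif.prems ok])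
    show "\<Theta> (\<Gamma> @ \<Delta>) (lif_arr C \<cdot> (m \<boxtimes> pair C l r) \<cdot> tsplit C (objs C \<Gamma>) (objs C \<Delta>)) Iota
      = lifs \<circ>\<^sub>s (\<Theta> \<Gamma> m Iota \<otimes>\<^sub>s spair (\<Theta> \<Delta> l Iota) (\<Theta> \<Delta> r Iota))"
      unfolding um_lif map_append using ok by (subst U_lif) (simp_all add: spair_def)
  qed (use I_lif in auto)
next
  case (I_exchange \<Gamma> v u \<Delta> M \<tau> m)
  show ?case
  proof (rule adq_exchange[OF I_exchange.prems interp_ok[OF I_exchange(1)]])
    show "adq x e (\<Gamma> @ [v, u] @ \<Delta>) M \<tau> m"
      using I_exchange.prems by (intro I_exchange.IH) auto
  qed (use interp_ok[OF I_exchange(1)] in \<open>subst um_exchange, simp add: U_exchange[simplified]\<close>)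
next
  case (I_ground k)
  obtain t where e: "e (Fv (Gnd k)) = Some (Iota, [], t)" using I_ground by (auto simp: good_def nonlin_def)
  note w = wfeD[OF I_ground(2) e]
  have a: "asm x e [Gnd k] = t" "tok e [Gnd k] = []"
    using asm_single[OF I_ground(2,1), of "Gnd k"] I_ground e by (simp_all add: av_def tk_def del: asm.simps)
  show ?case using I_ground(1,2) by (intro adq_nil[OF S_fv[of e, OF e] a(2)]) (use w in \<open>simp_all only: a \<Theta>_var, simp_all\<close>)
next
  case (I_ground_weak \<Gamma> M \<tau> m k)
  note ok = interp_ok[OF I_ground_weak(1)]
  have n: "nonlin (Gnd k)" by (simp add: nonlin_def)
  show ?case
  proof (rule adq_weak[OF I_ground_weak.prems(1-3) n ok])
    show "adq x e \<Gamma> M \<tau> m" using I_ground_weak.prems by (intro I_ground_weak.IH) auto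
  qed (use \<Theta>_weak[OF n ok, of "w_N C"] in \<open>simp add: ww_vc\<close>)
next
  case (I_ground_contr \<Gamma> k1 k2 M \<tau> m k)
  note ok = interp_ok[OF I_ground_contr(1)]
  have n: "nonlin (Gnd k)" by (simp add: nonlin_def)
  show ?case
  proof (rule adq_contr[OF I_ground_contr.prems n _ _ _ _ _ _ _ _ interp_distinct[OF I_ground_contr(1)] ok I_ground_contr.IH])
    show "\<Theta> (\<Gamma> @ [Gnd k]) (m \<cdot> tjoin C (objs C \<Gamma>) [N0, N0] \<cdot> (Id C (basis_obj C \<Gamma>) \<boxtimes> ((Id C N0 \<boxtimes> runit' C N0) \<cdot> c_N C))
     \<cdot> tunsnoc C (objs C \<Gamma>) N0) \<tau> = \<Theta> (\<Gamma> @ [Gnd k1, Gnd k2]) m \<tau> \<circ>\<^sub>s (ids (objs C \<Gamma>) \<otimes>\<^sub>s scc (vc (Gnd k)))"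
      using \<Theta>_contr[OF n ok, of "c_N C"] by (simp add: ww_vc)
  qed (use I_ground_contr.prems in \<open>auto simp: vc_def nonlin_def\<close>)
next
  case (I_higher k \<sigma> \<tau>)
  obtain L t where e: "e (Fv (Hov k \<sigma> \<tau>)) = Some (Lolli \<sigma> \<tau>, L, t)" using I_higher by (auto simp: good_def)
  note w = wfeD[OF I_higher(2) e]
  have a: "asm x e [Hov k \<sigma> \<tau>] = t" "tok e [Hov k \<sigma> \<tau>] = L"
    using asm_single[OF I_higher(2,1), of "Hov k \<sigma> \<tau>"] I_higher e by (simp_all add: av_def tk_def del: asm.simps)
  show ?case by (intro adqI[OF S_fv[of e, OF e]]) (use w in \<open>simp_all only: a \<Theta>_var, simp_all add: pm_refl\<close>)
next
  case (I_app \<Gamma> M \<sigma> \<tau> m \<Delta> N n)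
  note ok = interp_ok[OF I_app(1)] interp_ok[OF I_app(2)]
  show ?case
  proof (rule adq_app[OF I_app.prems ok])
    show "\<Theta> (\<Gamma> @ \<Delta>) (ev C (tob \<sigma>) (tob \<tau>) \<cdot> (m \<boxtimes> n) \<cdot> tsplit C (objs C \<Gamma>) (objs C \<Delta>)) \<tau>
      = evs (tob \<sigma>) (tob \<tau>) \<circ>\<^sub>s (\<Theta> \<Gamma> m (Lolli \<sigma> \<tau>) \<otimes>\<^sub>s \<Theta> \<Delta> n \<sigma>)"
      unfolding um_app map_append using ok by (subst U_app) simp_all
  qed (use I_app in auto)
next
  case (I_lam \<Gamma> v M \<tau> m)
  note ok = interp_ok[OF I_lam(1)] and lc = interp_lc[OF I_lam(1)]
  have d: "v \<notin> set \<Gamma>" using interp_distinct[OF I_lam(1)] by auto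
  have eq: "\<Theta> \<Gamma> (cur C (basis_obj C \<Gamma>) (tob (var_ty v)) (tob \<tau>) (m \<cdot> tsnoc C (objs C \<Gamma>) (var_obj C v))) (Lolli (var_ty v) \<tau>)
     = scur (objs C \<Gamma>) (tob (var_ty v)) (\<Theta> (\<Gamma> @ [v]) m \<tau>)"
    unfolding um_lam[OF var_obj_lam[OF I_lam(2)]] using ok var_obj_lam[OF I_lam(2)]
      U_lam[of "um (\<Gamma> @ [v]) m \<tau>" "objs C \<Gamma>" "tob (var_ty v)"] by simp
  show ?case
  proof (cases v)
    case (Gnd k)
    show ?thesis using eq ok d I_lam.IH unfolding Gnd by (simp only: var_ty.simps) (rule adq_lam_ground[OF I_lam.prems _ lc]; simp)
  next
    case (Hov k \<sigma>1 \<sigma>2)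
    show ?thesis using eq ok d I_lam.IH[OF I_lam.prems(1)] unfolding Hov by (simp only: var_ty.simps) (rule adq_lam_higher[OF I_lam.prems refl _ lc]; simp)
  qed (use I_lam(2) in \<open>simp add: stable_def\<close>)
next
  case (I_stable k \<sigma>)
  obtain t where e: "e (Fv (Stb k \<sigma>)) = Some (\<sigma>, [], t)" using I_stable by (auto simp: good_def nonlin_def)
  note w = wfeD[OF I_stable(2) e]
  have a: "asm x e [Stb k \<sigma>] = em (bng (ue t) \<circ>\<^sub>t x)" "tok e [Stb k \<sigma>] = []"
    using asm_single[OF I_stable(2,1), of "Stb k \<sigma>"] I_stable e by (simp_all add: av_def tk_def del: asm.simps)
  \<comment> \<open>Naturality of dereliction and the counit law of the stage together undo the
    promotion contained in \<open>av\<close>.\<close>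
  have n: "dert (tob \<sigma>) \<circ>\<^sub>t bng (ue t) = ue t \<circ>\<^sub>t dert (src x)" using w by (simp add: dert_nat)
  have "dert (tob \<sigma>) \<circ>\<^sub>t bng (ue t) \<circ>\<^sub>t x = ue t"
    using w I_stable by (simp add: tail2[OF n])
  then have "em (dert (tob \<sigma>)) \<circ>\<^sub>s em (bng (ue t) \<circ>\<^sub>t x) = t"
    using w I_stable by (simp flip: em_cmp)
  then show ?case using I_stable by (intro adq_nil[OF S_fv[of e, OF e] a(2)]) (simp_all only: a \<Theta>_var)
next
  case (I_stable_weak \<Gamma> M \<tau> m k \<sigma>)
  note ok = interp_ok[OF I_stable_weak(1)]
  have n: "nonlin (Stb k \<sigma>)" by (simp add: nonlin_def)
  show ?case
  proof (rule adq_weak[OF I_stable_weak.prems(1-3) n ok])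
    show "adq x e \<Gamma> M \<tau> m" using I_stable_weak.prems by (intro I_stable_weak.IH) auto
  qed (use \<Theta>_weak[OF n ok, of "erase C (tob \<sigma>)"] in \<open>simp add: ww_vc\<close>)
next
  case (I_stable_contr \<Gamma> k1 \<sigma> k2 M \<tau> m k)
  note ok = interp_ok[OF I_stable_contr(1)]
  let ?A = "bang C (tob \<sigma>)"
  have n: "nonlin (Stb k \<sigma>)" by (simp add: nonlin_def)
  show ?case
  proof (rule adq_contr[OF I_stable_contr.prems n _ _ _ _ _ _ _ _ interp_distinct[OF I_stable_contr(1)] ok I_stable_contr.IH])
    show "\<Theta> (\<Gamma> @ [Stb k \<sigma>]) (m \<cdot> tjoin C (objs C \<Gamma>) [?A, ?A] \<cdot> (Id C (basis_obj C \<Gamma>) \<boxtimes> ((Id C ?A \<boxtimes> runit' C ?A) \<cdot> dupl C (tob \<sigma>)))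
     \<cdot> tunsnoc C (objs C \<Gamma>) ?A) \<tau> = \<Theta> (\<Gamma> @ [Stb k1 \<sigma>, Stb k2 \<sigma>]) m \<tau> \<circ>\<^sub>s (ids (objs C \<Gamma>) \<otimes>\<^sub>s scc (vc (Stb k \<sigma>)))"
      using \<Theta>_contr[OF n ok, of "dupl C (tob \<sigma>)"] by (simp add: ww_vc)
  qed (use I_stable_contr.prems in \<open>auto simp: vc_def nonlin_def\<close>)
next
  case (I_mu \<Gamma> \<Delta> k \<sigma> M m)
  note ok = interp_ok[OF I_mu(1)] and lc = interp_lc[OF I_mu(1)]
  have d: "Stb k \<sigma> \<notin> set (\<Gamma> @ \<Delta>)" using interp_distinct[OF I_mu(1)] by auto
  have n: "\<forall>v\<in>set (\<Gamma> @ \<Delta>). nonlin v" using I_mu(2,3) nonlin_ground by auto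
  show ?case
    by (rule adq_mu[OF I_mu.prems(1-3) n d lc]) (use ok I_mu.IH um_mu[OF I_mu(2,3), of \<sigma> m k] in simp_all)
qed

text \<open>The generic environment of a basis: every variable is interpreted by itself.\<close>

lemma std_env: "distinct \<Gamma> \<Longrightarrow> \<exists>x e R j. coal x \<and> wfe x e \<and> cenv x e \<Gamma> \<and> distinct (tok e \<Gamma>) \<and>
    (\<forall>v\<in>set \<Gamma>. \<not> nonlin v \<longrightarrow> (\<exists>t. tk e v = [t] \<and> R t = v)) \<and> (\<forall>a. e a \<noteq> None \<longrightarrow> a \<in> Fv ` set \<Gamma>) \<and>
    arr j \<and> dm j = objs C \<Gamma> \<and> cd j = src x # obs (tok e \<Gamma>) \<and> asm x e \<Gamma> \<circ>\<^sub>s j = ids (objs C \<Gamma>)"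
proof (induction \<Gamma>)
  case Nil
  \<comment> \<open>The empty basis uses the unit as its stage. Discarding it is the identity by
    axiom, which provides the section.\<close>
  have q: "ww qut = idt \<one>" by (rule tri_eqI) (simp_all add: ww_def mor_simps bmor erase_q_unit)
  have "sww qut \<circ>\<^sub>s up [] (idt \<one>) = ids []"
    by (rule sarr_eqI) (simp_all add: sww_def q tr_simps tr_up tr_unu)
  then show ?case
    by (intro exI[of _ qut] exI[of _ "\<lambda>_. None"] exI[of _ "\<lambda>_. undefined"] exI[of _ "up [] (idt \<one>)"])
      (simp add: wfe_def)
next
  case (Cons v \<Gamma>)
  then obtain x e R j where x: "coal x" "wfe x e" "cenv x e \<Gamma>" "distinct (tok e \<Gamma>)"
    and R: "\<forall>v\<in>set \<Gamma>. \<not> nonlin v \<longrightarrow> (\<exists>t. tk e v = [t] \<and> R t = v)" and dom: "\<forall>a. e a \<noteq> None \<longrightarrow> a \<in> Fv ` set \<Gamma>"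
    and j: "arr j" "dm j = objs C \<Gamma>" "cd j = src x # obs (tok e \<Gamma>)" "asm x e \<Gamma> \<circ>\<^sub>s j = ids (objs C \<Gamma>)" by auto
  note A = asm_simps[OF x(2,1,3)]
  let ?V = "var_obj C v" and ?t = "tok e \<Gamma>"
  show ?case
  proof (cases "nonlin v")
    case True
    let ?x = "ct (vc v) x" and ?p = "p1 (vc v) x" and ?q = "p2 (vc v) x"
    note cv = vc_simps[OF True]
    have cp: "cmor ?x (vc v) ?p" "cmor ?x x ?q" using cmor_p1 cmor_p2 cv x by auto
    \<comment> \<open>An entry of a stable variable holds an arrow into \<sigma>, so the projection
      is derelicted here; \<open>av\<close> promotes it back to the projection.\<close>
    define t where "t = em (case v of Stb k \<sigma> \<Rightarrow> dert (tob \<sigma>) \<circ>\<^sub>t ?p | _ \<Rightarrow> ?p)"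
    define e' where "e' = (map_option (bmap ?q) \<circ> e)(Fv v := Some (var_ty v, [], t))"
    have tt: "arr t" "dm t = [?V \<otimes> src x]" "cd t = [tob (var_ty v)]"
      using True x cv by (cases v; simp add: t_def nonlin_def)+
    have w: "wfe ?x e'" unfolding e'_def using wfe_bmap[OF x(2) cp(2)] tt cv by (intro wfe_upd) simp_all
    have ag: "u \<in> set \<Gamma> \<Longrightarrow> e' (Fv u) = map_option (bmap ?q) (e (Fv u))" for u using Cons.prems by (auto simp: e'_def)
    have cx: "coal ?x" using cv x by simp
    have b: "tok e' \<Gamma> = ?t" "cenv ?x e' \<Gamma>" "asm ?x e' \<Gamma> = asm x e \<Gamma> \<circ>\<^sub>s (em ?q \<otimes>\<^sub>s ids (obs ?t))"
      using asm_base[OF ag x(3) x(1) cx cp(2) x(2)] by auto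
    have g: "good ?x e' v" using True cp(1) x cv by (cases v) (auto simp: good_def e'_def t_def nonlin_def vc_def)
    have av: "av ?x e' v = em ?p"
      using True cp(1) x cv cmor_dert[of ?x "tob \<sigma>" ?p for \<sigma>] by (cases v) (auto simp: av_def e'_def t_def nonlin_def vc_def)
    have tv: "tk e' v = []" by (simp add: tk_def e'_def)
    have as: "asm ?x e' (v # \<Gamma>) = (ids [?V] \<otimes>\<^sub>s asm x e \<Gamma>) \<circ>\<^sub>s (upk ?V (src x) \<otimes>\<^sub>s ids (obs ?t))"
      using av b tens2_cons[OF x(1) cv(1) A(1,2)] cv by simp
    \<comment> \<open>The section for the larger basis applies the old section beside the new object
      and then packs this object into the stage.\<close>
    have jj: "asm ?x e' (v # \<Gamma>) \<circ>\<^sub>s (pk ?V (src x) \<otimes>\<^sub>s ids (obs ?t)) \<circ>\<^sub>s (ids [?V] \<otimes>\<^sub>s j) = ids (objs C (v # \<Gamma>))"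
    proof -
      have "(upk ?V (src x) \<otimes>\<^sub>s ids (obs ?t)) \<circ>\<^sub>s (pk ?V (src x) \<otimes>\<^sub>s ids (obs ?t)) = ids (?V # src x # obs ?t)"
        by (simp add: stens_comp)
      note n = stail[OF this]
      show ?thesis unfolding as using j A x by (simp add: n stens_comp)
    qed
    have R': "\<forall>u\<in>set (v # \<Gamma>). \<not> nonlin u \<longrightarrow> (\<exists>t. tk e' u = [t] \<and> R t = u)"
    proof (intro ballI impI)
      fix u assume u: "u \<in> set (v # \<Gamma>)" "\<not> nonlin u"
      then have "u \<in> set \<Gamma>" using True by auto
      moreover from this have "tk e' u = tk e u" using ag[of u] x(3) by (auto simp: tk_def cenv_def good_def)
      ultimately show "\<exists>t. tk e' u = [t] \<and> R t = u" using R u(2) by auto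
    qed
    have d': "\<forall>a. e' a \<noteq> None \<longrightarrow> a \<in> Fv ` set (v # \<Gamma>)"
      using dom by (auto simp: e'_def split: if_splits)
    show ?thesis
      by (intro exI[of _ ?x] exI[of _ e'] exI[of _ R] exI[of _ "(pk ?V (src x) \<otimes>\<^sub>s ids (obs ?t)) \<circ>\<^sub>s (ids [?V] \<otimes>\<^sub>s j)"] conjI)
        (use cx w g b tv x jj R' j cv d' in auto)
  next
    case False
    then obtain k \<sigma>1 \<sigma>2 where v: "v = Hov k \<sigma>1 \<sigma>2" by (cases v) (auto simp: nonlin_def)
    let ?z = "(0, ?V)"
    define e' where "e' = (map_option (tmap Suc) \<circ> e)(Fv v := Some (var_ty v, [?z], sww x \<otimes>\<^sub>s ids [?V]))"
    have w: "wfe x e'" unfolding e'_def using wfe_tmap[OF x(2)] v x by (intro wfe_upd) simp_all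
    have ag: "u \<in> set \<Gamma> \<Longrightarrow> e' (Fv u) = map_option (tmap Suc) (e (Fv u))" for u using Cons.prems by (auto simp: e'_def)
    have b: "asm x e' \<Gamma> = asm x e \<Gamma>" "tok e' \<Gamma> = map (apfst Suc) ?t" "cenv x e' \<Gamma>"
      using asm_ren[of \<Gamma> e' Suc e x, OF ag x(3)] by auto
    have g: "good x e' v" using False v by (simp add: good_def e'_def)
    have av: "av x e' v = sww x \<otimes>\<^sub>s ids [?V]" using v by (simp add: av_def e'_def)
    have tv: "tk e' v = [?z]" by (simp add: tk_def e'_def)
    have as: "asm x e' (v # \<Gamma>) = (ids [?V] \<otimes>\<^sub>s asm x e \<Gamma>) \<circ>\<^sub>s (sw [src x] [?V] \<otimes>\<^sub>s ids (obs ?t))"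
      using av b tens2_var_left[OF x(1) A(1,2)] by simp
    \<comment> \<open>A linear variable becomes a token instead of a part of the stage, so this time
      the section only moves the new object past the stage.\<close>
    have jj: "asm x e' (v # \<Gamma>) \<circ>\<^sub>s (sw [?V] [src x] \<otimes>\<^sub>s ids (obs ?t)) \<circ>\<^sub>s (ids [?V] \<otimes>\<^sub>s j) = ids (objs C (v # \<Gamma>))"
    proof -
      have "(sw [src x] [?V] \<otimes>\<^sub>s ids (obs ?t)) \<circ>\<^sub>s (sw [?V] [src x] \<otimes>\<^sub>s ids (obs ?t)) = ids (?V # src x # obs ?t)"
        by (simp add: stens_comp)
      note n = stail[OF this]
      show ?thesis unfolding as using j A x by (simp add: n stens_comp)
    qed
    let ?R = "\<lambda>(n, o'). case n of 0 \<Rightarrow> v | Suc m \<Rightarrow> R (m, o')"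
    have R': "\<forall>u\<in>set (v # \<Gamma>). \<not> nonlin u \<longrightarrow> (\<exists>t. tk e' u = [t] \<and> ?R t = u)"
    proof (intro ballI impI)
      fix u assume u: "u \<in> set (v # \<Gamma>)" "\<not> nonlin u"
      show "\<exists>t. tk e' u = [t] \<and> ?R t = u"
      proof (cases "u = v")
        case True
        then show ?thesis using tv by (intro exI[of _ ?z]) simp
      next
        case False
        then have u': "u \<in> set \<Gamma>" using u by simp
        then obtain t where t: "tk e u = [t]" "R t = u" using R u by auto
        have "tk e' u = map (apfst Suc) (tk e u)" using ag[OF u'] x(3) u' by (auto simp: tk_def cenv_def good_def)
        then show ?thesis using t by (intro exI[of _ "apfst Suc t"]) (cases t, simp)
      qed
    qed
    have inj: "inj (apfst Suc :: nat \<times> 'o \<Rightarrow> _)" by (rule injI) simp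
    have dt: "distinct (tok e' (v # \<Gamma>))"
      using x(4) b tv by (auto simp: distinct_map intro!: inj_on_subset[OF inj])
    have d': "\<forall>a. e' a \<noteq> None \<longrightarrow> a \<in> Fv ` set (v # \<Gamma>)"
      using dom by (auto simp: e'_def split: if_splits)
    show ?thesis
      by (intro exI[of _ x] exI[of _ e'] exI[of _ ?R] exI[of _ "(sw [?V] [src x] \<otimes>\<^sub>s ids (obs ?t)) \<circ>\<^sub>s (ids [?V] \<otimes>\<^sub>s j)"] conjI)
        (use w g b tv x jj R' j dt d' in auto)
  qed
qed

lemma interp_unique:
  assumes "interp C \<Gamma> M \<sigma> m" "interp C \<Gamma> M \<sigma> m'" shows "m = m'"
proof -
  obtain x e R j where x: "coal x" "wfe x e" "cenv x e \<Gamma>" "distinct (tok e \<Gamma>)"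
    and j: "arr j" "dm j = objs C \<Gamma>" "cd j = src x # obs (tok e \<Gamma>)" "asm x e \<Gamma> \<circ>\<^sub>s j = ids (objs C \<Gamma>)"
    using std_env[OF interp_distinct[OF assms(1)]] by blast
  note A = asm_simps[OF x(2,1,3)] and ok = interp_ok[OF assms(1)] interp_ok[OF assms(2)]
  obtain L f where 1: "S x e M \<sigma> L f" "\<Theta> \<Gamma> m \<sigma> \<circ>\<^sub>s asm x e \<Gamma> = f \<circ>\<^sub>s (ids [src x] \<otimes>\<^sub>s pm (tok e \<Gamma>) L)"
    using interp_S[OF assms(1) x] by (auto simp: adq_def)
  obtain L' f' where 2: "S x e M \<sigma> L' f'" "\<Theta> \<Gamma> m' \<sigma> \<circ>\<^sub>s asm x e \<Gamma> = f' \<circ>\<^sub>s (ids [src x] \<otimes>\<^sub>s pm (tok e \<Gamma>) L')"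
    using interp_S[OF assms(2) x] by (auto simp: adq_def)
  have "\<Theta> \<Gamma> m \<sigma> \<circ>\<^sub>s asm x e \<Gamma> = \<Theta> \<Gamma> m' \<sigma> \<circ>\<^sub>s asm x e \<Gamma>" using S_det[OF 1(1) 2(1)] 1(2) 2(2) by simp
  then have "\<Theta> \<Gamma> m \<sigma> = \<Theta> \<Gamma> m' \<sigma>"
    by (rule s_epi_cancel[where j = j]) (use j A ok in simp_all)
  then have "um \<Gamma> m \<sigma> = um \<Gamma> m' \<sigma>" by (rule up_inj) (use ok in simp_all)
  then show ?thesis by (simp add: um_def)
qed

lemma den_eq: "interp C \<Gamma> M \<sigma> m \<Longrightarrow> den C \<Gamma> M \<sigma> = m"
  unfolding den_def using interp_unique by blast

section \<open>Substitution\<close>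

definition std :: "var list \<Rightarrow> ('o, 'm) tri \<Rightarrow> ('o, 'm) env \<Rightarrow> bool" where
  "std \<Gamma> x e \<longleftrightarrow> coal x \<and> wfe x e \<and> cenv x e \<Gamma> \<and> distinct (tok e \<Gamma>) \<and> distinct \<Gamma> \<and>
    (\<exists>R. \<forall>v\<in>set \<Gamma>. \<not> nonlin v \<longrightarrow> (\<exists>t. tk e v = [t] \<and> R t = v)) \<and> (\<forall>a. e a \<noteq> None \<longrightarrow> a \<in> Fv ` set \<Gamma>) \<and>
    (\<exists>j. arr j \<and> dm j = objs C \<Gamma> \<and> cd j = src x # obs (tok e \<Gamma>) \<and> asm x e \<Gamma> \<circ>\<^sub>s j = ids (objs C \<Gamma>))"

lemma std_exists: "distinct \<Gamma> \<Longrightarrow> \<exists>x e. std \<Gamma> x e"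
  unfolding std_def using std_env[of \<Gamma>] by blast

lemma stdD: "std \<Gamma> x e \<Longrightarrow> coal x" "std \<Gamma> x e \<Longrightarrow> wfe x e" "std \<Gamma> x e \<Longrightarrow> cenv x e \<Gamma>" "std \<Gamma> x e \<Longrightarrow> distinct (tok e \<Gamma>)"
  by (auto simp: std_def)

text \<open>In a generic environment each linear variable owns its own token, so consuming exactly
  the tokens of the basis means using every linear variable exactly once.\<close>

lemma std_typing:
  assumes "std \<Gamma> x e" "S x e M \<sigma> L f" "mset L = mset (tok e \<Gamma>)" "lc 0 M"
  shows "\<Gamma> \<turnstile> M \<Colon> \<sigma>"
proof -
  obtain R where R: "\<forall>v\<in>set \<Gamma>. \<not> nonlin v \<longrightarrow> (\<exists>t. tk e v = [t] \<and> R t = v)" using assms(1) by (auto simp: std_def)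
  \<comment> \<open>The value for other keys is a dummy: generic environments are defined on named
    variables only, and \<open>lc 0 M\<close> excludes dangling indices.\<close>
  define r where "r a = (case a of Fv v \<Rightarrow> v | _ \<Rightarrow> Gnd 0)" for a
  have g: "\<forall>v\<in>set \<Gamma>. good x e v" and dom: "\<forall>a. e a \<noteq> None \<longrightarrow> a \<in> Fv ` set \<Gamma>" and d: "distinct \<Gamma>"
    using assms(1) by (auto simp: std_def cenv_def)
  have "sorted_by e r R (filter nonlin \<Gamma>)" unfolding sorted_by_def
  proof (intro allI impI)
    fix a \<rho> L t assume a: "e a = Some (\<rho>, L, t)"
    then obtain v where v: "a = Fv v" "v \<in> set \<Gamma>" using dom by blast
    have "var_ty v = \<rho> \<and> (nonlin v \<longrightarrow> L = [])" "tk e v = L" using g v a by (auto simp: good_def tk_def)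
    then show "var_ty (r a) = \<rho> \<and> (if nonlin (r a) then L = [] \<and> r a \<in> set (filter nonlin \<Gamma>) else (\<exists>t. L = [t] \<and> R t = r a))"
      using R v by (auto simp: r_def)
  qed
  moreover have "map R (tok e \<Gamma>) = filter (\<lambda>v. \<not> nonlin v) \<Gamma>"
    using R g by (induction \<Gamma>) (auto simp: good_def tk_def)
  then have "mset (map R L) = mset (filter (\<lambda>v. \<not> nonlin v) \<Gamma>)" using assms(3) by (metis mset_map)
  then have "mset \<Gamma> = mset (filter nonlin \<Gamma> @ map R L)" by (simp del: mset_map)
  ultimately have "\<Gamma> \<turnstile> ren 0 r M \<Colon> \<sigma>"
    using d by (intro S_typing[OF assms(2)]) auto
  then show ?thesis using ren_lc[OF assms(4), of r] by (simp add: r_def)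
qed

text \<open>Common core of the three substitutions. \<open>M\<close> lives over \<Gamma>', which
  contains the replaced variable, and its environment \<open>e'\<close> gives that variable the
  value of the substituted term. The arrow \<open>\<theta>\<close> expresses the values of \<Gamma>'
  through those of \<Gamma>; the typing of \<open>M'\<close> comes from its semantics.\<close>

lemma subst_den:
  assumes m: "interp C \<Gamma>' M \<sigma> m" and st: "std \<Gamma> x e"
    and e': "wfe x e'" "cenv x e' \<Gamma>'" "distinct (tok e' \<Gamma>')" "mset (tok e \<Gamma>) = mset (tok e' \<Gamma>')"
    and \<theta>: "arr \<theta>" "dm \<theta> = objs C \<Gamma>" "cd \<theta> = objs C \<Gamma>'"
      "asm x e' \<Gamma>' \<circ>\<^sub>s (ids [src x] \<otimes>\<^sub>s pm (tok e \<Gamma>) (tok e' \<Gamma>')) = \<theta> \<circ>\<^sub>s asm x e \<Gamma>"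
    and sub: "\<And>L f. S x e' M \<sigma> L f \<Longrightarrow> S x e M' \<sigma> L f" and lc: "lc 0 M'"
  shows "\<Gamma> \<turnstile> M' \<Colon> \<sigma> \<and> ok (um \<Gamma> (den C \<Gamma> M' \<sigma>) \<sigma>) \<and> \<Theta> \<Gamma> (den C \<Gamma> M' \<sigma>) \<sigma> = \<Theta> \<Gamma>' m \<sigma> \<circ>\<^sub>s \<theta>"
proof -
  note x = stdD[OF st]
  let ?t = "tok e \<Gamma>" and ?t' = "tok e' \<Gamma>'"
  obtain L f where S: "S x e' M \<sigma> L f" "mset ?t' = mset L" "\<Theta> \<Gamma>' m \<sigma> \<circ>\<^sub>s asm x e' \<Gamma>' = f \<circ>\<^sub>s (ids [src x] \<otimes>\<^sub>s pm ?t' L)"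
    using interp_S[OF m x(1) e'(1-3)] by (auto simp: adq_def)
  have S': "S x e M' \<sigma> L f" by (rule sub[OF S(1)])
  have ty: "\<Gamma> \<turnstile> M' \<Colon> \<sigma>" using S(2) e'(4) by (intro std_typing[OF st S' _ lc]) simp
  then obtain m' where m': "interp C \<Gamma> M' \<sigma> m'" using typing_iff_interp[of \<Gamma> M' \<sigma> C] by auto
  obtain L' f' where S2: "S x e M' \<sigma> L' f'" "\<Theta> \<Gamma> m' \<sigma> \<circ>\<^sub>s asm x e \<Gamma> = f' \<circ>\<^sub>s (ids [src x] \<otimes>\<^sub>s pm ?t L')"
    using interp_S[OF m' x] by (auto simp: adq_def)
  have S3: "\<Theta> \<Gamma> m' \<sigma> \<circ>\<^sub>s asm x e \<Gamma> = f \<circ>\<^sub>s (ids [src x] \<otimes>\<^sub>s pm ?t L)" using S_det[OF S' S2(1)] S2(2) by simp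
  note ok = interp_ok[OF m] interp_ok[OF m']
  note A = asm_simps[OF x(2,1,3)] asm_simps[OF e'(1) x(1) e'(2)]
  note p = pm_arr[OF S(2)] pm_arr[OF e'(4)] and f = S_arr[OF S' x(2,1)]
  have pp: "pm ?t' L \<circ>\<^sub>s pm ?t ?t' = pm ?t L" by (rule pm_comp[OF e'(4) S(2) x(4)])
  have "\<Theta> \<Gamma> m' \<sigma> \<circ>\<^sub>s asm x e \<Gamma> = f \<circ>\<^sub>s (ids [src x] \<otimes>\<^sub>s pm ?t' L) \<circ>\<^sub>s (ids [src x] \<otimes>\<^sub>s pm ?t ?t')"
    unfolding S3 pp[symmetric] using p by (simp add: stens_comp)
  also have "\<dots> = (\<Theta> \<Gamma>' m \<sigma> \<circ>\<^sub>s asm x e' \<Gamma>') \<circ>\<^sub>s (ids [src x] \<otimes>\<^sub>s pm ?t ?t')"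
    unfolding S(3) using p f by (intro scomp_assoc[symmetric]) simp_all
  also have "\<dots> = \<Theta> \<Gamma>' m \<sigma> \<circ>\<^sub>s (\<theta> \<circ>\<^sub>s asm x e \<Gamma>)"
    unfolding \<theta>(4)[symmetric] using p A ok by (intro scomp_assoc) simp_all
  also have "\<dots> = (\<Theta> \<Gamma>' m \<sigma> \<circ>\<^sub>s \<theta>) \<circ>\<^sub>s asm x e \<Gamma>"
    using A ok \<theta> by (intro scomp_assoc[symmetric]) simp_all
  finally have eq: "\<Theta> \<Gamma> m' \<sigma> \<circ>\<^sub>s asm x e \<Gamma> = (\<Theta> \<Gamma>' m \<sigma> \<circ>\<^sub>s \<theta>) \<circ>\<^sub>s asm x e \<Gamma>" .
  obtain j where j: "arr j" "dm j = objs C \<Gamma>" "cd j = src x # obs ?t" "asm x e \<Gamma> \<circ>\<^sub>s j = ids (objs C \<Gamma>)"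
    using st by (auto simp: std_def)
  have "\<Theta> \<Gamma> m' \<sigma> = \<Theta> \<Gamma>' m \<sigma> \<circ>\<^sub>s \<theta>"
    by (rule s_epi_cancel[OF eq, where j = j]) (use j A ok \<theta> in simp_all)
  then show ?thesis using ty ok(2) den_eq[OF m'] by simp
qed

section \<open>The composites of the theorem as list arrows, and numerals\<close>

lemma U_num: assumes "ok m" "src m = ten (as @ [A] @ bs)" "ok n" "src n = \<one>" "tgt n = A"
  shows "up (as @ bs) (m \<circ>\<^sub>t J as ([A] @ bs) \<circ>\<^sub>t (idt (ten as) \<otimes>\<^sub>t (n \<otimes>\<^sub>t idt (ten bs))) \<circ>\<^sub>t (idt (ten as) \<otimes>\<^sub>t lun' (ten bs)) \<circ>\<^sub>t J' as bs)
    = up (as @ [A] @ bs) m \<circ>\<^sub>s (ids as \<otimes>\<^sub>s up [] n \<otimes>\<^sub>s ids bs)"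
  using assms by (intro sarr_eqI) (simp_all add: tr_simps tr_up tns_cmp_tail)

lemma U_cut: assumes "ok m" "src m = ten (as @ [A])" "ok n" "src n = ten bs" "tgt n = A"
  shows "up (as @ bs) (m \<circ>\<^sub>t J as [A] \<circ>\<^sub>t (idt (ten as) \<otimes>\<^sub>t run' A) \<circ>\<^sub>t (idt (ten as) \<otimes>\<^sub>t n) \<circ>\<^sub>t J' as bs)
    = up (as @ [A]) m \<circ>\<^sub>s (ids as \<otimes>\<^sub>s up bs n)"
  using assms by (intro sarr_eqI) (simp_all add: tr_simps tr_up tns_cmp_tail)

definition "numt n = Tri \<one> (numeral_arr C n) N0"

text \<open>Zero and successor are coalgebra morphisms by axiom, hence so are all numerals. This
  qualifies them as values of ground variables.\<close>

lemma cmor_numt: "cmor qut pt (numt n)"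
proof (induction n)
  case 0
  show ?case using zero_coalgebra_mor
    by (auto simp: cmor_def coalgebra_mor_def numt_def intro!: tri_eqI simp: mor_simps bmor mor_pt)
next
  case (Suc n)
  have s: "cmor pt pt succt" using succ_coalgebra_mor
    by (auto simp: cmor_def coalgebra_mor_def succt_def intro!: tri_eqI simp: mor_simps bmor mor_pt)
  have "numt (Suc n) = succt \<circ>\<^sub>t numt n" by (rule tri_eqI) (simp_all add: numt_def succt_def mor_simps)
  then show ?case using cmor_cmp[OF Suc s] by simp
qed

lemma numt_simps [simp]: "src (numt n) = \<one>" "tgt (numt n) = N0" "ok (numt n)" "mor (numt n) = numeral_arr C n"
  using cmorD[OF cmor_numt[of n]] by (simp_all add: numt_def)

text \<open>The numeral term applies the curried successor over and over; evaluation cancels the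
  currying, and the units that appear are removed by naturality.\<close>

lemma interp_numeral: "interp C [] (numeral_trm n) Iota (numeral_arr C n)"
proof (induction n)
  case 0
  show ?case by (simp add: I_zero)
next
  case (Suc n)
  have n: "lun N0 \<circ>\<^sub>t (idt \<one> \<otimes>\<^sub>t numt n) = numt n \<circ>\<^sub>t lun \<one>" by (simp add: lun_nat)
  have "evt N0 N0 \<circ>\<^sub>t (curt \<one> N0 (succt \<circ>\<^sub>t lun N0) \<otimes>\<^sub>t numt n) \<circ>\<^sub>t lun' \<one>
    = (evt N0 N0 \<circ>\<^sub>t (curt \<one> N0 (succt \<circ>\<^sub>t lun N0) \<otimes>\<^sub>t idt N0)) \<circ>\<^sub>t (idt \<one> \<otimes>\<^sub>t numt n) \<circ>\<^sub>t lun' \<one>"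
    by (simp add: tns_cmp_tail)
  also have "\<dots> = succt \<circ>\<^sub>t (lun N0 \<circ>\<^sub>t (idt \<one> \<otimes>\<^sub>t numt n)) \<circ>\<^sub>t lun' \<one>" by (simp add: evt_curt)
  also have "\<dots> = succt \<circ>\<^sub>t numt n" unfolding n by simp
  finally have "mor (evt N0 N0 \<circ>\<^sub>t (curt \<one> N0 (succt \<circ>\<^sub>t lun N0) \<otimes>\<^sub>t numt n) \<circ>\<^sub>t lun' \<one>) = mor (succt \<circ>\<^sub>t numt n)" by simp
  then have eq: "ev C N0 N0 \<cdot> (cur C \<one> N0 N0 (succ_arr C \<cdot> lunit C N0) \<boxtimes> numeral_arr C n) \<cdot> lunit' C \<one> = numeral_arr C (Suc n)"
    by (simp add: mor_simps evt_def curt_def succt_def)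
  have "interp C ([] @ []) (App Succ (numeral_trm n)) Iota (ev C (tob Iota) (tob Iota) \<cdot> (cur C \<one> N0 N0 (succ_arr C \<cdot> lunit C N0) \<boxtimes> numeral_arr C n) \<cdot> tsplit C (objs C []) (objs C []))"
    by (rule I_app[OF I_succ Suc]) simp
  then show ?case using eq by simp
qed

lemma lc_subst_lc: "lc 0 M \<Longrightarrow> lc 0 N \<Longrightarrow> lc 0 (M[v::=N])"
  by (rule lc_subst) (auto intro: lc_mono)

lemma cenv_upd: "v \<notin> set \<Gamma> \<Longrightarrow> cenv x (e(Fv v := E)) \<Gamma> = cenv x e \<Gamma>"
  "v \<notin> set \<Gamma> \<Longrightarrow> asm x (e(Fv v := E)) \<Gamma> = asm x e \<Gamma>" "v \<notin> set \<Gamma> \<Longrightarrow> tok (e(Fv v := E)) \<Gamma> = tok e \<Gamma>"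
  by (intro asm_cong; auto)+

lemma subst_numeral:
  assumes "\<Gamma> @ [Gnd k] @ \<Delta> \<turnstile> M \<Colon> \<sigma>"
  shows "\<Gamma> @ \<Delta> \<turnstile> M[Gnd k ::= numeral_trm n] \<Colon> \<sigma> \<and>
    den C (\<Gamma> @ \<Delta>) (M[Gnd k ::= numeral_trm n]) \<sigma>
      = den C (\<Gamma> @ [Gnd k] @ \<Delta>) M \<sigma>
        \<cdot> tjoin C (objs C \<Gamma>) (objs C ([Gnd k] @ \<Delta>))
        \<cdot> (Id C (basis_obj C \<Gamma>) \<boxtimes> (numeral_arr C n \<boxtimes> Id C (basis_obj C \<Delta>)))
        \<cdot> (Id C (basis_obj C \<Gamma>) \<boxtimes> lunit' C (basis_obj C \<Delta>))
        \<cdot> tsplit C (objs C \<Gamma>) (objs C \<Delta>)"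
proof -
  let ?v = "Gnd k" and ?M = "M[Gnd k ::= numeral_trm n]"
  obtain m where m: "interp C (\<Gamma> @ [?v] @ \<Delta>) M \<sigma> m" using assms typing_iff_interp[of _ M \<sigma> C] by blast
  note d = interp_distinct[OF m] and ok = interp_ok[OF m]
  obtain x e where st: "std (\<Gamma> @ \<Delta>) x e" using std_exists[of "\<Gamma> @ \<Delta>"] d by auto
  note x = stdD[OF st]
  \<comment> \<open>The numeral takes nothing from the stage, which is discarded. Being composed of
    coalgebra morphisms, it is an admissible ground value.\<close>
  define g where "g = up [] (numt n) \<circ>\<^sub>s sww x"
  define e' where "e' = e(Fv ?v := Some (Iota, [], g))"
  have g: "arr g" "dm g = [src x]" "cd g = [N0]" using x by (simp_all add: g_def)
  have w: "wfe x e'" unfolding e'_def using x g by (intro wfe_upd) simp_all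
  have c: "cenv x e \<Gamma>" "cenv x e \<Delta>" using x by auto
  have b: "cenv x e' \<Xi> = cenv x e \<Xi>" "asm x e' \<Xi> = asm x e \<Xi>" "tok e' \<Xi> = tok e \<Xi>" if "?v \<notin> set \<Xi>" for \<Xi>
    unfolding e'_def by (rule cenv_upd[OF that])+
  have ug: "ue g = numt n \<circ>\<^sub>t ww x" using x by (simp add: g_def ue_def dn_scomp tr_simps sww_def tr_unu tr_em)
  have gd: "good x e' ?v" using cmor_cmp[OF cmor_ww[OF x(1)] cmor_numt] x by (simp add: good_def e'_def ug)
  have av: "av x e' ?v = g" "tk e' ?v = []" by (simp_all add: av_def tk_def e'_def)
  have ce: "cenv x e' (\<Gamma> @ [?v] @ \<Delta>)" using b c d gd by simp
  have tt: "tok e' (\<Gamma> @ [?v] @ \<Delta>) = tok e (\<Gamma> @ \<Delta>)" using b d av by simp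
  let ?\<theta> = "ids (objs C \<Gamma>) \<otimes>\<^sub>s up [] (numt n) \<otimes>\<^sub>s ids (objs C \<Delta>)"
  note A = asm_simps[OF x(2,1) c(1)] asm_simps[OF x(2,1) c(2)]
  have as: "asm x e' (\<Gamma> @ [?v] @ \<Delta>) = ?\<theta> \<circ>\<^sub>s asm x e (\<Gamma> @ \<Delta>)"
  proof -
    have "asm x e' (\<Gamma> @ [?v] @ \<Delta>) = tens2 x (asm x e \<Gamma>) (tens2 x g (asm x e \<Delta>))"
      using asm_append[OF w x(1), of \<Gamma> "[?v] @ \<Delta>"] ce b d av by simp
    also have "tens2 x g (asm x e \<Delta>) = (up [] (numt n) \<otimes>\<^sub>s ids (objs C \<Delta>)) \<circ>\<^sub>s tens2 x (sww x) (asm x e \<Delta>)"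
      unfolding g_def using x A tens2_comp[of x "sww x" "asm x e \<Delta>" "[]" "obs (tok e \<Delta>)" "up [] (numt n)" "ids (objs C \<Delta>)"] by simp
    also have "tens2 x (sww x) (asm x e \<Delta>) = asm x e \<Delta>" using x A by (simp add: tens2_unit_left)
    also have "tens2 x (asm x e \<Gamma>) ((up [] (numt n) \<otimes>\<^sub>s ids (objs C \<Delta>)) \<circ>\<^sub>s asm x e \<Delta>) = ?\<theta> \<circ>\<^sub>s tens2 x (asm x e \<Gamma>) (asm x e \<Delta>)"
      using x A tens2_comp[of x "asm x e \<Gamma>" "asm x e \<Delta>" "obs (tok e \<Gamma>)" "obs (tok e \<Delta>)" "ids (objs C \<Gamma>)" "up [] (numt n) \<otimes>\<^sub>s ids (objs C \<Delta>)"] by simp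
    finally show ?thesis using asm_append[OF x(2,1) c] by simp
  qed
  \<comment> \<open>\<open>interp_S\<close> at the empty basis both provides a value for the numeral
    term and identifies it with \<open>g\<close>.\<close>
  have Sn: "S x e (numeral_trm n) Iota [] g"
  proof -
    have "adq x e [] (numeral_trm n) Iota (numeral_arr C n)" using x by (intro interp_S[OF interp_numeral]) auto
    then obtain f where f: "S x e (numeral_trm n) Iota [] f" "\<Theta> [] (numeral_arr C n) Iota \<circ>\<^sub>s sww x = f \<circ>\<^sub>s ids [src x]"
      by (auto simp: adq_def)
    have "um [] (numeral_arr C n) Iota = numt n" by (rule tri_eqI) simp_all
    then have "g = f" using f S_arr[OF f(1) x(2,1)] by (simp add: g_def)
    then show ?thesis using f(1) by simp
  qed
  have lcn: "lc 0 (numeral_trm n)" by (induction n) auto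
  have key: "\<Gamma> @ \<Delta> \<turnstile> ?M \<Colon> \<sigma> \<and> ok (um (\<Gamma> @ \<Delta>) (den C (\<Gamma> @ \<Delta>) ?M \<sigma>) \<sigma>) \<and> \<Theta> (\<Gamma> @ \<Delta>) (den C (\<Gamma> @ \<Delta>) ?M \<sigma>) \<sigma> = \<Theta> (\<Gamma> @ [?v] @ \<Delta>) m \<sigma> \<circ>\<^sub>s ?\<theta>"
  proof (rule subst_den[OF m st w ce])
    show "distinct (tok e' (\<Gamma> @ [?v] @ \<Delta>))" "mset (tok e (\<Gamma> @ \<Delta>)) = mset (tok e' (\<Gamma> @ [?v] @ \<Delta>))" unfolding tt using x by simp_all
    show "asm x e' (\<Gamma> @ [?v] @ \<Delta>) \<circ>\<^sub>s (ids [src x] \<otimes>\<^sub>s pm (tok e (\<Gamma> @ \<Delta>)) (tok e' (\<Gamma> @ [?v] @ \<Delta>))) = ?\<theta> \<circ>\<^sub>s asm x e (\<Gamma> @ \<Delta>)"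
      unfolding tt as pm_refl using asm_simps[OF x(2,1,3)] by simp
    show "S x e' M \<sigma> L f \<Longrightarrow> S x e ?M \<sigma> L f" for L f
      by (rule S_subst[OF _ e'_def Sn lcn x(1,2)])
  qed (use lc_subst_lc[OF interp_lc[OF m] lcn] in simp_all)
  let ?r = "um (\<Gamma> @ [?v] @ \<Delta>) m \<sigma> \<circ>\<^sub>t J (objs C \<Gamma>) ([N0] @ objs C \<Delta>) \<circ>\<^sub>t (idt (bob \<Gamma>) \<otimes>\<^sub>t (numt n \<otimes>\<^sub>t idt (bob \<Delta>)))
     \<circ>\<^sub>t (idt (bob \<Gamma>) \<otimes>\<^sub>t lun' (bob \<Delta>)) \<circ>\<^sub>t J' (objs C \<Gamma>) (objs C \<Delta>)"
  have "\<Theta> (\<Gamma> @ [?v] @ \<Delta>) m \<sigma> \<circ>\<^sub>s ?\<theta> = up (objs C \<Gamma> @ objs C \<Delta>) ?r"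
    using ok by (subst U_num) simp_all
  with key have "up (objs C \<Gamma> @ objs C \<Delta>) (um (\<Gamma> @ \<Delta>) (den C (\<Gamma> @ \<Delta>) ?M \<sigma>) \<sigma>) = up (objs C \<Gamma> @ objs C \<Delta>) ?r" by simp
  then have "um (\<Gamma> @ \<Delta>) (den C (\<Gamma> @ \<Delta>) ?M \<sigma>) \<sigma> = ?r"
    by (rule up_inj) (use key ok in simp_all)
  then have "mor (um (\<Gamma> @ \<Delta>) (den C (\<Gamma> @ \<Delta>) ?M \<sigma>) \<sigma>) = mor ?r" by simp
  then show ?thesis using key den_eq[OF m] by (simp add: mor_simps mor_J basis_obj_def)
qed

text \<open>Shared by the higher-order and the stable case, where the variable is last in the basis.
  The arrow \<open>n\<close> expresses the value of \<open>v\<close> through \<Delta>: it is the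
  interpretation of the substituted term for a linear variable and its promotion for a stable
  one.\<close>

lemma subst_cut:
  assumes m: "interp C (\<Gamma> @ [v]) M \<tau> m" and st: "std (\<Gamma> @ \<Delta>) x e"
    and N: "S x e N (var_ty v) L g" "mset (tok e \<Delta>) = mset L" "lc 0 N"
    and e': "e' = e(Fv v := Some (var_ty v, L, g))" and gd: "good x e' v"
    and n: "ok n" "src n = bob \<Delta>" "tgt n = var_obj C v" "av x e' v \<circ>\<^sub>s (ids [src x] \<otimes>\<^sub>s pm (tok e \<Delta>) L) = up (objs C \<Delta>) n \<circ>\<^sub>s asm x e \<Delta>"
  shows "\<Gamma> @ \<Delta> \<turnstile> M[v ::= N] \<Colon> \<tau> \<and> den C (\<Gamma> @ \<Delta>) (M[v ::= N]) \<tau>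
      = den C (\<Gamma> @ [v]) M \<tau> \<cdot> tsnoc C (objs C \<Gamma>) (var_obj C v) \<cdot> (Id C (basis_obj C \<Gamma>) \<boxtimes> mor n) \<cdot> tsplit C (objs C \<Gamma>) (objs C \<Delta>)"
proof -
  let ?M = "M[v ::= N]"
  note d = interp_distinct[OF m] and ok = interp_ok[OF m] and x = stdD[OF st]
  have c: "cenv x e \<Gamma>" "cenv x e \<Delta>" using x by auto
  note g = S_arr[OF N(1) x(2,1)]
  have w: "wfe x e'" unfolding e' using x g by (intro wfe_upd) simp_all
  have b: "cenv x e' \<Gamma> = cenv x e \<Gamma>" "asm x e' \<Gamma> = asm x e \<Gamma>" "tok e' \<Gamma> = tok e \<Gamma>"
    unfolding e' using d by (intro cenv_upd, simp)+
  have tv: "tk e' v = L" by (simp add: tk_def e')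
  have ce: "cenv x e' (\<Gamma> @ [v])" using b c d gd by simp
  have tt: "tok e' (\<Gamma> @ [v]) = tok e \<Gamma> @ L" using b d tv by simp
  note p = pm_arr[OF N(2)] and A = asm_simps[OF x(2,1) c(1)] asm_simps[OF x(2,1) c(2)] and av = av_simps[OF w x(1) gd]
  have pmt: "pm (tok e (\<Gamma> @ \<Delta>)) (tok e \<Gamma> @ L) = ids (obs (tok e \<Gamma>)) \<otimes>\<^sub>s pm (tok e \<Delta>) L"
    using x(4) N(2) by (simp add: pm_tens pm_refl)
  let ?\<theta> = "ids (objs C \<Gamma>) \<otimes>\<^sub>s up (objs C \<Delta>) n"
  have as: "asm x e' (\<Gamma> @ [v]) \<circ>\<^sub>s (ids [src x] \<otimes>\<^sub>s pm (tok e (\<Gamma> @ \<Delta>)) (tok e \<Gamma> @ L)) = ?\<theta> \<circ>\<^sub>s asm x e (\<Gamma> @ \<Delta>)"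
  proof -
    have "asm x e' (\<Gamma> @ [v]) = tens2 x (asm x e \<Gamma>) (av x e' v)"
      using asm_append[OF w x(1), of \<Gamma> "[v]"] ce b d asm_single[OF w x(1) gd] by simp
    then have "asm x e' (\<Gamma> @ [v]) \<circ>\<^sub>s (ids [src x] \<otimes>\<^sub>s pm (tok e (\<Gamma> @ \<Delta>)) (tok e \<Gamma> @ L))
      = tens2 x (asm x e \<Gamma>) (av x e' v) \<circ>\<^sub>s (ids [src x] \<otimes>\<^sub>s ids (obs (tok e \<Gamma>)) \<otimes>\<^sub>s pm (tok e \<Delta>) L)"
      unfolding pmt by simp
    also have "\<dots> = tens2 x (asm x e \<Gamma> \<circ>\<^sub>s (ids [src x] \<otimes>\<^sub>s ids (obs (tok e \<Gamma>)))) (av x e' v \<circ>\<^sub>s (ids [src x] \<otimes>\<^sub>s pm (tok e \<Delta>) L))"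
      using x A av tv p by (intro tens2_pre) simp_all
    also have "\<dots> = tens2 x (ids (objs C \<Gamma>) \<circ>\<^sub>s asm x e \<Gamma>) (up (objs C \<Delta>) n \<circ>\<^sub>s asm x e \<Delta>)"
      unfolding n(4) using A by simp
    also have "\<dots> = ?\<theta> \<circ>\<^sub>s tens2 x (asm x e \<Gamma>) (asm x e \<Delta>)"
      using x A n by (intro tens2_comp[symmetric]) simp_all
    finally show ?thesis using asm_append[OF x(2,1) c] by simp
  qed
  have key: "\<Gamma> @ \<Delta> \<turnstile> ?M \<Colon> \<tau> \<and> ok (um (\<Gamma> @ \<Delta>) (den C (\<Gamma> @ \<Delta>) ?M \<tau>) \<tau>) \<and> \<Theta> (\<Gamma> @ \<Delta>) (den C (\<Gamma> @ \<Delta>) ?M \<tau>) \<tau> = \<Theta> (\<Gamma> @ [v]) m \<tau> \<circ>\<^sub>s ?\<theta>"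
  proof (rule subst_den[OF m st w ce])
    have "mset (tok e (\<Gamma> @ \<Delta>)) = mset (tok e \<Gamma> @ L)" using N(2) by simp
    then show "mset (tok e (\<Gamma> @ \<Delta>)) = mset (tok e' (\<Gamma> @ [v]))" "distinct (tok e' (\<Gamma> @ [v]))" unfolding tt
      using x(4) mset_eq_imp_distinct_iff by metis+
    show "asm x e' (\<Gamma> @ [v]) \<circ>\<^sub>s (ids [src x] \<otimes>\<^sub>s pm (tok e (\<Gamma> @ \<Delta>)) (tok e' (\<Gamma> @ [v]))) = ?\<theta> \<circ>\<^sub>s asm x e (\<Gamma> @ \<Delta>)"
      unfolding tt by (rule as)
    show "S x e' M \<tau> L f \<Longrightarrow> S x e ?M \<tau> L f" for L f
      by (rule S_subst[OF _ e' N(1,3) x(1,2)])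
  qed (use lc_subst_lc[OF interp_lc[OF m] N(3)] n in simp_all)
  let ?r = "um (\<Gamma> @ [v]) m \<tau> \<circ>\<^sub>t J (objs C \<Gamma>) [var_obj C v] \<circ>\<^sub>t (idt (bob \<Gamma>) \<otimes>\<^sub>t run' (var_obj C v)) \<circ>\<^sub>t (idt (bob \<Gamma>) \<otimes>\<^sub>t n) \<circ>\<^sub>t J' (objs C \<Gamma>) (objs C \<Delta>)"
  have "\<Theta> (\<Gamma> @ [v]) m \<tau> \<circ>\<^sub>s ?\<theta> = up (objs C \<Gamma> @ objs C \<Delta>) ?r"
    using ok n by (subst U_cut) simp_all
  with key have "up (objs C \<Gamma> @ objs C \<Delta>) (um (\<Gamma> @ \<Delta>) (den C (\<Gamma> @ \<Delta>) ?M \<tau>) \<tau>) = up (objs C \<Gamma> @ objs C \<Delta>) ?r" by simp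
  then have "um (\<Gamma> @ \<Delta>) (den C (\<Gamma> @ \<Delta>) ?M \<tau>) \<tau> = ?r"
    by (rule up_inj) (use key ok n in simp_all)
  moreover have "den C (\<Gamma> @ [v]) M \<tau> \<cdot> tsnoc C (objs C \<Gamma>) (var_obj C v) \<cdot> (Id C (basis_obj C \<Gamma>) \<boxtimes> mor n) \<cdot> tsplit C (objs C \<Gamma>) (objs C \<Delta>) = mor ?r"
  proof -
    have "mor ?r = mor (um (\<Gamma> @ [v]) m \<tau> \<circ>\<^sub>t (J (objs C \<Gamma>) [var_obj C v] \<circ>\<^sub>t (idt (bob \<Gamma>) \<otimes>\<^sub>t run' (var_obj C v))) \<circ>\<^sub>t (idt (bob \<Gamma>) \<otimes>\<^sub>t n) \<circ>\<^sub>t J' (objs C \<Gamma>) (objs C \<Delta>))"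
      using n by (simp del: mor_simps)
    then show ?thesis using den_eq[OF m] by (simp only: mor_simps mor_J basis_obj_def tsnoc_def um_simps)
  qed
  ultimately show ?thesis using key by (metis um_simps(3))
qed

lemma subst_higher:
  assumes "\<Gamma> @ [Hov k \<sigma>1 \<sigma>2] \<turnstile> M \<Colon> \<tau>" "\<Delta> \<turnstile> N \<Colon> Lolli \<sigma>1 \<sigma>2" "set \<Gamma> \<inter> set \<Delta> = {}"
  shows "\<Gamma> @ \<Delta> \<turnstile> M[Hov k \<sigma>1 \<sigma>2 ::= N] \<Colon> \<tau> \<and> den C (\<Gamma> @ \<Delta>) (M[Hov k \<sigma>1 \<sigma>2 ::= N]) \<tau>
      = den C (\<Gamma> @ [Hov k \<sigma>1 \<sigma>2]) M \<tau> \<cdot> tsnoc C (objs C \<Gamma>) (tob (Lolli \<sigma>1 \<sigma>2))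
        \<cdot> (Id C (basis_obj C \<Gamma>) \<boxtimes> den C \<Delta> N (Lolli \<sigma>1 \<sigma>2)) \<cdot> tsplit C (objs C \<Gamma>) (objs C \<Delta>)"
proof -
  let ?v = "Hov k \<sigma>1 \<sigma>2"
  obtain m where m: "interp C (\<Gamma> @ [?v]) M \<tau> m" using assms typing_iff_interp[of _ M \<tau> C] by blast
  obtain n where n: "interp C \<Delta> N (Lolli \<sigma>1 \<sigma>2) n" using assms typing_iff_interp[of _ N _ C] by blast
  obtain x e where st: "std (\<Gamma> @ \<Delta>) x e"
    using std_exists[of "\<Gamma> @ \<Delta>"] interp_distinct[OF m] interp_distinct[OF n] assms(3) by auto
  note x = stdD[OF st]
  have "adq x e \<Delta> N (Lolli \<sigma>1 \<sigma>2) n" using x by (intro interp_S[OF n]) auto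
  then obtain L g where S: "S x e N (Lolli \<sigma>1 \<sigma>2) L g" "mset (tok e \<Delta>) = mset L"
    "\<Theta> \<Delta> n (Lolli \<sigma>1 \<sigma>2) \<circ>\<^sub>s asm x e \<Delta> = g \<circ>\<^sub>s (ids [src x] \<otimes>\<^sub>s pm (tok e \<Delta>) L)" by (auto simp: adq_def)
  have "\<Gamma> @ \<Delta> \<turnstile> M[?v ::= N] \<Colon> \<tau> \<and> den C (\<Gamma> @ \<Delta>) (M[?v ::= N]) \<tau>
      = den C (\<Gamma> @ [?v]) M \<tau> \<cdot> tsnoc C (objs C \<Gamma>) (var_obj C ?v) \<cdot> (Id C (basis_obj C \<Gamma>) \<boxtimes> mor (um \<Delta> n (Lolli \<sigma>1 \<sigma>2))) \<cdot> tsplit C (objs C \<Gamma>) (objs C \<Delta>)"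
    by (rule subst_cut[OF m st _ S(2) interp_lc[OF n] refl])
      (use S interp_ok[OF n] in \<open>simp_all add: good_def nonlin_def av_def\<close>)
  then show ?thesis using den_eq[OF n] by simp
qed

lemma subst_stable:
  assumes "\<Gamma> @ [Stb k \<sigma>] \<turnstile> M \<Colon> \<tau>" "\<Delta>1 @ \<Delta>2 \<turnstile> N \<Colon> \<sigma>" "ground \<Delta>1" "stable \<Delta>2" "set \<Gamma> \<inter> set (\<Delta>1 @ \<Delta>2) = {}"
  shows "\<Gamma> @ \<Delta>1 @ \<Delta>2 \<turnstile> M[Stb k \<sigma> ::= N] \<Colon> \<tau> \<and> den C (\<Gamma> @ \<Delta>1 @ \<Delta>2) (M[Stb k \<sigma> ::= N]) \<tau>
      = den C (\<Gamma> @ [Stb k \<sigma>]) M \<tau> \<cdot> tsnoc C (objs C \<Gamma>) (bang C (tob \<sigma>))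
        \<cdot> (Id C (basis_obj C \<Gamma>) \<boxtimes> (bang_arr C (den C (\<Delta>1 @ \<Delta>2) N \<sigma>) \<cdot> promote C \<Delta>1 \<Delta>2))
        \<cdot> tsplit C (objs C \<Gamma>) (objs C (\<Delta>1 @ \<Delta>2))"
proof -
  let ?v = "Stb k \<sigma>" and ?\<Delta> = "\<Delta>1 @ \<Delta>2"
  obtain m where m: "interp C (\<Gamma> @ [?v]) M \<tau> m" using assms typing_iff_interp[of _ M \<tau> C] by blast
  obtain n where n: "interp C ?\<Delta> N \<sigma> n" using assms typing_iff_interp[of _ N _ C] by blast
  have nl: "\<forall>v\<in>set ?\<Delta>. nonlin v" using assms(3,4) nonlin_ground by auto
  note pcs = pc_simps[OF nl]
  obtain x e where st: "std (\<Gamma> @ ?\<Delta>) x e"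
    using std_exists[of "\<Gamma> @ ?\<Delta>"] interp_distinct[OF m] interp_distinct[OF n] assms(5) by auto
  note x = stdD[OF st]
  have c: "cenv x e ?\<Delta>" using x by simp
  have t: "tok e ?\<Delta> = []" and ca: "cmor x (pc ?\<Delta>) (tr (asm x e ?\<Delta>) \<circ>\<^sub>t run' (src x))"
    using asm_cmor[OF x(2,1) c nl] by auto
  have "adq x e ?\<Delta> N \<sigma> n" using x c t by (intro interp_S[OF n]) simp_all
  then obtain L g where S: "S x e N \<sigma> L g" "mset (tok e ?\<Delta>) = mset L"
    "\<Theta> ?\<Delta> n \<sigma> \<circ>\<^sub>s asm x e ?\<Delta> = g \<circ>\<^sub>s (ids [src x] \<otimes>\<^sub>s pm (tok e ?\<Delta>) L)" by (auto simp: adq_def)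
  have L: "L = []" using S(2) unfolding t by simp
  note g = S_arr[OF S(1) x(2,1), unfolded L]
  let ?a = "asm x e ?\<Delta>"
  have A: "arr ?a" "dm ?a = [src x]" "cd ?a = objs C ?\<Delta>" using asm_simps[OF x(2,1) c] unfolding t by simp_all
  have gg: "g = \<Theta> ?\<Delta> n \<sigma> \<circ>\<^sub>s ?a" using S(3) g unfolding t L by simp
  let ?n = "um ?\<Delta> n \<sigma>"
  note ok = interp_ok[OF n]
  have ug: "ue g = ?n \<circ>\<^sub>t tr ?a \<circ>\<^sub>t run' (src x)"
    unfolding gg ue_def using A ok dn_scomp[of "\<Theta> ?\<Delta> n \<sigma>" ?a] by (simp del: asm_simps)
  define h where "h = tr ?a \<circ>\<^sub>t run' (src x)"
  note h = cmorD[OF ca[folded h_def]]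
  \<comment> \<open>Promoting the value of \<open>N\<close> along the stage agrees with evaluating
    the promoted interpretation in the environment, because \<open>h\<close> is a coalgebra morphism
    from the stage to the coalgebra of the basis.\<close>
  have "bng (ue g) \<circ>\<^sub>t x = bng ?n \<circ>\<^sub>t bng h \<circ>\<^sub>t x"
    unfolding ug h_def[symmetric] using h ok x pcs by (simp add: bng_cmp)
  also have "\<dots> = bng ?n \<circ>\<^sub>t pc ?\<Delta> \<circ>\<^sub>t h" using h by simp
  finally have bg: "bng (ue g) \<circ>\<^sub>t x = bng ?n \<circ>\<^sub>t pc ?\<Delta> \<circ>\<^sub>t h" .
  have "em (bng (ue g) \<circ>\<^sub>t x) = up (objs C ?\<Delta>) (bng ?n \<circ>\<^sub>t pc ?\<Delta>) \<circ>\<^sub>s ?a"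
    unfolding bg h_def using A ok pcs x by (intro sarr_eqI) (simp_all del: asm_simps add: tr_simps tr_up tr_em)
  note key = this
  have "\<Gamma> @ ?\<Delta> \<turnstile> M[?v ::= N] \<Colon> \<tau> \<and> den C (\<Gamma> @ ?\<Delta>) (M[?v ::= N]) \<tau>
      = den C (\<Gamma> @ [?v]) M \<tau> \<cdot> tsnoc C (objs C \<Gamma>) (var_obj C ?v) \<cdot> (Id C (basis_obj C \<Gamma>) \<boxtimes> mor (bng ?n \<circ>\<^sub>t pc ?\<Delta>)) \<cdot> tsplit C (objs C \<Gamma>) (objs C ?\<Delta>)"
  proof (rule subst_cut[OF m st _ S(2) interp_lc[OF n] refl])
    show "S x e N (var_ty ?v) L g" using S(1) by simp
    show "good x (e(Fv ?v := Some (var_ty ?v, L, g))) ?v" using L by (simp add: good_def)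
    have "av x (e(Fv ?v := Some (var_ty ?v, L, g))) ?v = em (bng (ue g) \<circ>\<^sub>t x)" by (simp add: av_def)
    then show "av x (e(Fv ?v := Some (var_ty ?v, L, g))) ?v \<circ>\<^sub>s (ids [src x] \<otimes>\<^sub>s pm (tok e ?\<Delta>) L) = up (objs C ?\<Delta>) (bng ?n \<circ>\<^sub>t pc ?\<Delta>) \<circ>\<^sub>s ?a"
      unfolding t L key using A ok pcs by (simp del: asm_simps)
  qed (use ok pcs in simp_all)
  then show ?thesis using den_eq[OF n] promote_pc[OF assms(3,4)] by (simp add: mor_simps bmor)
qed

end

theorem theorem1:
  fixes C :: "('o, 'm, 'r) sllcat_scheme" (structure)
  assumes "sll_category C"
  shows "(\<forall>\<Gamma> k \<Delta> M \<sigma> n.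
            \<Gamma> @ [Gnd k] @ \<Delta> \<turnstile> M \<Colon> \<sigma>
            \<longrightarrow> \<Gamma> @ \<Delta> \<turnstile> M[Gnd k ::= numeral_trm n] \<Colon> \<sigma> \<and>
                den C (\<Gamma> @ \<Delta>) (M[Gnd k ::= numeral_trm n]) \<sigma>
                = den C (\<Gamma> @ [Gnd k] @ \<Delta>) M \<sigma>
                  \<cdot> tjoin C (objs C \<Gamma>) (objs C ([Gnd k] @ \<Delta>))
                  \<cdot> (Id C (basis_obj C \<Gamma>) \<boxtimes> (numeral_arr C n \<boxtimes> Id C (basis_obj C \<Delta>)))
                  \<cdot> (Id C (basis_obj C \<Gamma>) \<boxtimes> lunit' C (basis_obj C \<Delta>))
                  \<cdot> tsplit C (objs C \<Gamma>) (objs C \<Delta>))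
       \<and> (\<forall>\<Gamma> \<Delta> k \<sigma>1 \<sigma>2 M N' \<tau>.
            \<Gamma> @ [Hov k \<sigma>1 \<sigma>2] \<turnstile> M \<Colon> \<tau> \<and> \<Delta> \<turnstile> N' \<Colon> Lolli \<sigma>1 \<sigma>2 \<and> set \<Gamma> \<inter> set \<Delta> = {}
            \<longrightarrow> \<Gamma> @ \<Delta> \<turnstile> M[Hov k \<sigma>1 \<sigma>2 ::= N'] \<Colon> \<tau> \<and>
                den C (\<Gamma> @ \<Delta>) (M[Hov k \<sigma>1 \<sigma>2 ::= N']) \<tau>
                = den C (\<Gamma> @ [Hov k \<sigma>1 \<sigma>2]) M \<tau>
                  \<cdot> tsnoc C (objs C \<Gamma>) (ty_obj C (Lolli \<sigma>1 \<sigma>2))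
                  \<cdot> (Id C (basis_obj C \<Gamma>) \<boxtimes> den C \<Delta> N' (Lolli \<sigma>1 \<sigma>2))
                  \<cdot> tsplit C (objs C \<Gamma>) (objs C \<Delta>))
       \<and> (\<forall>\<Gamma> \<Delta>1 \<Delta>2 k \<sigma> M N' \<tau>.
            \<Gamma> @ [Stb k \<sigma>] \<turnstile> M \<Colon> \<tau> \<and> \<Delta>1 @ \<Delta>2 \<turnstile> N' \<Colon> \<sigma> \<and> ground \<Delta>1 \<and> stable \<Delta>2 \<and>
            set \<Gamma> \<inter> set \<Delta>1 = {} \<and> set \<Gamma> \<inter> set \<Delta>2 = {} \<and> set \<Delta>1 \<inter> set \<Delta>2 = {}
            \<longrightarrow> \<Gamma> @ \<Delta>1 @ \<Delta>2 \<turnstile> M[Stb k \<sigma> ::= N'] \<Colon> \<tau> \<and>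
                den C (\<Gamma> @ \<Delta>1 @ \<Delta>2) (M[Stb k \<sigma> ::= N']) \<tau>
                = den C (\<Gamma> @ [Stb k \<sigma>]) M \<tau>
                  \<cdot> tsnoc C (objs C \<Gamma>) (bang C (ty_obj C \<sigma>))
                  \<cdot> (Id C (basis_obj C \<Gamma>)
                       \<boxtimes> (bang_arr C (den C (\<Delta>1 @ \<Delta>2) N' \<sigma>) \<cdot> promote C \<Delta>1 \<Delta>2))
                  \<cdot> tsplit C (objs C \<Gamma>) (objs C (\<Delta>1 @ \<Delta>2)))"
proof -
  interpret sll_category C by fact
  show ?thesis
    by (intro conjI allI impI, (elim conjE)?;
        (rule subst_numeral[THEN conjunct1] subst_numeral[THEN conjunct2] subst_higher[THEN conjunct1] subst_higher[THEN conjunct2]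
          subst_stable[THEN conjunct1] subst_stable[THEN conjunct2]); (assumption | auto))
qed

end
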